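(* Suppose $\gamma<\infty$. Then $$\lim_{\delta\to0}\liminf_{n\to\infty}\sup_{|c-c_0|<\delta}(r_n^{-1}\eta_n)^2\,\mathbb{E}_{n,c\eta_n}[(c^*_n-c)^2]\ge E[\tilde{u}^2]$$ for any $c_0\in\mathcal{C}$ and any estimator sequence $c^*_n$ in the experiments $(\mathbb{P}_{n,c\eta_n})_{c\in\mathcal{C}}$. In particular, $$\lim_{\delta\to0}\liminf_{n\to\infty}\sup_{|\vartheta|<\delta\eta_n}r_n^{-2}\,\mathbb{E}_{n,\vartheta}[(\vartheta^*_n-\vartheta)^2]\ge E[\tilde{u}^2]$$ for any estimator sequence $\vartheta^*_n$ in the experiments $(\mathbb{P}_{n,\vartheta})_{\vartheta\in\mathbb{R}}$.
   Context: Model. Let $\rho\in(-1,0)\cup(0,1)$. Let $B_t=(B^1_t,B^2_t)$, $t\in\mathbb{R}$, be a bivariate two-sided Brownian motion with $B_0=0$, $E[(B^1_1)^2]=E[(B^2_1)^2]=1$, $E[B^1_1B^2_1]=\rho$, and let $\epsilon_i=(\epsilon^1_i,\epsilon^2_i)$, $i=1,2,\dots$, be i.i.d. bivariate standard normal vectors independent of $B$. Let $(v_n)$ be a sequence of non-negative numbers such that $\limsup_n v_n<\infty$ and the limit $\gamma:=\lim_n nv_n\in[0,\infty]$ exists. For $\vartheta\in\mathbb{R}$ let $\mathbb{P}_{n,\vartheta}$ be the law on $\mathbb{R}^{2n}$ of $(X_1,\dots,X_n,Y_1,\dots,Y_n)^\top$, where for $i=1,\dots,n$: if $\vartheta\ge0$,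 $X_i=B^1_{i/n}+\sqrt{v_n}\,\epsilon^1_i$ and $Y_i=B^2_{i/n-\vartheta}+\sqrt{v_n}\,\epsilon^2_i$; if $\vartheta<0$, $X_i=B^1_{i/n+\vartheta}+\sqrt{v_n}\,\epsilon^1_i$ and $Y_i=B^2_{i/n}+\sqrt{v_n}\,\epsilon^2_i$. $\mathbb{E}_{n,\vartheta}$ is expectation under $\mathbb{P}_{n,\vartheta}$. An estimator sequence is a sequence of measurable real functions of the observation in $\mathbb{R}^{2n}$. When $\gamma<\infty$: $N_n=n$, $r_n=n^{-3/2}$. $\mathcal{C}$ is a bounded open interval in $\mathbb{R}$, and $\eta_n$ is a sequence of positive numbers tending to $0$ with $\eta_n=o(n^{-1}\vee N_n^{-4/3})$ (i.e. $\eta_n=o(n^{-1})$ here) and $r_n^{-1}\eta_n\to\infty$. $I_0=\frac{\rho^2}{2(1-\rho^2)}$; for $0<\gamma<\infty$, $I_\gamma=\frac{\rho\left(\sqrt{(1+\rho)(1+\rho+4\gamma)}-\sqrt{(1-\rho)(1-\rho+4\gamma)}-2\rho\right)}{8\gamma^2}$. $J_0=\frac{3\rho^2}{4}\left\{\frac{1}{(1+\rho)^2}+\frac{1}{(1-\rho)^2}\right\}$; for $0<\gamma<\infty$, $$J_\gamma=\frac{\rho^2}{16\gamma^2}\left[4-3\left\{\left(\tfrac{1+\rho}{1+\rho+4\gamma}\right)^{1/2}+\left(\tfrac{1-\rho}{1-\rho+4\gamma}\right)^{1/2}\right\}+\left\{\left(\tfrac{1+\rho}{1+\rho+4\gamma}\right)^{3/2}+\left(\tfrac{1-\rho}{1-\rho+4\gamma}\right)^{3/2}\right\}\right].$$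 Let $\zeta_1\sim\mathcal{N}(0,I_\gamma)$ and $\zeta_2\sim\mathcal{N}(0,J_\gamma)$ be independent, $Z(u)=\exp\left(u\zeta_1+|u|\zeta_2-\frac{u^2}{2}(I_\gamma+J_\gamma)\right)$ for $u\in\mathbb{R}$, and $\tilde u=\int_{-\infty}^\infty uZ(u)\,\mathrm{d}u\big/\int_{-\infty}^\infty Z(u)\,\mathrm{d}u$. *)

theory Defs
  imports "HOL-Probability.Probability" "HOL-Library.Landau_Symbols"
begin

text \<open>The case of variance zero is the Dirac mass at the origin.\<close>

definition centred_normal :: "'a measure \<Rightarrow> ('a \<Rightarrow> real) \<Rightarrow> real \<Rightarrow> bool" where
  "centred_normal M X s \<longleftrightarrow> X \<in> borel_measurable M \<and>
     ((s = 0 \<and> (AE \<omega> in M. X \<omega> = 0)) \<or>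
      (s > 0 \<and> distributed M lborel X (\<lambda>x. ennreal (normal_density 0 (sqrt s) x))))"

text \<open>Gaussian vectors are characterised by their linear combinations; the last three arguments
  are the entries of the covariance matrix.\<close>

definition centred_bivariate_normal ::
    "'a measure \<Rightarrow> ('a \<Rightarrow> real \<times> real) \<Rightarrow> real \<Rightarrow> real \<Rightarrow> real \<Rightarrow> bool" where
  "centred_bivariate_normal M U s11 s12 s22 \<longleftrightarrow>
     (\<forall>a b. centred_normal M (\<lambda>\<omega>. a * fst (U \<omega>) + b * snd (U \<omega>))
              (a\<^sup>2 * s11 + 2 * a * b * s12 + b\<^sup>2 * s22))"

text \<open>The parameters \<open>s11\<close>, \<open>s12\<close>, \<open>s22\<close> are the (co)variances of the two components of \<open>B\<close>
  at time \<open>1\<close>.\<close>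

definition two_sided_brownian_motion ::
    "'a measure \<Rightarrow> real \<Rightarrow> real \<Rightarrow> real \<Rightarrow> (real \<Rightarrow> 'a \<Rightarrow> real \<times> real) \<Rightarrow> bool" where
  "two_sided_brownian_motion M s11 s12 s22 B \<longleftrightarrow>
     (\<forall>t. B t \<in> borel_measurable M) \<and>
     (AE \<omega> in M. B 0 \<omega> = 0) \<and>
     (AE \<omega> in M. continuous_on UNIV (\<lambda>t. B t \<omega>)) \<and>
     (\<forall>t :: nat \<Rightarrow> real. strict_mono t \<longrightarrow>
        (\<forall>k. prob_space.indep_vars M (\<lambda>_. borel) (\<lambda>j \<omega>. B (t (Suc j)) \<omega> - B (t j) \<omega>) {..<k})) \<and>
     (\<forall>s t. s < t \<longrightarrow>
        centred_bivariate_normal M (\<lambda>\<omega>. B t \<omega> - B s \<omega>)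
          ((t - s) * s11) ((t - s) * s12) ((t - s) * s22))"

definition iid_standard_normal2 :: "'a measure \<Rightarrow> (nat \<Rightarrow> 'a \<Rightarrow> real \<times> real) \<Rightarrow> bool" where
  "iid_standard_normal2 M eps \<longleftrightarrow>
     prob_space.indep_vars M (\<lambda>_. borel) eps {1..} \<and>
     (\<forall>i\<ge>1. centred_bivariate_normal M (eps i) 1 0 1)"

text \<open>Independence of the generated \<open>\<sigma>\<close>-algebras; \<open>indep_var\<close> would require both processes to
  have the same type.\<close>

definition independent_of_noise ::
    "'a measure \<Rightarrow> (real \<Rightarrow> 'a \<Rightarrow> real \<times> real) \<Rightarrow> (nat \<Rightarrow> 'a \<Rightarrow> real \<times> real) \<Rightarrow> bool" where
  "independent_of_noise M B eps \<longleftrightarrow>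
     prob_space.indep_set M
       (sets (vimage_algebra (space M) (\<lambda>\<omega> t. B t \<omega>) (\<Pi>\<^sub>M t\<in>UNIV. borel)))
       (sets (vimage_algebra (space M) (\<lambda>\<omega>. \<lambda>i\<in>{1..}. eps i \<omega>) (\<Pi>\<^sub>M i\<in>{1..}. borel)))"

definition obs_X where
  "obs_X B eps v n \<theta> i \<omega> =
     fst (B (if \<theta> \<ge> 0 then real i / real n else real i / real n + \<theta>) \<omega>)
       + sqrt (v n) * fst (eps i \<omega>)"
  for B :: "real \<Rightarrow> 'a \<Rightarrow> real \<times> real" and eps :: "nat \<Rightarrow> 'a \<Rightarrow> real \<times> real"
    and v :: "nat \<Rightarrow> real" and n :: nat and \<theta> :: real and i :: nat and \<omega> :: 'a

definition obs_Y where
  "obs_Y B eps v n \<theta> i \<omega> =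
     snd (B (if \<theta> \<ge> 0 then real i / real n - \<theta> else real i / real n) \<omega>)
       + sqrt (v n) * snd (eps i \<omega>)"
  for B :: "real \<Rightarrow> 'a \<Rightarrow> real \<times> real" and eps :: "nat \<Rightarrow> 'a \<Rightarrow> real \<times> real"
    and v :: "nat \<Rightarrow> real" and n :: nat and \<theta> :: real and i :: nat and \<omega> :: 'a

text \<open>\<open>\<real>\<^sup>m\<close> with its Borel sets, as functions on \<open>{1..m}\<close>.\<close>

definition euclid :: "nat \<Rightarrow> (nat \<Rightarrow> real) measure" where
  "euclid m = (\<Pi>\<^sub>M i\<in>{1..m}. borel)"

definition obs_law ::
    "'a measure \<Rightarrow> (real \<Rightarrow> 'a \<Rightarrow> real \<times> real) \<Rightarrow> (nat \<Rightarrow> 'a \<Rightarrow> real \<times> real) \<Rightarrow> (nat \<Rightarrow> real) \<Rightarrow>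
     nat \<Rightarrow> real \<Rightarrow> (nat \<Rightarrow> real) measure" where
  "obs_law M B eps v n \<theta> = distr M (euclid (2 * n))
     (\<lambda>\<omega>. \<lambda>i\<in>{1..2 * n}. if i \<le> n then obs_X B eps v n \<theta> i \<omega> else obs_Y B eps v n \<theta> (i - n) \<omega>)"

definition estimator_sequence :: "(nat \<Rightarrow> (nat \<Rightarrow> real) \<Rightarrow> real) \<Rightarrow> bool" where
  "estimator_sequence T \<longleftrightarrow> (\<forall>n. T n \<in> borel_measurable (euclid (2 * n)))"

text \<open>The mean squared error takes values in \<open>[0, \<infinity>]\<close>, so that an infinite risk is not
  mistaken for zero.\<close>

definition mse :: "(nat \<Rightarrow> real) measure \<Rightarrow> ((nat \<Rightarrow> real) \<Rightarrow> real) \<Rightarrow> real \<Rightarrow> ennreal" where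
  "mse P T a = (\<integral>\<^sup>+ x. ennreal ((T x - a)\<^sup>2) \<partial>P)"

definition rate :: "nat \<Rightarrow> real" where
  "rate n = real n powr (- 3 / 2)"

definition info_I :: "real \<Rightarrow> real \<Rightarrow> real" where
  "info_I \<rho> \<gamma> =
     (if \<gamma> = 0 then \<rho>\<^sup>2 / (2 * (1 - \<rho>\<^sup>2))
      else \<rho> * (sqrt ((1 + \<rho>) * (1 + \<rho> + 4 * \<gamma>)) - sqrt ((1 - \<rho>) * (1 - \<rho> + 4 * \<gamma>)) - 2 * \<rho>)
             / (8 * \<gamma>\<^sup>2))"

definition info_J :: "real \<Rightarrow> real \<Rightarrow> real" where
  "info_J \<rho> \<gamma> =
     (if \<gamma> = 0 then 3 * \<rho>\<^sup>2 / 4 * (1 / (1 + \<rho>)\<^sup>2 + 1 / (1 - \<rho>)\<^sup>2)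
      else \<rho>\<^sup>2 / (16 * \<gamma>\<^sup>2) *
        (4 - 3 * (((1 + \<rho>) / (1 + \<rho> + 4 * \<gamma>)) powr (1 / 2)
                  + ((1 - \<rho>) / (1 - \<rho> + 4 * \<gamma>)) powr (1 / 2))
           + (((1 + \<rho>) / (1 + \<rho> + 4 * \<gamma>)) powr (3 / 2)
              + ((1 - \<rho>) / (1 - \<rho> + 4 * \<gamma>)) powr (3 / 2))))"

definition Z_limit :: "real \<Rightarrow> real \<Rightarrow> real \<Rightarrow> real \<Rightarrow> real \<Rightarrow> real" where
  "Z_limit I J z1 z2 u = exp (u * z1 + \<bar>u\<bar> * z2 - u\<^sup>2 / 2 * (I + J))"

definition u_tilde :: "real \<Rightarrow> real \<Rightarrow> real \<Rightarrow> real \<Rightarrow> real" where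
  "u_tilde I J z1 z2 =
     (\<integral>u. u * Z_limit I J z1 z2 u \<partial>lborel) / (\<integral>u. Z_limit I J z1 z2 u \<partial>lborel)"

end

theory Submission
  imports Defs "HOL-Real_Asymp.Real_Asymp"
begin

text \<open>Both sides are compared with \<open>1 / (I + J)\<close>, where \<open>I = info_I \<rho> \<gamma>\<close> and \<open>J = info_J \<rho> \<gamma>\<close>.

  Lower bound for the risk. For lags \<open>\<bar>\<theta>\<bar> < 1 / n\<close> the normalised increments of the observations are
  centred Gaussian with covariance \<open>\<Sigma> h = \<Sigma> 0 + h A\<close>, affine in \<open>h = n \<bar>\<theta>\<bar>\<close>. The van Trees inequality
  bounds the Bayes risk for a smooth prior on an interval of lags; the information of the prior is
  negligible because \<open>inverse (rate n) * \<eta> n\<close> tends to infinity. What remains is to show that the Fisher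
  information \<open>tr ((\<Sigma>\<^sup>-\<^sup>1 A)\<^sup>2) / 2\<close> is at most \<open>n (I + J + o(1))\<close>. The inverse is never formed: an explicit
  symmetric Toeplitz matrix \<open>W\<close> satisfies \<open>\<Sigma> W \<Sigma> = A\<close> up to boundary terms, hence yields the score up to
  a negligible error, and \<open>tr (W A)\<close> is read off from the symbols.

  Upper bound for \<open>E[u_tilde\<^sup>2]\<close>. Stein's identity for \<open>\<zeta>1\<close> and \<open>\<zeta>2\<close> gives
  \<open>E[u_tilde\<^sup>2] \<le> 1 / (I + J)\<close>. If \<open>I + J = 0\<close>, then \<open>u_tilde\<close> is a quotient with zero denominator,
  because \<open>Z = 1\<close> is not integrable, and its value is \<open>0\<close>.\<close>

section \<open>Uniqueness of characteristic functions\<close>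

text \<open>The dependence on the lag through \<open>\<bar>\<theta>\<bar>\<close> has a kink at 0,
  and 1 / (I + J) is the value that avoids it. Every neighbourhood in the two suprema contains a
  compact interval of lags of one sign. There the covariance is affine in the lag, and the exponent
  of \<open>Z_limit\<close> is that of a Gaussian shift with information I + J.

  The density of the increments would involve the inverse and the determinant of \<Sigma>, whereas
  their characteristic function is explicit. The van Trees inequality is therefore derived from
  characteristic functions, by uniqueness in several variables.

  The matrix W alone does not satisfy the derivative identity exactly. The score is therefore taken
  on a larger Gaussian noise that generates the observation. Projecting such a score on the
  observation can only decrease its variance, so the bound stays valid, and the additional noise
  variables absorb the error A - \<Sigma> W \<Sigma> exactly. Diagonal dominance of \<Sigma>
  provides both an explicit square root and a lower bound for the strength of this additional
  noise.\<close>

lemma finite_measure_eqI_char: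
  fixes \<mu> \<nu> :: "real measure"
  assumes "finite_measure \<mu>" "finite_measure \<nu>"
    and [measurable_cong]: "sets \<mu> = sets borel" "sets \<nu> = sets borel"
    and eq: "\<And>t. (CLINT x|\<mu>. iexp (t * x)) = (CLINT x|\<nu>. iexp (t * x))"
  shows "\<mu> = \<nu>"
proof -
  interpret \<mu>: finite_measure \<mu> by fact
  interpret \<nu>: finite_measure \<nu> by fact
  have sp: "space \<mu> = UNIV" "space \<nu> = UNIV"
    using assms(3,4) by (auto dest!: sets_eq_imp_space_eq)
  define c where "c = measure \<mu> UNIV"
  have c': "measure \<nu> UNIV = c"
    using eq[of 0] by (simp add: c_def sp)
  show ?thesis
  proof (cases "c = 0")
    case True
    then have "emeasure \<mu> UNIV = 0" "emeasure \<nu> UNIV = 0"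
      using c' by (simp_all add: c_def \<mu>.emeasure_eq_measure \<nu>.emeasure_eq_measure)
    then have "emeasure \<mu> A = 0" "emeasure \<nu> A = 0" for A
      by (metis emeasure_mono le_zero_eq sets.top sp subset_UNIV)+
    then show ?thesis
      by (intro measure_eqI) (simp_all add: assms)
  next
    case False
    then have c0: "c > 0" by (simp add: c_def zero_less_measure_iff)
    \<comment> \<open>The common mass \<open>c\<close> is read off at frequency 0. After division by
      it both measures are distributions on the line, where Levy's uniqueness theorem
      applies.\<close>
    define D where "D m = density m (\<lambda>_. ennreal (1 / c))" for m :: "real measure"
    have rd: "real_distribution (D m)" if m: "m = \<mu> \<or> m = \<nu>" for m
    proof -
      have [simp]: "sets m = sets borel" "space m = UNIV" "emeasure m UNIV = ennreal c"
        using m assms sp c' by (auto simp: \<mu>.emeasure_eq_measure \<nu>.emeasure_eq_measure c_def)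
      have "emeasure (D m) UNIV = ennreal (1 / c) * ennreal c"
        by (simp add: D_def emeasure_density_const)
      also have "\<dots> = 1"
        using c0 by (simp flip: ennreal_mult)
      finally have "prob_space (D m)"
        by (intro prob_spaceI) (simp add: D_def)
      then show ?thesis
        by (simp add: real_distribution_def real_distribution_axioms_def D_def)
    qed
    have ch: "char (D m) t = of_real (1 / c) * (CLINT x|m. iexp (t * x))" if m: "m = \<mu> \<or> m = \<nu>" for m t
    proof -
      have [measurable_cong]: "sets m = sets borel" using m assms by auto
      show ?thesis
        unfolding char_def D_def using c0
        by (subst integral_density) (auto simp: scaleR_conv_of_real)
    qed
    have "D \<mu> = D \<nu>"
      by (intro Levy_uniqueness rd ext) (simp_all add: ch eq del: of_real_mult)
    show ?thesis
    proof (rule measure_eqI)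
      fix A assume A: "A \<in> sets \<mu>"
      have "emeasure (D \<mu>) A = emeasure (D \<nu>) A" by (simp add: \<open>D \<mu> = D \<nu>\<close>)
      then have "ennreal (1 / c) * emeasure \<mu> A = ennreal (1 / c) * emeasure \<nu> A"
        using A by (simp add: D_def emeasure_density_const assms)
      then show "emeasure \<mu> A = emeasure \<nu> A"
        using c0 by (simp add: ennreal_mult_cancel_left)
    qed (simp add: assms)
  qed
qed

text \<open>The image under \<open>X\<close> of the measure with density \<open>\<phi>\<close> is
  finite, because \<open>\<phi>\<close> is bounded, and its characteristic function is the weighted
  integral in the hypothesis. The effect is to trade one exponential factor for an
  indicator.\<close>

lemma weighted_integral_indicator_eqI_char:
  fixes \<mu> \<nu> :: "'a measure" and X \<phi> :: "'a \<Rightarrow> real"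
  assumes "finite_measure \<mu>" "finite_measure \<nu>" and s: "sets \<mu> = sets \<nu>"
    and [measurable]: "X \<in> borel_measurable \<mu>" "\<phi> \<in> borel_measurable \<mu>"
    and \<phi>: "\<And>x. 0 \<le> \<phi> x" "\<And>x. \<phi> x \<le> C"
    and eq: "\<And>s. (CLINT x|\<mu>. \<phi> x * iexp (s * X x)) = (CLINT x|\<nu>. \<phi> x * iexp (s * X x))"
    and B: "B \<in> sets borel"
  shows "(LINT x|\<mu>. \<phi> x * indicator B (X x)) = (LINT x|\<nu>. \<phi> x * indicator B (X x))"
proof -
  define D where "D m = distr (density m (\<lambda>x. ennreal (\<phi> x))) borel X" for m :: "'a measure"
  have fin: "finite_measure (D m)" and int: "(CLINT x|D m. iexp (t * x)) = (CLINT x|m. \<phi> x * iexp (t * X x))"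
    and B': "(LINT x|m. \<phi> x * indicator B (X x)) = (LINT x|D m. indicator B x)"
    if m: "finite_measure m" "sets m = sets \<mu>" for m t
  proof -
    note [measurable_cong] = m(2)
    interpret finite_measure m by fact
    have "emeasure (density m (\<lambda>x. ennreal (\<phi> x))) (space m) = (\<integral>\<^sup>+x. ennreal (\<phi> x) \<partial>m)"
      by (simp add: emeasure_density cong: nn_integral_cong)
    also have "\<dots> \<le> (\<integral>\<^sup>+x. ennreal C \<partial>m)"
      by (intro nn_integral_mono) (simp add: \<phi> ennreal_leI)
    also have "\<dots> < \<infinity>" using emeasure_finite[of "space m"] by (simp add: ennreal_mult_less_top less_top del: emeasure_finite)
    finally have "finite_measure (density m (\<lambda>x. ennreal (\<phi> x)))"
      by (intro finite_measureI) simp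
    then show "finite_measure (D m)"
      unfolding D_def by (rule finite_measure.finite_measure_distr) simp
    show "(CLINT x|D m. iexp (t * x)) = (CLINT x|m. \<phi> x * iexp (t * X x))"
      unfolding D_def using \<phi>
      by (subst integral_distr) (simp_all add: integral_density scaleR_conv_of_real)
    show "(LINT x|m. \<phi> x * indicator B (X x)) = (LINT x|D m. indicator B x)"
      unfolding D_def using \<phi> B
      by (subst integral_distr) (simp_all add: integral_density)
  qed
  have "D \<mu> = D \<nu>"
  proof (rule finite_measure_eqI_char)
    show "(CLINT x|D \<mu>. iexp (t * x)) = (CLINT x|D \<nu>. iexp (t * x))" for t
      using int[OF assms(1), of t] int[OF assms(2) s[symmetric], of t] eq[of t] by (simp only:)
  qed (use assms(1,2) s in \<open>auto intro!: fin\<close>, simp_all add: D_def)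
  then show ?thesis
    using assms(1,2) s by (simp add: B')
qed

text \<open>The weights of the preceding lemma have to be nonnegative, whereas the exponential of
  the remaining coordinates is complex. Adding 1 to its real and imaginary parts makes them
  admissible. Euler's formula then expands the product into exponentials with the multiples 0, 1 and
  -1 of the phase \<open>y\<close>.\<close>

lemma iexp_mult_one_plus_cos_sin:
  fixes g y a :: real
  shows "complex_of_real (g * (1 + cos y)) * iexp a =
      1 * (g * iexp (a + 0 * y)) + (1/2) * (g * iexp (a + 1 * y)) + (1/2) * (g * iexp (a + -1 * y))"
    and "complex_of_real (g * (1 + sin y)) * iexp a =
      1 * (g * iexp (a + 0 * y)) + (1/(2*\<i>)) * (g * iexp (a + 1 * y)) + (-1/(2*\<i>)) * (g * iexp (a + -1 * y))"
proof -
  have *: "iexp (a + c * y) = iexp a * iexp (c * y)" for c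
    by (simp flip: exp_add add: ring_distribs)
  have cs: "complex_of_real (cos y) = (iexp (1 * y) + iexp (-1 * y)) / 2"
      "complex_of_real (sin y) = (iexp (1 * y) - iexp (-1 * y)) / (2 * \<i>)"
    by (simp_all flip: cos_of_real sin_of_real add: cos_exp_eq sin_exp_eq)
  show "complex_of_real (g * (1 + cos y)) * iexp a =
      1 * (g * iexp (a + 0 * y)) + (1/2) * (g * iexp (a + 1 * y)) + (1/2) * (g * iexp (a + -1 * y))"
    "complex_of_real (g * (1 + sin y)) * iexp a =
      1 * (g * iexp (a + 0 * y)) + (1/(2*\<i>)) * (g * iexp (a + 1 * y)) + (-1/(2*\<i>)) * (g * iexp (a + -1 * y))"
    unfolding of_real_mult[of g] of_real_add of_real_1 cs *
    by (simp_all only: mult_zero_left of_real_0 mult_zero_right exp_zero mult_1 mult_1_right) (simp_all add: exp_add exp_diff exp_minus divide_simps ring_distribs)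
qed

text \<open>The coordinates are treated one at a time: an exponential factor is exchanged for an
  indicator by one-dimensional uniqueness, until only the indicator of a box is left. Boxes
  determine the measure.\<close>

proposition PiM_eqI_char:
  fixes \<mu> \<nu> :: "('k \<Rightarrow> real) measure"
  assumes K: "finite K" and fin: "finite_measure \<mu>" "finite_measure \<nu>"
    and s\<mu>[measurable_cong]: "sets \<mu> = sets (\<Pi>\<^sub>M k\<in>K. borel)"
    and s\<nu>[measurable_cong]: "sets \<nu> = sets (\<Pi>\<^sub>M k\<in>K. borel)"
    and eq: "\<And>t. (CLINT x|\<mu>. iexp (\<Sum>k\<in>K. t k * x k)) = (CLINT x|\<nu>. iexp (\<Sum>k\<in>K. t k * x k))"
  shows "\<mu> = \<nu>"
proof -
  interpret \<mu>: finite_measure \<mu> by fact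
  interpret \<nu>: finite_measure \<nu> by fact
  \<comment> \<open>\<open>J\<close> is the set of coordinates already exchanged for indicators. The
    frequencies \<open>t\<close> stay arbitrary, because the induction step uses the hypothesis at
    modified frequencies.\<close>
  have claim: "(CLINT x|\<mu>. (\<Prod>k\<in>J. indicator (B k) (x k)) * iexp (\<Sum>k\<in>K-J. t k * x k)) =
       (CLINT x|\<nu>. (\<Prod>k\<in>J. indicator (B k) (x k)) * iexp (\<Sum>k\<in>K-J. t k * x k))"
    if "finite J" "J \<subseteq> K" "\<And>k. k \<in> J \<Longrightarrow> B k \<in> sets borel" for J B t
    using that
  proof (induction J arbitrary: t rule: finite_induct)
    case empty
    then show ?case using eq[of t] by simp
  next
    case (insert j J)
    define g :: "('k \<Rightarrow> real) \<Rightarrow> real" where "g x = (\<Prod>k\<in>J. indicator (B k) (x k))" for x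
    define \<theta> where "\<theta> x = (\<Sum>k\<in>K - insert j J. t k * x k)" for x :: "'k \<Rightarrow> real"
    have J: "finite J" "j \<in> K" "J \<subseteq> K" "j \<notin> J" using insert by auto
    have gm: "g \<in> borel_measurable (\<Pi>\<^sub>M k\<in>K. borel)"
      unfolding g_def using insert(5) J(3)
      by (intro borel_measurable_prod borel_measurable_indicator' measurable_component_singleton) auto
    have tm: "\<theta> \<in> borel_measurable (\<Pi>\<^sub>M k\<in>K. borel)"
      unfolding \<theta>_def by measurable
    have jm: "(\<lambda>x. x j) \<in> borel_measurable (\<Pi>\<^sub>M k\<in>K. borel)"
      using J by simp
    note [measurable] = gm tm jm
    have g01: "0 \<le> g x" "g x \<le> 1" for x
      unfolding g_def by (auto intro!: prod_nonneg prod_le_1 simp: indicator_def)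
    have gc: "complex_of_real (g x) = (\<Prod>k\<in>J. indicator (B k) (x k))" for x
      unfolding g_def of_real_prod by (intro prod.cong refl) (simp add: indicator_def)
    \<comment> \<open>The frequency of coordinate \<open>j\<close> is free and the remaining ones
      carry a common factor \<open>c\<close>; the values 0, 1 and -1 of \<open>c\<close> are those
      of the expansion of the weights.\<close>
    have IH: "(CLINT x|\<mu>. g x * iexp (s * x j + c * \<theta> x)) = (CLINT x|\<nu>. g x * iexp (s * x j + c * \<theta> x))" for s c
    proof -
      have "(\<Sum>k\<in>K - J. (if k = j then s else c * t k) * x k) = s * x j + c * \<theta> x" for x :: "'k \<Rightarrow> real"
      proof -
        have *: "K - J = insert j (K - insert j J)" using J by auto
        have "(\<Sum>k\<in>K - insert j J. (if k = j then s else c * t k) * x k) = c * \<theta> x"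
          unfolding \<theta>_def sum_distrib_left by (intro sum.cong) auto
        then show ?thesis
          unfolding * using K by (subst sum.insert) auto
      qed
      note * = this
      have "(CLINT x|\<mu>. (\<Prod>k\<in>J. indicator (B k) (x k)) * iexp (\<Sum>k\<in>K - J. (if k = j then s else c * t k) * x k)) =
        (CLINT x|\<nu>. (\<Prod>k\<in>J. indicator (B k) (x k)) * iexp (\<Sum>k\<in>K - J. (if k = j then s else c * t k) * x k))"
        by (rule insert.IH) (use insert.prems in auto)
      then show ?thesis
        by (simp only: gc *)
    qed
    have int: "integrable m (\<lambda>x. complex_of_real (g x) * iexp (s * x j + c * \<theta> x))"
      if "m = \<mu> \<or> m = \<nu>" for m s c
    proof -
      have [measurable_cong]: "sets m = sets (\<Pi>\<^sub>M k\<in>K. borel)" and "finite_measure m"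
        using that s\<mu> s\<nu> fin by auto
      then interpret finite_measure m by simp
      show ?thesis
        by (rule integrable_const_bound[where B=1]) (auto simp: norm_mult g01)
    qed
    have key: "(LINT x|\<mu>. \<phi> x * indicator (B j) (x j)) = (LINT x|\<nu>. \<phi> x * indicator (B j) (x j))"
      if \<phi>: "\<phi> = g \<or> \<phi> = (\<lambda>x. g x * (1 + cos (\<theta> x))) \<or> \<phi> = (\<lambda>x. g x * (1 + sin (\<theta> x)))" for \<phi>
    proof (rule weighted_integral_indicator_eqI_char[where C=2])
      have cs: "0 \<le> 1 + cos (\<theta> x)" "0 \<le> 1 + sin (\<theta> x)" "1 + cos (\<theta> x) \<le> 2" "1 + sin (\<theta> x) \<le> 2" for x
        using cos_ge_minus_one[of "\<theta> x"] sin_ge_minus_one[of "\<theta> x"] cos_le_one[of "\<theta> x"] sin_le_one[of "\<theta> x"]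
        by linarith+
      show "0 \<le> \<phi> x" for x
        using \<phi> g01[of x] cs[of x] by (auto intro!: mult_nonneg_nonneg)
      show "\<phi> x \<le> 2" for x
        using \<phi> g01[of x] cs[of x]
          mult_mono[of "g x" 1 "1 + cos (\<theta> x)" 2] mult_mono[of "g x" 1 "1 + sin (\<theta> x)" 2]
        by auto
      show "\<phi> \<in> borel_measurable \<mu>" using \<phi> by auto
      show "B j \<in> sets borel" using insert by auto
      show "sets \<mu> = sets \<nu>" by (simp add: s\<mu> s\<nu>)
      show "(\<lambda>x. x j) \<in> borel_measurable \<mu>" by measurable
      show "finite_measure \<mu>" "finite_measure \<nu>" by fact+
      let ?e = "\<lambda>s c x. complex_of_real (g x) * iexp (s * x j + c * \<theta> x)"
      have "\<exists>a b d. \<forall>x s. \<phi> x * iexp (s * x j) = a * ?e s 0 x + b * ?e s 1 x + d * ?e s (-1) x"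
      proof -
        have c: "complex_of_real (g x * (1 + cos (\<theta> x))) * iexp (s * x j) = 1 * ?e s 0 x + (1/2) * ?e s 1 x + (1/2) * ?e s (-1) x"
          "complex_of_real (g x * (1 + sin (\<theta> x))) * iexp (s * x j) = 1 * ?e s 0 x + (1/(2*\<i>)) * ?e s 1 x + (-1/(2*\<i>)) * ?e s (-1) x" for x s
          using iexp_mult_one_plus_cos_sin[of "g x" "\<theta> x" "s * x j" for x s] by simp_all
        have c0: "complex_of_real (g x) * iexp (s * x j) = 1 * ?e s 0 x + 0 * ?e s 1 x + 0 * ?e s (-1) x" for x s
          by simp
        show ?thesis
          using \<phi>
        proof (elim disjE)
          assume "\<phi> = g"
          show ?thesis unfolding \<open>\<phi> = g\<close> by (intro exI allI) (rule c0)
        next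
          assume *: "\<phi> = (\<lambda>x. g x * (1 + cos (\<theta> x)))"
          show ?thesis unfolding * by (intro exI allI) (rule c(1))
        next
          assume *: "\<phi> = (\<lambda>x. g x * (1 + sin (\<theta> x)))"
          show ?thesis unfolding * by (intro exI allI) (rule c(2))
        qed
      qed
      then obtain a b d where *: "\<And>x s. \<phi> x * iexp (s * x j) = a * ?e s 0 x + b * ?e s 1 x + d * ?e s (-1) x"
        by blast
      have **: "(CLINT x|m. \<phi> x * iexp (s * x j)) = a * (CLINT x|m. ?e s 0 x) + b * (CLINT x|m. ?e s 1 x) + d * (CLINT x|m. ?e s (-1) x)"
        if "m = \<mu> \<or> m = \<nu>" for m s
      proof -
        have i: "integrable m (\<lambda>x. k * ?e s c x)" for k c
          by (intro integrable_mult_right int that)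
        have "(CLINT x|m. \<phi> x * iexp (s * x j)) = (CLINT x|m. (a * ?e s 0 x + b * ?e s 1 x) + d * ?e s (-1) x)"
          by (intro Bochner_Integration.integral_cong refl) (rule *)
        also have "\<dots> = (CLINT x|m. a * ?e s 0 x) + (CLINT x|m. b * ?e s 1 x) + (CLINT x|m. d * ?e s (-1) x)"
          by (subst Bochner_Integration.integral_add, intro Bochner_Integration.integrable_add i, rule i,
              subst Bochner_Integration.integral_add, rule i, rule i, rule refl)
        also have "\<dots> = a * (CLINT x|m. ?e s 0 x) + b * (CLINT x|m. ?e s 1 x) + d * (CLINT x|m. ?e s (-1) x)"
          by (simp only: integral_mult_right_zero)
        finally show ?thesis .
      qed
      show "(CLINT x|\<mu>. \<phi> x * iexp (s * x j)) = (CLINT x|\<nu>. \<phi> x * iexp (s * x j))" for s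
        by (simp only: ** IH simp_thms)
    qed
    have intr: "integrable m (\<lambda>x. g x * cos (\<theta> x) * indicator (B j) (x j))"
        "integrable m (\<lambda>x. g x * sin (\<theta> x) * indicator (B j) (x j))"
        "integrable m (\<lambda>x. g x * indicator (B j) (x j))"
      if "m = \<mu> \<or> m = \<nu>" for m
    proof -
      have [measurable_cong]: "sets m = sets (\<Pi>\<^sub>M k\<in>K. borel)" and "finite_measure m"
        using that s\<mu> s\<nu> fin by auto
      then interpret finite_measure m by simp
      have [measurable]: "B j \<in> sets borel" using insert by auto
      have le: "\<bar>g x\<bar> * \<bar>z\<bar> * w \<le> 1" if "\<bar>z\<bar> \<le> 1" "0 \<le> w" "w \<le> 1" for x z w
        using g01[of x] that by (intro mult_le_one) auto
      show "integrable m (\<lambda>x. g x * cos (\<theta> x) * indicator (B j) (x j))"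
        "integrable m (\<lambda>x. g x * sin (\<theta> x) * indicator (B j) (x j))"
        by (rule integrable_const_bound[where B=1]; auto simp: abs_mult intro!: le)+
      show "integrable m (\<lambda>x. g x * indicator (B j) (x j))"
        using g01 by (intro integrable_const_bound[where B=1]) (auto simp: abs_mult mult_le_one)
    qed
    have split: "(CLINT x|m. (\<Prod>k\<in>insert j J. indicator (B k) (x k)) * iexp (\<theta> x)) =
       Complex (LINT x|m. g x * cos (\<theta> x) * indicator (B j) (x j)) (LINT x|m. g x * sin (\<theta> x) * indicator (B j) (x j))"
      if "m = \<mu> \<or> m = \<nu>" for m
    proof -
      have "(CLINT x|m. (\<Prod>k\<in>insert j J. indicator (B k) (x k)) * iexp (\<theta> x)) =
        (CLINT x|m. of_real (g x * cos (\<theta> x) * indicator (B j) (x j)) + \<i> * of_real (g x * sin (\<theta> x) * indicator (B j) (x j)))"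
      proof (intro Bochner_Integration.integral_cong refl)
        fix x
        have p: "(\<Prod>k\<in>insert j J. indicator (B k) (x k)) = indicator (B j) (x j) * complex_of_real (g x)"
          using J by (simp add: gc)
        show "(\<Prod>k\<in>insert j J. indicator (B k) (x k)) * iexp (\<theta> x) =
            of_real (g x * cos (\<theta> x) * indicator (B j) (x j)) + \<i> * of_real (g x * sin (\<theta> x) * indicator (B j) (x j))"
          unfolding p by (simp add: exp_Euler cos_of_real sin_of_real indicator_def ring_distribs)
      qed
      also have "\<dots> = of_real (LINT x|m. g x * cos (\<theta> x) * indicator (B j) (x j)) + \<i> * of_real (LINT x|m. g x * sin (\<theta> x) * indicator (B j) (x j))"
        using intr[OF that] by (subst Bochner_Integration.integral_add) (simp_all del: of_real_mult)
      finally show ?thesis by (simp add: complex_eq_iff)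
    qed
    \<comment> \<open>The added 1 contributes the integral for the weight \<open>g\<close> itself,
      which is also known and is subtracted again.\<close>
    have cs: "(LINT x|\<mu>. g x * f x * indicator (B j) (x j)) = (LINT x|\<nu>. g x * f x * indicator (B j) (x j))"
      if "f = (\<lambda>x. cos (\<theta> x)) \<or> f = (\<lambda>x. sin (\<theta> x))" for f
    proof -
      have "(LINT x|m. g x * (1 + f x) * indicator (B j) (x j)) = (LINT x|m. g x * indicator (B j) (x j)) + (LINT x|m. g x * f x * indicator (B j) (x j))"
        if "m = \<mu> \<or> m = \<nu>" for m
        using intr[OF that] \<open>f = _ \<or> _\<close>
        by (auto simp: ring_distribs Bochner_Integration.integral_add)
      moreover have "(LINT x|\<mu>. g x * (1 + f x) * indicator (B j) (x j)) = (LINT x|\<nu>. g x * (1 + f x) * indicator (B j) (x j))"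
        using that key[of "\<lambda>x. g x * (1 + f x)"] by auto
      moreover note key[of g]
      ultimately show ?thesis by simp
    qed
    show ?case
      using split cs by (simp add: \<theta>_def)
  qed
  show ?thesis
  proof (rule measure_eqI_PiM_finite[OF K s\<mu> s\<nu>])
    fix A :: "'k \<Rightarrow> real set" assume A: "\<And>i. i \<in> K \<Longrightarrow> A i \<in> sets borel"
    have "measure m (Pi\<^sub>E K A) = (CLINT x|m. (\<Prod>k\<in>K. indicator (A k) (x k)))"
      if m: "finite_measure m" "sets m = sets (\<Pi>\<^sub>M k\<in>K. borel)" for m
    proof -
      have "(CLINT x|m. (\<Prod>k\<in>K. indicator (A k) (x k))) = (CLINT x|m. of_real (indicator (Pi\<^sub>E K A) x))"
      proof (intro Bochner_Integration.integral_cong refl)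
        fix x assume "x \<in> space m"
        then have "x \<in> extensional K"
          using sets_eq_imp_space_eq[OF m(2)] by (auto simp: space_PiM PiE_def)
        then show "(\<Prod>k\<in>K. indicator (A k) (x k)) = complex_of_real (indicator (Pi\<^sub>E K A) x)"
          using K by (auto simp: indicator_def PiE_def Pi_def prod_eq_1_iff)
      qed
      also have "\<dots> = measure m (Pi\<^sub>E K A)"
      proof -
        interpret finite_measure m by fact
        have "Pi\<^sub>E K A \<in> sets m"
          unfolding m(2) using A K by (intro sets_PiM_I_finite)
        then show ?thesis
          using sets.sets_into_space[of "Pi\<^sub>E K A" m] by (simp add: Int_absorb1)
      qed
      finally show ?thesis by simp
    qed
    note meas = this
    have "complex_of_real (measure \<mu> (Pi\<^sub>E K A)) = complex_of_real (measure \<nu> (Pi\<^sub>E K A))"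
      using claim[of K A "\<lambda>_. 0"] K A by (simp add: meas[OF fin(1) s\<mu>] meas[OF fin(2) s\<nu>])
    then have "measure \<mu> (Pi\<^sub>E K A) = measure \<nu> (Pi\<^sub>E K A)"
      by (simp only: of_real_eq_iff)
    then show "emeasure \<mu> (Pi\<^sub>E K A) = emeasure \<nu> (Pi\<^sub>E K A)"
      by (simp add: \<mu>.emeasure_eq_measure \<nu>.emeasure_eq_measure)
  next
    show "range (\<lambda>_::nat. Pi\<^sub>E K (\<lambda>_. UNIV)) \<subseteq> prod_algebra K (\<lambda>_. borel::real measure)"
      using K by (auto intro!: prod_algebraI_finite)
    show "(\<Union>i::nat. Pi\<^sub>E K (\<lambda>_. UNIV)) = space (\<Pi>\<^sub>M k\<in>K. borel::real measure)"
      by (simp add: space_PiM)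
    show "\<mu> (Pi\<^sub>E K (\<lambda>_. UNIV)) \<noteq> \<infinity>" by simp
  qed
qed

text \<open>The positive and the negative part of \<open>\<psi>\<close> define two finite measures
  whose images under \<open>X\<close> have the same characteristic function, hence coincide. In the
  van Trees argument \<open>\<psi>\<close> is the derivative of a weighted joint density, tested
  against an estimator \<open>f\<close>.\<close>

corollary integral_eq_0_if_char_eq_0:
  fixes \<psi> :: "'a \<Rightarrow> real" and f :: "('k \<Rightarrow> real) \<Rightarrow> real"
  assumes K: "finite K" and \<psi>: "integrable M \<psi>"
    and [measurable]: "X \<in> measurable M (\<Pi>\<^sub>M k\<in>K. borel)"
    and zero: "\<And>t. (CLINT \<omega>|M. \<psi> \<omega> * iexp (\<Sum>k\<in>K. t k * X \<omega> k)) = 0"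
    and f[measurable]: "f \<in> borel_measurable (\<Pi>\<^sub>M k\<in>K. borel)" and bdd: "\<And>x. \<bar>f x\<bar> \<le> C"
  shows "(LINT \<omega>|M. \<psi> \<omega> * f (X \<omega>)) = 0"
proof -
  note [measurable] = borel_measurable_integrable[OF \<psi>]
  define D where "D p = distr (density M (\<lambda>x. ennreal (p x))) (\<Pi>\<^sub>M k\<in>K. borel) X" for p :: "'a \<Rightarrow> real"
  have X[measurable]: "(\<lambda>\<omega>. X \<omega> k) \<in> borel_measurable M" if "k \<in> K" for k
    using that by measurable
  have E: "finite_measure (D p)"
    "(CLINT x|D p. iexp (\<Sum>k\<in>K. t k * x k)) = (CLINT \<omega>|M. p \<omega> * iexp (\<Sum>k\<in>K. t k * X \<omega> k))"
    "(LINT x|D p. f x) = (LINT \<omega>|M. p \<omega> * f (X \<omega>))"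
    if p: "integrable M p" "\<And>x. 0 \<le> p x" for p t
  proof -
    note [measurable] = borel_measurable_integrable[OF p(1)]
    have "(\<integral>\<^sup>+x. ennreal (p x) \<partial>M) < \<infinity>"
      using p by (simp add: nn_integral_eq_integral)
    then have "finite_measure (density M (\<lambda>x. ennreal (p x)))"
      by (intro finite_measureI) (simp add: emeasure_density cong: nn_integral_cong)
    then show "finite_measure (D p)"
      unfolding D_def by (rule finite_measure.finite_measure_distr) simp
    show "(CLINT x|D p. iexp (\<Sum>k\<in>K. t k * x k)) = (CLINT \<omega>|M. p \<omega> * iexp (\<Sum>k\<in>K. t k * X \<omega> k))"
      unfolding D_def using p
      by (subst integral_distr) (simp_all add: integral_density scaleR_conv_of_real)
    show "(LINT x|D p. f x) = (LINT \<omega>|M. p \<omega> * f (X \<omega>))"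
      unfolding D_def using p by (subst integral_distr) (simp_all add: integral_density)
  qed
  have ip: "integrable M (\<lambda>x. max 0 (\<psi> x))" "integrable M (\<lambda>x. max 0 (- \<psi> x))"
    using \<psi> by auto
  have ii: "integrable M (\<lambda>\<omega>. complex_of_real (p \<omega>) * iexp (\<Sum>k\<in>K. t k * X \<omega> k))"
    and ir: "integrable M (\<lambda>\<omega>. p \<omega> * f (X \<omega>))"
    if p: "integrable M p" for p t
  proof -
    note [measurable] = borel_measurable_integrable[OF p]
    show "integrable M (\<lambda>\<omega>. complex_of_real (p \<omega>) * iexp (\<Sum>k\<in>K. t k * X \<omega> k))"
      by (rule Bochner_Integration.integrable_bound[OF p]) (simp_all add: norm_mult)
    have "integrable M (\<lambda>\<omega>. C * p \<omega>)" using p by simp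
    then show "integrable M (\<lambda>\<omega>. p \<omega> * f (X \<omega>))"
    proof (rule Bochner_Integration.integrable_bound)
      have "\<bar>p \<omega>\<bar> * \<bar>f (X \<omega>)\<bar> \<le> \<bar>p \<omega>\<bar> * \<bar>C\<bar>" for \<omega>
        using bdd[of "X \<omega>"] by (intro mult_left_mono) auto
      then show "AE x in M. norm (p x * f (X x)) \<le> norm (C * p x)"
        by (simp add: abs_mult mult.commute)
    qed simp
  qed
  have max: "\<psi> \<omega> = max 0 (\<psi> \<omega>) - max 0 (- \<psi> \<omega>)" for \<omega> by auto
  have "D (\<lambda>x. max 0 (\<psi> x)) = D (\<lambda>x. max 0 (- \<psi> x))"
  proof (rule PiM_eqI_char[OF K])
    fix t
    have "(CLINT \<omega>|M. \<psi> \<omega> * iexp (\<Sum>k\<in>K. t k * X \<omega> k)) =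
       (CLINT \<omega>|M. max 0 (\<psi> \<omega>) * iexp (\<Sum>k\<in>K. t k * X \<omega> k)) - (CLINT \<omega>|M. max 0 (- \<psi> \<omega>) * iexp (\<Sum>k\<in>K. t k * X \<omega> k))"
      by (subst Bochner_Integration.integral_diff[symmetric, OF ii[OF ip(1)] ii[OF ip(2)]])
        (subst max, simp only: of_real_diff left_diff_distrib)
    then show "(CLINT x|D (\<lambda>x. max 0 (\<psi> x)). iexp (\<Sum>k\<in>K. t k * x k)) = (CLINT x|D (\<lambda>x. max 0 (- \<psi> x)). iexp (\<Sum>k\<in>K. t k * x k))"
      using E(2)[OF ip(1), of t] E(2)[OF ip(2), of t] zero[of t] by (simp del: of_real_sum of_real_mult)
  qed (use ip in \<open>auto intro!: E\<close>, simp_all add: D_def)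
  then have "(LINT \<omega>|M. max 0 (\<psi> \<omega>) * f (X \<omega>)) = (LINT \<omega>|M. max 0 (- \<psi> \<omega>) * f (X \<omega>))"
    using E(3)[OF ip(1)] E(3)[OF ip(2)] by simp
  moreover have "(LINT \<omega>|M. \<psi> \<omega> * f (X \<omega>)) = (LINT \<omega>|M. max 0 (\<psi> \<omega>) * f (X \<omega>)) - (LINT \<omega>|M. max 0 (- \<psi> \<omega>) * f (X \<omega>))"
    by (subst Bochner_Integration.integral_diff[symmetric, OF ir[OF ip(1)] ir[OF ip(2)]])
      (subst max, simp only: left_diff_distrib)
  ultimately show ?thesis by simp
qed

section \<open>Gaussian moments\<close>

lemma normal_density_tendsto_0:
  fixes \<sigma> :: real
  assumes "\<sigma> > 0"
  shows "((\<lambda>x. normal_density 0 \<sigma> x * (1 + x\<^sup>2)) \<longlongrightarrow> 0) at_top"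
    and "((\<lambda>x. normal_density 0 \<sigma> x * (1 + x\<^sup>2)) \<longlongrightarrow> 0) at_bot"
proof -
  define c d where "c = 1 / (2 * \<sigma>\<^sup>2)" and "d = 1 / sqrt (2 * pi * \<sigma>\<^sup>2)"
  have c: "c > 0" using assms by (simp add: c_def)
  have *: "normal_density 0 \<sigma> x * (1 + x\<^sup>2) = d * (exp (- c * x\<^sup>2) * (1 + x\<^sup>2))" for x
    by (simp add: normal_density_def c_def d_def)
  have "((\<lambda>x. exp (- c * x\<^sup>2) * (1 + x\<^sup>2)) \<longlongrightarrow> 0) at_top"
    using c by real_asymp
  from tendsto_mult[OF tendsto_const[of d] this]
  show 1: "((\<lambda>x. normal_density 0 \<sigma> x * (1 + x\<^sup>2)) \<longlongrightarrow> 0) at_top"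
    unfolding * by simp
  then show "((\<lambda>x. normal_density 0 \<sigma> x * (1 + x\<^sup>2)) \<longlongrightarrow> 0) at_bot"
    by (subst filterlim_at_bot_mirror) (simp add: normal_density_def)
qed

text \<open>Absolute normal moments up to order three dominate both integrands. Values in a
  Euclidean space admit complex exponentials as well as real functions.\<close>

lemma integrable_normal_density_le_square:
  fixes f :: "real \<Rightarrow> 'a::euclidean_space"
  assumes \<sigma>: "\<sigma> > 0" and f[measurable]: "f \<in> borel_measurable borel"
    and le: "\<And>x. norm (f x) \<le> C * (1 + x\<^sup>2)"
  shows "integrable lborel (\<lambda>x. normal_density 0 \<sigma> x *\<^sub>R f x)"
    and "integrable lborel (\<lambda>x. normal_density 0 \<sigma> x *\<^sub>R (x *\<^sub>R f x))"
proof -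
  have m: "integrable lborel (\<lambda>x. normal_density 0 \<sigma> x * \<bar>x\<bar> ^ k)" for k
    using integrable_normal_moment_abs[OF \<sigma>, of 0 k] by simp
  have i1: "integrable lborel (\<lambda>x. C * (normal_density 0 \<sigma> x * \<bar>x\<bar> ^ 0 + normal_density 0 \<sigma> x * \<bar>x\<bar> ^ 2))"
    and i2: "integrable lborel (\<lambda>x. C * (normal_density 0 \<sigma> x * \<bar>x\<bar> ^ 1 + normal_density 0 \<sigma> x * \<bar>x\<bar> ^ 3))"
    by (intro integrable_mult_right Bochner_Integration.integrable_add m)+
  have nn: "0 \<le> normal_density 0 \<sigma> x" for x by (simp add: normal_density_nonneg)
  show "integrable lborel (\<lambda>x. normal_density 0 \<sigma> x *\<^sub>R f x)"
  proof (rule Bochner_Integration.integrable_bound[OF i1])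
    have "normal_density 0 \<sigma> x * norm (f x) \<le> \<bar>C * (normal_density 0 \<sigma> x * \<bar>x\<bar> ^ 0 + normal_density 0 \<sigma> x * \<bar>x\<bar> ^ 2)\<bar>" for x
    proof -
      have "normal_density 0 \<sigma> x * norm (f x) \<le> normal_density 0 \<sigma> x * (C * (1 + x\<^sup>2))"
        by (intro mult_left_mono le nn)
      also have "\<dots> = C * (normal_density 0 \<sigma> x * \<bar>x\<bar> ^ 0 + normal_density 0 \<sigma> x * \<bar>x\<bar> ^ 2)"
        by (simp add: algebra_simps)
      finally show ?thesis by linarith
    qed
    then show "AE x in lborel. norm (normal_density 0 \<sigma> x *\<^sub>R f x) \<le>
        norm (C * (normal_density 0 \<sigma> x * \<bar>x\<bar> ^ 0 + normal_density 0 \<sigma> x * \<bar>x\<bar> ^ 2))"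
      using nn by (simp add: abs_of_nonneg)
  qed simp
  show "integrable lborel (\<lambda>x. normal_density 0 \<sigma> x *\<^sub>R (x *\<^sub>R f x))"
  proof (rule Bochner_Integration.integrable_bound[OF i2])
    have "normal_density 0 \<sigma> x * (\<bar>x\<bar> * norm (f x)) \<le> \<bar>C * (normal_density 0 \<sigma> x * \<bar>x\<bar> ^ 1 + normal_density 0 \<sigma> x * \<bar>x\<bar> ^ 3)\<bar>" for x
    proof -
      have "normal_density 0 \<sigma> x * (\<bar>x\<bar> * norm (f x)) \<le> normal_density 0 \<sigma> x * (\<bar>x\<bar> * (C * (1 + x\<^sup>2)))"
        by (intro mult_left_mono le nn) auto
      also have "\<dots> = C * (normal_density 0 \<sigma> x * \<bar>x\<bar> ^ 1 + normal_density 0 \<sigma> x * \<bar>x\<bar> ^ 3)"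
        by (simp add: algebra_simps power3_eq_cube power2_eq_square flip: abs_mult)
      finally show ?thesis by linarith
    qed
    then show "AE x in lborel. norm (normal_density 0 \<sigma> x *\<^sub>R (x *\<^sub>R f x)) \<le>
        norm (C * (normal_density 0 \<sigma> x * \<bar>x\<bar> ^ 1 + normal_density 0 \<sigma> x * \<bar>x\<bar> ^ 3))"
      using nn by (simp add: abs_mult abs_of_nonneg mult.assoc)
  qed simp
qed

text \<open>Integration by parts: the density satisfies
  \<open>\<phi>' = - (x / \<sigma>\<^sup>2) * \<phi>\<close>, so the two integrands combine to the
  derivative of \<open>\<phi> * f\<close>, and the growth bound makes \<open>\<phi> * f\<close>
  vanish at both ends of the line.\<close>

lemma stein_normal_density:
  fixes f :: "real \<Rightarrow> 'a::euclidean_space"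
  assumes \<sigma>: "\<sigma> > 0"
    and f: "\<And>x. (f has_vector_derivative f' x) (at x)" and f': "continuous_on UNIV f'"
    and le: "\<And>x. norm (f x) \<le> C * (1 + x\<^sup>2)" "\<And>x. norm (f' x) \<le> C * (1 + x\<^sup>2)"
  shows "(\<integral>x. normal_density 0 \<sigma> x *\<^sub>R (x *\<^sub>R f x) \<partial>lborel) = \<sigma>\<^sup>2 *\<^sub>R (\<integral>x. normal_density 0 \<sigma> x *\<^sub>R f' x \<partial>lborel)"
proof -
  define \<phi> where "\<phi> = normal_density 0 \<sigma>"
  have cf: "continuous_on UNIV f"
    using f by (meson continuous_at_imp_continuous_on has_vector_derivative_continuous)
  have [measurable]: "f \<in> borel_measurable borel" "f' \<in> borel_measurable borel"
    using cf f' by (auto intro: borel_measurable_continuous_onI)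
  note i = integrable_normal_density_le_square[OF \<sigma> \<open>f \<in> borel_measurable borel\<close> le(1), folded \<phi>_def]
    integrable_normal_density_le_square[OF \<sigma> \<open>f' \<in> borel_measurable borel\<close> le(2), folded \<phi>_def]
  have \<phi>': "(\<phi> has_real_derivative - (x / \<sigma>\<^sup>2) * \<phi> x) (at x)" for x
    unfolding \<phi>_def normal_density_def using \<sigma>
    by (auto intro!: derivative_eq_intros simp: field_simps)
  define F where "F x = \<phi> x *\<^sub>R f x" for x
  define F' where "F' x = \<phi> x *\<^sub>R f' x - (1 / \<sigma>\<^sup>2) *\<^sub>R (\<phi> x *\<^sub>R (x *\<^sub>R f x))" for x
  have F: "(F has_vector_derivative F' x) (at x)" for x
    unfolding F_def F'_def
    by (rule has_vector_derivative_eq_rhs[OF has_vector_derivative_scaleR[OF \<phi>' f]]) simp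
  have c\<phi>: "isCont \<phi> x" for x using \<phi>' by (rule DERIV_isCont)
  have cF': "isCont F' x" for x
    unfolding F'_def using f' cf c\<phi>
    by (intro continuous_intros) (auto simp: continuous_on_eq_continuous_at)
  have iF': "integrable lborel F'"
    unfolding F'_def using i by (intro Bochner_Integration.integrable_diff integrable_scaleR_right) auto
  have lim: "(F \<longlongrightarrow> 0) G" if "((\<lambda>x. \<phi> x * (1 + x\<^sup>2)) \<longlongrightarrow> 0) G" for G
  proof (rule Lim_null_comparison)
    show "((\<lambda>x. C * (\<phi> x * (1 + x\<^sup>2))) \<longlongrightarrow> 0) G"
      using tendsto_mult[OF tendsto_const[of C] that] by simp
    have "norm (F x) \<le> C * (\<phi> x * (1 + x\<^sup>2))" for x
      using mult_left_mono[OF le(1)[of x], of "\<phi> x"] by (simp add: F_def \<phi>_def normal_density_nonneg ac_simps)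
    then show "\<forall>\<^sub>F x in G. norm (F x) \<le> C * (\<phi> x * (1 + x\<^sup>2))" by simp
  qed
  have "(LBINT x=-\<infinity>..\<infinity>. F' x) = 0 - 0"
  proof (rule interval_integral_FTC_integrable)
    show "((F \<circ> real_of_ereal) \<longlongrightarrow> 0) (at_right (- \<infinity>))" "((F \<circ> real_of_ereal) \<longlongrightarrow> 0) (at_left \<infinity>)"
      using lim normal_density_tendsto_0[OF \<sigma>, folded \<phi>_def] by (simp_all add: ereal_tendsto_simps)
    show "set_integrable lborel (einterval (- \<infinity>) \<infinity>) F'"
      using iF' by (simp add: set_integrable_def)
  qed (use F cF' in auto)
  then have "(\<integral>x. F' x \<partial>lborel) = 0"
    by (simp add: interval_lebesgue_integral_def set_lebesgue_integral_def)
  then have "(\<integral>x. \<phi> x *\<^sub>R f' x \<partial>lborel) = (1 / \<sigma>\<^sup>2) *\<^sub>R (\<integral>x. \<phi> x *\<^sub>R (x *\<^sub>R f x) \<partial>lborel)"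
    unfolding F'_def
    by (simp only: Bochner_Integration.integral_diff[OF i(3) integrable_scaleR_right[OF i(2)]]
        integral_scaleR_right right_minus_eq)
  then show ?thesis
    unfolding \<phi>_def using \<sigma> by simp
qed

abbreviation std_gaussian :: "'l set \<Rightarrow> ('l \<Rightarrow> real) measure" where
  "std_gaussian L \<equiv> \<Pi>\<^sub>M l\<in>L. std_normal_distribution"

lemma prob_space_std_normal: "prob_space std_normal_distribution"
  by (rule prob_space_normal_density) simp

lemma product_prob_space_std_normal: "product_prob_space (\<lambda>_. std_normal_distribution)"
  by (simp add: product_prob_space_def product_prob_space_axioms_def product_sigma_finite_def
      prob_space_std_normal prob_space_imp_sigma_finite)

lemma prob_space_std_gaussian: "prob_space (std_gaussian L)"
  by (rule prob_space_PiM) (rule prob_space_std_normal)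

lemma borel_measurable_std_normal [measurable_cong]: "sets std_normal_distribution = sets borel"
  by simp

text \<open>Starting from the known characteristic function, Stein's identity for
  \<open>iexp (s * x)\<close> and for \<open>x * iexp (s * x)\<close> raises the power of
  \<open>x\<close> by one each time.\<close>

lemma integral_std_normal_power_iexp:
  fixes s :: real
  assumes "m \<le> 2"
  shows "(CLINT x|std_normal_distribution. of_real (x ^ m) * iexp (s * x)) =
      (if m = 0 then 1 else if m = 1 then \<i> * s else 1 - s\<^sup>2) * exp (- s\<^sup>2 / 2)" (is "?L m = _")
    and "integrable std_normal_distribution (\<lambda>x. complex_of_real (x ^ m) * iexp (s * x))" (is "?I m")
proof -
  have ie: "integrable std_normal_distribution (\<lambda>x. complex_of_real (x ^ k) * iexp (s * x))" for k
    by (rule Bochner_Integration.integrable_bound[OF integrable_std_normal_distribution_moment[of k]])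
      (simp_all add: norm_mult norm_power power_abs)
  then show "?I m" .
  have L0: "?L 0 = exp (- s\<^sup>2 / 2)"
    using fun_cong[OF char_std_normal_distribution, of s] by (simp add: char_def)
  have dens: "(CLINT x|std_normal_distribution. f x) = (\<integral>x. std_normal_density x *\<^sub>R f x \<partial>lborel)"
    if [measurable]: "f \<in> borel_measurable borel" for f :: "real \<Rightarrow> complex"
    by (subst integral_density) auto
  have L1: "?L 1 = \<i> * s * ?L 0"
  proof -
    have "(\<integral>x. std_normal_density x *\<^sub>R (x *\<^sub>R iexp (s * x)) \<partial>lborel) =
      1\<^sup>2 *\<^sub>R (\<integral>x. std_normal_density x *\<^sub>R (\<i> * s * iexp (s * x)) \<partial>lborel)"
    proof (rule stein_normal_density)
      show "((\<lambda>x. iexp (s * x)) has_vector_derivative \<i> * s * iexp (s * x)) (at x)" for x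
      proof -
        have "((\<lambda>z. exp (\<i> * s * z)) has_field_derivative \<i> * s * iexp (s * x)) (at (complex_of_real x))"
          by (auto intro!: derivative_eq_intros simp: mult.assoc)
        from has_vector_derivative_real_field[OF this] show ?thesis by (simp add: mult.assoc)
      qed
      show "continuous_on UNIV (\<lambda>x. \<i> * s * iexp (s * x))" by (intro continuous_intros)
      show "norm (iexp (s * x)) \<le> (1 + \<bar>s\<bar>) * (1 + x\<^sup>2)" "norm (\<i> * s * iexp (s * x)) \<le> (1 + \<bar>s\<bar>) * (1 + x\<^sup>2)" for x
        by (simp_all add: norm_mult ring_distribs)
    qed simp
    then show ?thesis
      by (simp add: dens scaleR_conv_of_real)
        (simp flip: integral_mult_right_zero add: ac_simps)
  qed
  have L2: "?L 2 = ?L 0 + \<i> * s * ?L 1"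
  proof -
    have "(\<integral>x. std_normal_density x *\<^sub>R (x *\<^sub>R (x * iexp (s * x))) \<partial>lborel) =
      1\<^sup>2 *\<^sub>R (\<integral>x. std_normal_density x *\<^sub>R (iexp (s * x) + \<i> * s * (x * iexp (s * x))) \<partial>lborel)"
    proof (rule stein_normal_density)
      show "((\<lambda>x. x * iexp (s * x)) has_vector_derivative iexp (s * x) + \<i> * s * (x * iexp (s * x))) (at x)" for x
      proof -
        have "((\<lambda>z. z * exp (\<i> * s * z)) has_field_derivative iexp (s * x) + \<i> * s * (x * iexp (s * x))) (at (complex_of_real x))"
          by (auto intro!: derivative_eq_intros simp: algebra_simps)
        from has_vector_derivative_real_field[OF this] show ?thesis by (simp add: mult.assoc)
      qed
      show "continuous_on UNIV (\<lambda>x. iexp (s * x) + \<i> * s * (x * iexp (s * x)))" by (intro continuous_intros)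
      have x: "\<bar>x\<bar> \<le> 1 + x\<^sup>2" for x :: real
        using sum_power2_ge_zero[of "\<bar>x\<bar> - 1" 0] zero_le_power2[of x] by (simp add: power2_eq_square algebra_simps)
      show "norm (x * iexp (s * x)) \<le> (1 + \<bar>s\<bar>) * (1 + x\<^sup>2)" for x
        using x[of x] mult_right_mono[of 1 "1 + \<bar>s\<bar>" "1 + x\<^sup>2"] by (simp add: norm_mult)
      have "norm (iexp (s * x) + \<i> * s * (x * iexp (s * x))) \<le> 1 + \<bar>s\<bar> * \<bar>x\<bar>" for x
        by (rule norm_triangle_le) (simp add: norm_mult)
      moreover have "1 + \<bar>s\<bar> * \<bar>x\<bar> \<le> (1 + \<bar>s\<bar>) * (1 + x\<^sup>2)" for x
        using mult_left_mono[OF x[of x], of "\<bar>s\<bar>"] by (simp add: ring_distribs) (use zero_le_power2[of x] in linarith)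
      ultimately show "norm (iexp (s * x) + \<i> * s * (x * iexp (s * x))) \<le> (1 + \<bar>s\<bar>) * (1 + x\<^sup>2)" for x
        by (rule order_trans)
    qed simp
    then have "?L 2 = (CLINT x|std_normal_distribution. of_real (x ^ 0) * iexp (s * x) + \<i> * s * (of_real (x ^ 1) * iexp (s * x)))"
      by (simp add: dens scaleR_conv_of_real power2_eq_square mult.assoc)
    also have "\<dots> = ?L 0 + \<i> * s * ?L 1"
      using ie[of 0] ie[of 1] by (subst Bochner_Integration.integral_add) auto
    finally show ?thesis .
  qed
  have "m = 0 \<or> m = 1 \<or> m = 2" using assms by auto
  then show "?L m = (if m = 0 then 1 else if m = 1 then \<i> * s else 1 - s\<^sup>2) * exp (- s\<^sup>2 / 2)"
    using L0 L1 L2 by (elim disjE) (simp_all add: algebra_simps power2_eq_square)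
qed

text \<open>The second claim is the transform of a Hermite polynomial of degree two: subtracting
  \<open>of_bool (j = k)\<close> removes the constant, and only the product of the two frequencies
  survives. Quadratic forms in these polynomials therefore act as derivatives of a Gaussian
  characteristic function with respect to the covariance.\<close>

lemma integral_std_gaussian_iexp:
  fixes s :: "'l \<Rightarrow> real"
  assumes L: "finite L"
  shows "(CLINT g|std_gaussian L. iexp (\<Sum>l\<in>L. s l * g l)) = exp (- (\<Sum>l\<in>L. (s l)\<^sup>2) / 2)"
    and "j \<in> L \<Longrightarrow> k \<in> L \<Longrightarrow>
      (CLINT g|std_gaussian L. of_real (g j * g k - of_bool (j = k)) * iexp (\<Sum>l\<in>L. s l * g l)) =
      - of_real (s j * s k * exp (- (\<Sum>l\<in>L. (s l)\<^sup>2) / 2))"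
proof -
  define e :: complex where "e = exp (- (\<Sum>l\<in>L. (s l)\<^sup>2) / 2)"
  define c :: "nat \<Rightarrow> real \<Rightarrow> complex" where "c m t = (if m = 0 then 1 else if m = 1 then \<i> * t else 1 - t\<^sup>2)" for m t
  have e: "e = (\<Prod>l\<in>L. exp (- complex_of_real ((s l)\<^sup>2) / 2))"
    using L by (simp add: e_def exp_sum[symmetric] sum_negf sum_divide_distrib flip: exp_of_real)
  have P: "(CLINT g|std_gaussian L. (\<Prod>l\<in>L. of_real (g l ^ m l) * iexp (s l * g l))) = (\<Prod>l\<in>L. c (m l) (s l)) * e"
    and PI: "integrable (std_gaussian L) (\<lambda>g. \<Prod>l\<in>L. complex_of_real (g l ^ m l) * iexp (s l * g l))"
    if m: "\<And>l. m l \<le> 2" for m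
  proof -
    have "(CLINT g|std_gaussian L. (\<Prod>l\<in>L. of_real (g l ^ m l) * iexp (s l * g l))) =
        (\<Prod>l\<in>L. CLINT x|std_normal_distribution. of_real (x ^ m l) * iexp (s l * x))"
      by (intro product_sigma_finite.product_integral_prod product_prob_space_std_normal[THEN product_prob_space.axioms(1)] L integral_std_normal_power_iexp(2) m)
    also have "\<dots> = (\<Prod>l\<in>L. c (m l) (s l) * exp (- complex_of_real ((s l)\<^sup>2) / 2))"
      by (intro prod.cong refl, subst integral_std_normal_power_iexp(1)[OF m]) (simp add: c_def exp_of_real[symmetric])
    finally show "(CLINT g|std_gaussian L. (\<Prod>l\<in>L. of_real (g l ^ m l) * iexp (s l * g l))) = (\<Prod>l\<in>L. c (m l) (s l)) * e"
      by (simp add: prod.distrib e)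
    show "integrable (std_gaussian L) (\<lambda>g. \<Prod>l\<in>L. complex_of_real (g l ^ m l) * iexp (s l * g l))"
      by (intro product_sigma_finite.product_integrable_prod product_prob_space_std_normal[THEN product_prob_space.axioms(1)] L integral_std_normal_power_iexp(2) m)
  qed
  have ie: "iexp (\<Sum>l\<in>L. s l * g l) = (\<Prod>l\<in>L. iexp (s l * g l))" for g
    using L by (simp add: exp_sum sum_distrib_left)
  show 1: "(CLINT g|std_gaussian L. iexp (\<Sum>l\<in>L. s l * g l)) = exp (- (\<Sum>l\<in>L. (s l)\<^sup>2) / 2)"
    using P[of "\<lambda>_. 0"] by (simp add: ie c_def e_def del: of_real_sum)
  assume jk: "j \<in> L" "k \<in> L"
  \<comment> \<open>The exponents of the monomial \<open>g j * g k\<close>: a single 2 if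
    \<open>j = k\<close>, and two exponents 1 otherwise.\<close>
  define m :: "'l \<Rightarrow> nat" where "m l = of_bool (l = j) + of_bool (l = k)" for l
  have m: "m l \<le> 2" for l by (simp add: m_def)
  have pm: "(\<Prod>l\<in>L. complex_of_real (g l ^ m l) * iexp (s l * g l)) = of_real (g j * g k) * iexp (\<Sum>l\<in>L. s l * g l)" for g
  proof -
    have "(\<Prod>l\<in>L. g l ^ m l) = (\<Prod>l\<in>L. if l = j then g l else 1) * (\<Prod>l\<in>L. if l = k then g l else 1)"
      unfolding prod.distrib[symmetric] by (intro prod.cong) (auto simp: m_def power2_eq_square)
    then have "(\<Prod>l\<in>L. g l ^ m l) = g j * g k"
      using jk L by (simp add: prod.delta)
    then show ?thesis
      unfolding ie prod.distrib of_real_prod[symmetric] by (simp only:)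
  qed
  have cm: "(\<Prod>l\<in>L. c (m l) (s l)) = of_bool (j = k) - of_real (s j * s k)"
  proof (cases "j = k")
    case True
    have "(\<Prod>l\<in>L. c (m l) (s l)) = (\<Prod>l\<in>L. if l = j then 1 - of_real ((s l)\<^sup>2) else 1)"
      by (intro prod.cong) (auto simp: m_def c_def True)
    then show ?thesis using True jk L by (simp add: power2_eq_square)
  next
    case False
    have "(\<Prod>l\<in>L. c (m l) (s l)) = (\<Prod>l\<in>L. if l = j then \<i> * s l else 1) * (\<Prod>l\<in>L. if l = k then \<i> * s l else 1)"
      unfolding prod.distrib[symmetric] by (intro prod.cong) (use False in \<open>auto simp: m_def c_def\<close>)
    then show ?thesis using False jk L by (simp add: algebra_simps)
  qed
  have "(CLINT g|std_gaussian L. of_real (g j * g k - of_bool (j = k)) * iexp (\<Sum>l\<in>L. s l * g l)) =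
     (CLINT g|std_gaussian L. (\<Prod>l\<in>L. complex_of_real (g l ^ m l) * iexp (s l * g l)) -
        of_bool (j = k) * (\<Prod>l\<in>L. complex_of_real (g l ^ 0) * iexp (s l * g l)))"
    unfolding pm
    by (intro Bochner_Integration.integral_cong refl, cases "j = k";
      simp only: power_0 of_real_1 mult_1 ie[symmetric] of_real_diff left_diff_distrib of_bool_eq simp_thms of_real_0 mult_zero_left)
  also have "\<dots> = (\<Prod>l\<in>L. c (m l) (s l)) * e - of_bool (j = k) * ((\<Prod>l\<in>L. c 0 (s l)) * e)"
    using PI[OF m] PI[of "\<lambda>_. 0"] P[OF m] P[of "\<lambda>_. 0"]
    by (subst Bochner_Integration.integral_diff) auto
  also have "\<dots> = - of_real (s j * s k) * e"
    unfolding cm by (cases "j = k") (simp_all add: c_def ring_distribs)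
  finally show "(CLINT g|std_gaussian L. of_real (g j * g k - of_bool (j = k)) * iexp (\<Sum>l\<in>L. s l * g l)) =
      - of_real (s j * s k * exp (- (\<Sum>l\<in>L. (s l)\<^sup>2) / 2))"
    by (simp add: e_def flip: exp_of_real)
qed

text \<open>Monomials are indexed by lists of coordinates, so that an expectation factorises over
  the multiplicities \<open>count_list\<close>. What remains is a finite case distinction on
  coincidences among the four indices.\<close>

lemma isserlis:
  assumes L: "finite L" and mem: "j \<in> L" "k \<in> L" "p \<in> L" "q \<in> L"
  shows "(LINT g|std_gaussian L. (g j * g k - of_bool (j = k)) * (g p * g q - of_bool (p = q))) =
      of_bool (j = p \<and> k = q) + of_bool (j = q \<and> k = p)" (is ?A)
    and "integrable (std_gaussian L) (\<lambda>g. (g j * g k - of_bool (j = k)) * (g p * g q - of_bool (p = q)))" (is ?B)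
    and "integrable (std_gaussian L) (\<lambda>g. g j * g k)" (is ?C)
    and "(LINT g|std_gaussian L. g j * g k) = of_bool (j = k)" (is ?D)
proof -
  define \<mu> :: "nat \<Rightarrow> real" where "\<mu> m = (LINT x|std_normal_distribution. x ^ m)" for m
  have "\<mu> 0 = 1" "\<mu> (Suc 0) = 0" "\<mu> 2 = 1" "\<mu> 3 = 0" "\<mu> 4 = 3"
    using std_normal_distribution_even_moments(1)[of 0] std_normal_distribution_even_moments(1)[of 1]
      std_normal_distribution_even_moments(1)[of 2] integral_std_normal_distribution_moment_odd[of 1]
      integral_std_normal_distribution_moment_odd[of 3]
    by (simp_all add: \<mu>_def fact_numeral)
  then have \<mu>: "\<mu> 0 = 1" "\<mu> (Suc 0) = 0" "\<mu> (Suc (Suc 0)) = 1" "\<mu> (Suc (Suc (Suc 0))) = 0" "\<mu> (Suc (Suc (Suc (Suc 0)))) = 3"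
    by (simp_all add: eval_nat_numeral)
  define w :: "'a list \<Rightarrow> ('a \<Rightarrow> real) \<Rightarrow> real" where "w is g = (\<Prod>l\<in>L. g l ^ count_list is l)" for "is" g
  have w: "integrable (std_gaussian L) (w is)" "(LINT g|std_gaussian L. w is g) = (\<Prod>l\<in>set is. \<mu> (count_list is l))"
    if "set is \<subseteq> L" for "is"
  proof -
    show "integrable (std_gaussian L) (w is)"
      unfolding w_def by (intro product_sigma_finite.product_integrable_prod product_prob_space_std_normal[THEN product_prob_space.axioms(1)] L integrable_std_normal_distribution_moment)
    have "(LINT g|std_gaussian L. w is g) = (\<Prod>l\<in>L. \<mu> (count_list is l))"
      unfolding w_def \<mu>_def by (intro product_sigma_finite.product_integral_prod product_prob_space_std_normal[THEN product_prob_space.axioms(1)] L integrable_std_normal_distribution_moment)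
    also have "\<dots> = (\<Prod>l\<in>set is. \<mu> (count_list is l))"
      using that L by (intro prod.mono_neutral_right) (auto simp: \<mu> count_list_0_iff)
    finally show "(LINT g|std_gaussian L. w is g) = \<dots>" .
  qed
  have w_Cons: "w (i # is) g = g i * w is g" if "i \<in> L" for i "is" g
  proof -
    have "w (i # is) g = (\<Prod>l\<in>L. (if l = i then g l else 1) * g l ^ count_list is l)"
      unfolding w_def by (intro prod.cong) auto
    also have "\<dots> = g i * w is g"
      using that L by (simp add: w_def prod.distrib)
    finally show ?thesis .
  qed
  have w_Nil: "w [] g = 1" for g by (simp add: w_def)
  have ex: "(g j * g k - of_bool (j = k)) * (g p * g q - of_bool (p = q)) =
      w [j,k,p,q] g - of_bool (p = q) * w [j,k] g - of_bool (j = k) * w [p,q] g + of_bool (j = k) * of_bool (p = q) * w [] g" for g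
    using mem by (simp add: w_Cons w_Nil algebra_simps)
  have i: "integrable (std_gaussian L) (w [j,k,p,q])" "integrable (std_gaussian L) (w [j,k])"
    "integrable (std_gaussian L) (w [p,q])" "integrable (std_gaussian L) (w [])"
    using mem by (auto intro!: w)
  show ?B unfolding ex using i by auto
  have "w [j,k] = (\<lambda>g. g j * g k)"
    using mem by (auto simp: w_Cons w_Nil)
  then show ?C using i(2) by simp
  show ?D using w(2)[of "[j,k]"] mem by (cases "j = k") (auto simp: w_Cons w_Nil \<mu>)
  have "(LINT g|std_gaussian L. (g j * g k - of_bool (j = k)) * (g p * g q - of_bool (p = q))) =
      (LINT g|std_gaussian L. w [j,k,p,q] g) - of_bool (p = q) * (LINT g|std_gaussian L. w [j,k] g)
       - of_bool (j = k) * (LINT g|std_gaussian L. w [p,q] g) + of_bool (j = k) * of_bool (p = q) * (LINT g|std_gaussian L. w [] g)"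
    unfolding ex using i by simp
  also have "\<dots> = of_bool (j = p \<and> k = q) + of_bool (j = q \<and> k = p)"
    using mem
    by (cases "j = k"; cases "p = q"; cases "j = p"; cases "j = q"; cases "k = p"; cases "k = q")
      (simp_all add: w(2) \<mu> insert_commute)
  finally show ?A .
qed

section \<open>The van Trees inequality\<close>

lemma integral_FTC_Icc_lborel:
  fixes F f :: "real \<Rightarrow> real"
  assumes "l \<le> u" "\<And>x. (F has_real_derivative f x) (at x)" "continuous_on UNIV f"
  shows "(\<integral>x. indicator {l..u} x * f x \<partial>lborel) = F u - F l"
    and "integrable lborel (\<lambda>x. indicator {l..u} x * f x)"
proof -
  have "has_bochner_integral lborel (\<lambda>x. f x * indicator {l..u} x) (F u - F l)"
    using assms
    by (intro has_bochner_integral_FTC_Icc_real) (auto simp: continuous_on_eq_continuous_at intro: DERIV_subset)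
  then show "(\<integral>x. indicator {l..u} x * f x \<partial>lborel) = F u - F l"
    "integrable lborel (\<lambda>x. indicator {l..u} x * f x)"
    by (auto simp: has_bochner_integral_iff mult.commute)
qed

text \<open>The prior density is proportional to \<open>((h - l) (u - h))\<^sup>2\<close>, whose Fisher information is \<open>40 / (u - l)\<^sup>2\<close>.
  The score \<open>\<Psi>\<close> is allowed to depend on more than the observation \<open>X\<close>: it only has to reproduce the
  derivative of the characteristic function of \<open>X\<close>.\<close>

proposition van_Trees:
  fixes X :: "real \<Rightarrow> 'g \<Rightarrow> 'k \<Rightarrow> real" and \<Psi> :: "real \<Rightarrow> 'g \<Rightarrow> real"
    and T :: "('k \<Rightarrow> real) \<Rightarrow> real"
  assumes K: "finite K" and G: "prob_space G" and lu: "l < u"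
    and X[measurable]: "case_prod X \<in> measurable (borel \<Otimes>\<^sub>M G) (\<Pi>\<^sub>M k\<in>K. borel)"
    and \<Psi>[measurable]: "case_prod \<Psi> \<in> borel_measurable (borel \<Otimes>\<^sub>M G)"
    and T[measurable]: "T \<in> borel_measurable (\<Pi>\<^sub>M k\<in>K. borel)" and bdd: "\<And>x. \<bar>T x\<bar> \<le> C"
    and \<Psi>2: "\<And>h. h \<in> {l..u} \<Longrightarrow> integrable G (\<lambda>g. (\<Psi> h g)\<^sup>2)"
    and \<Psi>0: "\<And>h. h \<in> {l..u} \<Longrightarrow> (LINT g|G. \<Psi> h g) = 0"
    and F: "\<And>h. h \<in> {l..u} \<Longrightarrow> (LINT g|G. (\<Psi> h g)\<^sup>2) \<le> F"
    and char: "\<And>h t. h \<in> {l..u} \<Longrightarrow> (CLINT g|G. iexp (\<Sum>k\<in>K. t k * X h g k)) = of_real (exp (- (q0 t + h * qA t) / 2))"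
    and score: "\<And>h t. h \<in> {l..u} \<Longrightarrow> (CLINT g|G. \<Psi> h g * iexp (\<Sum>k\<in>K. t k * X h g k)) =
        of_real (- qA t / 2 * exp (- (q0 t + h * qA t) / 2))"
    and risk: "\<And>h. h \<in> {l..u} \<Longrightarrow> (LINT g|G. (T (X h g) - h)\<^sup>2) \<le> R"
  shows "1 \<le> R * (F + 40 / (u - l)\<^sup>2)"
proof -
  interpret G: prob_space G by fact
  \<comment> \<open>Lebesgue measure on the interval, not yet the prior; the prior density
    \<open>\<kappa>\<^sup>2 / c\<close> enters as a weight in the integrands.\<close>
  define \<nu> where "\<nu> = density lborel (\<lambda>h. indicator {l..u} h)"
  have "emeasure \<nu> UNIV = ennreal (u - l)"
    using lu by (simp add: \<nu>_def emeasure_density)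
  then interpret \<nu>: finite_measure \<nu>
    by (intro finite_measureI) (simp add: \<nu>_def)
  have [measurable_cong]: "sets \<nu> = sets borel" by (simp add: \<nu>_def)
  interpret P: pair_sigma_finite \<nu> G ..
  interpret P: finite_measure "\<nu> \<Otimes>\<^sub>M G"
    by (rule finite_measure_pair_measure) unfold_locales
  have int\<nu>: "(LINT h|\<nu>. f h) = (\<integral>h. indicator {l..u} h *\<^sub>R f h \<partial>lborel)"
      "integrable \<nu> f \<longleftrightarrow> integrable lborel (\<lambda>h. indicator {l..u} h *\<^sub>R f h)"
    if [measurable]: "f \<in> borel_measurable borel" for f :: "real \<Rightarrow> 'z::{banach,second_countable_topology}"
    unfolding \<nu>_def ennreal_indicator[symmetric]
    by (subst integral_density integrable_density; simp)+
  have AE\<nu>: "AE h in \<nu>. h \<in> {l..u}"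
    unfolding \<nu>_def by (subst AE_density) (auto simp: indicator_def)
  have AEP: "AE p in \<nu> \<Otimes>\<^sub>M G. fst p \<in> {l..u}"
    by (rule P.AE_pair_measure) (use AE\<nu> in \<open>auto elim: eventually_mono\<close>)
  \<comment> \<open>The square root of the unnormalised prior density. It vanishes at both ends of
    the interval, which removes all boundary terms below.\<close>
  define \<kappa> where "\<kappa> h = (h - l) * (u - h)" for h
  define \<kappa>' where "\<kappa>' h = l + u - 2 * h" for h
  have \<kappa>': "(\<kappa> has_real_derivative \<kappa>' h) (at h)" for h
    unfolding \<kappa>_def \<kappa>'_def by (auto intro!: derivative_eq_intros)
  have \<kappa>0: "\<kappa> l = 0" "\<kappa> u = 0" by (simp_all add: \<kappa>_def)
  have c\<kappa>: "continuous_on S \<kappa>" "continuous_on S \<kappa>'" for S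
    unfolding \<kappa>_def \<kappa>'_def by (intro continuous_intros)+
  have [measurable]: "\<kappa> \<in> borel_measurable borel" "\<kappa>' \<in> borel_measurable borel"
    by (intro borel_measurable_continuous_onI c\<kappa>)+
  \<comment> \<open>The integral of \<open>\<kappa>\<^sup>2\<close>. The integral of
    \<open>\<kappa>'\<^sup>2\<close> is \<open>(u - l) ^ 3 / 3\<close>, and four times the quotient
    of the two is the constant \<open>40 / (u - l)\<^sup>2\<close>.\<close>
  define c where "c = (u - l) ^ 5 / 30"
  have c: "c > 0" using lu by (simp add: c_def)
  have I1: "(LINT h|\<nu>. (\<kappa> h)\<^sup>2) = c" "integrable \<nu> (\<lambda>h. (\<kappa> h)\<^sup>2)"
  proof -
    define H where "H h = (h - l) ^ 3 * ((u - l)\<^sup>2 / 3 - (u - l) * (h - l) / 2 + (h - l)\<^sup>2 / 5)" for h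
    have H: "(H has_real_derivative (\<kappa> h)\<^sup>2) (at h)" for h
      unfolding H_def \<kappa>_def
      by (auto intro!: derivative_eq_intros simp: field_simps power2_eq_square power3_eq_cube eval_nat_numeral)
    have "H u - H l = c"
      by (simp add: H_def c_def eval_nat_numeral field_simps)
    then show "(LINT h|\<nu>. (\<kappa> h)\<^sup>2) = c" "integrable \<nu> (\<lambda>h. (\<kappa> h)\<^sup>2)"
      using integral_FTC_Icc_lborel[OF less_imp_le[OF lu] H continuous_on_power[OF c\<kappa>(1)]]
      by (auto simp: int\<nu>)
  qed
  have I2: "(LINT h|\<nu>. (\<kappa>' h)\<^sup>2) = (u - l) ^ 3 / 3" "integrable \<nu> (\<lambda>h. (\<kappa>' h)\<^sup>2)"
  proof -
    define H where "H h = - ((\<kappa>' h) ^ 3) / 6" for h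
    have H: "(H has_real_derivative (\<kappa>' h)\<^sup>2) (at h)" for h
      unfolding H_def \<kappa>'_def
      by (auto intro!: derivative_eq_intros)
    have "H u - H l = (u - l) ^ 3 / 3"
      by (simp add: H_def \<kappa>'_def eval_nat_numeral field_simps)
    then show "(LINT h|\<nu>. (\<kappa>' h)\<^sup>2) = (u - l) ^ 3 / 3" "integrable \<nu> (\<lambda>h. (\<kappa>' h)\<^sup>2)"
      using integral_FTC_Icc_lborel[OF less_imp_le[OF lu] H continuous_on_power[OF c\<kappa>(2)]]
      by (auto simp: int\<nu>)
  qed
  have I3: "(LINT h|\<nu>. h * (2 * \<kappa> h * \<kappa>' h)) = - c"
  proof -
    have "((\<lambda>h. h * (\<kappa> h)\<^sup>2) has_real_derivative (\<kappa> h)\<^sup>2 + h * (2 * \<kappa> h * \<kappa>' h)) (at h)" for h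
      using \<kappa>' by (auto intro!: derivative_eq_intros simp: algebra_simps)
    moreover have "continuous_on UNIV (\<lambda>h. (\<kappa> h)\<^sup>2 + h * (2 * \<kappa> h * \<kappa>' h))"
      by (intro continuous_intros c\<kappa>)
    ultimately have "integrable \<nu> (\<lambda>h. (\<kappa> h)\<^sup>2 + h * (2 * \<kappa> h * \<kappa>' h))" "(LINT h|\<nu>. (\<kappa> h)\<^sup>2 + h * (2 * \<kappa> h * \<kappa>' h)) = 0"
      using integral_FTC_Icc_lborel[OF less_imp_le[OF lu], of "\<lambda>h. h * (\<kappa> h)\<^sup>2" "\<lambda>h. (\<kappa> h)\<^sup>2 + h * (2 * \<kappa> h * \<kappa>' h)"]
      by (auto simp: int\<nu> \<kappa>0)
    then show ?thesis
      using I1 Bochner_Integration.integral_diff[of \<nu> "\<lambda>h. (\<kappa> h)\<^sup>2 + h * (2 * \<kappa> h * \<kappa>' h)" "\<lambda>h. (\<kappa> h)\<^sup>2"] by simp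
  qed
  \<comment> \<open>\<open>\<kappa>\<close> times the joint score: formally, a density weighted by
    \<open>\<kappa>\<^sup>2\<close> has the logarithmic derivative
    \<open>2 * \<kappa>' / \<kappa> + \<Psi>\<close>. The product \<open>\<kappa> * \<xi>\<close>,
    called \<open>\<psi>\<close> below, corresponds to the derivative of the weighted joint
    density.\<close>
  define \<xi> where "\<xi> p = 2 * \<kappa>' (fst p) + \<kappa> (fst p) * \<Psi> (fst p) (snd p)" for p
  have [measurable]: "(\<lambda>p. \<Psi> (fst p) (snd p)) \<in> borel_measurable (\<nu> \<Otimes>\<^sub>M G)"
    "(\<lambda>p. X (fst p) (snd p)) \<in> measurable (\<nu> \<Otimes>\<^sub>M G) (\<Pi>\<^sub>M k\<in>K. borel)"
    using \<Psi> X by (simp_all add: case_prod_beta' cong: measurable_cong_sets)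
  have \<Psi>h[measurable]: "\<Psi> h \<in> borel_measurable G" and Xh[measurable]: "X h \<in> measurable G (\<Pi>\<^sub>M k\<in>K. borel)" for h
    using measurable_Pair2[OF \<Psi>, of h] measurable_Pair2[OF X, of h] by auto
  have [measurable]: "\<xi> \<in> borel_measurable (\<nu> \<Otimes>\<^sub>M G)"
    unfolding \<xi>_def by measurable
  have \<Psi>1: "integrable G (\<Psi> h)" if "h \<in> {l..u}" for h
    using \<Psi>2[OF that] by (rule G.square_integrable_imp_integrable[rotated]) auto
  \<comment> \<open>The mixed term of the square integrates to 0 because \<open>\<Psi>\<close> is
    centred, so the information of the prior and that of the observation add up.\<close>
  have \<xi>h: "(\<integral>\<^sup>+g. ennreal ((\<xi> (h, g))\<^sup>2) \<partial>G) \<le> ennreal (4 * (\<kappa>' h)\<^sup>2 + F * (\<kappa> h)\<^sup>2)" if h: "h \<in> {l..u}" for h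
  proof -
    have eq: "(\<xi> (h, g))\<^sup>2 = 4 * (\<kappa>' h)\<^sup>2 + 4 * \<kappa>' h * \<kappa> h * \<Psi> h g + (\<kappa> h)\<^sup>2 * (\<Psi> h g)\<^sup>2" for g
      by (simp add: \<xi>_def power2_eq_square algebra_simps)
    have i: "integrable G (\<lambda>g. (\<xi> (h, g))\<^sup>2)"
      unfolding eq using \<Psi>1[OF h] \<Psi>2[OF h] by auto
    have "(LINT g|G. (\<xi> (h, g))\<^sup>2) = 4 * (\<kappa>' h)\<^sup>2 + (\<kappa> h)\<^sup>2 * (LINT g|G. (\<Psi> h g)\<^sup>2)"
      unfolding eq using \<Psi>1[OF h] \<Psi>2[OF h] \<Psi>0[OF h] by (simp add: G.prob_space)
    also have "\<dots> \<le> 4 * (\<kappa>' h)\<^sup>2 + F * (\<kappa> h)\<^sup>2"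
      using mult_left_mono[OF F[OF h], of "(\<kappa> h)\<^sup>2"] by (simp add: mult.commute)
    finally show ?thesis
      using i by (subst nn_integral_eq_integral) (auto intro!: ennreal_leI)
  qed
  have F0: "F \<ge> 0"
    by (rule order_trans[OF _ F[of l]]) (use lu in auto)
  define Gb where "Gb = F + 40 / (u - l)\<^sup>2"
  have Gb: "Gb > 0" using F0 lu by (simp add: Gb_def add_nonneg_pos)
  have nn\<xi>: "(\<integral>\<^sup>+p. ennreal ((\<xi> p)\<^sup>2) \<partial>(\<nu> \<Otimes>\<^sub>M G)) \<le> ennreal (c * Gb)"
  proof -
    have "(\<integral>\<^sup>+p. ennreal ((\<xi> p)\<^sup>2) \<partial>(\<nu> \<Otimes>\<^sub>M G)) = (\<integral>\<^sup>+h. \<integral>\<^sup>+g. ennreal ((\<xi> (h, g))\<^sup>2) \<partial>G \<partial>\<nu>)"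
      by (subst G.nn_integral_fst[symmetric]) auto
    also have "\<dots> \<le> (\<integral>\<^sup>+h. ennreal (4 * (\<kappa>' h)\<^sup>2 + F * (\<kappa> h)\<^sup>2) \<partial>\<nu>)"
      using AE\<nu> \<xi>h by (intro nn_integral_mono_AE) (auto elim: eventually_mono)
    also have "\<dots> = ennreal (LINT h|\<nu>. 4 * (\<kappa>' h)\<^sup>2 + F * (\<kappa> h)\<^sup>2)"
      using I1 I2 F0 by (intro nn_integral_eq_integral) auto
    also have "(LINT h|\<nu>. 4 * (\<kappa>' h)\<^sup>2 + F * (\<kappa> h)\<^sup>2) = 4 * ((u - l) ^ 3 / 3) + F * c"
      using I1 I2 by simp
    also have "4 * ((u - l) ^ 3 / 3) + F * c = c * Gb"
    proof -
      have "d ^ 5 / 30 * (40 / d\<^sup>2) = 4 * (d ^ 3 / 3)" if "d > 0" for d :: real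
        using that by (simp add: eval_nat_numeral divide_simps)
      then have 1: "(u - l) ^ 5 / 30 * (40 / (u - l)\<^sup>2) = 4 * ((u - l) ^ 3 / 3)"
        using lu by simp
      show ?thesis
        unfolding Gb_def c_def distrib_left 1 by (simp add: mult.commute)
    qed
    finally show ?thesis .
  qed
  have i\<xi>2: "integrable (\<nu> \<Otimes>\<^sub>M G) (\<lambda>p. (\<xi> p)\<^sup>2)"
    by (rule integrableI_nonneg) (use nn\<xi> in \<open>auto simp: less_top[symmetric] top_unique\<close>)
  have I\<xi>2: "(LINT p|(\<nu> \<Otimes>\<^sub>M G). (\<xi> p)\<^sup>2) \<le> c * Gb"
    using nn\<xi> nn_integral_eq_integral[OF i\<xi>2] c Gb by simp
  have i\<xi>: "integrable (\<nu> \<Otimes>\<^sub>M G) \<xi>"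
    using i\<xi>2 by (rule P.square_integrable_imp_integrable[rotated]) auto
  have \<kappa>le: "\<bar>\<kappa> h\<bar> \<le> (u - l)\<^sup>2" if "h \<in> {l..u}" for h
    using that lu unfolding \<kappa>_def abs_mult power2_eq_square by (intro mult_mono) auto
  have ibd: "integrable (\<nu> \<Otimes>\<^sub>M G) (\<lambda>p. f p *\<^sub>R z p)"
    if f: "integrable (\<nu> \<Otimes>\<^sub>M G) f" and [measurable]: "z \<in> borel_measurable (\<nu> \<Otimes>\<^sub>M G)"
      and b: "AE p in \<nu> \<Otimes>\<^sub>M G. norm (z p) \<le> b"
    for f :: "real \<times> 'g \<Rightarrow> real" and z :: "real \<times> 'g \<Rightarrow> 'z::{banach,second_countable_topology}" and b
  proof (rule Bochner_Integration.integrable_bound)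
    show "integrable (\<nu> \<Otimes>\<^sub>M G) (\<lambda>p. b * f p)" using f by simp
    show "AE p in \<nu> \<Otimes>\<^sub>M G. norm (f p *\<^sub>R z p) \<le> norm (b * f p)"
      using b
    proof eventually_elim
      case (elim p)
      then show ?case
        using mult_right_mono[of "norm (z p)" "\<bar>b\<bar>" "\<bar>f p\<bar>"] by (simp add: abs_mult mult.commute)
    qed
  qed (use borel_measurable_integrable[OF f] in measurable)
  define \<psi> where "\<psi> p = \<kappa> (fst p) * \<xi> p" for p
  have AE\<kappa>: "AE p in \<nu> \<Otimes>\<^sub>M G. norm (\<kappa> (fst p)) \<le> (u - l)\<^sup>2"
    using AEP \<kappa>le by (auto elim: eventually_mono)
  have i\<psi>: "integrable (\<nu> \<Otimes>\<^sub>M G) \<psi>"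
    using ibd[OF i\<xi> _ AE\<kappa>] by (simp add: \<psi>_def[abs_def] mult.commute)
  \<comment> \<open>An estimator does not depend on \<open>h\<close>, so the derivative of the
    weighted density should integrate to 0 against it. It suffices to test with exponentials of
    \<open>X\<close>: their inner integral is the derivative of
    \<open>\<kappa>\<^sup>2 * \<phi>\<close>, which vanishes at the ends.\<close>
  have zero: "(LINT p|(\<nu> \<Otimes>\<^sub>M G). \<psi> p * T (X (fst p) (snd p))) = 0"
  proof (rule integral_eq_0_if_char_eq_0[OF K i\<psi> _ _ T bdd])
    show "(\<lambda>p. X (fst p) (snd p)) \<in> measurable (\<nu> \<Otimes>\<^sub>M G) (\<Pi>\<^sub>M k\<in>K. borel)" by measurable
    fix t :: "'k \<Rightarrow> real"
    define \<phi> where "\<phi> h = exp (- (q0 t + h * qA t) / 2)" for h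
    have [measurable]: "(\<lambda>p. X (fst p) (snd p) k) \<in> borel_measurable (\<nu> \<Otimes>\<^sub>M G)" "(\<lambda>g. X h g k) \<in> borel_measurable G" if "k \<in> K" for k h
      using that by (auto intro: measurable_PiM_component_rev simp: measurable_component_singleton[THEN measurable_compose_rev])
    have i: "integrable (\<nu> \<Otimes>\<^sub>M G) (\<lambda>p. \<psi> p * iexp (\<Sum>k\<in>K. t k * X (fst p) (snd p) k))"
      using ibd[OF i\<psi>, of "\<lambda>p. iexp (\<Sum>k\<in>K. t k * X (fst p) (snd p) k)" 1] by (simp add: scaleR_conv_of_real)
    have inner: "(CLINT g|G. \<psi> (h, g) * iexp (\<Sum>k\<in>K. t k * X h g k)) =
        of_real (2 * \<kappa> h * \<kappa>' h * \<phi> h + (\<kappa> h)\<^sup>2 * (- qA t / 2 * \<phi> h))" if h: "h \<in> {l..u}" for h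
    proof -
      let ?e = "\<lambda>g. iexp (\<Sum>k\<in>K. t k * X h g k)"
      have i1: "integrable G ?e"
        by (rule G.integrable_const_bound[where B=1]) auto
      have i2: "integrable G (\<lambda>g. \<Psi> h g * ?e g)"
        by (rule Bochner_Integration.integrable_bound[OF \<Psi>1[OF h]]) (auto simp: norm_mult)
      have "(CLINT g|G. \<psi> (h, g) * ?e g) =
          (CLINT g|G. of_real (2 * \<kappa> h * \<kappa>' h) * ?e g + of_real ((\<kappa> h)\<^sup>2) * (\<Psi> h g * ?e g))"
        by (intro Bochner_Integration.integral_cong refl) (simp add: \<psi>_def \<xi>_def algebra_simps power2_eq_square)
      also have "\<dots> = of_real (2 * \<kappa> h * \<kappa>' h) * (CLINT g|G. ?e g) + of_real ((\<kappa> h)\<^sup>2) * (CLINT g|G. \<Psi> h g * ?e g)"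
        using i1 i2 by (subst Bochner_Integration.integral_add) auto
      finally show ?thesis
        unfolding char[OF h] score[OF h] \<phi>_def by simp
    qed
    have "(CLINT p|(\<nu> \<Otimes>\<^sub>M G). \<psi> p * iexp (\<Sum>k\<in>K. t k * X (fst p) (snd p) k)) =
        (CLINT h|\<nu>. CLINT g|G. \<psi> (h, g) * iexp (\<Sum>k\<in>K. t k * X h g k))"
      using P.integral_fst'[OF i] by simp
    also have "\<dots> = (CLINT h|\<nu>. of_real (2 * \<kappa> h * \<kappa>' h * \<phi> h + (\<kappa> h)\<^sup>2 * (- qA t / 2 * \<phi> h)))"
    proof (rule integral_cong_AE)
      show "(\<lambda>h. CLINT g|G. \<psi> (h, g) * iexp (\<Sum>k\<in>K. t k * X h g k)) \<in> borel_measurable \<nu>"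
        using borel_measurable_integrable[OF P.integrable_fst'[OF i]] by (simp only: fst_conv snd_conv)
      show "(\<lambda>h. complex_of_real (2 * \<kappa> h * \<kappa>' h * \<phi> h + (\<kappa> h)\<^sup>2 * (- qA t / 2 * \<phi> h))) \<in> borel_measurable \<nu>"
        unfolding \<phi>_def by measurable
      show "AE h in \<nu>. (CLINT g|G. \<psi> (h, g) * iexp (\<Sum>k\<in>K. t k * X h g k)) =
          of_real (2 * \<kappa> h * \<kappa>' h * \<phi> h + (\<kappa> h)\<^sup>2 * (- qA t / 2 * \<phi> h))"
        using AE\<nu> by eventually_elim (rule inner)
    qed
    also have "\<dots> = of_real (LINT h|\<nu>. 2 * \<kappa> h * \<kappa>' h * \<phi> h + (\<kappa> h)\<^sup>2 * (- qA t / 2 * \<phi> h))"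
      by (rule integral_complex_of_real)
    also have "(LINT h|\<nu>. 2 * \<kappa> h * \<kappa>' h * \<phi> h + (\<kappa> h)\<^sup>2 * (- qA t / 2 * \<phi> h)) = 0"
    proof -
      have "((\<lambda>h. (\<kappa> h)\<^sup>2 * \<phi> h) has_real_derivative 2 * \<kappa> h * \<kappa>' h * \<phi> h + (\<kappa> h)\<^sup>2 * (- qA t / 2 * \<phi> h)) (at h)" for h
        unfolding \<phi>_def using \<kappa>' by (auto intro!: derivative_eq_intros simp: algebra_simps)
      moreover have "continuous_on UNIV (\<lambda>h. 2 * \<kappa> h * \<kappa>' h * \<phi> h + (\<kappa> h)\<^sup>2 * (- qA t / 2 * \<phi> h))"
        unfolding \<phi>_def by (intro continuous_intros c\<kappa>) auto
      moreover have "\<phi> \<in> borel_measurable borel" unfolding \<phi>_def by measurable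
      ultimately show ?thesis
        using integral_FTC_Icc_lborel(1)[OF less_imp_le[OF lu], of "\<lambda>h. (\<kappa> h)\<^sup>2 * \<phi> h"
            "\<lambda>h. 2 * \<kappa> h * \<kappa>' h * \<phi> h + (\<kappa> h)\<^sup>2 * (- qA t / 2 * \<phi> h)"]
        by (subst int\<nu>) (simp_all add: \<kappa>0)
    qed
    finally show "(CLINT p|(\<nu> \<Otimes>\<^sub>M G). \<psi> p * iexp (\<Sum>k\<in>K. t k * X (fst p) (snd p) k)) = 0" by simp
  qed
  have i\<psi>T: "integrable (\<nu> \<Otimes>\<^sub>M G) (\<lambda>p. \<psi> p * T (X (fst p) (snd p)))"
    using ibd[OF i\<psi>, of "\<lambda>p. T (X (fst p) (snd p))" C] bdd by simp
  have AEh: "AE p in \<nu> \<Otimes>\<^sub>M G. norm (fst p) \<le> \<bar>l\<bar> + \<bar>u\<bar>"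
    using AEP by eventually_elim auto
  have i\<psi>h: "integrable (\<nu> \<Otimes>\<^sub>M G) (\<lambda>p. \<psi> p * fst p)"
    using ibd[OF i\<psi> _ AEh] by simp
  \<comment> \<open>Integration by parts moves the derivative to the factor \<open>h\<close> and
    leaves minus the integral of \<open>\<kappa>\<^sup>2\<close>.\<close>
  have \<psi>h: "(LINT p|(\<nu> \<Otimes>\<^sub>M G). \<psi> p * fst p) = - c"
  proof -
    have inner: "(LINT g|G. \<psi> (h, g) * h) = h * (2 * \<kappa> h * \<kappa>' h)" if h: "h \<in> {l..u}" for h
    proof -
      have "(LINT g|G. \<psi> (h, g) * h) = (LINT g|G. h * (2 * \<kappa> h * \<kappa>' h) + h * (\<kappa> h)\<^sup>2 * \<Psi> h g)"
        by (intro Bochner_Integration.integral_cong refl) (simp add: \<psi>_def \<xi>_def algebra_simps power2_eq_square)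
      also have "\<dots> = h * (2 * \<kappa> h * \<kappa>' h)"
        using \<Psi>1[OF h] \<Psi>0[OF h] by (simp add: G.prob_space)
      finally show ?thesis .
    qed
    have "(LINT p|(\<nu> \<Otimes>\<^sub>M G). \<psi> p * fst p) = (LINT h|\<nu>. LINT g|G. \<psi> (h, g) * h)"
      using P.integral_fst'[OF i\<psi>h] by simp
    also have "\<dots> = (LINT h|\<nu>. h * (2 * \<kappa> h * \<kappa>' h))"
    proof (rule integral_cong_AE)
      show "(\<lambda>h. LINT g|G. \<psi> (h, g) * h) \<in> borel_measurable \<nu>"
        using borel_measurable_integrable[OF P.integrable_fst'[OF i\<psi>h]] by (simp only: fst_conv)
      show "AE h in \<nu>. (LINT g|G. \<psi> (h, g) * h) = h * (2 * \<kappa> h * \<kappa>' h)"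
        using AE\<nu> by eventually_elim (rule inner)
    qed measurable
    finally show ?thesis using I3 by simp
  qed
  define f where "f p = \<kappa> (fst p) * (T (X (fst p) (snd p)) - fst p)" for p
  have f: "(LINT p|(\<nu> \<Otimes>\<^sub>M G). f p * \<xi> p) = c" "integrable (\<nu> \<Otimes>\<^sub>M G) (\<lambda>p. f p * \<xi> p)"
  proof -
    have eq: "f p * \<xi> p = \<psi> p * T (X (fst p) (snd p)) - \<psi> p * fst p" for p
      by (simp add: f_def \<psi>_def algebra_simps)
    show "(LINT p|(\<nu> \<Otimes>\<^sub>M G). f p * \<xi> p) = c" "integrable (\<nu> \<Otimes>\<^sub>M G) (\<lambda>p. f p * \<xi> p)"
      unfolding eq using i\<psi>T i\<psi>h zero \<psi>h by auto
  qed
  have [measurable]: "f \<in> borel_measurable (\<nu> \<Otimes>\<^sub>M G)" unfolding f_def by measurable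
  have if2: "integrable (\<nu> \<Otimes>\<^sub>M G) (\<lambda>p. (f p)\<^sup>2)"
  proof (rule P.integrable_const_bound[where B="((u - l)\<^sup>2 * (C + (\<bar>l\<bar> + \<bar>u\<bar>)))\<^sup>2"])
    show "AE p in \<nu> \<Otimes>\<^sub>M G. norm ((f p)\<^sup>2) \<le> ((u - l)\<^sup>2 * (C + (\<bar>l\<bar> + \<bar>u\<bar>)))\<^sup>2"
      using AEP
    proof eventually_elim
      case (elim p)
      have "\<bar>f p\<bar> \<le> (u - l)\<^sup>2 * (C + (\<bar>l\<bar> + \<bar>u\<bar>))"
        unfolding f_def abs_mult using \<kappa>le[OF elim] bdd[of "X (fst p) (snd p)"] elim by (intro mult_mono) auto
      then have "\<bar>f p\<bar>\<^sup>2 \<le> ((u - l)\<^sup>2 * (C + (\<bar>l\<bar> + \<bar>u\<bar>)))\<^sup>2"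
        by (intro power_mono) auto
      then show ?case by simp
    qed
  qed measurable
  have If2: "(LINT p|(\<nu> \<Otimes>\<^sub>M G). (f p)\<^sup>2) \<le> R * c"
  proof -
    have "(LINT p|(\<nu> \<Otimes>\<^sub>M G). (f p)\<^sup>2) = (LINT h|\<nu>. LINT g|G. (f (h, g))\<^sup>2)"
      using P.integral_fst'[OF if2] by simp
    also have "\<dots> = (LINT h|\<nu>. (\<kappa> h)\<^sup>2 * (LINT g|G. (T (X h g) - h)\<^sup>2))"
      by (simp add: f_def power_mult_distrib)
    also have "\<dots> \<le> (LINT h|\<nu>. R * (\<kappa> h)\<^sup>2)"
    proof (rule integral_mono_AE)
      show "integrable \<nu> (\<lambda>h. (\<kappa> h)\<^sup>2 * (LINT g|G. (T (X h g) - h)\<^sup>2))"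
        using P.integrable_fst'[OF if2] by (simp add: f_def power_mult_distrib)
      show "AE h in \<nu>. (\<kappa> h)\<^sup>2 * (LINT g|G. (T (X h g) - h)\<^sup>2) \<le> R * (\<kappa> h)\<^sup>2"
        using AE\<nu>
      proof eventually_elim
        case (elim h)
        show ?case using mult_left_mono[OF risk[OF elim], of "(\<kappa> h)\<^sup>2"] by (simp add: mult.commute)
      qed
    qed (use I1 in simp)
    also have "\<dots> = R * c" using I1 by simp
    finally show ?thesis .
  qed
  \<comment> \<open>Cauchy-Schwarz in additive form, with the weight \<open>Gb\<close> for which the
    bound on the integral of \<open>\<xi>\<^sup>2\<close> contributes exactly
    \<open>c\<close>.\<close>
  have "2 * c = (LINT p|(\<nu> \<Otimes>\<^sub>M G). 2 * (f p * \<xi> p))" using f by simp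
  also have "\<dots> \<le> (LINT p|(\<nu> \<Otimes>\<^sub>M G). Gb * (f p)\<^sup>2 + (\<xi> p)\<^sup>2 / Gb)"
  proof (rule integral_mono)
    fix p
    have "0 \<le> (Gb * f p - \<xi> p)\<^sup>2 / Gb" using Gb by simp
    then show "2 * (f p * \<xi> p) \<le> Gb * (f p)\<^sup>2 + (\<xi> p)\<^sup>2 / Gb"
      using Gb by (simp add: power2_eq_square field_simps)
  qed (use f if2 i\<xi>2 in auto)
  also have "\<dots> = Gb * (LINT p|(\<nu> \<Otimes>\<^sub>M G). (f p)\<^sup>2) + (LINT p|(\<nu> \<Otimes>\<^sub>M G). (\<xi> p)\<^sup>2) / Gb"
    using if2 i\<xi>2 by simp
  also have "\<dots> \<le> Gb * (R * c) + c * Gb / Gb"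
    using Gb If2 I\<xi>2 by (intro add_mono mult_left_mono divide_right_mono) auto
  finally have "2 * c \<le> Gb * (R * c) + c" using Gb by simp
  then have "c * 1 \<le> c * (R * Gb)" by (simp add: algebra_simps)
  then show ?thesis
    using c unfolding Gb_def by (simp only: mult_le_cancel_left_pos)
qed

section \<open>Gaussian families with affine covariance\<close>

lemma double_sum_mult:
  fixes f :: "'a \<Rightarrow> 'b \<Rightarrow> 'e::semiring_0"
  shows "(\<Sum>j\<in>A. \<Sum>k\<in>B. f j k) * (\<Sum>p\<in>C. \<Sum>q\<in>D. g p q) = (\<Sum>j\<in>A. \<Sum>k\<in>B. \<Sum>p\<in>C. \<Sum>q\<in>D. f j k * g p q)"
  by (simp only: sum_distrib_right) (simp only: sum_distrib_left)

text \<open>\<open>\<Psi>\<close> is the score of a Gaussian vector whose covariance leaves the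
  identity in the direction \<open>S\<close>; its variance is the Fisher information, half the
  squared Frobenius norm of \<open>S\<close>. The last identity provides the derivative of the
  characteristic function that the van Trees inequality asks of a score.\<close>

lemma std_gaussian_quadratic_form:
  fixes S :: "'l \<Rightarrow> 'l \<Rightarrow> real"
  assumes L: "finite L" and sym: "\<And>j k. S j k = S k j"
  defines "\<Psi> \<equiv> \<lambda>g. (\<Sum>j\<in>L. \<Sum>k\<in>L. S j k * (g j * g k - of_bool (j = k))) / 2"
  shows "integrable (std_gaussian L) (\<lambda>g. (\<Psi> g)\<^sup>2)"
    and "(LINT g|std_gaussian L. (\<Psi> g)\<^sup>2) = (\<Sum>j\<in>L. \<Sum>k\<in>L. (S j k)\<^sup>2) / 2"
    and "(LINT g|std_gaussian L. \<Psi> g) = 0"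
    and "(CLINT g|std_gaussian L. \<Psi> g * iexp (\<Sum>l\<in>L. s l * g l)) =
      of_real (- (\<Sum>j\<in>L. \<Sum>k\<in>L. S j k * (s j * s k)) / 2 * exp (- (\<Sum>l\<in>L. (s l)\<^sup>2) / 2))"
proof -
  interpret G: prob_space "std_gaussian L" by (rule prob_space_std_gaussian)
  define x where "x j k g = g j * g k - of_bool (j = k)" for j k and g :: "'l \<Rightarrow> real"
  have ix: "integrable (std_gaussian L) (x j k)" and Ex: "(LINT g|std_gaussian L. x j k g) = 0"
    if "j \<in> L" "k \<in> L" for j k
    using isserlis(3,4)[OF L that that] by (auto simp: x_def[abs_def] G.prob_space)
  have ixx: "integrable (std_gaussian L) (\<lambda>g. x j k g * x p q g)"
    and Exx: "(LINT g|std_gaussian L. x j k g * x p q g) = of_bool (j = p \<and> k = q) + of_bool (j = q \<and> k = p)"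
    if "j \<in> L" "k \<in> L" "p \<in> L" "q \<in> L" for j k p q
    using isserlis(1,2)[OF L that] by (auto simp: x_def[abs_def])
  have \<Psi>: "\<Psi> g = (\<Sum>j\<in>L. \<Sum>k\<in>L. S j k * x j k g) / 2" for g
    by (simp add: \<Psi>_def x_def)
  have \<Psi>2: "(\<Psi> g)\<^sup>2 = (\<Sum>j\<in>L. \<Sum>k\<in>L. \<Sum>p\<in>L. \<Sum>q\<in>L. S j k * S p q * (x j k g * x p q g)) / 4" for g
    unfolding \<Psi> power_divide power2_eq_square[of "sum _ _"] double_sum_mult by (simp add: ac_simps)
  show "integrable (std_gaussian L) (\<lambda>g. (\<Psi> g)\<^sup>2)"
    unfolding \<Psi>2 by (intro integrable_divide Bochner_Integration.integrable_sum integrable_mult_right ixx)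
  have "(LINT g|std_gaussian L. (\<Psi> g)\<^sup>2) =
      (\<Sum>j\<in>L. \<Sum>k\<in>L. \<Sum>p\<in>L. \<Sum>q\<in>L. S j k * S p q * (of_bool (j = p \<and> k = q) + of_bool (j = q \<and> k = p))) / 4"
    unfolding \<Psi>2 using Exx ixx
    by (simp add: Bochner_Integration.integral_sum integral_mult_right_zero)
  also have "\<dots> = (\<Sum>j\<in>L. \<Sum>k\<in>L. 2 * (S j k)\<^sup>2) / 4"
  proof -
    have "(\<Sum>p\<in>L. \<Sum>q\<in>L. S j k * S p q * (of_bool (j = p \<and> k = q) + of_bool (j = q \<and> k = p))) = 2 * (S j k)\<^sup>2"
      if jk: "j \<in> L" "k \<in> L" for j k
    proof -
      have "(\<Sum>p\<in>L. \<Sum>q\<in>L. S j k * S p q * (of_bool (j = p \<and> k = q) + of_bool (j = q \<and> k = p))) =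
        (\<Sum>p\<in>L. \<Sum>q\<in>L. (if p = j then if q = k then S j k * S p q else 0 else 0) + (if q = j then if p = k then S j k * S p q else 0 else 0))"
        by (intro sum.cong refl) auto
      also have "\<dots> = S j k * S j k + S j k * S k j"
      proof -
        have 1: "(\<Sum>q\<in>L. if b then if q = i then c else 0 else 0) = (if b then c else 0)" if "i \<in> L" for b i and c :: real
          using L that by simp
        have 2: "(\<Sum>q\<in>L. if q = i then if b then c q else 0 else 0) = (if b then c i else 0)" if "i \<in> L" for b i and c :: "'l \<Rightarrow> real"
          using L that by simp
        have "(\<Sum>q\<in>L. if p = j then if q = k then S j k * S p q else 0 else 0) = (if p = j then S j k * S j k else 0)" for p
          using 1[OF jk(2), of "p = j" "S j k * S p k"] by (simp cong: if_cong)
        moreover have "(\<Sum>q\<in>L. if q = j then if p = k then S j k * S p q else 0 else 0) = (if p = k then S j k * S k j else 0)" for p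
          using 2[OF jk(1), of "p = k" "\<lambda>q. S j k * S p q"] by (simp cong: if_cong)
        ultimately show ?thesis
          unfolding sum.distrib using L jk by simp
      qed
      finally show ?thesis by (simp add: sym[of k j] power2_eq_square)
    qed
    then show ?thesis by simp
  qed
  also have "\<dots> = (\<Sum>j\<in>L. \<Sum>k\<in>L. (S j k)\<^sup>2) / 2"
    by (simp flip: sum_distrib_left)
  finally show "(LINT g|std_gaussian L. (\<Psi> g)\<^sup>2) = (\<Sum>j\<in>L. \<Sum>k\<in>L. (S j k)\<^sup>2) / 2" .
  show "(LINT g|std_gaussian L. \<Psi> g) = 0"
    unfolding \<Psi> using ix Ex by (simp add: Bochner_Integration.integral_sum)
  let ?e = "\<lambda>g. iexp (\<Sum>l\<in>L. s l * g l)"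
  define e where "e = exp (- (\<Sum>l\<in>L. (s l)\<^sup>2) / 2)"
  have gl: "(\<lambda>g. g l) \<in> borel_measurable (std_gaussian L)" if "l \<in> L" for l
    using measurable_component_singleton[OF that, of "\<lambda>_. std_normal_distribution"] by simp
  have [measurable]: "?e \<in> borel_measurable (std_gaussian L)"
    using gl by (auto intro!: borel_measurable_sum borel_measurable_times measurable_compose[OF _ borel_measurable_exp[where 'a=complex]] borel_measurable_of_real simp del: of_real_sum of_real_mult)
  have ie: "integrable (std_gaussian L) (\<lambda>g. of_real (x j k g) * ?e g)" if "j \<in> L" "k \<in> L" for j k
    using ix[OF that] borel_measurable_integrable[OF ix[OF that]]
    by (intro Bochner_Integration.integrable_bound[OF ix[OF that]]) (auto simp: norm_mult)
  have "(CLINT g|std_gaussian L. \<Psi> g * ?e g) = (CLINT g|std_gaussian L. (\<Sum>j\<in>L. \<Sum>k\<in>L. of_real (S j k / 2) * (of_real (x j k g) * ?e g)))"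
  proof (intro Bochner_Integration.integral_cong refl)
    fix g
    have "complex_of_real (\<Psi> g) = (\<Sum>j\<in>L. \<Sum>k\<in>L. of_real (S j k / 2) * of_real (x j k g))"
      by (simp add: \<Psi> sum_divide_distrib)
    then show "\<Psi> g * ?e g = (\<Sum>j\<in>L. \<Sum>k\<in>L. of_real (S j k / 2) * (of_real (x j k g) * ?e g))"
      by (simp only: sum_distrib_right mult.assoc)
  qed
  also have "\<dots> = (\<Sum>j\<in>L. \<Sum>k\<in>L. of_real (S j k / 2) * (CLINT g|std_gaussian L. of_real (x j k g) * ?e g))"
    using ie by (subst Bochner_Integration.integral_sum, intro Bochner_Integration.integrable_sum integrable_mult_right, assumption,
      intro sum.cong refl, subst Bochner_Integration.integral_sum, intro integrable_mult_right, assumption)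
      (simp only: integral_mult_right_zero)
  also have "\<dots> = (\<Sum>j\<in>L. \<Sum>k\<in>L. of_real (S j k / 2) * (- of_real (s j * s k * e)))"
    using integral_std_gaussian_iexp(2)[OF L, of _ _ s]
    by (intro sum.cong refl) (simp only: x_def e_def)
  also have "\<dots> = of_real (- (\<Sum>j\<in>L. \<Sum>k\<in>L. S j k * (s j * s k)) / 2 * e)"
    by (simp add: sum_distrib_right sum_negf sum_divide_distrib mult.assoc)
  finally show "(CLINT g|std_gaussian L. \<Psi> g * ?e g) =
      of_real (- (\<Sum>j\<in>L. \<Sum>k\<in>L. S j k * (s j * s k)) / 2 * exp (- (\<Sum>l\<in>L. (s l)\<^sup>2) / 2))"
    unfolding e_def .
qed

text \<open>A diagonally dominant covariance matrix \<open>S\<close> is realised by an independent standard normal for each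
  ordered pair of indices: the pair \<open>(a, b)\<close> with \<open>a \<noteq> b\<close> produces the off-diagonal entry \<open>S a b / 2\<close>,
  and \<open>(a, a)\<close> the excess of the diagonal.\<close>

definition excess :: "'k set \<Rightarrow> ('k \<Rightarrow> 'k \<Rightarrow> real) \<Rightarrow> 'k \<Rightarrow> real" where
  "excess K S a = S a a - (\<Sum>b\<in>K. of_bool (a \<noteq> b) * \<bar>S a b\<bar>)"

definition loading :: "'k set \<Rightarrow> ('k \<Rightarrow> 'k \<Rightarrow> real) \<Rightarrow> 'k \<Rightarrow> 'k \<times> 'k \<Rightarrow> real" where
  "loading K S k p = (case p of (a, b) \<Rightarrow>
     if a = b then of_bool (k = a) * sqrt (excess K S a)
     else sqrt (\<bar>S a b\<bar> / 2) * (of_bool (k = a) + sgn (S a b) * of_bool (k = b)))"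

lemma sum_loading:
  assumes "finite K" "a \<in> K" "b \<in> K"
  shows "(\<Sum>k\<in>K. t k * loading K S k (a, b)) =
    (if a = b then t a * sqrt (excess K S a) else sqrt (\<bar>S a b\<bar> / 2) * (t a + sgn (S a b) * t b))"
proof (cases "a = b")
  case True
  then have "(\<Sum>k\<in>K. t k * loading K S k (a, b)) = (\<Sum>k\<in>K. if k = a then t k * sqrt (excess K S a) else 0)"
    by (intro sum.cong) (auto simp: loading_def)
  then show ?thesis using assms True by simp
next
  case False
  then have "(\<Sum>k\<in>K. t k * loading K S k (a, b)) =
      (\<Sum>k\<in>K. (if k = a then t k * sqrt (\<bar>S a b\<bar> / 2) else 0) + (if k = b then t k * (sqrt (\<bar>S a b\<bar> / 2) * sgn (S a b)) else 0))"
    by (intro sum.cong) (auto simp: loading_def)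
  then show ?thesis using assms False by (simp add: sum.distrib algebra_simps)
qed

text \<open>An ordered pair with \<open>a \<noteq> b\<close> contributes half of the cross terms
  with coefficient \<open>S a b\<close>, together with diagonal terms of size
  \<open>\<bar>S a b\<bar> / 2\<close>. Summed over both orders, these diagonal terms are exactly
  what \<open>excess\<close> subtracts from \<open>S a a\<close>.\<close>

lemma sum_loading_bilinear:
  assumes K: "finite K" and sym: "\<And>a b. S a b = S b a" and ex: "\<And>a. a \<in> K \<Longrightarrow> 0 \<le> excess K S a"
  shows "(\<Sum>p\<in>K \<times> K. (\<Sum>k\<in>K. t k * loading K S k p) * (\<Sum>k\<in>K. r k * loading K S k p)) =
    (\<Sum>a\<in>K. \<Sum>b\<in>K. S a b * (t a * r b))"
proof -
  have "(\<Sum>p\<in>K \<times> K. (\<Sum>k\<in>K. t k * loading K S k p) * (\<Sum>k\<in>K. r k * loading K S k p)) =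
      (\<Sum>a\<in>K. \<Sum>b\<in>K. of_bool (a = b) * (t a * r a * excess K S a) + of_bool (a \<noteq> b) * \<bar>S a b\<bar> / 2 * (t a * r a)
         + of_bool (a \<noteq> b) * \<bar>S a b\<bar> / 2 * (t b * r b) + of_bool (a \<noteq> b) * (S a b / 2 * (t a * r b)) + of_bool (a \<noteq> b) * (S a b / 2 * (t b * r a)))"
    unfolding sum.cartesian_product'
  proof (intro sum.cong refl)
    fix a b assume ab: "a \<in> K" "b \<in> K"
    show "(\<Sum>k\<in>K. t k * loading K S k (a, b)) * (\<Sum>k\<in>K. r k * loading K S k (a, b)) =
      of_bool (a = b) * (t a * r a * excess K S a) + of_bool (a \<noteq> b) * \<bar>S a b\<bar> / 2 * (t a * r a)
         + of_bool (a \<noteq> b) * \<bar>S a b\<bar> / 2 * (t b * r b) + of_bool (a \<noteq> b) * (S a b / 2 * (t a * r b)) + of_bool (a \<noteq> b) * (S a b / 2 * (t b * r a))"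
    proof (cases "a = b")
      case True
      then show ?thesis
        using ex[OF ab(1)] unfolding sum_loading[OF K ab] by (simp add: algebra_simps)
    next
      case False
      have "(sqrt (\<bar>S a b\<bar> / 2) * (t a + sgn (S a b) * t b)) * (sqrt (\<bar>S a b\<bar> / 2) * (r a + sgn (S a b) * r b)) =
         (sqrt (\<bar>S a b\<bar> / 2))\<^sup>2 * ((t a + sgn (S a b) * t b) * (r a + sgn (S a b) * r b))"
        by (simp add: power2_eq_square ac_simps)
      also have "\<dots> = \<bar>S a b\<bar> / 2 * (t a * r a + (sgn (S a b))\<^sup>2 * (t b * r b)) + (\<bar>S a b\<bar> * sgn (S a b)) / 2 * (t a * r b + t b * r a)"
        by (simp add: power2_eq_square algebra_simps add_divide_distrib)
      also have "\<dots> = \<bar>S a b\<bar> / 2 * (t a * r a + t b * r b) + S a b / 2 * (t a * r b + t b * r a)"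
        by (cases "S a b = 0") (simp_all add: sgn_if)
      finally show ?thesis
        using False unfolding sum_loading[OF K ab] by (simp add: algebra_simps)
    qed
  qed
  also have "\<dots> = (\<Sum>a\<in>K. t a * r a * excess K S a) + (\<Sum>a\<in>K. \<Sum>b\<in>K. of_bool (a \<noteq> b) * \<bar>S a b\<bar> / 2 * (t a * r a))
      + (\<Sum>a\<in>K. \<Sum>b\<in>K. of_bool (a \<noteq> b) * \<bar>S a b\<bar> / 2 * (t b * r b))
      + (\<Sum>a\<in>K. \<Sum>b\<in>K. of_bool (a \<noteq> b) * (S a b / 2 * (t a * r b))) + (\<Sum>a\<in>K. \<Sum>b\<in>K. of_bool (a \<noteq> b) * (S a b / 2 * (t b * r a)))"
  proof -
    have "(\<Sum>b\<in>K. of_bool (a = b) * (t a * r a * excess K S a)) = t a * r a * excess K S a" if "a \<in> K" for a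
    proof -
      have "(\<Sum>b\<in>K. of_bool (a = b) * (t a * r a * excess K S a)) = (\<Sum>b\<in>K. if b = a then t a * r a * excess K S a else 0)"
        by (intro sum.cong) auto
      then show ?thesis using K that by simp
    qed
    then show ?thesis by (simp add: sum.distrib)
  qed
  also have "(\<Sum>a\<in>K. \<Sum>b\<in>K. of_bool (a \<noteq> b) * \<bar>S a b\<bar> / 2 * (t b * r b)) = (\<Sum>a\<in>K. \<Sum>b\<in>K. of_bool (a \<noteq> b) * \<bar>S a b\<bar> / 2 * (t a * r a))"
  proof (subst sum.swap, intro sum.cong refl)
    fix x y
    show "of_bool (y \<noteq> x) * \<bar>S y x\<bar> / 2 * (t x * r x) = of_bool (x \<noteq> y) * \<bar>S x y\<bar> / 2 * (t x * r x)"
      by (simp only: sym[of y x] eq_commute[of y x])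
  qed
  also have "(\<Sum>a\<in>K. \<Sum>b\<in>K. of_bool (a \<noteq> b) * (S a b / 2 * (t b * r a))) = (\<Sum>a\<in>K. \<Sum>b\<in>K. of_bool (a \<noteq> b) * (S a b / 2 * (t a * r b)))"
  proof (subst sum.swap, intro sum.cong refl)
    fix x y
    show "of_bool (y \<noteq> x) * (S y x / 2 * (t x * r y)) = of_bool (x \<noteq> y) * (S x y / 2 * (t x * r y))"
      by (simp only: sym[of y x] eq_commute[of y x])
  qed
  also have "(\<Sum>a\<in>K. t a * r a * excess K S a) = (\<Sum>a\<in>K. S a a * (t a * r a)) - 2 * (\<Sum>a\<in>K. \<Sum>b\<in>K. of_bool (a \<noteq> b) * \<bar>S a b\<bar> / 2 * (t a * r a))"
    by (simp add: excess_def sum_subtractf sum_distrib_left sum_distrib_right algebra_simps)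
  also have "(\<Sum>a\<in>K. S a a * (t a * r a)) = (\<Sum>a\<in>K. \<Sum>b\<in>K. of_bool (a = b) * (S a b * (t a * r b)))"
  proof (intro sum.cong refl)
    fix a assume "a \<in> K"
    have "(\<Sum>b\<in>K. of_bool (a = b) * (S a b * (t a * r b))) = (\<Sum>b\<in>K. if b = a then S a b * (t a * r b) else 0)"
      by (intro sum.cong) auto
    then show "S a a * (t a * r a) = (\<Sum>b\<in>K. of_bool (a = b) * (S a b * (t a * r b)))"
      using K \<open>a \<in> K\<close> by simp
  qed
  finally have "(\<Sum>p\<in>K \<times> K. (\<Sum>k\<in>K. t k * loading K S k p) * (\<Sum>k\<in>K. r k * loading K S k p)) =
      (\<Sum>a\<in>K. \<Sum>b\<in>K. of_bool (a = b) * (S a b * (t a * r b))) + 2 * (\<Sum>a\<in>K. \<Sum>b\<in>K. of_bool (a \<noteq> b) * (S a b / 2 * (t a * r b)))"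
    by simp
  also have "\<dots> = (\<Sum>a\<in>K. \<Sum>b\<in>K. S a b * (t a * r b))"
    unfolding sum_distrib_left sum.distrib[symmetric] by (intro sum.cong refl) auto
  finally show ?thesis .
qed

text \<open>The bilinear identity tested with unit vectors: the loadings times their transpose give
  \<open>S\<close>.\<close>

lemma sum_loading_mult:
  assumes K: "finite K" and sym: "\<And>a b. S a b = S b a" and ex: "\<And>a. a \<in> K \<Longrightarrow> 0 \<le> excess K S a"
    and k: "k \<in> K"
  shows "(\<Sum>p\<in>K \<times> K. loading K S k p * (\<Sum>j\<in>K. t j * loading K S j p)) = (\<Sum>b\<in>K. S k b * t b)"
    and "j \<in> K \<Longrightarrow> (\<Sum>p\<in>K \<times> K. loading K S k p * loading K S j p) = S k j"
proof -
  have unit: "(\<Sum>i\<in>K. of_bool (i = j) * f i) = f j" if "j \<in> K" for j and f :: "'a \<Rightarrow> real"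
  proof -
    have "(\<Sum>i\<in>K. of_bool (i = j) * f i) = (\<Sum>i\<in>K. if i = j then f i else 0)" by (intro sum.cong) auto
    then show ?thesis using K that by simp
  qed
  have A: "(\<Sum>a\<in>K. \<Sum>b\<in>K. S a b * (of_bool (a = k) * r b)) = (\<Sum>b\<in>K. S k b * r b)" for r
  proof -
    have "(\<Sum>a\<in>K. \<Sum>b\<in>K. S a b * (of_bool (a = k) * r b)) = (\<Sum>a\<in>K. of_bool (a = k) * (\<Sum>b\<in>K. S a b * r b))"
      by (simp add: sum_distrib_left ac_simps)
    then show ?thesis using unit[OF k] by simp
  qed
  show 1: "(\<Sum>p\<in>K \<times> K. loading K S k p * (\<Sum>j\<in>K. t j * loading K S j p)) = (\<Sum>b\<in>K. S k b * t b)" for t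
    using sum_loading_bilinear[OF K sym ex, of "\<lambda>i. of_bool (i = k)" t] by (simp add: unit[OF k] A)
  show "(\<Sum>p\<in>K \<times> K. loading K S k p * loading K S j p) = S k j" if j: "j \<in> K"
    using 1[of "\<lambda>i. of_bool (i = j)"] by (simp add: unit[OF j] mult.commute[of "S _ _"])
qed

lemma sum_diagonal:
  fixes f :: "'k \<times> 'k \<Rightarrow> real"
  assumes "finite K"
  shows "(\<Sum>p\<in>K \<times> K. of_bool (fst p = snd p) * f p) = (\<Sum>a\<in>K. f (a, a))"
proof -
  have "(\<Sum>p\<in>K \<times> K. of_bool (fst p = snd p) * f p) = (\<Sum>a\<in>K. \<Sum>b\<in>K. if b = a then f (a, b) else 0)"
    unfolding sum.cartesian_product' by (intro sum.cong) auto
  then show ?thesis using assms by simp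
qed

text \<open>The score of the observation is sought as a quadratic form in the driving noise whose
  matrix becomes the derivative of the covariance when multiplied by the loadings from both sides.
  Conjugating \<open>W\<close> with the loadings yields \<open>S W S\<close>. The missing part
  \<open>E\<close> is put on the noise variables \<open>(a, a)\<close>: each of them enters
  coordinate \<open>a\<close> alone, with the weight \<open>sqrt (excess K S a)\<close>, so division
  by these weights suffices.\<close>

definition score_matrix ::
    "'k set \<Rightarrow> ('k \<Rightarrow> 'k \<Rightarrow> real) \<Rightarrow> ('k \<Rightarrow> 'k \<Rightarrow> real) \<Rightarrow> ('k \<Rightarrow> 'k \<Rightarrow> real) \<Rightarrow> 'k \<times> 'k \<Rightarrow> 'k \<times> 'k \<Rightarrow> real" where
  "score_matrix K S W E p q = (\<Sum>j\<in>K. \<Sum>k\<in>K. loading K S j p * W j k * loading K S k q) +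
     of_bool (fst p = snd p \<and> fst q = snd q) * (E (fst p) (fst q) / (sqrt (excess K S (fst p)) * sqrt (excess K S (fst q))))"

text \<open>The loadings on either side of \<open>W\<close> combine to \<open>S\<close>, and on the
  diagonal pairs the square roots of the excesses cancel, which leaves \<open>E\<close>.\<close>

lemma score_matrix_quadratic_form:
  fixes t :: "'k \<Rightarrow> real"
  assumes K: "finite K" and sym: "\<And>a b. S a b = S b a" and ex: "\<And>a. a \<in> K \<Longrightarrow> 0 < excess K S a"
  defines "s \<equiv> \<lambda>p. \<Sum>k\<in>K. t k * loading K S k p"
  shows "(\<Sum>p\<in>K \<times> K. \<Sum>q\<in>K \<times> K. score_matrix K S W E p q * (s p * s q)) =
    (\<Sum>a\<in>K. \<Sum>b\<in>K. ((\<Sum>j\<in>K. \<Sum>k\<in>K. S a j * W j k * S k b) + E a b) * (t a * t b))"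
proof -
  have ex0: "\<And>a. a \<in> K \<Longrightarrow> 0 \<le> excess K S a" using ex by (simp add: less_imp_le)
  have L: "(\<Sum>p\<in>K \<times> K. loading K S k p * s p) = (\<Sum>b\<in>K. S k b * t b)" if "k \<in> K" for k
    unfolding s_def by (rule sum_loading_mult(1)[OF K sym _ that]) (rule ex0)
  have "(\<Sum>p\<in>K \<times> K. \<Sum>q\<in>K \<times> K. (\<Sum>j\<in>K. \<Sum>k\<in>K. loading K S j p * W j k * loading K S k q) * (s p * s q)) =
      (\<Sum>p\<in>K \<times> K. \<Sum>q\<in>K \<times> K. \<Sum>j\<in>K. \<Sum>k\<in>K. W j k * ((loading K S j p * s p) * (loading K S k q * s q)))"
    by (simp only: sum_distrib_right) (intro sum.cong refl, simp only: ac_simps)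
  also have "\<dots> = (\<Sum>j\<in>K. \<Sum>k\<in>K. \<Sum>p\<in>K \<times> K. \<Sum>q\<in>K \<times> K. W j k * ((loading K S j p * s p) * (loading K S k q * s q)))"
    by (subst (2) sum.swap, subst (1) sum.swap, subst (3) sum.swap, subst (2) sum.swap) (rule refl)
  also have "\<dots> = (\<Sum>j\<in>K. \<Sum>k\<in>K. W j k * ((\<Sum>b\<in>K. S j b * t b) * (\<Sum>b\<in>K. S k b * t b)))"
  proof (intro sum.cong refl)
    fix j k assume jk: "j \<in> K" "k \<in> K"
    have "(\<Sum>p\<in>K \<times> K. \<Sum>q\<in>K \<times> K. W j k * ((loading K S j p * s p) * (loading K S k q * s q))) =
        W j k * ((\<Sum>p\<in>K \<times> K. loading K S j p * s p) * (\<Sum>q\<in>K \<times> K. loading K S k q * s q))"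
      by (subst sum_product) (simp only: sum_distrib_left)
    then show "(\<Sum>p\<in>K \<times> K. \<Sum>q\<in>K \<times> K. W j k * ((loading K S j p * s p) * (loading K S k q * s q))) =
        W j k * ((\<Sum>b\<in>K. S j b * t b) * (\<Sum>b\<in>K. S k b * t b))"
      unfolding L[OF jk(1)] L[OF jk(2)] .
  qed
  also have "\<dots> = (\<Sum>j\<in>K. \<Sum>k\<in>K. \<Sum>a\<in>K. \<Sum>b\<in>K. S a j * W j k * S k b * (t a * t b))"
  proof (intro sum.cong refl)
    fix j k
    have "W j k * ((\<Sum>b\<in>K. S j b * t b) * (\<Sum>b\<in>K. S k b * t b)) = (\<Sum>a\<in>K. \<Sum>b\<in>K. W j k * ((S j a * t a) * (S k b * t b)))"
      by (subst sum_product) (simp only: sum_distrib_left)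
    also have "\<dots> = (\<Sum>a\<in>K. \<Sum>b\<in>K. S a j * W j k * S k b * (t a * t b))"
    proof (intro sum.cong refl)
      fix a b
      show "W j k * ((S j a * t a) * (S k b * t b)) = S a j * W j k * S k b * (t a * t b)"
        by (simp only: sym[of j a]) (simp only: ac_simps)
    qed
    finally show "W j k * ((\<Sum>b\<in>K. S j b * t b) * (\<Sum>b\<in>K. S k b * t b)) = (\<Sum>a\<in>K. \<Sum>b\<in>K. S a j * W j k * S k b * (t a * t b))" .
  qed
  also have "\<dots> = (\<Sum>a\<in>K. \<Sum>b\<in>K. \<Sum>j\<in>K. \<Sum>k\<in>K. S a j * W j k * S k b * (t a * t b))"
    by (subst (2) sum.swap, subst (1) sum.swap, subst (3) sum.swap, subst (2) sum.swap) (rule refl)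
  finally have 1: "(\<Sum>p\<in>K \<times> K. \<Sum>q\<in>K \<times> K. (\<Sum>j\<in>K. \<Sum>k\<in>K. loading K S j p * W j k * loading K S k q) * (s p * s q)) =
      (\<Sum>a\<in>K. \<Sum>b\<in>K. (\<Sum>j\<in>K. \<Sum>k\<in>K. S a j * W j k * S k b) * (t a * t b))"
    by (simp add: sum_distrib_right)
  have "(\<Sum>p\<in>K \<times> K. \<Sum>q\<in>K \<times> K. of_bool (fst p = snd p \<and> fst q = snd q) * (E (fst p) (fst q) / (sqrt (excess K S (fst p)) * sqrt (excess K S (fst q)))) * (s p * s q)) =
      (\<Sum>p\<in>K \<times> K. of_bool (fst p = snd p) * (\<Sum>q\<in>K \<times> K. of_bool (fst q = snd q) * ((E (fst p) (fst q) / (sqrt (excess K S (fst p)) * sqrt (excess K S (fst q)))) * (s p * s q))))"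
    unfolding sum_distrib_left by (intro sum.cong refl) (simp add: of_bool_conj)
  also have "\<dots> = (\<Sum>a\<in>K. \<Sum>b\<in>K. E a b * (t a * t b))"
    unfolding sum_diagonal[OF K]
  proof (intro sum.cong refl)
    fix a b assume ab: "a \<in> K" "b \<in> K"
    have "sqrt (excess K S a) > 0" "sqrt (excess K S b) > 0" using ex ab by auto
    then show "E (fst (a, a)) (fst (b, b)) / (sqrt (excess K S (fst (a, a))) * sqrt (excess K S (fst (b, b)))) * (s (a, a) * s (b, b)) = E a b * (t a * t b)"
      using sum_loading[OF K ab(1) ab(1), of t S] sum_loading[OF K ab(2) ab(2), of t S]
      by (simp add: s_def)
  qed
  finally have 2: "(\<Sum>p\<in>K \<times> K. \<Sum>q\<in>K \<times> K. of_bool (fst p = snd p \<and> fst q = snd q) * (E (fst p) (fst q) / (sqrt (excess K S (fst p)) * sqrt (excess K S (fst q)))) * (s p * s q)) =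
      (\<Sum>a\<in>K. \<Sum>b\<in>K. E a b * (t a * t b))" .
  show ?thesis
    unfolding score_matrix_def distrib_right sum.distrib 1 2 ..
qed

text \<open>Minkowski's inequality separates the two parts of the score. Since the loadings times
  their transpose give \<open>S\<close>, the first part has squared norm tr (W S W S). In the second
  part each entry of \<open>E\<close> is divided by at least \<open>lam\<close>.\<close>

lemma score_matrix_norm_le:
  assumes K: "finite K" and sym: "\<And>a b. S a b = S b a" and ex: "\<And>a. a \<in> K \<Longrightarrow> lam \<le> excess K S a" and l: "lam > 0"
  shows "(\<Sum>p\<in>K \<times> K. \<Sum>q\<in>K \<times> K. (score_matrix K S W E p q)\<^sup>2) \<le>
    (sqrt (\<Sum>j\<in>K. \<Sum>k\<in>K. W j k * (\<Sum>a\<in>K. \<Sum>b\<in>K. S j a * W a b * S b k)) + sqrt (\<Sum>a\<in>K. \<Sum>b\<in>K. (E a b)\<^sup>2) / lam)\<^sup>2"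
proof -
  have ex0: "\<And>a. a \<in> K \<Longrightarrow> 0 \<le> excess K S a" using ex l by fastforce
  have M: "(\<Sum>p\<in>K \<times> K. loading K S k p * loading K S j p) = S k j" if "k \<in> K" "j \<in> K" for k j
    by (rule sum_loading_mult(2)[OF K sym _ that]) (rule ex0)
  define f where "f r = (\<Sum>j\<in>K. \<Sum>k\<in>K. loading K S j (fst r) * W j k * loading K S k (snd r))" for r
  define g where "g r = of_bool (fst (fst r) = snd (fst r) \<and> fst (snd r) = snd (snd r)) *
      (E (fst (fst r)) (fst (snd r)) / (sqrt (excess K S (fst (fst r))) * sqrt (excess K S (fst (snd r)))))" for r
  let ?R = "(K \<times> K) \<times> (K \<times> K)"
  have 1: "(\<Sum>p\<in>K \<times> K. \<Sum>q\<in>K \<times> K. (score_matrix K S W E p q)\<^sup>2) = (\<Sum>r\<in>?R. (f r + g r)\<^sup>2)"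
    unfolding sum.cartesian_product'[of _ "K \<times> K"] by (simp only: score_matrix_def f_def g_def fst_conv snd_conv)
  have 2: "(\<Sum>r\<in>?R. (f r + g r)\<^sup>2) = (L2_set (\<lambda>r. f r + g r) ?R)\<^sup>2"
    by (simp add: L2_set_def sum_nonneg)
  have 3: "(L2_set (\<lambda>r. f r + g r) ?R)\<^sup>2 \<le> (L2_set f ?R + L2_set g ?R)\<^sup>2"
    by (intro power_mono L2_set_triangle_ineq L2_set_nonneg)
  have 4: "(L2_set f ?R + L2_set g ?R)\<^sup>2 \<le> (sqrt (\<Sum>j\<in>K. \<Sum>k\<in>K. W j k * (\<Sum>a\<in>K. \<Sum>b\<in>K. S j a * W a b * S b k)) + sqrt (\<Sum>a\<in>K. \<Sum>b\<in>K. (E a b)\<^sup>2) / lam)\<^sup>2"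
  proof (intro power_mono add_mono add_nonneg_nonneg L2_set_nonneg)
    have "(\<Sum>r\<in>?R. (f r)\<^sup>2) = (\<Sum>p\<in>K \<times> K. \<Sum>q\<in>K \<times> K. (\<Sum>j\<in>K. \<Sum>k\<in>K. loading K S j p * W j k * loading K S k q) * (\<Sum>a\<in>K. \<Sum>b\<in>K. loading K S a p * W a b * loading K S b q))"
      unfolding sum.cartesian_product'[of _ "K \<times> K"] by (simp only: f_def power2_eq_square fst_conv snd_conv)
    also have "\<dots> = (\<Sum>p\<in>K \<times> K. \<Sum>q\<in>K \<times> K. \<Sum>j\<in>K. \<Sum>k\<in>K. \<Sum>a\<in>K. \<Sum>b\<in>K. W j k * W a b * ((loading K S j p * loading K S a p) * (loading K S k q * loading K S b q)))"
      unfolding double_sum_mult by (intro sum.cong refl) (simp only: ac_simps)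
    also have "\<dots> = (\<Sum>j\<in>K. \<Sum>k\<in>K. \<Sum>a\<in>K. \<Sum>b\<in>K. \<Sum>p\<in>K \<times> K. \<Sum>q\<in>K \<times> K. W j k * W a b * ((loading K S j p * loading K S a p) * (loading K S k q * loading K S b q)))"
    proof -
      have sw: "(\<Sum>p\<in>P. \<Sum>q\<in>P. \<Sum>j\<in>K. H p q j) = (\<Sum>j\<in>K. \<Sum>p\<in>P. \<Sum>q\<in>P. H p q j)" for P :: "('a \<times> 'a) set" and H :: "_ \<Rightarrow> _ \<Rightarrow> _ \<Rightarrow> real"
        by (subst (2) sum.swap, subst (1) sum.swap) (rule refl)
      show ?thesis by (simp only: sw)
    qed
    also have "\<dots> = (\<Sum>j\<in>K. \<Sum>k\<in>K. \<Sum>a\<in>K. \<Sum>b\<in>K. W j k * W a b * (S j a * S k b))"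
    proof (intro sum.cong refl)
      fix j k a b assume jk: "j \<in> K" "k \<in> K" "a \<in> K" "b \<in> K"
      have "(\<Sum>p\<in>K \<times> K. \<Sum>q\<in>K \<times> K. W j k * W a b * ((loading K S j p * loading K S a p) * (loading K S k q * loading K S b q))) =
          W j k * W a b * ((\<Sum>p\<in>K \<times> K. loading K S j p * loading K S a p) * (\<Sum>q\<in>K \<times> K. loading K S k q * loading K S b q))"
        by (subst sum_product) (simp only: sum_distrib_left)
      then show "(\<Sum>p\<in>K \<times> K. \<Sum>q\<in>K \<times> K. W j k * W a b * ((loading K S j p * loading K S a p) * (loading K S k q * loading K S b q))) =
          W j k * W a b * (S j a * S k b)"
        unfolding M[OF jk(1,3)] M[OF jk(2,4)] .
    qed
    also have "\<dots> = (\<Sum>j\<in>K. \<Sum>k\<in>K. W j k * (\<Sum>a\<in>K. \<Sum>b\<in>K. S j a * W a b * S b k))"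
    proof (intro sum.cong refl, unfold sum_distrib_left, intro sum.cong refl)
      fix j k a b
      show "W j k * W a b * (S j a * S k b) = W j k * (S j a * W a b * S b k)"
        by (simp only: sym[of k b]) (simp only: ac_simps)
    qed
    finally show "L2_set f ?R \<le> sqrt (\<Sum>j\<in>K. \<Sum>k\<in>K. W j k * (\<Sum>a\<in>K. \<Sum>b\<in>K. S j a * W a b * S b k))"
      by (simp add: L2_set_def)
    have "(\<Sum>r\<in>?R. (g r)\<^sup>2) = (\<Sum>p\<in>K \<times> K. \<Sum>q\<in>K \<times> K. of_bool (fst p = snd p \<and> fst q = snd q) * (E (fst p) (fst q) / (sqrt (excess K S (fst p)) * sqrt (excess K S (fst q))))\<^sup>2)"
      unfolding sum.cartesian_product'[of _ "K \<times> K"] by (intro sum.cong refl) (auto simp: g_def of_bool_def)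
    also have "\<dots> = (\<Sum>a\<in>K. \<Sum>b\<in>K. (E a b / (sqrt (excess K S a) * sqrt (excess K S b)))\<^sup>2)"
      by (simp add: of_bool_conj mult.assoc sum_diagonal[OF K] flip: sum_distrib_left)
    also have "\<dots> \<le> (\<Sum>a\<in>K. \<Sum>b\<in>K. (E a b / lam)\<^sup>2)"
    proof (intro sum_mono)
      fix a b assume ab: "a \<in> K" "b \<in> K"
      have "lam * lam \<le> excess K S a * excess K S b"
        using ex[OF ab(1)] ex[OF ab(2)] l by (intro mult_mono) auto
      then have "(E a b)\<^sup>2 / (excess K S a * excess K S b) \<le> (E a b)\<^sup>2 / (lam * lam)"
        using l by (intro divide_left_mono) (auto intro: mult_pos_pos less_le_trans)
      then show "(E a b / (sqrt (excess K S a) * sqrt (excess K S b)))\<^sup>2 \<le> (E a b / lam)\<^sup>2"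
        using ex0 ab by (simp add: power_divide power_mult_distrib power2_eq_square[of lam])
    qed
    also have "\<dots> = (\<Sum>a\<in>K. \<Sum>b\<in>K. (E a b)\<^sup>2) / lam\<^sup>2"
      by (simp add: power_divide sum_divide_distrib)
    finally have "(\<Sum>r\<in>?R. (g r)\<^sup>2) \<le> (\<Sum>a\<in>K. \<Sum>b\<in>K. (E a b)\<^sup>2) / lam\<^sup>2" .
    from real_sqrt_le_mono[OF this] show "L2_set g ?R \<le> sqrt (\<Sum>a\<in>K. \<Sum>b\<in>K. (E a b)\<^sup>2) / lam"
      unfolding L2_set_def real_sqrt_divide using l by simp
  qed
  show ?thesis
    unfolding 1 2 by (rule order_trans[OF 3 4])
qed

text \<open>Because \<open>\<Sigma> W \<Sigma> = A - E\<close>, the first square root in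
  \<open>F\<close> is that of tr (W \<Sigma> W \<Sigma>). For E = 0 the bound \<open>F\<close> is tr
  (W A) / 2, the exact Fisher information. The law \<open>\<mu> h\<close> is arbitrary apart from
  its characteristic function, so it may be replaced by the law of a vector built from independent
  standard normals.\<close>

proposition Gaussian_van_Trees:
  fixes K :: "'k set" and \<Sigma>0 A W :: "'k \<Rightarrow> 'k \<Rightarrow> real" and \<mu> :: "real \<Rightarrow> ('k \<Rightarrow> real) measure" and T :: "('k \<Rightarrow> real) \<Rightarrow> real"
  defines "\<Sigma> \<equiv> \<lambda>h a b. \<Sigma>0 a b + h * A a b"
  defines "E \<equiv> \<lambda>h a b. A a b - (\<Sum>j\<in>K. \<Sum>k\<in>K. \<Sigma> h a j * W j k * \<Sigma> h k b)"
  assumes K: "finite K" and lu: "l < u"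
    and sym: "\<And>a b. \<Sigma>0 a b = \<Sigma>0 b a" "\<And>a b. A a b = A b a" "\<And>a b. W a b = W b a"
    and lam: "lam > 0" and ex: "\<And>h a. h \<in> {l..u} \<Longrightarrow> a \<in> K \<Longrightarrow> lam \<le> excess K (\<Sigma> h) a"
    and F: "\<And>h. h \<in> {l..u} \<Longrightarrow>
      (sqrt (\<Sum>a\<in>K. \<Sum>b\<in>K. W a b * (A a b - E h a b)) + sqrt (\<Sum>a\<in>K. \<Sum>b\<in>K. (E h a b)\<^sup>2) / lam)\<^sup>2 / 2 \<le> F"
    and T: "T \<in> borel_measurable (\<Pi>\<^sub>M k\<in>K. borel)" and bdd: "\<And>x. \<bar>T x\<bar> \<le> C"
    and \<mu>: "\<And>h. h \<in> {l..u} \<Longrightarrow> finite_measure (\<mu> h)" "\<And>h. h \<in> {l..u} \<Longrightarrow> sets (\<mu> h) = sets (\<Pi>\<^sub>M k\<in>K. borel)"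
    and char: "\<And>h t. h \<in> {l..u} \<Longrightarrow> (CLINT x|\<mu> h. iexp (\<Sum>k\<in>K. t k * x k)) =
        of_real (exp (- (\<Sum>a\<in>K. \<Sum>b\<in>K. \<Sigma> h a b * (t a * t b)) / 2))"
    and risk: "\<And>h. h \<in> {l..u} \<Longrightarrow> (LINT x|\<mu> h. (T x - h)\<^sup>2) \<le> R"
  shows "1 \<le> R * (F + 40 / (u - l)\<^sup>2)"
proof -
  define L where "L = K \<times> K"
  have L: "finite L" using K by (simp add: L_def)
  interpret G: prob_space "std_gaussian L" by (rule prob_space_std_gaussian)
  have sym\<Sigma>: "\<Sigma> h a b = \<Sigma> h b a" for h a b
    unfolding \<Sigma>_def by (simp only: sym(1)[of a b] sym(2)[of a b])
  define X where "X h g = (\<lambda>k\<in>K. \<Sum>p\<in>L. loading K (\<Sigma> h) k p * g p)" for h and g :: "'k \<times> 'k \<Rightarrow> real"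
  define \<Psi> where "\<Psi> h g = (\<Sum>p\<in>L. \<Sum>q\<in>L. score_matrix K (\<Sigma> h) W (E h) p q * (g p * g q - of_bool (p = q))) / 2" for h and g :: "'k \<times> 'k \<Rightarrow> real"
  define s where "s h t p = (\<Sum>k\<in>K. t k * loading K (\<Sigma> h) k p)" for h and t :: "'k \<Rightarrow> real" and p
  have tX: "(\<Sum>k\<in>K. t k * X h g k) = (\<Sum>p\<in>L. s h t p * g p)" for t h g
  proof -
    have "(\<Sum>k\<in>K. t k * X h g k) = (\<Sum>k\<in>K. \<Sum>p\<in>L. t k * loading K (\<Sigma> h) k p * g p)"
      by (intro sum.cong refl) (simp add: X_def sum_distrib_left mult.assoc)
    also have "\<dots> = (\<Sum>p\<in>L. s h t p * g p)"
      by (subst sum.swap) (simp add: s_def sum_distrib_right)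
    finally show ?thesis .
  qed
  have ex0: "0 < excess K (\<Sigma> h) a" if "h \<in> {l..u}" "a \<in> K" for h a
    using ex[OF that] lam by linarith
  have s2: "(\<Sum>p\<in>L. (s h t p)\<^sup>2) = (\<Sum>a\<in>K. \<Sum>b\<in>K. \<Sigma> h a b * (t a * t b))" if h: "h \<in> {l..u}" for h t
    using sum_loading_bilinear[where K=K and S="\<Sigma> h" and t=t and r=t, OF K sym\<Sigma>] ex0[OF h, THEN less_imp_le]
    by (simp add: L_def s_def power2_eq_square)
  have E_sym: "E h a b = E h b a" for h a b
  proof -
    have "(\<Sum>j\<in>K. \<Sum>k\<in>K. \<Sigma> h a j * W j k * \<Sigma> h k b) = (\<Sum>j\<in>K. \<Sum>k\<in>K. \<Sigma> h b j * W j k * \<Sigma> h k a)"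
    proof (subst sum.swap, intro sum.cong refl)
      fix k j
      show "\<Sigma> h a j * W j k * \<Sigma> h k b = \<Sigma> h b k * W k j * \<Sigma> h j a"
        using sym(3)[of j k] sym\<Sigma>[of h a j] sym\<Sigma>[of h k b] by simp
    qed
    then show ?thesis unfolding E_def using sym(2)[of a b] by simp
  qed
  have SM_sym: "score_matrix K (\<Sigma> h) W (E h) p q = score_matrix K (\<Sigma> h) W (E h) q p" for h p q
  proof -
    have "(\<Sum>j\<in>K. \<Sum>k\<in>K. loading K (\<Sigma> h) j p * W j k * loading K (\<Sigma> h) k q) =
        (\<Sum>j\<in>K. \<Sum>k\<in>K. loading K (\<Sigma> h) j q * W j k * loading K (\<Sigma> h) k p)"
    proof (subst sum.swap, intro sum.cong refl)
      fix x y
      show "loading K (\<Sigma> h) y p * W y x * loading K (\<Sigma> h) x q = loading K (\<Sigma> h) x q * W x y * loading K (\<Sigma> h) y p"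
        by (simp only: sym(3)[of y x]) (simp only: ac_simps)
    qed
    then show ?thesis
      unfolding score_matrix_def using E_sym[of h "fst p" "fst q"] by (simp add: conj_commute mult.commute)
  qed
  have Q: "integrable (std_gaussian L) (\<lambda>g. (\<Psi> h g)\<^sup>2)"
    "(LINT g|std_gaussian L. (\<Psi> h g)\<^sup>2) = (\<Sum>p\<in>L. \<Sum>q\<in>L. (score_matrix K (\<Sigma> h) W (E h) p q)\<^sup>2) / 2"
    "(LINT g|std_gaussian L. \<Psi> h g) = 0"
    "(CLINT g|std_gaussian L. \<Psi> h g * iexp (\<Sum>p\<in>L. r p * g p)) =
      of_real (- (\<Sum>p\<in>L. \<Sum>q\<in>L. score_matrix K (\<Sigma> h) W (E h) p q * (r p * r q)) / 2 * exp (- (\<Sum>p\<in>L. (r p)\<^sup>2) / 2))" for h r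
    unfolding \<Psi>_def by (rule std_gaussian_quadratic_form[OF L SM_sym])+
  have m\<Sigma>: "(\<lambda>h. \<Sigma> h a b) \<in> borel_measurable borel" for a b
    unfolding \<Sigma>_def by measurable
  have mex: "(\<lambda>h. excess K (\<Sigma> h) a) \<in> borel_measurable borel" for a
    unfolding excess_def using m\<Sigma> by measurable
  have mload: "(\<lambda>h. loading K (\<Sigma> h) k p) \<in> borel_measurable borel" for k p
  proof (cases p)
    case (Pair a b)
    note [measurable] = m\<Sigma> mex
    show ?thesis unfolding loading_def Pair prod.case by (cases "a = b") simp_all
  qed
  have mE: "(\<lambda>h. E h a b) \<in> borel_measurable borel" for a b
    unfolding E_def using m\<Sigma> by measurable
  have mS: "(\<lambda>h. score_matrix K (\<Sigma> h) W (E h) p q) \<in> borel_measurable borel" for p q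
    unfolding score_matrix_def using mE mex mload by measurable
  have gl: "(\<lambda>z. snd z p) \<in> borel_measurable (borel \<Otimes>\<^sub>M std_gaussian L)" if "p \<in> L" for p
  proof -
    have "(\<lambda>g. g p) \<in> borel_measurable (std_gaussian L)"
      using measurable_component_singleton[OF that, of "\<lambda>_. std_normal_distribution"] by simp
    from measurable_compose[OF measurable_snd this] show ?thesis .
  qed
  have fm: "(\<lambda>z. f (fst z)) \<in> borel_measurable (borel \<Otimes>\<^sub>M std_gaussian L)" if "f \<in> borel_measurable borel" for f :: "real \<Rightarrow> real"
    using that by measurable
  have XM: "case_prod X \<in> measurable (borel \<Otimes>\<^sub>M std_gaussian L) (\<Pi>\<^sub>M k\<in>K. borel)"
    unfolding case_prod_beta' X_def
    by (intro measurable_restrict borel_measurable_sum borel_measurable_times gl fm mload)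
  have \<Psi>M: "case_prod \<Psi> \<in> borel_measurable (borel \<Otimes>\<^sub>M std_gaussian L)"
    unfolding case_prod_beta' \<Psi>_def
    by (intro borel_measurable_divide borel_measurable_const borel_measurable_sum borel_measurable_times borel_measurable_diff gl fm mS)
  have XMh: "X h \<in> measurable (std_gaussian L) (\<Pi>\<^sub>M k\<in>K. borel)" for h
    using measurable_Pair2[OF XM, of h] by simp
  have sumlin: "(\<Sum>a\<in>K. \<Sum>b\<in>K. \<Sigma> h a b * (t a * t b)) =
      (\<Sum>a\<in>K. \<Sum>b\<in>K. \<Sigma>0 a b * (t a * t b)) + h * (\<Sum>a\<in>K. \<Sum>b\<in>K. A a b * (t a * t b))" for h t
    by (simp add: \<Sigma>_def ring_distribs sum.distrib sum_distrib_left mult.assoc)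
  have charX: "(CLINT g|std_gaussian L. iexp (\<Sum>k\<in>K. t k * X h g k)) =
      of_real (exp (- (\<Sum>a\<in>K. \<Sum>b\<in>K. \<Sigma> h a b * (t a * t b)) / 2))" if h: "h \<in> {l..u}" for h t
    unfolding tX using integral_std_gaussian_iexp(1)[OF L, of "s h t"] by (simp only: s2[OF h])
  \<comment> \<open>This identification by characteristic functions is what allows the score to live
    on the space of the driving noise.\<close>
  have \<mu>X: "\<mu> h = distr (std_gaussian L) (\<Pi>\<^sub>M k\<in>K. borel) (X h)" if h: "h \<in> {l..u}" for h
  proof (rule PiM_eqI_char[OF K \<mu>(1)[OF h] _ \<mu>(2)[OF h]])
    show "finite_measure (distr (std_gaussian L) (\<Pi>\<^sub>M k\<in>K. borel) (X h))"
      using XMh by (rule G.finite_measure_distr)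
    fix t
    have "(CLINT x|distr (std_gaussian L) (\<Pi>\<^sub>M k\<in>K. borel) (X h). iexp (\<Sum>k\<in>K. t k * x k)) =
        (CLINT g|std_gaussian L. iexp (\<Sum>k\<in>K. t k * X h g k))"
      using XMh by (rule integral_distr) measurable
    then show "(CLINT x|\<mu> h. iexp (\<Sum>k\<in>K. t k * x k)) = (CLINT x|distr (std_gaussian L) (\<Pi>\<^sub>M k\<in>K. borel) (X h). iexp (\<Sum>k\<in>K. t k * x k))"
      unfolding char[OF h] charX[OF h] by simp
  qed simp
  have F0: "(LINT g|std_gaussian L. (\<Psi> h g)\<^sup>2) \<le> F" if h: "h \<in> {l..u}" for h
  proof -
    have "(\<Sum>a\<in>K. \<Sum>b\<in>K. W a b * (A a b - E h a b)) = (\<Sum>j\<in>K. \<Sum>k\<in>K. W j k * (\<Sum>a\<in>K. \<Sum>b\<in>K. \<Sigma> h j a * W a b * \<Sigma> h b k))"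
      by (simp add: E_def)
    then have "(\<Sum>p\<in>L. \<Sum>q\<in>L. (score_matrix K (\<Sigma> h) W (E h) p q)\<^sup>2) / 2 \<le> F"
      using score_matrix_norm_le[where K=K and S="\<Sigma> h" and W=W and E="E h", OF K sym\<Sigma> ex[OF h] lam] F[OF h] by (simp add: L_def)
    then show ?thesis using Q(2)[of h] by simp
  qed
  show ?thesis
  proof (rule van_Trees[OF K prob_space_std_gaussian lu XM \<Psi>M T bdd Q(1) Q(3) F0])
    fix h t assume h: "h \<in> {l..u}"
    show "(CLINT g|std_gaussian L. iexp (\<Sum>k\<in>K. t k * X h g k)) =
        of_real (exp (- ((\<Sum>a\<in>K. \<Sum>b\<in>K. \<Sigma>0 a b * (t a * t b)) + h * (\<Sum>a\<in>K. \<Sum>b\<in>K. A a b * (t a * t b))) / 2))"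
      using charX[OF h] by (simp only: sumlin)
    have "(\<Sum>p\<in>L. \<Sum>q\<in>L. score_matrix K (\<Sigma> h) W (E h) p q * (s h t p * s h t q)) = (\<Sum>a\<in>K. \<Sum>b\<in>K. A a b * (t a * t b))"
      using score_matrix_quadratic_form[where K=K and S="\<Sigma> h" and t=t and W=W and E="E h", OF K sym\<Sigma> ex0[OF h]]
      by (simp add: L_def s_def E_def)
    then show "(CLINT g|std_gaussian L. \<Psi> h g * iexp (\<Sum>k\<in>K. t k * X h g k)) =
        of_real (- (\<Sum>a\<in>K. \<Sum>b\<in>K. A a b * (t a * t b)) / 2 *
          exp (- ((\<Sum>a\<in>K. \<Sum>b\<in>K. \<Sigma>0 a b * (t a * t b)) + h * (\<Sum>a\<in>K. \<Sum>b\<in>K. A a b * (t a * t b))) / 2))"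
      unfolding tX Q(4) s2[OF h] sumlin by (simp only:)
  next
    fix h assume h: "h \<in> {l..u}"
    have "(LINT x|\<mu> h. (T x - h)\<^sup>2) = (LINT g|std_gaussian L. (T (X h g) - h)\<^sup>2)"
      unfolding \<mu>X[OF h] by (rule integral_distr[OF XMh]) (intro borel_measurable_power borel_measurable_diff T borel_measurable_const)
    then show "(LINT g|std_gaussian L. (T (X h g) - h)\<^sup>2) \<le> R"
      using risk[OF h] by simp
  qed
qed

section \<open>Green kernels and Toeplitz symbols\<close>

text \<open>The Green kernel of \<open>L + 2 g - g (shift + shift\<^sup>*)\<close> and its convolution square, in terms of the
  parameter \<open>t = sqrt (L / (L + 4 g))\<close>, which makes all coefficients rational.\<close>

definition green_param :: "real \<Rightarrow> real \<Rightarrow> real" where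
  "green_param L g = sqrt (L / (L + 4 * g))"

definition green_ratio :: "real \<Rightarrow> real \<Rightarrow> real" where
  "green_ratio L g = (1 - green_param L g) / (1 + green_param L g)"

definition green :: "real \<Rightarrow> real \<Rightarrow> int \<Rightarrow> real" where
  "green L g k = green_param L g / L * green_ratio L g ^ nat \<bar>k\<bar>"

definition green2 :: "real \<Rightarrow> real \<Rightarrow> int \<Rightarrow> real" where
  "green2 L g k = (green_param L g / L)\<^sup>2 * green_ratio L g ^ nat \<bar>k\<bar> *
     (of_int \<bar>k\<bar> + (1 + (green_param L g)\<^sup>2) / (2 * green_param L g))"

definition tridiag :: "real \<Rightarrow> real \<Rightarrow> (int \<Rightarrow> real) \<Rightarrow> int \<Rightarrow> real" where
  "tridiag L g x k = (L + 2 * g) * x k - g * (x (k - 1) + x (k + 1))"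

text \<open>Solving the definition of \<open>t = green_param L g\<close> for \<open>g\<close>
  removes the square root, so that later identities are rational in \<open>t\<close>. The value
  \<open>t = 1\<close>, with ratio 0, is the noiseless case \<open>g = 0\<close>.\<close>

lemma green_param:
  assumes "L > 0" "g \<ge> 0"
  shows "0 < green_param L g" "green_param L g \<le> 1" "g = L * (1 - (green_param L g)\<^sup>2) / (4 * (green_param L g)\<^sup>2)"
    and "0 \<le> green_ratio L g" "green_ratio L g < 1"
proof -
  show 1: "0 < green_param L g" using assms by (simp add: green_param_def)
  show 2: "green_param L g \<le> 1" using assms by (simp add: green_param_def)
  have "(green_param L g)\<^sup>2 = L / (L + 4 * g)" using assms by (simp add: green_param_def)
  then show "g = L * (1 - (green_param L g)\<^sup>2) / (4 * (green_param L g)\<^sup>2)"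
    using assms 1 by (simp add: field_simps)
  show "0 \<le> green_ratio L g" "green_ratio L g < 1"
    using 1 2 by (simp_all add: green_ratio_def)
qed

text \<open>Away from 0 both kernels solve a recurrence whose characteristic root inside the unit
  disc is \<open>green_ratio\<close>. The factor \<open>green_param L g / L\<close> normalises the
  jump at 0. In \<open>green2\<close> the resonance produces the factor
  \<open>\<bar>k\<bar>\<close>, and the additive constant next to it is fixed by the equation at
  \<open>k = 0\<close>.\<close>

lemma tridiag_green:
  assumes "L > 0" "g \<ge> 0"
  shows "tridiag L g (green L g) k = of_bool (k = 0)"
    and "tridiag L g (green2 L g) k = green L g k"
proof -
  define t where "t = green_param L g"
  define r where "r = green_ratio L g"
  have t: "0 < t" "t \<le> 1" and g: "g = L * (1 - t\<^sup>2) / (4 * t\<^sup>2)" and r: "r = (1 - t) / (1 + t)"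
    using green_param[OF assms] by (simp_all add: t_def r_def green_ratio_def)
  note d = green_def green2_def t_def[symmetric] r_def[symmetric]
  have L: "L \<noteq> 0" and t1: "1 + t \<noteq> 0" "t \<noteq> 0" using assms t by auto
  have k0: "tridiag L g (green L g) 0 = 1" "tridiag L g (green2 L g) 0 = green L g 0"
    unfolding tridiag_def d using L t1 by (simp_all add: g r divide_simps) (simp_all add: algebra_simps power2_eq_square)
  have kS: "tridiag L g (green L g) k = 0" "tridiag L g (green2 L g) k = green L g k"
    if k: "k = int (Suc m) \<or> k = - int (Suc m)" for k m
  proof -
    have n: "nat \<bar>k\<bar> = Suc m" "\<bar>k\<bar> = int m + 1" using k by auto
    have pm: "f (k - 1) + f (k + 1) = f (int m) + f (int m + 2)" if "\<And>j. f (- j) = f j" for f :: "int \<Rightarrow> real"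
      using k
    proof
      assume "k = - int (Suc m)"
      then have "k - 1 = - (int m + 2)" "k + 1 = - int m" by auto
      then show ?thesis by (simp only: that add.commute)
    qed (auto simp: add_ac)
    have ev: "green L g (- j) = green L g j" "green2 L g (- j) = green2 L g j" for j
      by (simp_all add: green_def green2_def)
    have n2: "nat \<bar>int m + 2\<bar> = Suc (Suc m)" "nat \<bar>int m\<bar> = m" "\<bar>int m + 2\<bar> = int m + 2" "\<bar>int m\<bar> = int m"
      "nat (int m + 2) = Suc (Suc m)" "nat (int m + 1) = Suc m" by auto
    \<comment> \<open>The characteristic equation of the recurrence at
      \<open>r = green_ratio L g\<close>.\<close>
    have rel: "(L + 2 * g) * r = g * (1 + r\<^sup>2)"
      using L t1 by (simp add: g r divide_simps) (simp add: algebra_simps power2_eq_square)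
    have "tridiag L g (green L g) k = t / L * r ^ m * ((L + 2 * g) * r - g * (1 + r\<^sup>2))"
      unfolding tridiag_def pm[of "green L g", OF ev(1)] unfolding d n(1) n2(1,2) power_Suc using L by (simp add: field_simps power2_eq_square)
    then show "tridiag L g (green L g) k = 0" using rel by simp
    define b where "b = (1 + t\<^sup>2) / (2 * t)"
    define c where "c = t / L"
    have "tridiag L g (green2 L g) k =
        (t / L)\<^sup>2 * r ^ m * ((real m + 1 + (1 + t\<^sup>2) / (2 * t)) * ((L + 2 * g) * r - g * (1 + r\<^sup>2)) + g * (1 - r\<^sup>2))"
      unfolding tridiag_def pm[of "green2 L g", OF ev(2)] unfolding d n(1) n2(1,2) unfolding n(2) n2(3,4) power_Suc b_def[symmetric] c_def[symmetric] by (simp add: algebra_simps power2_eq_square)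
    also have "\<dots> = (t / L)\<^sup>2 * r ^ m * (g * (1 - r\<^sup>2))" using rel by simp
    also have "g * (1 - r\<^sup>2) = L / t * r"
      using L t1 by (simp add: g r divide_simps) (simp add: algebra_simps power2_eq_square)
    also have "(t / L)\<^sup>2 * r ^ m * (L / t * r) = t / L * r ^ Suc m"
      using L t1 by (simp add: power2_eq_square)
    finally show "tridiag L g (green2 L g) k = green L g k"
      unfolding d n(1) .
  qed
  have "tridiag L g (green L g) k = of_bool (k = 0) \<and> tridiag L g (green2 L g) k = green L g k"
  proof (cases k rule: int_cases)
    case (nonneg n)
    show ?thesis
    proof (cases n)
      case 0
      then show ?thesis using k0 nonneg by simp
    next
      case (Suc m)
      then have "k = int (Suc m) \<or> k = - int (Suc m)" using nonneg by simp
      from kS[OF this] show ?thesis using nonneg Suc by simp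
    qed
  next
    case (neg n)
    then have "k = int (Suc n) \<or> k = - int (Suc n)" by simp
    from kS[OF this] show ?thesis using neg by simp
  qed
  then show "tridiag L g (green L g) k = of_bool (k = 0)" "tridiag L g (green2 L g) k = green L g k"
    by auto
qed

lemma tridiag_simps:
  "tridiag L g (\<lambda>k. a * x k) k = a * tridiag L g x k"
  "tridiag L g (\<lambda>k. x k + y k) k = tridiag L g x k + tridiag L g y k"
  "tridiag L g (\<lambda>k. x k - y k) k = tridiag L g x k - tridiag L g y k"
  "tridiag L g (\<lambda>k. x (k + j)) k = tridiag L g x (k + j)"
  "tridiag L g (\<lambda>k. x (k - j)) k = tridiag L g x (k - j)"
  by (simp_all add: tridiag_def algebra_simps)

text \<open>The symbols of the derivative of the covariance (\<open>drift_symbol\<close>), of its two-sided product with the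
  inverse covariance (\<open>score_symbol\<close>), and of the intermediate one-sided product (\<open>half_symbol\<close>).
  The indices \<open>s, s' \<in> {1, -1}\<close> refer to the sum and the difference of the two components.\<close>

definition drift_symbol :: "real \<Rightarrow> real \<Rightarrow> real \<Rightarrow> int \<Rightarrow> real" where
  "drift_symbol \<rho> s s' k = \<rho> / 2 * (- (s + s') * of_bool (k = 0) + s' * of_bool (k = -1) + s * of_bool (k = 1))"

text \<open>For \<open>s = s'\<close> this is the drift convolved with the square of one Green
  kernel. For \<open>s \<noteq> s'\<close> the kernels for \<open>1 + \<rho>\<close> and
  \<open>1 - \<rho>\<close> are to be convolved; as the operators differ by the constant
  \<open>2 * \<rho>\<close>, the resolvent identity turns this convolution into the difference of
  the kernels divided by \<open>2 * \<rho>\<close>. The denominator cancels against the factor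
  \<rho> of the drift, and \<open>(s - s') / 8\<close> equals \<open>s / 4\<close>.\<close>

definition score_symbol :: "real \<Rightarrow> real \<Rightarrow> real \<Rightarrow> real \<Rightarrow> int \<Rightarrow> real" where
  "score_symbol \<rho> g s s' k =
     of_bool (s = s') * (s * \<rho> / 2 * (green2 (1 + s * \<rho>) g (k + 1) + green2 (1 + s * \<rho>) g (k - 1) - 2 * green2 (1 + s * \<rho>) g k))
     + (s - s') / 8 * ((green (1 - \<rho>) g (k - 1) - green (1 + \<rho>) g (k - 1)) - (green (1 - \<rho>) g (k + 1) - green (1 + \<rho>) g (k + 1)))"

definition half_symbol :: "real \<Rightarrow> real \<Rightarrow> real \<Rightarrow> real \<Rightarrow> int \<Rightarrow> real" where
  "half_symbol \<rho> g s s' = tridiag (1 + s * \<rho>) g (score_symbol \<rho> g s s')"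

text \<open>Multiplication by the covariance acts with \<open>1 + s * \<rho>\<close> on the row
  index and with \<open>1 + s' * \<rho>\<close> on the column index. After the first operator one
  Green kernel is left, with the parameter \<open>1 + s' * \<rho>\<close> that the second operator
  inverts.\<close>

lemma tridiag_half_symbol:
  assumes \<rho>: "\<bar>\<rho>\<bar> < 1" and g: "g \<ge> 0" and s: "s \<in> {1, -1}" "s' \<in> {1, -1}"
  shows "tridiag (1 + s' * \<rho>) g (half_symbol \<rho> g s s') k = drift_symbol \<rho> s s' k"
proof -
  have L: "0 < 1 + s * \<rho>" "0 < 1 - \<rho>" "0 < 1 + \<rho>" using \<rho> s by auto
  show ?thesis
  proof (cases "s = s'")
    case True
    have w: "score_symbol \<rho> g s s' = (\<lambda>k. s * \<rho> / 2 * (green2 (1 + s * \<rho>) g (k + 1) + green2 (1 + s * \<rho>) g (k - 1) - 2 * green2 (1 + s * \<rho>) g k))"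
      using True by (simp add: score_symbol_def fun_eq_iff)
    have h: "half_symbol \<rho> g s s' = (\<lambda>k. s * \<rho> / 2 * (green (1 + s * \<rho>) g (k + 1) + green (1 + s * \<rho>) g (k - 1) - 2 * green (1 + s * \<rho>) g k))"
      unfolding half_symbol_def w by (rule ext) (simp only: tridiag_simps tridiag_green[OF L(1) g])
    show ?thesis
      unfolding h unfolding True[symmetric] by (simp only: tridiag_simps tridiag_green[OF L(1) g]) (auto simp: drift_symbol_def)
  next
    case False
    then have s': "s' = - s" using s by auto
    have w: "score_symbol \<rho> g s s' = (\<lambda>k. s / 4 * ((green (1 - \<rho>) g (k - 1) - green (1 + \<rho>) g (k - 1)) - (green (1 - \<rho>) g (k + 1) - green (1 + \<rho>) g (k + 1))))"
      using False by (simp add: score_symbol_def fun_eq_iff s')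
    \<comment> \<open>The two operators differ by a constant; this is the resolvent identity behind
      the off-diagonal symbols.\<close>
    have sh: "tridiag (1 + s * \<rho>) g x k = tridiag (1 - s * \<rho>) g x k + 2 * s * \<rho> * x k" for x k
      by (simp add: tridiag_def algebra_simps)
    have d: "tridiag (1 + s * \<rho>) g (\<lambda>k. green (1 - \<rho>) g k - green (1 + \<rho>) g k) k = 2 * \<rho> * green (1 - s * \<rho>) g k" for k
    proof (cases "s = 1")
      case True
      then show ?thesis
        using sh[of "green (1 - \<rho>) g" k] tridiag_green(1)[OF L(2) g, of k] tridiag_green(1)[OF L(3) g, of k]
        by (simp only: tridiag_simps) simp
    next
      case False
      then have "s = -1" using s by auto
      then show ?thesis
        using sh[of "green (1 + \<rho>) g" k] tridiag_green(1)[OF L(2) g, of k] tridiag_green(1)[OF L(3) g, of k]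
        by (simp only: tridiag_simps) simp
    qed
    have h: "half_symbol \<rho> g s s' = (\<lambda>k. s / 4 * (2 * \<rho> * green (1 - s * \<rho>) g (k - 1) - 2 * \<rho> * green (1 - s * \<rho>) g (k + 1)))"
    proof (rule ext)
      fix k
      have "half_symbol \<rho> g s s' k = s / 4 * (tridiag (1 + s * \<rho>) g (\<lambda>k. green (1 - \<rho>) g k - green (1 + \<rho>) g k) (k - 1)
          - tridiag (1 + s * \<rho>) g (\<lambda>k. green (1 - \<rho>) g k - green (1 + \<rho>) g k) (k + 1))"
        unfolding half_symbol_def w by (simp add: tridiag_def algebra_simps) (simp add: field_simps)
      then show "half_symbol \<rho> g s s' k = s / 4 * (2 * \<rho> * green (1 - s * \<rho>) g (k - 1) - 2 * \<rho> * green (1 - s * \<rho>) g (k + 1))"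
        unfolding d .
    qed
    have L': "0 < 1 - s * \<rho>" using \<rho> s by auto
    have e: "1 + s' * \<rho> = 1 - s * \<rho>" using s' by simp
    show ?thesis
      unfolding h e
      by (simp only: tridiag_simps tridiag_green(1)[OF L' g]) (auto simp: drift_symbol_def s')
  qed
qed

text \<open>The Green kernels are even, so exchanging the signs reverses the index; this is the
  symmetry of the Toeplitz matrix W.\<close>

lemma score_symbol_swap: "score_symbol \<rho> g s s' k = score_symbol \<rho> g s' s (- k)"
proof -
  have a: "\<bar>- k - 1\<bar> = \<bar>k + 1\<bar>" "\<bar>- k + 1\<bar> = \<bar>k - 1\<bar>" by auto
  have e: "green L g (- k - 1) = green L g (k + 1)" "green L g (- k + 1) = green L g (k - 1)"
    "green2 L g (- k - 1) = green2 L g (k + 1)" "green2 L g (- k + 1) = green2 L g (k - 1)"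
    "green2 L g (- k) = green2 L g k" for L
    unfolding green_def green2_def a abs_minus_cancel by (rule refl)+
  show ?thesis
    unfolding score_symbol_def e by (cases "s = s'") (simp_all add: algebra_simps, simp_all add: field_simps)
qed

text \<open>Any larger ratio absorbs the linear factor of \<open>green2\<close> at the price of a
  constant.\<close>

lemma linear_power_bounded:
  fixes p q :: real
  assumes "0 \<le> p" "p < q"
  shows "\<exists>C\<ge>0. \<forall>m. (real m + b) * p ^ m \<le> C * q ^ m"
proof -
  have q: "q > 0" and pq: "\<bar>p / q\<bar> < 1" using assms by auto
  have "(\<lambda>m. real m * (p / q) ^ m) \<longlonglongrightarrow> 0"
    using pq powser_times_n_limit_0[of "p / q"] by simp
  moreover have "(\<lambda>m. b * (p / q) ^ m) \<longlonglongrightarrow> b * 0"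
    using pq by (intro tendsto_mult tendsto_const LIMSEQ_power_zero) simp
  ultimately have "(\<lambda>m. real m * (p / q) ^ m + b * (p / q) ^ m) \<longlonglongrightarrow> 0 + b * 0"
    by (rule tendsto_add)
  then have "Bseq (\<lambda>m. real m * (p / q) ^ m + b * (p / q) ^ m)"
    by (intro convergent_imp_Bseq convergentI)
  then obtain C where "C > 0" "\<forall>m. norm (real m * (p / q) ^ m + b * (p / q) ^ m) \<le> C"
    by (rule BseqE)
  then have C: "C > 0" "\<And>m. norm (real m * (p / q) ^ m + b * (p / q) ^ m) \<le> C"
    by auto
  have "(real m + b) * p ^ m \<le> C * q ^ m" for m
  proof -
    have "(real m + b) * p ^ m = (real m * (p / q) ^ m + b * (p / q) ^ m) * q ^ m"
      using q by (simp add: power_divide field_simps)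
    also have "\<dots> \<le> C * q ^ m"
      using C(2)[of m] q by (intro mult_right_mono) auto
    finally show ?thesis .
  qed
  then show ?thesis using C(1) by (intro exI[of _ C]) auto
qed

text \<open>Strict positivity of \<open>q\<close> allows a shift of the index to be paid for by
  dividing the constant by \<open>q\<close>.\<close>

definition exp_decay :: "(int \<Rightarrow> real) \<Rightarrow> bool" where
  "exp_decay x \<longleftrightarrow> (\<exists>C q. 0 \<le> C \<and> 0 < q \<and> q < 1 \<and> (\<forall>k. \<bar>x k\<bar> \<le> C * q ^ nat \<bar>k\<bar>))"

text \<open>The ratio 0 occurs for \<open>g = 0\<close>; replacing \<open>q\<close> by the midpoint
  of \<open>q\<close> and 1 restores positivity.\<close>

lemma exp_decayI:
  assumes "0 \<le> q" "q < 1" "\<And>k. \<bar>x k\<bar> \<le> C * q ^ nat \<bar>k\<bar>"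
  shows "exp_decay x"
proof -
  define p where "p = (1 + q) / 2"
  have p: "0 < p" "p < 1" "q \<le> p" using assms by (auto simp: p_def)
  have "\<bar>x k\<bar> \<le> \<bar>C\<bar> * p ^ nat \<bar>k\<bar>" for k
  proof -
    have "\<bar>x k\<bar> \<le> \<bar>C\<bar> * q ^ nat \<bar>k\<bar>"
      using assms(1) by (intro order_trans[OF assms(3)] mult_right_mono) auto
    also have "\<dots> \<le> \<bar>C\<bar> * p ^ nat \<bar>k\<bar>"
      using p assms by (intro mult_left_mono power_mono) auto
    finally show ?thesis .
  qed
  then show ?thesis
    unfolding exp_decay_def using p by (intro exI[of _ "\<bar>C\<bar>"] exI[of _ p]) auto
qed

lemma exp_decay_green:
  assumes "L > 0" "g \<ge> 0"
  shows "exp_decay (green L g)" "exp_decay (green2 L g)"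
proof -
  note p = green_param[OF assms]
  show "exp_decay (green L g)"
    by (rule exp_decayI[of "green_ratio L g" _ "green_param L g / L"]) (use p assms in \<open>auto simp: green_def abs_mult\<close>)
  define b where "b = (1 + (green_param L g)\<^sup>2) / (2 * green_param L g)"
  have b: "b \<ge> 0" using p by (simp add: b_def)
  obtain C where C: "C \<ge> 0" "\<And>m. (real m + b) * green_ratio L g ^ m \<le> C * ((1 + green_ratio L g) / 2) ^ m"
    using linear_power_bounded[of "green_ratio L g" "(1 + green_ratio L g) / 2" b] p by auto
  show "exp_decay (green2 L g)"
  proof (rule exp_decayI)
    fix k
    have "\<bar>green2 L g k\<bar> = (green_param L g / L)\<^sup>2 * ((real (nat \<bar>k\<bar>) + b) * green_ratio L g ^ nat \<bar>k\<bar>)"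
      using p b by (simp add: green2_def b_def[symmetric] abs_mult)
    also have "\<dots> \<le> (green_param L g / L)\<^sup>2 * (C * ((1 + green_ratio L g) / 2) ^ nat \<bar>k\<bar>)"
      by (intro mult_left_mono C) auto
    finally show "\<bar>green2 L g k\<bar> \<le> (green_param L g / L)\<^sup>2 * C * ((1 + green_ratio L g) / 2) ^ nat \<bar>k\<bar>"
      by (simp only: mult.assoc)
  qed (use p in auto)
qed

lemma exp_decay_cmult: "exp_decay x \<Longrightarrow> exp_decay (\<lambda>k. a * x k)"
  unfolding exp_decay_def
proof (elim exE conjE)
  fix C q assume *: "0 \<le> C" "0 < q" "q < 1" "\<forall>k. \<bar>x k\<bar> \<le> C * q ^ nat \<bar>k\<bar>"
  have "\<bar>a * x k\<bar> \<le> (\<bar>a\<bar> * C) * q ^ nat \<bar>k\<bar>" for k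
    using mult_left_mono[OF spec[OF *(4), of k], of "\<bar>a\<bar>"] by (simp add: abs_mult mult.assoc)
  then show "\<exists>C q. 0 \<le> C \<and> 0 < q \<and> q < 1 \<and> (\<forall>k. \<bar>a * x k\<bar> \<le> C * q ^ nat \<bar>k\<bar>)"
    using * by (intro exI[of _ "\<bar>a\<bar> * C"] exI[of _ q]) auto
qed

lemma exp_decay_add:
  assumes "exp_decay x" "exp_decay y"
  shows "exp_decay (\<lambda>k. x k + y k)"
proof -
  obtain C q where x: "0 \<le> C" "0 < q" "q < 1" "\<And>k. \<bar>x k\<bar> \<le> C * q ^ nat \<bar>k\<bar>" using assms(1) unfolding exp_decay_def by blast
  obtain D p where y: "0 \<le> D" "0 < p" "p < 1" "\<And>k. \<bar>y k\<bar> \<le> D * p ^ nat \<bar>k\<bar>" using assms(2) unfolding exp_decay_def by blast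
  show ?thesis
  proof (rule exp_decayI[of "max p q" _ "C + D"])
    fix k
    have "\<bar>x k\<bar> \<le> C * max p q ^ nat \<bar>k\<bar>" "\<bar>y k\<bar> \<le> D * max p q ^ nat \<bar>k\<bar>"
      using x y by (auto intro!: order_trans[OF x(4)] order_trans[OF y(4)] mult_left_mono power_mono)
    then show "\<bar>x k + y k\<bar> \<le> (C + D) * max p q ^ nat \<bar>k\<bar>"
      unfolding distrib_right by linarith
  qed (use x y in auto)
qed

lemma exp_decay_shift1:
  assumes "exp_decay x"
  shows "exp_decay (\<lambda>k. x (k + 1))" "exp_decay (\<lambda>k. x (k - 1))"
proof -
  obtain C q where x: "0 \<le> C" "0 < q" "q < 1" "\<And>k. \<bar>x k\<bar> \<le> C * q ^ nat \<bar>k\<bar>" using assms unfolding exp_decay_def by blast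
  have *: "\<bar>x j\<bar> \<le> C / q * q ^ nat \<bar>k\<bar>" if "\<bar>k\<bar> \<le> \<bar>j\<bar> + 1" for j k
  proof -
    have "q * \<bar>x j\<bar> \<le> C * q ^ Suc (nat \<bar>j\<bar>)"
      using mult_left_mono[OF x(4)[of j], of q] x by (simp add: ac_simps)
    also have "\<dots> \<le> C * q ^ nat \<bar>k\<bar>"
      using x that by (intro mult_left_mono power_decreasing) auto
    finally show ?thesis using x(2) by (simp add: pos_le_divide_eq mult.commute)
  qed
  have "exp_decay (\<lambda>k. x (k + e))" if "\<bar>e\<bar> \<le> 1" for e
  proof (rule exp_decayI)
    show "0 \<le> q" "q < 1" using x by auto
    show "\<bar>x (k + e)\<bar> \<le> C / q * q ^ nat \<bar>k\<bar>" for k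
      by (rule *) (use that in arith)
  qed
  from this[of 1] this[of "-1"] show "exp_decay (\<lambda>k. x (k + 1))" "exp_decay (\<lambda>k. x (k - 1))"
    by simp_all
qed

lemma exp_decay_symbols:
  assumes \<rho>: "\<bar>\<rho>\<bar> < 1" and g: "g \<ge> 0" and s: "s \<in> {1, -1}" "s' \<in> {1, -1}"
  shows "exp_decay (score_symbol \<rho> g s s')" "exp_decay (half_symbol \<rho> g s s')"
proof -
  have L: "0 < 1 + s * \<rho>" "0 < 1 - \<rho>" "0 < 1 + \<rho>" using \<rho> s by auto
  have diff: "exp_decay (\<lambda>k. x k - y k)" if "exp_decay x" "exp_decay y" for x y
    using exp_decay_add[OF that(1) exp_decay_cmult[OF that(2), of "-1"]] by simp
  show 1: "exp_decay (score_symbol \<rho> g s s')"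
    unfolding score_symbol_def[abs_def]
    by (intro exp_decay_add diff exp_decay_cmult exp_decay_shift1 exp_decay_green L g)
  show "exp_decay (half_symbol \<rho> g s s')"
    unfolding half_symbol_def tridiag_def
    by (intro exp_decay_add diff exp_decay_cmult exp_decay_shift1 1)
qed

text \<open>The limit of the Fisher information per observation, in units of \<open>n\<^sup>2\<close>.\<close>

lemma sum_drift_score_symbol:
  assumes \<rho>: "\<bar>\<rho>\<bar> < 1" and g: "g \<ge> 0"
  shows "(\<Sum>s\<in>{1,-1}. \<Sum>s'\<in>{1,-1}. \<Sum>k\<in>{-1,0,1}. score_symbol \<rho> g s s' k * drift_symbol \<rho> s s' k) =
    2 * (info_I \<rho> g + info_J \<rho> g)"
proof -
  define P where "P = 1 + \<rho>"
  define M where "M = 1 - \<rho>"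
  have PM: "P > 0" "M > 0" using \<rho> by (auto simp: P_def M_def)
  have \<rho>PM: "2 * \<rho> = P - M" by (simp add: P_def M_def)
  define a where "a = green_param P g"
  define b where "b = green_param M g"
  have a: "0 < a" "a \<le> 1" "g = P * (1 - a\<^sup>2) / (4 * a\<^sup>2)" and b: "0 < b" "b \<le> 1" "g = M * (1 - b\<^sup>2) / (4 * b\<^sup>2)"
    using green_param[OF PM(1) g] green_param[OF PM(2) g] by (simp_all add: a_def b_def)
  \<comment> \<open>\<open>D0\<close> comes from the blocks with \<open>s \<noteq> s'\<close> and
    becomes \<open>info_I\<close>; \<open>U\<close> comes from the blocks with \<open>s = s'\<close>
    and becomes \<open>info_J\<close>. The coefficients 3/2, -2, 1/2 arise from pairing two second
    differences: they are the folded fourth difference 6, -8, 2 divided by 4.\<close>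
  have D0: "green L g 0 - green L g 2 = 4 * t\<^sup>2 / (L * (1 + t)\<^sup>2)"
    and U: "3 / 2 * green2 L g 0 - 2 * green2 L g 1 + green2 L g 2 / 2 = 2 * t ^ 4 * (2 + t) / (L\<^sup>2 * (1 + t)\<^sup>2)"
    if L: "L > 0" and t: "t = green_param L g" for L t
  proof -
    have t0: "0 < t" using green_param(1)[OF L g] by (simp add: t)
    then have nz: "t \<noteq> 0" "1 + t \<noteq> 0" "L \<noteq> 0" using L by auto
    show "green L g 0 - green L g 2 = 4 * t\<^sup>2 / (L * (1 + t)\<^sup>2)"
      unfolding green_def green_ratio_def t[symmetric] using nz
      by (simp add: divide_simps) (simp add: algebra_simps power2_eq_square)
    show "3 / 2 * green2 L g 0 - 2 * green2 L g 1 + green2 L g 2 / 2 = 2 * t ^ 4 * (2 + t) / (L\<^sup>2 * (1 + t)\<^sup>2)"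
      unfolding green2_def green_ratio_def t[symmetric] using nz
      by (simp add: divide_simps) (simp add: algebra_simps power2_eq_square eval_nat_numeral)
  qed
  have "(\<Sum>s\<in>{1,-1}. \<Sum>s'\<in>{1,-1}. \<Sum>k\<in>{-1,0,1}. score_symbol \<rho> g s s' k * drift_symbol \<rho> s s' k) =
      \<rho>\<^sup>2 * (3 / 2 * green2 P g 0 - 2 * green2 P g 1 + green2 P g 2 / 2) + \<rho>\<^sup>2 * (3 / 2 * green2 M g 0 - 2 * green2 M g 1 + green2 M g 2 / 2)
      + \<rho> / 2 * ((green M g 0 - green M g 2) - (green P g 0 - green P g 2))"
  proof -
    have ev: "green L g (-1) = green L g 1" "green L g (-2) = green L g 2" "green2 L g (-1) = green2 L g 1" "green2 L g (-2) = green2 L g 2" for L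
      by (simp_all add: green_def green2_def)
    show ?thesis
      by (simp add: score_symbol_def drift_symbol_def P_def M_def ev)
        (simp add: field_simps power2_eq_square)
  qed
  also have "\<dots> = \<rho>\<^sup>2 * (2 * a ^ 4 * (2 + a) / (P\<^sup>2 * (1 + a)\<^sup>2)) + \<rho>\<^sup>2 * (2 * b ^ 4 * (2 + b) / (M\<^sup>2 * (1 + b)\<^sup>2))
      + \<rho> / 2 * (4 * b\<^sup>2 / (M * (1 + b)\<^sup>2) - 4 * a\<^sup>2 / (P * (1 + a)\<^sup>2))"
    unfolding U[OF PM(1) a_def] U[OF PM(2) b_def] D0[OF PM(1) a_def] D0[OF PM(2) b_def] ..
  also have "\<dots> = 2 * (info_I \<rho> g + info_J \<rho> g)"
  proof (cases "g = 0")
    case True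
    then have ab: "a = 1" "b = 1" using PM by (simp_all add: a_def b_def green_param_def)
    have "1 - \<rho>\<^sup>2 = P * M" by (simp add: P_def M_def power2_eq_square algebra_simps)
    then have I: "info_I \<rho> g = \<rho>\<^sup>2 / (2 * (P * M))" by (simp add: info_I_def True)
    have "\<rho> / 2 * (1 / M - 1 / P) = \<rho> / 2 * ((P - M) / (P * M))"
      using PM by (simp add: field_simps)
    also have "\<dots> = 2 * info_I \<rho> g" unfolding I \<rho>PM[symmetric] by (simp add: power2_eq_square)
    finally show ?thesis
      by (simp add: ab info_J_def True P_def[symmetric] M_def[symmetric] ring_distribs power2_eq_square)
  next
    case False
    then have g0: "g > 0" using g by simp
    have nz: "a \<noteq> 0" "b \<noteq> 0" "1 + a \<noteq> 0" "1 + b \<noteq> 0" using a b by auto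
    have a1: "a < 1" "b < 1"
      using g0 PM by (simp_all add: a_def b_def green_param_def)
    have sq: "sqrt (L * (L + 4 * g)) = L / t" and pw: "(L / (L + 4 * g)) powr (1 / 2) = t" "(L / (L + 4 * g)) powr (3 / 2) = t ^ 3"
      and I: "(sqrt (L * (L + 4 * g)) - L) / (8 * g\<^sup>2) = 1 / (4 * g) - t\<^sup>2 / (L * (1 + t)\<^sup>2)"
      and J: "(2 - 3 * t + t ^ 3) / (16 * g\<^sup>2) = t ^ 4 * (2 + t) / (L\<^sup>2 * (1 + t)\<^sup>2)"
      if L: "L > 0" and t: "t = green_param L g" and t1: "t < 1" for L t
    proof -
      have t0: "0 < t" and gt: "g = L * (1 - t\<^sup>2) / (4 * t\<^sup>2)"
        using green_param(1,3)[OF L g] by (simp_all add: t)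
      have Lg: "L + 4 * g = L / t\<^sup>2" using t0 by (subst gt) (simp add: field_simps)
      show s: "sqrt (L * (L + 4 * g)) = L / t"
        unfolding Lg using t0 L by (intro real_sqrt_unique) (simp_all add: power2_eq_square)
      have q: "L / (L + 4 * g) = t\<^sup>2" unfolding Lg using t0 L by simp
      show "(L / (L + 4 * g)) powr (1 / 2) = t" unfolding q using t0 by (simp add: powr_half_sqrt)
      have t2: "t\<^sup>2 = t powr 2" using t0 by (simp add: powr_numeral)
      show "(L / (L + 4 * g)) powr (3 / 2) = t ^ 3"
        unfolding q t2 powr_powr using t0 by (simp add: powr_numeral)
      have gt': "g = L * ((1 - t) * (1 + t)) / (4 * t\<^sup>2)" by (subst gt) (simp add: power2_eq_square algebra_simps)
      have nz: "t \<noteq> 0" "1 - t \<noteq> 0" "1 + t \<noteq> 0" "L \<noteq> 0" using t0 t1 L by auto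
      show "(sqrt (L * (L + 4 * g)) - L) / (8 * g\<^sup>2) = 1 / (4 * g) - t\<^sup>2 / (L * (1 + t)\<^sup>2)"
        unfolding s unfolding gt' using nz by (simp add: divide_simps) (simp add: algebra_simps power2_eq_square eval_nat_numeral)
      \<comment> \<open>The double zero at \<open>t = 1\<close> cancels the two factors
        \<open>1 - t\<close> of \<open>g\<^sup>2\<close>.\<close>
      have c: "2 - 3 * t + t ^ 3 = (1 - t)\<^sup>2 * (2 + t)" by (simp add: algebra_simps power2_eq_square power3_eq_cube)
      show "(2 - 3 * t + t ^ 3) / (16 * g\<^sup>2) = t ^ 4 * (2 + t) / (L\<^sup>2 * (1 + t)\<^sup>2)"
        unfolding c unfolding gt' using nz by (simp add: divide_simps power2_eq_square eval_nat_numeral)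
    qed
    have "2 * info_I \<rho> g = 2 * \<rho> * ((sqrt (P * (P + 4 * g)) - P) / (8 * g\<^sup>2) - (sqrt (M * (M + 4 * g)) - M) / (8 * g\<^sup>2))"
      using False by (simp add: info_I_def P_def M_def diff_divide_distrib[symmetric] add_ac)
    also have "\<dots> = \<rho> / 2 * (4 * b\<^sup>2 / (M * (1 + b)\<^sup>2) - 4 * a\<^sup>2 / (P * (1 + a)\<^sup>2))"
      unfolding I[OF PM(1) a_def a1(1)] I[OF PM(2) b_def a1(2)] by (simp add: algebra_simps)
    finally have 1: "2 * info_I \<rho> g = \<rho> / 2 * (4 * b\<^sup>2 / (M * (1 + b)\<^sup>2) - 4 * a\<^sup>2 / (P * (1 + a)\<^sup>2))" .
    have "info_J \<rho> g = \<rho>\<^sup>2 / (16 * g\<^sup>2) * (4 - 3 * (a + b) + (a ^ 3 + b ^ 3))"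
      using False pw[OF PM(1) a_def a1(1)] pw[OF PM(2) b_def a1(2)] by (simp add: info_J_def P_def M_def)
    also have "\<dots> = \<rho>\<^sup>2 * ((2 - 3 * a + a ^ 3) / (16 * g\<^sup>2) + (2 - 3 * b + b ^ 3) / (16 * g\<^sup>2))"
      by (simp add: add_divide_distrib[symmetric])
    finally have 2: "2 * info_J \<rho> g = \<rho>\<^sup>2 * (2 * a ^ 4 * (2 + a) / (P\<^sup>2 * (1 + a)\<^sup>2)) + \<rho>\<^sup>2 * (2 * b ^ 4 * (2 + b) / (M\<^sup>2 * (1 + b)\<^sup>2))"
      unfolding J[OF PM(1) a_def a1(1)] J[OF PM(2) b_def a1(2)] by (simp add: algebra_simps)
    show ?thesis using 1 2 by simp
  qed
  finally show ?thesis .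
qed

section \<open>Finite sections\<close>

text \<open>The first component tells sums from differences of the two processes. It is a real
  number, so that it can enter coefficients such as \<open>1 + s * \<rho>\<close> directly.\<close>

definition obs_index :: "nat \<Rightarrow> (real \<times> nat) set" where
  "obs_index n = {1, -1} \<times> {1..n}"

lemma finite_obs_index [simp]: "finite (obs_index n)"
  by (simp add: obs_index_def)

lemma sum_obs_index: "(\<Sum>a\<in>obs_index n. f a) = (\<Sum>s\<in>{1,-1}. \<Sum>i=1..n. f (s, i))"
  unfolding obs_index_def by (rule sum.cartesian_product')

text \<open>The covariance of the differenced noise. The first increment contains a single noise
  variable, since the process starts from 0 without noise; hence the entry 1 instead of 2 at (1,
  1).\<close>

definition diff_cov :: "nat \<Rightarrow> nat \<Rightarrow> real" where
  "diff_cov i j = 2 * of_bool (i = j) - of_bool (i = 1 \<and> j = 1) - of_bool (i = Suc j) - of_bool (j = Suc i)"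

text \<open>The covariance of the normalised increments at lag 0, with \<open>g\<close> in the role
  of n times the noise variance. The sum and the difference of the components are uncorrelated, with
  Brownian variances \<open>1 + \<rho>\<close> and \<open>1 - \<rho>\<close>.\<close>

definition incr_cov :: "real \<Rightarrow> real \<Rightarrow> real \<times> nat \<Rightarrow> real \<times> nat \<Rightarrow> real" where
  "incr_cov \<rho> g a b = of_bool (fst a = fst b) * ((1 + fst a * \<rho>) * of_bool (snd a = snd b) + g * diff_cov (snd a) (snd b))"

text \<open>The lag moves part of the overlap of increments to the neighbouring index, which is the
  Toeplitz part. The corner entry is there because the first increment of the lagged component
  starts at time 0 and is shortened by the lag.\<close>

definition incr_cov_deriv :: "real \<Rightarrow> real \<times> nat \<Rightarrow> real \<times> nat \<Rightarrow> real" where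
  "incr_cov_deriv \<rho> a b = drift_symbol \<rho> (fst a) (fst b) (int (snd a) - int (snd b))
     - fst a * fst b / 2 * of_bool (snd a = 1 \<and> snd b = 1)"

definition score_toeplitz :: "real \<Rightarrow> real \<Rightarrow> real \<times> nat \<Rightarrow> real \<times> nat \<Rightarrow> real" where
  "score_toeplitz \<rho> g a b = score_symbol \<rho> g (fst a) (fst b) (int (snd a) - int (snd b))"

lemma incr_cov_sym: "incr_cov \<rho> g a b = incr_cov \<rho> g b a"
  by (auto simp: incr_cov_def diff_cov_def)

lemma incr_cov_deriv_sym: "incr_cov_deriv \<rho> a b = incr_cov_deriv \<rho> b a"
  by (auto simp: incr_cov_deriv_def drift_symbol_def of_bool_def algebra_simps)

lemma score_toeplitz_sym: "score_toeplitz \<rho> g a b = score_toeplitz \<rho> g b a"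
  unfolding score_toeplitz_def by (subst score_symbol_swap) simp

section \<open>Frobenius norms of matrices and of their products\<close>

definition frobenius :: "'k set \<Rightarrow> ('k \<Rightarrow> 'k \<Rightarrow> real) \<Rightarrow> real" where
  "frobenius K X = sqrt (\<Sum>a\<in>K. \<Sum>b\<in>K. (X a b)\<^sup>2)"

definition mat_prod :: "'k set \<Rightarrow> ('k \<Rightarrow> 'k \<Rightarrow> real) \<Rightarrow> ('k \<Rightarrow> 'k \<Rightarrow> real) \<Rightarrow> 'k \<Rightarrow> 'k \<Rightarrow> real" where
  "mat_prod K X Y a b = (\<Sum>c\<in>K. X a c * Y c b)"

lemma frobenius_L2_set: "frobenius K X = L2_set (\<lambda>p. X (fst p) (snd p)) (K \<times> K)"
  by (simp add: frobenius_def L2_set_def sum.cartesian_product')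

lemma frobenius_nonneg [simp]: "0 \<le> frobenius K X"
  by (simp add: frobenius_L2_set)

lemma frobenius_add: "frobenius K (\<lambda>a b. X a b + Y a b) \<le> frobenius K X + frobenius K Y"
  unfolding frobenius_L2_set by (rule L2_set_triangle_ineq)

lemma frobenius_uminus: "frobenius K (\<lambda>a b. - X a b) = frobenius K X"
  by (simp add: frobenius_def)

lemma frobenius_diff: "frobenius K (\<lambda>a b. X a b - Y a b) \<le> frobenius K X + frobenius K Y"
  using frobenius_add[of K X "\<lambda>a b. - Y a b"] by (simp add: frobenius_uminus)

lemma frobenius_cong: "(\<And>a b. a \<in> K \<Longrightarrow> b \<in> K \<Longrightarrow> X a b = Y a b) \<Longrightarrow> frobenius K X = frobenius K Y"
  by (simp add: frobenius_def)

lemma frobenius_inner_le: "\<bar>\<Sum>a\<in>K. \<Sum>b\<in>K. X a b * Y a b\<bar> \<le> frobenius K X * frobenius K Y"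
proof -
  have "\<bar>\<Sum>a\<in>K. \<Sum>b\<in>K. X a b * Y a b\<bar> \<le> (\<Sum>p\<in>K \<times> K. \<bar>X (fst p) (snd p)\<bar> * \<bar>Y (fst p) (snd p)\<bar>)"
    unfolding sum.cartesian_product' fst_conv snd_conv abs_mult[symmetric]
    by (intro order_trans[OF sum_abs] sum_mono sum_abs)
  also have "\<dots> \<le> frobenius K X * frobenius K Y"
    unfolding frobenius_L2_set by (rule L2_set_mult_ineq)
  finally show ?thesis .
qed

lemma frobenius_transpose: "frobenius K (\<lambda>a b. X b a) = frobenius K X"
  unfolding frobenius_def by (subst sum.swap) (rule refl)

text \<open>Schur test: Cauchy--Schwarz with the weights \<open>\<bar>Y a b\<bar>\<close>.\<close>

lemma frobenius_mat_prod_le: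
  assumes K: "finite K" and sym: "\<And>a b. Y a b = Y b a" and row: "\<And>a. a \<in> K \<Longrightarrow> (\<Sum>b\<in>K. \<bar>Y a b\<bar>) \<le> \<tau>" and \<tau>: "\<tau> \<ge> 0"
  shows "frobenius K (mat_prod K Y X) \<le> \<tau> * frobenius K X" "frobenius K (mat_prod K X Y) \<le> \<tau> * frobenius K X"
proof -
  have 1: "frobenius K (mat_prod K Y X) \<le> \<tau> * frobenius K X" for X
  proof -
    have "(mat_prod K Y X a c)\<^sup>2 \<le> \<tau> * (\<Sum>b\<in>K. \<bar>Y a b\<bar> * (X b c)\<^sup>2)" if a: "a \<in> K" for a c
    proof -
      have "\<bar>mat_prod K Y X a c\<bar> \<le> (\<Sum>b\<in>K. \<bar>sqrt \<bar>Y a b\<bar>\<bar> * \<bar>sqrt \<bar>Y a b\<bar> * X b c\<bar>)"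
        unfolding mat_prod_def by (intro order_trans[OF sum_abs] sum_mono) (simp add: abs_mult flip: mult.assoc)
      also have "\<dots> \<le> L2_set (\<lambda>b. sqrt \<bar>Y a b\<bar>) K * L2_set (\<lambda>b. sqrt \<bar>Y a b\<bar> * X b c) K"
        by (rule L2_set_mult_ineq)
      finally have "\<bar>mat_prod K Y X a c\<bar>\<^sup>2 \<le> (L2_set (\<lambda>b. sqrt \<bar>Y a b\<bar>) K * L2_set (\<lambda>b. sqrt \<bar>Y a b\<bar> * X b c) K)\<^sup>2"
        by (intro power_mono) auto
      also have "\<dots> = (\<Sum>b\<in>K. \<bar>Y a b\<bar>) * (\<Sum>b\<in>K. \<bar>Y a b\<bar> * (X b c)\<^sup>2)"
        by (simp add: L2_set_def power_mult_distrib sum_nonneg)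
      also have "\<dots> \<le> \<tau> * (\<Sum>b\<in>K. \<bar>Y a b\<bar> * (X b c)\<^sup>2)"
        using row[OF a] by (intro mult_right_mono sum_nonneg) auto
      finally show ?thesis by simp
    qed
    then have "(\<Sum>a\<in>K. \<Sum>c\<in>K. (mat_prod K Y X a c)\<^sup>2) \<le> (\<Sum>a\<in>K. \<Sum>c\<in>K. \<tau> * (\<Sum>b\<in>K. \<bar>Y a b\<bar> * (X b c)\<^sup>2))"
      by (intro sum_mono)
    also have "\<dots> = \<tau> * (\<Sum>b\<in>K. \<Sum>c\<in>K. (\<Sum>a\<in>K. \<bar>Y a b\<bar>) * (X b c)\<^sup>2)"
      unfolding sum_distrib_left[symmetric] sum_distrib_right
      by (intro arg_cong2[where f=times] refl, subst (3) sum.swap, subst (2) sum.swap, subst (1) sum.swap) (rule refl)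
    also have "\<dots> \<le> \<tau> * (\<Sum>b\<in>K. \<Sum>c\<in>K. \<tau> * (X b c)\<^sup>2)"
    proof (intro mult_left_mono[OF _ \<tau>] sum_mono mult_right_mono zero_le_power2)
      fix b assume b: "b \<in> K"
      have "(\<Sum>a\<in>K. \<bar>Y a b\<bar>) = (\<Sum>a\<in>K. \<bar>Y b a\<bar>)"
        by (rule sum.cong[OF refl]) (subst sym, rule refl)
      then show "(\<Sum>a\<in>K. \<bar>Y a b\<bar>) \<le> \<tau>" using row[OF b] by simp
    qed
    also have "\<dots> = \<tau>\<^sup>2 * (\<Sum>b\<in>K. \<Sum>c\<in>K. (X b c)\<^sup>2)"
      by (simp add: sum_distrib_left power2_eq_square mult.assoc)
    finally have "frobenius K (mat_prod K Y X) \<le> sqrt (\<tau>\<^sup>2 * (\<Sum>b\<in>K. \<Sum>c\<in>K. (X b c)\<^sup>2))"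
      unfolding frobenius_def by (rule real_sqrt_le_mono)
    then show ?thesis using \<tau> by (simp add: real_sqrt_mult frobenius_def)
  qed
  show "frobenius K (mat_prod K Y X) \<le> \<tau> * frobenius K X" by (rule 1)
  have e: "X a c * Y c b = Y b c * X a c" for a b c
    using sym[of c b] by simp
  have "mat_prod K X Y = (\<lambda>a b. mat_prod K Y (\<lambda>a b. X b a) b a)"
    unfolding mat_prod_def e by (rule refl)
  then have "frobenius K (mat_prod K X Y) = frobenius K (mat_prod K Y (\<lambda>a b. X b a))"
    using frobenius_transpose[of K "mat_prod K Y (\<lambda>a b. X b a)"] by simp
  also have "\<dots> \<le> \<tau> * frobenius K X"
    using 1[of "\<lambda>a b. X b a"] unfolding frobenius_transpose[of K X] .
  finally show "frobenius K (mat_prod K X Y) \<le> \<tau> * frobenius K X" .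
qed

lemma mat_prod_add: "mat_prod K (\<lambda>a b. X a b + Y a b) Z = (\<lambda>a b. mat_prod K X Z a b + mat_prod K Y Z a b)"
  "mat_prod K Z (\<lambda>a b. X a b + Y a b) = (\<lambda>a b. mat_prod K Z X a b + mat_prod K Z Y a b)"
  by (simp_all add: mat_prod_def fun_eq_iff sum.distrib algebra_simps)

section \<open>Row sums and diagonal dominance of the covariance\<close>

lemma sum_of_bool_mult_le1:
  assumes "finite S" "\<And>i j. P i \<Longrightarrow> P j \<Longrightarrow> i = j" "c \<ge> 0"
  shows "(\<Sum>j\<in>S. of_bool (P j) * c) \<le> (c :: real)"
proof (cases "\<exists>i\<in>S. P i")
  case True
  then obtain i where i: "i \<in> S" "P i" by blast
  have e1: "(\<Sum>j\<in>S. of_bool (P j) * c) = (\<Sum>j\<in>S. if j = i then c else 0)"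
    using i assms(2) by (intro sum.cong) auto
  have e2: "(\<Sum>j\<in>S. if j = i then c else 0) = c"
    using assms(1) i by simp
  show ?thesis by (simp only: e1 e2 order_refl)
next
  case False
  then have e1: "(\<Sum>j\<in>S. of_bool (P j) * c) = (\<Sum>j\<in>S. 0)"
    by (intro sum.cong) auto
  show ?thesis unfolding e1 using assms by simp
qed

lemma sum_sign_of_bool:
  assumes "s \<in> {1, -1 :: real}"
  shows "(\<Sum>s'\<in>{1,-1}. of_bool (s = s') * f s') = (f s :: real)"
  using assms by auto

lemma row_sum_diff_cov:
  shows "(\<Sum>j=1..n. \<bar>diff_cov i j\<bar>) \<le> 4"
proof -
  have "(\<Sum>j=1..n. \<bar>diff_cov i j\<bar>) \<le> (\<Sum>j=1..n. of_bool (i = j) * 2 + of_bool (i = Suc j) * 1 + of_bool (j = Suc i) * 1)"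
    by (intro sum_mono) (auto simp: diff_cov_def)
  also have "\<dots> \<le> 2 + 1 + 1"
    unfolding sum.distrib by (intro add_mono sum_of_bool_mult_le1) auto
  finally show ?thesis by simp
qed

text \<open>The input for the Schur test: bounds independent of \<open>n\<close> for the covariance,
  for its change when \<open>g\<close> varies, and for its derivative in the lag.\<close>

lemma row_sum_incr_cov:
  assumes \<rho>: "\<bar>\<rho>\<bar> < 1" and a: "a \<in> obs_index n"
  shows "(\<Sum>b\<in>obs_index n. \<bar>incr_cov \<rho> g a b\<bar>) \<le> 2 + 4 * \<bar>g\<bar>"
    and "(\<Sum>b\<in>obs_index n. \<bar>incr_cov \<rho> g a b - incr_cov \<rho> g' a b\<bar>) \<le> 4 * \<bar>g - g'\<bar>"
    and "(\<Sum>b\<in>obs_index n. \<bar>incr_cov_deriv \<rho> a b\<bar>) \<le> 4"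
proof -
  obtain s i where si: "a = (s, i)" "s \<in> {1, -1}" "i \<in> {1..n}" using a by (auto simp: obs_index_def)
  have "(\<Sum>b\<in>obs_index n. \<bar>incr_cov \<rho> g a b\<bar>) = (\<Sum>j=1..n. \<bar>(1 + s * \<rho>) * of_bool (i = j) + g * diff_cov i j\<bar>)"
    unfolding sum_obs_index si using sum_sign_of_bool[OF si(2), of "\<lambda>_. \<Sum>j=1..n. \<bar>(1 + s * \<rho>) * of_bool (i = j) + g * diff_cov i j\<bar>"]
    by (simp add: incr_cov_def abs_mult sum_distrib_left)
  also have "\<dots> \<le> (\<Sum>j=1..n. of_bool (i = j) * 2 + \<bar>g\<bar> * \<bar>diff_cov i j\<bar>)"
    using \<rho> si by (intro sum_mono order_trans[OF abs_triangle_ineq] add_mono) (auto simp: abs_mult)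
  also have "\<dots> \<le> 2 + \<bar>g\<bar> * 4"
    unfolding sum.distrib sum_distrib_left[symmetric]
    by (intro add_mono sum_of_bool_mult_le1 mult_left_mono row_sum_diff_cov) auto
  finally show "(\<Sum>b\<in>obs_index n. \<bar>incr_cov \<rho> g a b\<bar>) \<le> 2 + 4 * \<bar>g\<bar>" by simp
  have "(\<Sum>b\<in>obs_index n. \<bar>incr_cov \<rho> g a b - incr_cov \<rho> g' a b\<bar>) = (\<Sum>j=1..n. \<bar>g - g'\<bar> * \<bar>diff_cov i j\<bar>)"
  proof -
    have "(\<Sum>b\<in>obs_index n. \<bar>incr_cov \<rho> g a b - incr_cov \<rho> g' a b\<bar>) = (\<Sum>s'\<in>{1,-1}. of_bool (s = s') * (\<Sum>j=1..n. \<bar>g - g'\<bar> * \<bar>diff_cov i j\<bar>))"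
      unfolding sum_obs_index si sum_distrib_left
      by (intro sum.cong refl) (auto simp: incr_cov_def of_bool_def algebra_simps simp flip: abs_mult)
    then show ?thesis by (simp only: sum_sign_of_bool[OF si(2)])
  qed
  also have "\<dots> \<le> \<bar>g - g'\<bar> * 4"
    unfolding sum_distrib_left[symmetric] by (intro mult_left_mono row_sum_diff_cov) auto
  finally show "(\<Sum>b\<in>obs_index n. \<bar>incr_cov \<rho> g a b - incr_cov \<rho> g' a b\<bar>) \<le> 4 * \<bar>g - g'\<bar>" by simp
  have "(\<Sum>b\<in>obs_index n. \<bar>incr_cov_deriv \<rho> a b\<bar>) \<le> (\<Sum>s'\<in>{1,-1}. \<Sum>j=1..n.
      of_bool (j = i) * (\<bar>s + s'\<bar> / 2) + of_bool (j = Suc i) * (1 / 2) + of_bool (i = Suc j) * (1 / 2) + of_bool (i = 1 \<and> j = 1) * (1 / 2))"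
    unfolding sum_obs_index
  proof (intro sum_mono)
    fix s' :: real and j assume s': "s' \<in> {1, -1}"
    have "\<bar>incr_cov_deriv \<rho> a (s', j)\<bar> \<le> \<bar>\<rho>\<bar> * (of_bool (j = i) * (\<bar>s + s'\<bar> / 2)) + \<bar>\<rho>\<bar> * (of_bool (j = Suc i) * (1 / 2))
        + \<bar>\<rho>\<bar> * (of_bool (i = Suc j) * (1 / 2)) + of_bool (i = 1 \<and> j = 1) * (1 / 2)"
      using s' si by (auto simp: incr_cov_deriv_def drift_symbol_def abs_mult)
    also have "\<dots> \<le> 1 * (of_bool (j = i) * (\<bar>s + s'\<bar> / 2)) + 1 * (of_bool (j = Suc i) * (1 / 2))
        + 1 * (of_bool (i = Suc j) * (1 / 2)) + of_bool (i = 1 \<and> j = 1) * (1 / 2)"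
      using \<rho> by (intro add_mono mult_right_mono) auto
    finally show "\<bar>incr_cov_deriv \<rho> a (s', j)\<bar> \<le> of_bool (j = i) * (\<bar>s + s'\<bar> / 2) + of_bool (j = Suc i) * (1 / 2)
        + of_bool (i = Suc j) * (1 / 2) + of_bool (i = 1 \<and> j = 1) * (1 / 2)"
      by simp
  qed
  also have "\<dots> \<le> (\<Sum>s'\<in>{1,-1}. \<bar>s + s'\<bar> / 2 + 1 / 2 + 1 / 2 + 1 / 2)"
    unfolding sum.distrib by (intro sum_mono add_mono sum_of_bool_mult_le1) auto
  also have "\<dots> \<le> 4" using si(2) by auto
  finally show "(\<Sum>b\<in>obs_index n. \<bar>incr_cov_deriv \<rho> a b\<bar>) \<le> 4" .
qed

text \<open>The noise part is weakly diagonally dominant, including its reduced first entry, and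
  contributes nothing negative. The Brownian part leaves at least
  \<open>1 - \<bar>\<rho>\<bar>\<close>, and the lag costs at most a full row sum of the
  derivative.\<close>

lemma excess_incr_cov:
  assumes \<rho>: "\<bar>\<rho>\<bar> < 1" and g: "g \<ge> 0" and a: "a \<in> obs_index n"
  shows "1 - \<bar>\<rho>\<bar> - 4 * \<bar>h\<bar> \<le> excess (obs_index n) (\<lambda>a b. incr_cov \<rho> g a b + h * incr_cov_deriv \<rho> a b) a"
proof -
  obtain s i where si: "a = (s, i)" "s \<in> {1, -1}" "i \<in> {1..n}" using a by (auto simp: obs_index_def)
  have "(\<Sum>b\<in>obs_index n. of_bool (a \<noteq> b) * \<bar>incr_cov \<rho> g a b + h * incr_cov_deriv \<rho> a b\<bar>) \<le>
      (\<Sum>b\<in>obs_index n. of_bool (a \<noteq> b) * \<bar>incr_cov \<rho> g a b\<bar> + of_bool (a \<noteq> b) * (\<bar>h\<bar> * \<bar>incr_cov_deriv \<rho> a b\<bar>))"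
    by (intro sum_mono) (auto simp: abs_mult[symmetric] abs_triangle_ineq)
  also have "\<dots> = (\<Sum>b\<in>obs_index n. of_bool (a \<noteq> b) * \<bar>incr_cov \<rho> g a b\<bar>) + (\<Sum>b\<in>obs_index n. of_bool (a \<noteq> b) * (\<bar>h\<bar> * \<bar>incr_cov_deriv \<rho> a b\<bar>))"
    by (rule sum.distrib)
  also have "(\<Sum>b\<in>obs_index n. of_bool (a \<noteq> b) * \<bar>incr_cov \<rho> g a b\<bar>) \<le> g * (2 - of_bool (i = 1))"
  proof -
    have "(\<Sum>b\<in>obs_index n. of_bool (a \<noteq> b) * \<bar>incr_cov \<rho> g a b\<bar>) = (\<Sum>j=1..n. g * (of_bool (i \<noteq> j) * \<bar>diff_cov i j\<bar>))"
    proof -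
      have "(\<Sum>b\<in>obs_index n. of_bool (a \<noteq> b) * \<bar>incr_cov \<rho> g a b\<bar>) = (\<Sum>s'\<in>{1,-1}. of_bool (s = s') * (\<Sum>j=1..n. g * (of_bool (i \<noteq> j) * \<bar>diff_cov i j\<bar>)))"
        unfolding sum_obs_index si sum_distrib_left
        using g by (intro sum.cong refl) (simp add: incr_cov_def of_bool_def abs_mult)
      then show ?thesis by (simp only: sum_sign_of_bool[OF si(2)])
    qed
    also have "\<dots> = g * (\<Sum>j=1..n. of_bool (i \<noteq> j) * \<bar>diff_cov i j\<bar>)"
      by (rule sum_distrib_left[symmetric])
    also have "\<dots> \<le> g * (2 - of_bool (i = 1))"
    proof (rule mult_left_mono[OF _ g])
      have "(\<Sum>j=1..n. of_bool (i \<noteq> j) * \<bar>diff_cov i j\<bar>) \<le> (\<Sum>j=1..n. of_bool (i = Suc j) * (1 - of_bool (i = 1)) + of_bool (j = Suc i) * 1)"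
        by (intro sum_mono) (auto simp: diff_cov_def)
      also have "\<dots> \<le> (1 - of_bool (i = 1)) + 1"
        unfolding sum.distrib by (intro add_mono sum_of_bool_mult_le1) auto
      finally show "(\<Sum>j=1..n. of_bool (i \<noteq> j) * \<bar>diff_cov i j\<bar>) \<le> 2 - of_bool (i = 1)" by simp
    qed
    finally show ?thesis .
  qed
  also have "(\<Sum>b\<in>obs_index n. of_bool (a \<noteq> b) * (\<bar>h\<bar> * \<bar>incr_cov_deriv \<rho> a b\<bar>)) = (\<Sum>b\<in>obs_index n. \<bar>h\<bar> * \<bar>incr_cov_deriv \<rho> a b\<bar>) - \<bar>h\<bar> * \<bar>incr_cov_deriv \<rho> a a\<bar>"
  proof -
    have "(\<Sum>b\<in>obs_index n. \<bar>h\<bar> * \<bar>incr_cov_deriv \<rho> a b\<bar>) = \<bar>h\<bar> * \<bar>incr_cov_deriv \<rho> a a\<bar> + (\<Sum>b\<in>obs_index n - {a}. \<bar>h\<bar> * \<bar>incr_cov_deriv \<rho> a b\<bar>)"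
      using a by (subst sum.remove[of _ a]) auto
    also have "(\<Sum>b\<in>obs_index n - {a}. \<bar>h\<bar> * \<bar>incr_cov_deriv \<rho> a b\<bar>) = (\<Sum>b\<in>obs_index n. of_bool (a \<noteq> b) * (\<bar>h\<bar> * \<bar>incr_cov_deriv \<rho> a b\<bar>))"
      by (intro sum.mono_neutral_cong_left) auto
    finally show ?thesis by simp
  qed
  also have "(\<Sum>b\<in>obs_index n. \<bar>h\<bar> * \<bar>incr_cov_deriv \<rho> a b\<bar>) \<le> \<bar>h\<bar> * 4"
    unfolding sum_distrib_left[symmetric] using row_sum_incr_cov(3)[OF \<rho> a] by (intro mult_left_mono) auto
  finally have *: "(\<Sum>b\<in>obs_index n. of_bool (a \<noteq> b) * \<bar>incr_cov \<rho> g a b + h * incr_cov_deriv \<rho> a b\<bar>) \<le>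
      g * (2 - of_bool (i = 1)) + (\<bar>h\<bar> * 4 - \<bar>h\<bar> * \<bar>incr_cov_deriv \<rho> a a\<bar>)" by simp
  have "incr_cov \<rho> g a a = 1 + s * \<rho> + g * (2 - of_bool (i = 1))"
    by (simp add: incr_cov_def diff_cov_def si)
  moreover have "- (\<bar>h\<bar> * \<bar>incr_cov_deriv \<rho> a a\<bar>) \<le> h * incr_cov_deriv \<rho> a a"
    unfolding abs_mult[symmetric] by linarith
  moreover have "- \<bar>\<rho>\<bar> \<le> s * \<rho>" using si by auto
  ultimately show ?thesis
    unfolding excess_def using * by linarith
qed

section \<open>Boundary terms of the finite sections\<close>

lemma exp_decay_sum_squares:
  assumes "exp_decay x"
  obtains D where "\<And>A. finite A \<Longrightarrow> (\<Sum>k\<in>A. (x k)\<^sup>2) \<le> D"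
proof -
  obtain C q where x: "0 \<le> C" "0 < q" "q < 1" "\<And>k. \<bar>x k\<bar> \<le> C * q ^ nat \<bar>k\<bar>" using assms unfolding exp_decay_def by blast
  define r where "r = q\<^sup>2"
  have r: "0 < r" "r < 1" using x by (auto simp: r_def power_less_one_iff abs_square_less_1)
  have geo: "(\<Sum>k\<in>A. r ^ nat \<bar>k\<bar>) \<le> 1 / (1 - r)" if "finite A" "inj_on (\<lambda>k. nat \<bar>k\<bar>) A" for A :: "int set"
  proof -
    have "(\<Sum>k\<in>A. r ^ nat \<bar>k\<bar>) = (\<Sum>i\<in>(\<lambda>k. nat \<bar>k\<bar>) ` A. r ^ i)"
      by (simp add: sum.reindex[OF that(2)])
    also have "\<dots> \<le> (\<Sum>i. r ^ i)"
      using r that by (intro sum_le_suminf) auto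
    finally show ?thesis using r by (simp add: suminf_geometric)
  qed
  have "(\<Sum>k\<in>A. (x k)\<^sup>2) \<le> C\<^sup>2 * (2 / (1 - r))" if A: "finite A" for A
  proof -
    have "(x k)\<^sup>2 \<le> C\<^sup>2 * r ^ nat \<bar>k\<bar>" for k
    proof -
      have "\<bar>x k\<bar>\<^sup>2 \<le> (C * q ^ nat \<bar>k\<bar>)\<^sup>2" by (intro power_mono x(4)) auto
      then show ?thesis by (simp add: power_mult_distrib r_def mult.commute flip: power_mult)
    qed
    then have "(\<Sum>k\<in>A. (x k)\<^sup>2) \<le> C\<^sup>2 * (\<Sum>k\<in>A. r ^ nat \<bar>k\<bar>)"
      unfolding sum_distrib_left by (intro sum_mono)
    moreover have "(\<Sum>k\<in>A. r ^ nat \<bar>k\<bar>) = (\<Sum>k\<in>A \<inter> {0..}. r ^ nat \<bar>k\<bar>) + (\<Sum>k\<in>A \<inter> {..<0}. r ^ nat \<bar>k\<bar>)"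
      using A by (subst sum.union_disjoint[symmetric]) (auto intro!: sum.cong)
    moreover have "(\<Sum>k\<in>A \<inter> {0..}. r ^ nat \<bar>k\<bar>) \<le> 1 / (1 - r)" "(\<Sum>k\<in>A \<inter> {..<0}. r ^ nat \<bar>k\<bar>) \<le> 1 / (1 - r)"
      using A by (intro geo inj_onI; force)+
    ultimately show ?thesis
      using mult_left_mono[of "\<Sum>k\<in>A. r ^ nat \<bar>k\<bar>" "2 / (1 - r)" "C\<^sup>2"] by simp
  qed
  then show ?thesis by (rule that)
qed

lemma sum_of_bool_mult:
  assumes "finite A"
  shows "(\<Sum>k\<in>A. of_bool (k = i) * y k) = (of_bool (i \<in> A) * y i :: real)"
proof -
  have "(\<Sum>k\<in>A. of_bool (k = i) * y k) = (\<Sum>k\<in>A. if k = i then y k else 0)"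
    by (intro sum.cong) auto
  then show ?thesis using assms by simp
qed

text \<open>Compared with the whole line, the last row lacks its right neighbour, and the first row
  lacks its left neighbour and has a diagonal entry smaller by \<open>g\<close>. All other rows
  agree.\<close>

lemma sum_tridiag_section:
  assumes i: "i \<in> {1..n}"
  shows "(\<Sum>k=1..n. (L * of_bool (i = k) + g * diff_cov i k) * x (int k - l)) =
    tridiag L g x (int i - l) + of_bool (i = 1) * (g * (x (- l) - x (1 - l))) + of_bool (i = n) * (g * x (int n + 1 - l))"
proof -
  define y where "y k = x (int k - l)" for k :: nat
  have "(\<Sum>k=1..n. (L * of_bool (i = k) + g * diff_cov i k) * y k) =
      (\<Sum>k=1..n. of_bool (k = i) * ((L + 2 * g) * y k) - of_bool (k = 1) * (of_bool (i = 1) * (g * y k))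
        - of_bool (k = i - 1) * (g * y k) - of_bool (k = Suc i) * (g * y k))"
    using i by (intro sum.cong refl) (auto simp: diff_cov_def algebra_simps)
  also have "\<dots> = (L + 2 * g) * y i - of_bool (i = 1) * (g * y 1) - of_bool (i - 1 \<in> {1..n}) * (g * y (i - 1)) - of_bool (Suc i \<in> {1..n}) * (g * y (Suc i))"
    unfolding sum_subtractf sum_of_bool_mult[OF finite_atLeastAtMost] using i by simp
  also have "\<dots> = tridiag L g x (int i - l) + of_bool (i = 1) * (g * (x (- l) - x (1 - l))) + of_bool (i = n) * (g * x (int n + 1 - l))"
  proof -
    have "i - 1 \<in> {1..n} \<longleftrightarrow> i \<noteq> 1" "Suc i \<in> {1..n} \<longleftrightarrow> i \<noteq> n" using i by auto
    moreover have "int (i - 1) = int i - 1" using i by simp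
    moreover have "int i - 1 - l = int i - l - 1" "int i + 1 - l = int i - l + 1" "int (Suc i) - l = int i - l + 1" by simp_all
    ultimately show ?thesis
      by (cases "i = 1"; cases "i = n") (simp_all add: tridiag_def y_def algebra_simps)
  qed
  finally show ?thesis by (simp only: y_def)
qed

text \<open>A matrix supported on a single time index in rows (or columns) has as its norm the
  square-summable norm of a piece of the symbol, which does not grow with \<open>n\<close>. The
  factor 2 is the square root of the number of sign pairs.\<close>

lemma frobenius_row_le:
  assumes D: "\<And>s s'. s \<in> {1,-1} \<Longrightarrow> s' \<in> {1,-1} \<Longrightarrow> (\<Sum>l=1..n. (y s s' l)\<^sup>2) \<le> D"
  shows "frobenius (obs_index n) (\<lambda>a b. of_bool (snd a = i0) * y (fst a) (fst b) (snd b)) \<le> 2 * sqrt D"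
    and "frobenius (obs_index n) (\<lambda>a b. of_bool (snd b = i0) * y (fst b) (fst a) (snd a)) \<le> 2 * sqrt D"
proof -
  have D0: "D \<ge> 0" using order_trans[OF sum_nonneg D[of 1 1]] by simp
  let ?Y = "\<lambda>a b. of_bool (snd a = i0) * y (fst a) (fst b) (snd b)"
  have "(\<Sum>a\<in>obs_index n. \<Sum>b\<in>obs_index n. (?Y a b)\<^sup>2) =
      (\<Sum>s\<in>{1,-1}. \<Sum>i=1..n. of_bool (i = i0) * (\<Sum>s'\<in>{1,-1}. \<Sum>l=1..n. (y s s' l)\<^sup>2))"
    unfolding sum_obs_index fst_conv snd_conv by (intro sum.cong refl) (auto simp: power_mult_distrib)
  also have "\<dots> \<le> (\<Sum>s\<in>{1,-1 :: real}. \<Sum>s'\<in>{1,-1 :: real}. D)"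
    unfolding sum_of_bool_mult[OF finite_atLeastAtMost]
  proof (intro sum_mono)
    fix s :: real assume s: "s \<in> {1,-1}"
    have "0 \<le> (\<Sum>s'\<in>{1,-1 :: real}. \<Sum>l=1..n. (y s s' l)\<^sup>2)" by (intro sum_nonneg) auto
    moreover have "(\<Sum>s'\<in>{1,-1 :: real}. \<Sum>l=1..n. (y s s' l)\<^sup>2) \<le> (\<Sum>s'\<in>{1,-1 :: real}. D)"
      by (intro sum_mono D s)
    ultimately show "of_bool (i0 \<in> {1..n}) * (\<Sum>s'\<in>{1,-1 :: real}. \<Sum>l=1..n. (y s s' l)\<^sup>2) \<le> (\<Sum>s'\<in>{1,-1 :: real}. D)"
      by (cases "i0 \<in> {1..n}") auto
  qed
  also have "\<dots> = 4 * D" by simp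
  finally have "frobenius (obs_index n) ?Y \<le> sqrt (4 * D)"
    unfolding frobenius_def by (rule real_sqrt_le_mono)
  also have "\<dots> = 2 * sqrt D" by (simp add: real_sqrt_mult)
  finally show "frobenius (obs_index n) ?Y \<le> 2 * sqrt D" .
  then show "frobenius (obs_index n) (\<lambda>a b. of_bool (snd b = i0) * y (fst b) (fst a) (snd a)) \<le> 2 * sqrt D"
    using frobenius_transpose[of "obs_index n" ?Y] by simp
qed

text \<open>On the whole line the Toeplitz matrices with symbols \<open>score_symbol\<close> solve the equation
  \<open>\<Sigma> W \<Sigma> = A\<close> exactly; the finite sections only produce boundary terms of bounded norm.\<close>

lemma score_toeplitz_residual:
  assumes \<rho>: "\<bar>\<rho>\<bar> < 1" and g: "g \<ge> 0"
  obtains c D where "c \<ge> 0" "D \<ge> 0"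
    "\<And>n. n \<ge> 1 \<Longrightarrow> frobenius (obs_index n) (\<lambda>a b. incr_cov_deriv \<rho> a b - mat_prod (obs_index n) (mat_prod (obs_index n) (incr_cov \<rho> g) (score_toeplitz \<rho> g)) (incr_cov \<rho> g) a b) \<le> c"
    "\<And>n. frobenius (obs_index n) (score_toeplitz \<rho> g) \<le> D * sqrt n"
proof -
  define w where "w = score_symbol \<rho> g"
  define h where "h = half_symbol \<rho> g"
  \<comment> \<open>\<open>z1\<close> and \<open>z2\<close> are the defects in the first and the
    last row after multiplying by the covariance from the left; \<open>z3\<close> and
    \<open>z4\<close> are the defects in the first and the last column after multiplying from the
    right.\<close>
  define z1 where "z1 s s' k = g * (w s s' k - w s s' (k + 1))" for s s' k
  define z2 where "z2 s s' k = g * w s s' k" for s s' k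
  define z3 where "z3 s s' k = g * (h s s' k - h s s' (k - 1))" for s s' k
  define z4 where "z4 s s' k = g * h s s' k" for s s' k
  have diff: "exp_decay (\<lambda>k. x k - y k)" if "exp_decay x" "exp_decay y" for x y
    using exp_decay_add[OF that(1) exp_decay_cmult[OF that(2), of "-1"]] by simp
  have dec: "exp_decay (w s s')" "exp_decay (z1 s s')" "exp_decay (z2 s s')" "exp_decay (z3 s s')" "exp_decay (z4 s s')"
    if "s \<in> {1,-1}" "s' \<in> {1,-1}" for s s'
  proof -
    note e = exp_decay_symbols[OF \<rho> g that, folded w_def h_def]
    show "exp_decay (w s s')" by (rule e)
    show "exp_decay (z1 s s')" "exp_decay (z2 s s')" "exp_decay (z3 s s')" "exp_decay (z4 s s')"
      unfolding z1_def[abs_def] z2_def[abs_def] z3_def[abs_def] z4_def[abs_def]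
      by (intro exp_decay_cmult diff exp_decay_shift1 e)+
  qed
  have unif: "\<exists>D. \<forall>s\<in>{1,-1}. \<forall>s'\<in>{1,-1}. \<forall>A. finite A \<longrightarrow> (\<Sum>k\<in>A. (x s s' k)\<^sup>2) \<le> D"
    if "\<And>s s'. s \<in> {1,-1} \<Longrightarrow> s' \<in> {1,-1} \<Longrightarrow> exp_decay (x s s')" for x :: "real \<Rightarrow> real \<Rightarrow> int \<Rightarrow> real"
  proof -
    have "\<forall>s\<in>{1,-1}. \<forall>s'\<in>{1,-1}. \<exists>D. \<forall>A. finite A \<longrightarrow> (\<Sum>k\<in>A. (x s s' k)\<^sup>2) \<le> D"
      using exp_decay_sum_squares[OF that] by metis
    then obtain D where D: "\<forall>s\<in>{1,-1}. \<forall>s'\<in>{1,-1}. \<forall>A. finite A \<longrightarrow> (\<Sum>k\<in>A. (x s s' k)\<^sup>2) \<le> D s s'"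
      by metis
    define E where "E = max (max (D 1 1) (D 1 (-1))) (max (D (-1) 1) (D (-1) (-1)))"
    have "D s s' \<le> E" if "s \<in> {1,-1}" "s' \<in> {1,-1}" for s s'
      using that by (auto simp: E_def)
    then show ?thesis using D by (meson order_trans)
  qed
  obtain D0 where D0: "\<And>s s' A. s \<in> {1,-1} \<Longrightarrow> s' \<in> {1,-1} \<Longrightarrow> finite A \<Longrightarrow> (\<Sum>k\<in>A. (w s s' k)\<^sup>2) \<le> D0"
    using unif[of w, OF dec(1)] by blast
  obtain D1 where D1: "\<And>s s' A. s \<in> {1,-1} \<Longrightarrow> s' \<in> {1,-1} \<Longrightarrow> finite A \<Longrightarrow> (\<Sum>k\<in>A. (z1 s s' k)\<^sup>2) \<le> D1"
    using unif[of z1, OF dec(2)] by blast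
  obtain D2 where D2: "\<And>s s' A. s \<in> {1,-1} \<Longrightarrow> s' \<in> {1,-1} \<Longrightarrow> finite A \<Longrightarrow> (\<Sum>k\<in>A. (z2 s s' k)\<^sup>2) \<le> D2"
    using unif[of z2, OF dec(3)] by blast
  obtain D3 where D3: "\<And>s s' A. s \<in> {1,-1} \<Longrightarrow> s' \<in> {1,-1} \<Longrightarrow> finite A \<Longrightarrow> (\<Sum>k\<in>A. (z3 s s' k)\<^sup>2) \<le> D3"
    using unif[of z3, OF dec(4)] by blast
  obtain D4 where D4: "\<And>s s' A. s \<in> {1,-1} \<Longrightarrow> s' \<in> {1,-1} \<Longrightarrow> finite A \<Longrightarrow> (\<Sum>k\<in>A. (z4 s s' k)\<^sup>2) \<le> D4"
    using unif[of z4, OF dec(5)] by blast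
  have nonneg: "D0 \<ge> 0" "D1 \<ge> 0" "D2 \<ge> 0" "D3 \<ge> 0" "D4 \<ge> 0"
    using D0[of 1 1 "{}"] D1[of 1 1 "{}"] D2[of 1 1 "{}"] D3[of 1 1 "{}"] D4[of 1 1 "{}"] by simp_all
  have re: "(\<Sum>l=1..n. (f (\<phi> l))\<^sup>2) = (\<Sum>k\<in>\<phi> ` {1..n}. (f k)\<^sup>2)" if "inj \<phi>" for f :: "int \<Rightarrow> real" and \<phi> :: "nat \<Rightarrow> int" and n
    by (subst sum.reindex) (auto intro: inj_on_subset[OF that])
  have inj: "inj (\<lambda>l. e - int l)" "inj (\<lambda>l. int l - e)" for e by (auto simp: inj_def)
  define \<tau> where "\<tau> = 2 + 4 * g"
  \<comment> \<open>The corner entry contributes at most 2, the boundary columns the bound with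
    \<open>D3\<close> and \<open>D4\<close>. The boundary rows are still multiplied by the
    covariance, whose row sums are at most \<open>\<tau>\<close>.\<close>
  define c where "c = 2 + (2 * sqrt D3 + 2 * sqrt D4) + \<tau> * (2 * sqrt D1 + 2 * sqrt D2)"
  show ?thesis
  proof (rule that[of c "2 * sqrt D0"])
    show "0 \<le> c" "0 \<le> 2 * sqrt D0" using nonneg g by (auto simp: c_def \<tau>_def)
    fix n :: nat
    let ?K = "obs_index n"
    define P where "P a b = of_bool (snd a = 1) * z1 (fst a) (fst b) (0 - int (snd b)) +
        of_bool (snd a = n) * z2 (fst a) (fst b) (int n + 1 - int (snd b))" for a b
    define Q where "Q a b = of_bool (snd b = 1) * z3 (fst a) (fst b) (int (snd a) - 0) +
        of_bool (snd b = n) * z4 (fst a) (fst b) (int (snd a) - (int n + 1))" for a b :: "real \<times> nat"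
    define H where "H a b = h (fst a) (fst b) (int (snd a) - int (snd b))" for a b :: "real \<times> nat"
    have fP: "frobenius ?K P \<le> 2 * sqrt D1 + 2 * sqrt D2"
      unfolding P_def
      by (intro order_trans[OF frobenius_add] add_mono frobenius_row_le(1)[where y = "\<lambda>s s' l. z1 s s' (0 - int l)"]
          frobenius_row_le(1)[where y = "\<lambda>s s' l. z2 s s' (int n + 1 - int l)"])
        (simp_all only: re[OF inj(1)], auto intro!: D1 D2)
    have fQ: "frobenius ?K Q \<le> 2 * sqrt D3 + 2 * sqrt D4"
      unfolding Q_def
      by (intro order_trans[OF frobenius_add] add_mono frobenius_row_le(2)[where y = "\<lambda>s' s l. z3 s s' (int l - 0)"]
          frobenius_row_le(2)[where y = "\<lambda>s' s l. z4 s s' (int l - (int n + 1))"])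
        (simp_all only: re[OF inj(2)], auto intro!: D3 D4)
    have f0: "frobenius ?K (\<lambda>a b. fst a * fst b / 2 * of_bool (snd a = 1 \<and> snd b = 1)) \<le> 2 * sqrt 1"
    proof -
      have "(\<Sum>l=1..n. (s * s' / 2 * of_bool (l = 1))\<^sup>2) \<le> 1" if "s \<in> {1,-1}" "s' \<in> {1,-1}" for s s' :: real
      proof -
        have "(\<Sum>l=1..n. (s * s' / 2 * of_bool (l = 1))\<^sup>2) = (\<Sum>l=1..n. of_bool (l = 1) * ((1 / 4) :: real))"
          using that by (intro sum.cong refl) (auto simp: power2_eq_square)
        then show ?thesis by (simp only: sum_of_bool_mult[OF finite_atLeastAtMost]) simp
      qed
      from frobenius_row_le(1)[where y = "\<lambda>s s' l. s * s' / 2 * of_bool (l = 1)" and n = n and ?i0.0 = 1, OF this]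
      have "frobenius ?K (\<lambda>a b. of_bool (snd a = 1) * (fst a * fst b / 2 * of_bool (snd b = 1))) \<le> 2 * sqrt 1"
        by simp
      then show ?thesis
        by (rule order_trans[OF eq_refl, rotated]) (auto intro!: frobenius_cong)
    qed
    \<comment> \<open>One multiplication turns the score symbol into the half symbol, up to the
      boundary rows \<open>P\<close>.\<close>
    have mW: "mat_prod ?K (incr_cov \<rho> g) (score_toeplitz \<rho> g) a b = H a b + P a b" if a: "a \<in> ?K" for a b
    proof -
      obtain s i where si: "a = (s, i)" "s \<in> {1, -1}" "i \<in> {1..n}" using a by (auto simp: obs_index_def)
      obtain s' l where b: "b = (s', l)" by force
      have "mat_prod ?K (incr_cov \<rho> g) (score_toeplitz \<rho> g) a b =
          (\<Sum>t\<in>{1,-1}. of_bool (s = t) * (\<Sum>k=1..n. ((1 + s * \<rho>) * of_bool (i = k) + g * diff_cov i k) * w t s' (int k - int l)))"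
        unfolding mat_prod_def sum_obs_index si b sum_distrib_left
        by (intro sum.cong refl) (simp add: incr_cov_def score_toeplitz_def w_def)
      also have "\<dots> = (\<Sum>k=1..n. ((1 + s * \<rho>) * of_bool (i = k) + g * diff_cov i k) * w s s' (int k - int l))"
        by (rule sum_sign_of_bool[OF si(2)])
      also have "\<dots> = H a b + P a b"
        unfolding sum_tridiag_section[OF si(3)] by (simp add: H_def P_def h_def w_def half_symbol_def z1_def z2_def si b)
      finally show ?thesis .
    qed
    \<comment> \<open>The columns are handled by the same section formula applied to the reflected
      symbol, because the covariance is symmetric. The drift without its corner entry results, which
      explains the explicit corner term.\<close>
    have mH: "mat_prod ?K H (incr_cov \<rho> g) a b = incr_cov_deriv \<rho> a b + fst a * fst b / 2 * of_bool (snd a = 1 \<and> snd b = 1) + Q a b"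
      if ab: "a \<in> ?K" "b \<in> ?K" for a b
    proof -
      obtain s i where si: "a = (s, i)" "s \<in> {1, -1}" "i \<in> {1..n}" using ab by (auto simp: obs_index_def)
      obtain s' l where b: "b = (s', l)" "s' \<in> {1, -1}" "l \<in> {1..n}" using ab by (auto simp: obs_index_def)
      have sym: "diff_cov k l = diff_cov l k" for k by (auto simp: diff_cov_def)
      have "mat_prod ?K H (incr_cov \<rho> g) a b =
          (\<Sum>t\<in>{1,-1}. of_bool (s' = t) * (\<Sum>k=1..n. ((1 + s' * \<rho>) * of_bool (l = k) + g * diff_cov l k) * h s t (- (int k - int i))))"
        unfolding mat_prod_def sum_obs_index si b sum_distrib_left
        by (intro sum.cong refl) (auto simp: incr_cov_def H_def sym)
      also have "\<dots> = (\<Sum>k=1..n. ((1 + s' * \<rho>) * of_bool (l = k) + g * diff_cov l k) * h s s' (- (int k - int i)))"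
        by (rule sum_sign_of_bool[OF b(2)])
      also have "\<dots> = tridiag (1 + s' * \<rho>) g (\<lambda>k. h s s' (- k)) (int l - int i) + Q a b"
        unfolding sum_tridiag_section[OF b(3), where x = "\<lambda>k. h s s' (- k)"] by (simp add: Q_def z3_def z4_def si b)
      also have "tridiag (1 + s' * \<rho>) g (\<lambda>k. h s s' (- k)) (int l - int i) = tridiag (1 + s' * \<rho>) g (h s s') (int i - int l)"
        by (simp add: tridiag_def algebra_simps)
      also have "\<dots> = drift_symbol \<rho> s s' (int i - int l)"
        unfolding h_def by (rule tridiag_half_symbol[OF \<rho> g si(2) b(2)])
      finally show ?thesis by (simp add: incr_cov_deriv_def si b)
    qed
    have row: "(\<Sum>b\<in>?K. \<bar>incr_cov \<rho> g a b\<bar>) \<le> \<tau>" if "a \<in> ?K" for a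
      using row_sum_incr_cov(1)[OF \<rho> that, of g] g by (simp add: \<tau>_def)
    have \<tau>0: "\<tau> \<ge> 0" using g by (simp add: \<tau>_def)
    have "mat_prod ?K (mat_prod ?K (incr_cov \<rho> g) (score_toeplitz \<rho> g)) (incr_cov \<rho> g) a b = mat_prod ?K H (incr_cov \<rho> g) a b + mat_prod ?K P (incr_cov \<rho> g) a b"
      if "a \<in> ?K" for a b
      unfolding mat_prod_def[of ?K "mat_prod ?K (incr_cov \<rho> g) (score_toeplitz \<rho> g)"] mW[OF that]
      by (simp add: mat_prod_def sum.distrib algebra_simps)
    then have res: "frobenius ?K (\<lambda>a b. incr_cov_deriv \<rho> a b - mat_prod ?K (mat_prod ?K (incr_cov \<rho> g) (score_toeplitz \<rho> g)) (incr_cov \<rho> g) a b) =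
        frobenius ?K (\<lambda>a b. - (fst a * fst b / 2 * of_bool (snd a = 1 \<and> snd b = 1) + Q a b + mat_prod ?K P (incr_cov \<rho> g) a b))"
      using mH by (intro frobenius_cong) simp
    have b2: "frobenius ?K (mat_prod ?K P (incr_cov \<rho> g)) \<le> \<tau> * frobenius ?K P"
      by (rule frobenius_mat_prod_le(2)[OF finite_obs_index incr_cov_sym row \<tau>0])
    have b3: "\<tau> * frobenius ?K P \<le> \<tau> * (2 * sqrt D1 + 2 * sqrt D2)"
      by (rule mult_left_mono[OF fP \<tau>0])
    have b1: "frobenius ?K (\<lambda>a b. fst a * fst b / 2 * of_bool (snd a = 1 \<and> snd b = 1) + Q a b + mat_prod ?K P (incr_cov \<rho> g) a b) \<le>
        frobenius ?K (\<lambda>a b. fst a * fst b / 2 * of_bool (snd a = 1 \<and> snd b = 1)) + frobenius ?K Q + frobenius ?K (mat_prod ?K P (incr_cov \<rho> g))"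
      by (intro order_trans[OF frobenius_add] add_mono frobenius_add order_refl)
    show "frobenius ?K (\<lambda>a b. incr_cov_deriv \<rho> a b - mat_prod ?K (mat_prod ?K (incr_cov \<rho> g) (score_toeplitz \<rho> g)) (incr_cov \<rho> g) a b) \<le> c"
      unfolding res frobenius_uminus c_def using b1 b2 b3 f0 fQ by simp
    show "frobenius ?K (score_toeplitz \<rho> g) \<le> 2 * sqrt D0 * sqrt n"
    proof -
      have "(\<Sum>a\<in>?K. \<Sum>b\<in>?K. (score_toeplitz \<rho> g a b)\<^sup>2) \<le> (\<Sum>s\<in>{1,-1::real}. \<Sum>i=1..n. \<Sum>s'\<in>{1,-1::real}. D0)"
        unfolding sum_obs_index score_toeplitz_def fst_conv snd_conv w_def[symmetric]
      proof (intro sum_mono)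
        fix s s' :: real and i assume s: "s \<in> {1,-1}" "s' \<in> {1,-1}"
        show "(\<Sum>l=1..n. (w s s' (int i - int l))\<^sup>2) \<le> D0"
          unfolding re[OF inj(1), of "w s s'"] by (rule D0[OF s]) simp
      qed
      also have "\<dots> = 4 * (D0 * n)" by simp
      finally have "frobenius ?K (score_toeplitz \<rho> g) \<le> sqrt (4 * (D0 * n))"
        unfolding frobenius_def by (rule real_sqrt_le_mono)
      then show ?thesis by (simp add: real_sqrt_mult)
    qed
  qed
qed

text \<open>Only the lags -1, 0 and 1 contribute. The first row lacks lag 1, the last row lacks lag
  -1, and the corner entry occurs once, so the deviation from \<open>n\<close> copies of the symbol
  sum is a constant independent of \<open>n\<close>.\<close>

lemma trace_score_toeplitz:
  assumes \<rho>: "\<bar>\<rho>\<bar> < 1" and g: "g \<ge> 0"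
  obtains C where "\<And>n. n \<ge> 1 \<Longrightarrow> (\<Sum>a\<in>obs_index n. \<Sum>b\<in>obs_index n. score_toeplitz \<rho> g a b * incr_cov_deriv \<rho> a b) =
      2 * (info_I \<rho> g + info_J \<rho> g) * n + C"
proof -
  define w where "w = score_symbol \<rho> g"
  define f where "f s s' k = w s s' k * drift_symbol \<rho> s s' k" for s s' k
  define C where "C = (\<Sum>s\<in>{1,-1::real}. \<Sum>s'\<in>{1,-1::real}. - f s s' 1 - f s s' (-1) - s * s' / 2 * w s s' 0)"
  show ?thesis
  proof (rule that[of C])
    fix n :: nat assume n: "n \<ge> 1"
    have row: "(\<Sum>i=1..n. \<Sum>l=1..n. w s s' (int i - int l) * incr_cov_deriv \<rho> (s, i) (s', l)) =
        real n * (\<Sum>k\<in>{-1,0,1}. f s s' k) + (- f s s' 1 - f s s' (-1) - s * s' / 2 * w s s' 0)" for s s'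
    proof -
      have "(\<Sum>l=1..n. w s s' (int i - int l) * incr_cov_deriv \<rho> (s, i) (s', l)) =
          (\<Sum>k\<in>{-1,0,1}. f s s' k) - of_bool (i = 1) * f s s' 1 - of_bool (i = n) * f s s' (-1) - of_bool (i = 1) * (s * s' / 2 * w s s' 0)"
        if i: "i \<in> {1..n}" for i
      proof -
        have "(\<Sum>l=1..n. w s s' (int i - int l) * incr_cov_deriv \<rho> (s, i) (s', l)) =
            (\<Sum>l=1..n. of_bool (l = i) * f s s' 0 + of_bool (l = i - 1) * f s s' 1 + of_bool (l = Suc i) * f s s' (-1)
              - of_bool (l = 1) * (of_bool (i = 1) * (s * s' / 2 * w s s' 0)))"
        proof (intro sum.cong refl)
          fix l assume l: "l \<in> {1..n}"
          consider "l = i" | "l = i - 1" "l \<noteq> i" | "l = Suc i" | "l \<noteq> i" "l \<noteq> i - 1" "l \<noteq> Suc i" by blast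
          then show "w s s' (int i - int l) * incr_cov_deriv \<rho> (s, i) (s', l) =
              of_bool (l = i) * f s s' 0 + of_bool (l = i - 1) * f s s' 1 + of_bool (l = Suc i) * f s s' (-1)
              - of_bool (l = 1) * (of_bool (i = 1) * (s * s' / 2 * w s s' 0))"
          proof cases
            case 1
            then show ?thesis using i by (auto simp: incr_cov_deriv_def f_def algebra_simps)
          next
            case 2
            then have e: "int i - int l = 1" "l \<noteq> Suc i" "\<not> (l = 1 \<and> i = 1)" using i l by auto
            then show ?thesis using 2 by (auto simp: incr_cov_deriv_def f_def)
          next
            case 3
            then have e: "int i - int l = -1" "l \<noteq> i" "l \<noteq> i - 1" "\<not> (l = 1 \<and> i = 1)" using i l by auto
            then show ?thesis using 3 by (auto simp: incr_cov_deriv_def f_def)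
          next
            case 4
            then have e: "int i - int l \<noteq> 0" "int i - int l \<noteq> 1" "int i - int l \<noteq> -1" using i l by auto
            then show ?thesis using 4 by (auto simp: incr_cov_deriv_def f_def drift_symbol_def)
          qed
        qed
        also have "\<dots> = of_bool (i \<in> {1..n}) * f s s' 0 + of_bool (i - 1 \<in> {1..n}) * f s s' 1 + of_bool (Suc i \<in> {1..n}) * f s s' (-1)
              - of_bool (1 \<in> {1..n}) * (of_bool (i = 1) * (s * s' / 2 * w s s' 0))"
          unfolding sum_subtractf sum.distrib sum_of_bool_mult[OF finite_atLeastAtMost] ..
        also have "\<dots> = (\<Sum>k\<in>{-1,0,1}. f s s' k) - of_bool (i = 1) * f s s' 1 - of_bool (i = n) * f s s' (-1) - of_bool (i = 1) * (s * s' / 2 * w s s' 0)"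
        proof -
          have "i - 1 \<in> {1..n} \<longleftrightarrow> i \<noteq> 1" "Suc i \<in> {1..n} \<longleftrightarrow> i \<noteq> n" using i by auto
          then show ?thesis using i n by (cases "i = 1"; cases "i = n") simp_all
        qed
        finally show ?thesis .
      qed
      then have "(\<Sum>i=1..n. \<Sum>l=1..n. w s s' (int i - int l) * incr_cov_deriv \<rho> (s, i) (s', l)) =
          (\<Sum>i=1..n. (\<Sum>k\<in>{-1,0,1}. f s s' k) - of_bool (i = 1) * f s s' 1 - of_bool (i = n) * f s s' (-1) - of_bool (i = 1) * (s * s' / 2 * w s s' 0))"
        by (intro sum.cong refl)
      also have "\<dots> = real n * (\<Sum>k\<in>{-1,0,1}. f s s' k) - f s s' 1 - f s s' (-1) - s * s' / 2 * w s s' 0"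
        unfolding sum_subtractf sum_of_bool_mult[OF finite_atLeastAtMost] using n by simp
      finally show ?thesis by simp
    qed
    have "(\<Sum>a\<in>obs_index n. \<Sum>b\<in>obs_index n. score_toeplitz \<rho> g a b * incr_cov_deriv \<rho> a b) =
        (\<Sum>s\<in>{1,-1}. \<Sum>s'\<in>{1,-1}. \<Sum>i=1..n. \<Sum>l=1..n. w s s' (int i - int l) * incr_cov_deriv \<rho> (s, i) (s', l))"
      unfolding sum_obs_index score_toeplitz_def fst_conv snd_conv w_def[symmetric]
      by (intro sum.cong refl) (rule sum.swap)
    also have "\<dots> = real n * (\<Sum>s\<in>{1,-1}. \<Sum>s'\<in>{1,-1}. \<Sum>k\<in>{-1,0,1}. f s s' k) + C"
      unfolding row C_def sum.distrib sum_distrib_left ..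
    also have "(\<Sum>s\<in>{1,-1}. \<Sum>s'\<in>{1,-1}. \<Sum>k\<in>{-1,0,1}. f s s' k) = 2 * (info_I \<rho> g + info_J \<rho> g)"
      unfolding f_def w_def by (rule sum_drift_score_symbol[OF \<rho> g])
    finally show "(\<Sum>a\<in>obs_index n. \<Sum>b\<in>obs_index n. score_toeplitz \<rho> g a b * incr_cov_deriv \<rho> a b) =
      2 * (info_I \<rho> g + info_J \<rho> g) * n + C" by simp
  qed
qed

lemma triple_sum_eq_mat_prod:
  fixes S W :: "'k \<Rightarrow> 'k \<Rightarrow> real"
  shows "(\<Sum>j\<in>K. \<Sum>k\<in>K. S a j * W j k * S k b) = mat_prod K S (mat_prod K W S) a b"
    and "(\<Sum>j\<in>K. \<Sum>k\<in>K. S a j * W j k * S k b) = mat_prod K (mat_prod K S W) S a b"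
proof -
  show "(\<Sum>j\<in>K. \<Sum>k\<in>K. S a j * W j k * S k b) = mat_prod K S (mat_prod K W S) a b"
    by (simp only: mat_prod_def sum_distrib_left mult.assoc)
  show "(\<Sum>j\<in>K. \<Sum>k\<in>K. S a j * W j k * S k b) = mat_prod K (mat_prod K S W) S a b"
    unfolding mat_prod_def sum_distrib_right by (rule sum.swap)
qed

text \<open>Expanding the product with \<open>S + D\<close> on both sides gives two mixed terms and
  one quadratic term; the Schur test bounds each of them by row sums times the norm of
  \<open>W\<close>.\<close>

lemma frobenius_residual_perturbation:
  assumes K: "finite K" and S: "\<And>a b. S a b = S b a" and D: "\<And>a b. D a b = D b a"
    and rS: "\<And>a. a \<in> K \<Longrightarrow> (\<Sum>b\<in>K. \<bar>S a b\<bar>) \<le> \<tau>" and rD: "\<And>a. a \<in> K \<Longrightarrow> (\<Sum>b\<in>K. \<bar>D a b\<bar>) \<le> d"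
    and pos: "\<tau> \<ge> 0" "d \<ge> 0"
  shows "frobenius K (\<lambda>a b. A a b - mat_prod K (\<lambda>a b. S a b + D a b) (mat_prod K W (\<lambda>a b. S a b + D a b)) a b) \<le>
    frobenius K (\<lambda>a b. A a b - mat_prod K S (mat_prod K W S) a b) + (2 * \<tau> * d + d\<^sup>2) * frobenius K W"
proof -
  note lS = frobenius_mat_prod_le[OF K S rS pos(1)] and lD = frobenius_mat_prod_le[OF K D rD pos(2)]
  have e: "(\<lambda>a b. A a b - mat_prod K (\<lambda>a b. S a b + D a b) (mat_prod K W (\<lambda>a b. S a b + D a b)) a b) =
      (\<lambda>a b. (A a b - mat_prod K S (mat_prod K W S) a b) - ((mat_prod K S (mat_prod K W D) a b + mat_prod K D (mat_prod K W S) a b) + mat_prod K D (mat_prod K W D) a b))"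
    unfolding mat_prod_add by (simp add: fun_eq_iff)
  have t: "frobenius K (mat_prod K S (mat_prod K W D)) \<le> \<tau> * (d * frobenius K W)"
    by (rule order_trans[OF lS(1) mult_left_mono[OF lD(2) pos(1)]])
  have u: "frobenius K (mat_prod K D (mat_prod K W S)) \<le> d * (\<tau> * frobenius K W)"
    by (rule order_trans[OF lD(1) mult_left_mono[OF lS(2) pos(2)]])
  have v: "frobenius K (mat_prod K D (mat_prod K W D)) \<le> d * (d * frobenius K W)"
    by (rule order_trans[OF lD(1) mult_left_mono[OF lD(2) pos(2)]])
  note 1 = frobenius_diff[of K "\<lambda>a b. A a b - mat_prod K S (mat_prod K W S) a b" "\<lambda>a b. (mat_prod K S (mat_prod K W D) a b + mat_prod K D (mat_prod K W S) a b) + mat_prod K D (mat_prod K W D) a b"]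
  note 2 = frobenius_add[of K "\<lambda>a b. mat_prod K S (mat_prod K W D) a b + mat_prod K D (mat_prod K W S) a b" "mat_prod K D (mat_prod K W D)"]
  note 3 = frobenius_add[of K "mat_prod K S (mat_prod K W D)" "mat_prod K D (mat_prod K W S)"]
  have 4: "(2 * \<tau> * d + d\<^sup>2) * frobenius K W = \<tau> * (d * frobenius K W) + d * (\<tau> * frobenius K W) + d * (d * frobenius K W)"
    by (simp add: algebra_simps power2_eq_square)
  show ?thesis unfolding e 4 using 1 2 3 t u v by linarith
qed

text \<open>\<open>W\<close> is frozen at the limit \<open>\<gamma>\<close> and at lag 0, although
  the covariance depends on \<open>g n\<close> and \<open>h\<close>. The norm of \<open>W\<close>
  grows like the square root of \<open>n\<close>; the residual consists of a bounded boundary part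
  and a perturbation o(1) times the norm of \<open>W\<close>. Hence tr (W E) is o(n), and the
  leading term is the trace computed from the symbols.\<close>

lemma eventually_information_le:
  fixes g \<delta> :: "nat \<Rightarrow> real"
  assumes \<rho>: "\<bar>\<rho>\<bar> < 1" and \<gamma>: "\<gamma> \<ge> 0" and g: "g \<longlonglongrightarrow> \<gamma>" and \<delta>: "\<delta> \<longlonglongrightarrow> 0"
    and \<kappa>: "info_I \<rho> \<gamma> + info_J \<rho> \<gamma> \<ge> 0" and \<epsilon>: "\<epsilon> > 0" and lam: "lam > 0"
  defines "S \<equiv> \<lambda>n h a b. incr_cov \<rho> (g n) a b + h * incr_cov_deriv \<rho> a b"
  defines "E \<equiv> \<lambda>n h a b. incr_cov_deriv \<rho> a b - (\<Sum>j\<in>obs_index n. \<Sum>k\<in>obs_index n. S n h a j * score_toeplitz \<rho> \<gamma> j k * S n h k b)"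
  shows "\<forall>\<^sub>F n in sequentially. \<forall>h. \<bar>h\<bar> \<le> \<delta> n \<longrightarrow>
    (sqrt (\<Sum>a\<in>obs_index n. \<Sum>b\<in>obs_index n. score_toeplitz \<rho> \<gamma> a b * (incr_cov_deriv \<rho> a b - E n h a b))
      + sqrt (\<Sum>a\<in>obs_index n. \<Sum>b\<in>obs_index n. (E n h a b)\<^sup>2) / lam)\<^sup>2 / 2
      \<le> real n * (info_I \<rho> \<gamma> + info_J \<rho> \<gamma> + \<epsilon>)"
proof -
  define \<kappa> where "\<kappa> = info_I \<rho> \<gamma> + info_J \<rho> \<gamma>"
  have \<kappa>0: "\<kappa> \<ge> 0" using \<kappa> by (simp add: \<kappa>_def)
  obtain c D where c: "c \<ge> 0" "D \<ge> 0"
    "\<And>n. n \<ge> 1 \<Longrightarrow> frobenius (obs_index n) (\<lambda>a b. incr_cov_deriv \<rho> a b - mat_prod (obs_index n) (mat_prod (obs_index n) (incr_cov \<rho> \<gamma>) (score_toeplitz \<rho> \<gamma>)) (incr_cov \<rho> \<gamma>) a b) \<le> c"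
    "\<And>n. frobenius (obs_index n) (score_toeplitz \<rho> \<gamma>) \<le> D * sqrt n"
    using score_toeplitz_residual[OF \<rho> \<gamma>] by blast
  obtain C where C: "\<And>n. n \<ge> 1 \<Longrightarrow> (\<Sum>a\<in>obs_index n. \<Sum>b\<in>obs_index n. score_toeplitz \<rho> \<gamma> a b * incr_cov_deriv \<rho> a b) = 2 * \<kappa> * n + C"
    using trace_score_toeplitz[OF \<rho> \<gamma>] unfolding \<kappa>_def by blast
  define \<tau> where "\<tau> = 2 + 4 * \<gamma>"
  define d where "d n = 4 * \<bar>g n - \<gamma>\<bar> + 4 * \<bar>\<delta> n\<bar>" for n
  have d: "d \<longlonglongrightarrow> 0"
  proof -
    have "(\<lambda>n. \<bar>g n - \<gamma>\<bar>) \<longlonglongrightarrow> \<bar>\<gamma> - \<gamma>\<bar>" by (intro tendsto_intros g)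
    moreover have "(\<lambda>n. \<bar>\<delta> n\<bar>) \<longlonglongrightarrow> \<bar>0\<bar>" by (intro tendsto_intros \<delta>)
    ultimately have "d \<longlonglongrightarrow> 4 * \<bar>\<gamma> - \<gamma>\<bar> + 4 * \<bar>0\<bar>"
      unfolding d_def[abs_def] by (intro tendsto_add tendsto_mult tendsto_const)
    then show ?thesis by simp
  qed
  \<comment> \<open>A bound for the norm of the residual divided by the square root of
    \<open>n\<close>.\<close>
  define p where "p n = c * inverse (sqrt (real n)) + (2 * \<tau> * d n + (d n)\<^sup>2) * D" for n
  have sq: "(\<lambda>n. inverse (sqrt (real n))) \<longlonglongrightarrow> 0"
    by (intro tendsto_inverse_0_at_top filterlim_compose[OF sqrt_at_top] filterlim_real_sequentially)
  have p: "p \<longlonglongrightarrow> 0"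
  proof -
    have "p \<longlonglongrightarrow> c * 0 + (2 * \<tau> * 0 + 0\<^sup>2) * D"
      unfolding p_def[abs_def] by (intro tendsto_intros d sq)
    then show ?thesis by simp
  qed
  have d0: "d n \<ge> 0" for n by (simp add: d_def)
  have \<tau>0: "\<tau> \<ge> 0" using \<gamma> by (simp add: \<tau>_def)
  have p0: "p n \<ge> 0" for n using c(1,2) d0 \<tau>0 by (simp add: p_def)
  \<comment> \<open>The bound of the statement divided by \<open>n\<close>; its limit is
    \<kappa>.\<close>
  define G where "G n = (sqrt (2 * \<kappa> + \<bar>C\<bar> / n + D * p n) + p n / lam)\<^sup>2 / 2" for n
  have "(\<lambda>n. \<bar>C\<bar> / real n) \<longlonglongrightarrow> 0"
    by (rule lim_const_over_n)
  then have "G \<longlonglongrightarrow> (sqrt (2 * \<kappa> + 0 + D * 0) + 0 / lam)\<^sup>2 / 2"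
    unfolding G_def[abs_def] using lam by (intro tendsto_intros p) auto
  moreover have "(sqrt (2 * \<kappa> + 0 + D * 0) + 0 / lam)\<^sup>2 / 2 = \<kappa>" using \<kappa>0 by simp
  ultimately have "G \<longlonglongrightarrow> \<kappa>" by simp
  then have "\<forall>\<^sub>F n in sequentially. G n < \<kappa> + \<epsilon>"
    using \<epsilon> by (intro order_tendstoD(2)) auto
  moreover have "\<forall>\<^sub>F n in sequentially. n \<ge> (1::nat)" by (rule eventually_ge_at_top)
  ultimately show ?thesis
  proof eventually_elim
    case (elim n)
    have n: "n \<ge> 1" "real n > 0" using elim by auto
    let ?K = "obs_index n"
    let ?W = "score_toeplitz \<rho> \<gamma>"
    show ?case
    proof (intro allI impI)
      fix h assume h: "\<bar>h\<bar> \<le> \<delta> n"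
      define \<Delta> where "\<Delta> a b = (incr_cov \<rho> (g n) a b - incr_cov \<rho> \<gamma> a b) + h * incr_cov_deriv \<rho> a b" for a b
      have S: "S n h = (\<lambda>a b. incr_cov \<rho> \<gamma> a b + \<Delta> a b)" by (simp add: S_def \<Delta>_def fun_eq_iff)
      have En: "E n h = (\<lambda>a b. incr_cov_deriv \<rho> a b - mat_prod ?K (\<lambda>a b. incr_cov \<rho> \<gamma> a b + \<Delta> a b) (mat_prod ?K ?W (\<lambda>a b. incr_cov \<rho> \<gamma> a b + \<Delta> a b)) a b)"
        unfolding E_def triple_sum_eq_mat_prod(1) S ..
      have row: "(\<Sum>b\<in>?K. \<bar>\<Delta> a b\<bar>) \<le> d n" if a: "a \<in> ?K" for a
      proof -
        have "(\<Sum>b\<in>?K. \<bar>\<Delta> a b\<bar>) \<le> (\<Sum>b\<in>?K. \<bar>incr_cov \<rho> (g n) a b - incr_cov \<rho> \<gamma> a b\<bar> + \<bar>h\<bar> * \<bar>incr_cov_deriv \<rho> a b\<bar>)"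
          unfolding \<Delta>_def abs_mult[symmetric] by (intro sum_mono abs_triangle_ineq)
        then have 1: "(\<Sum>b\<in>?K. \<bar>\<Delta> a b\<bar>) \<le> (\<Sum>b\<in>?K. \<bar>incr_cov \<rho> (g n) a b - incr_cov \<rho> \<gamma> a b\<bar>) + \<bar>h\<bar> * (\<Sum>b\<in>?K. \<bar>incr_cov_deriv \<rho> a b\<bar>)"
          unfolding sum.distrib sum_distrib_left[symmetric] .
        have 2: "\<bar>h\<bar> * (\<Sum>b\<in>?K. \<bar>incr_cov_deriv \<rho> a b\<bar>) \<le> \<bar>h\<bar> * 4"
          by (intro mult_left_mono row_sum_incr_cov(3)[OF \<rho> a]) simp
        have "\<bar>h\<bar> \<le> \<bar>\<delta> n\<bar>" using h by linarith
        then show ?thesis using 1 2 row_sum_incr_cov(2)[OF \<rho> a, of "g n" \<gamma>] unfolding d_def by linarith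
      qed
      have row0: "(\<Sum>b\<in>?K. \<bar>incr_cov \<rho> \<gamma> a b\<bar>) \<le> \<tau>" if "a \<in> ?K" for a
        using row_sum_incr_cov(1)[OF \<rho> that, of \<gamma>] \<gamma> by (simp add: \<tau>_def)
      have sym: "\<Delta> a b = \<Delta> b a" for a b
        unfolding \<Delta>_def incr_cov_sym[of _ _ a b] incr_cov_deriv_sym[of _ a b] ..
      have w0: "frobenius ?K ?W \<le> D * sqrt n" by (rule c(4))
      have f1: "frobenius ?K (E n h) \<le> c + (2 * \<tau> * d n + (d n)\<^sup>2) * (D * sqrt n)"
      proof -
        have "frobenius ?K (E n h) \<le> frobenius ?K (\<lambda>a b. incr_cov_deriv \<rho> a b - mat_prod ?K (incr_cov \<rho> \<gamma>) (mat_prod ?K ?W (incr_cov \<rho> \<gamma>)) a b)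
            + (2 * \<tau> * d n + (d n)\<^sup>2) * frobenius ?K ?W"
          unfolding En by (rule frobenius_residual_perturbation[OF finite_obs_index incr_cov_sym sym row0 row \<tau>0 d0])
        moreover have "frobenius ?K (\<lambda>a b. incr_cov_deriv \<rho> a b - mat_prod ?K (incr_cov \<rho> \<gamma>) (mat_prod ?K ?W (incr_cov \<rho> \<gamma>)) a b) \<le> c"
          using c(3)[OF n(1)] unfolding triple_sum_eq_mat_prod(2)[symmetric] triple_sum_eq_mat_prod(1) .
        moreover have "(2 * \<tau> * d n + (d n)\<^sup>2) * frobenius ?K ?W \<le> (2 * \<tau> * d n + (d n)\<^sup>2) * (D * sqrt n)"
          using \<tau>0 d0[of n] by (intro mult_left_mono w0) auto
        ultimately show ?thesis by linarith
      qed
      have f2: "c + (2 * \<tau> * d n + (d n)\<^sup>2) * (D * sqrt n) = sqrt n * p n"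
        using n by (simp add: p_def field_simps)
      have f: "frobenius ?K (E n h) \<le> sqrt n * p n" using f1 unfolding f2 .
      have "(\<Sum>a\<in>?K. \<Sum>b\<in>?K. ?W a b * (incr_cov_deriv \<rho> a b - E n h a b)) =
          (\<Sum>a\<in>?K. \<Sum>b\<in>?K. ?W a b * incr_cov_deriv \<rho> a b) - (\<Sum>a\<in>?K. \<Sum>b\<in>?K. ?W a b * E n h a b)"
        by (simp add: right_diff_distrib sum_subtractf)
      moreover have "\<bar>\<Sum>a\<in>?K. \<Sum>b\<in>?K. ?W a b * E n h a b\<bar> \<le> frobenius ?K ?W * frobenius ?K (E n h)"
        by (rule frobenius_inner_le)
      moreover have "frobenius ?K ?W * frobenius ?K (E n h) \<le> (D * sqrt n) * (sqrt n * p n)"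
        using c(2) by (intro mult_mono w0 f) auto
      moreover have "(D * sqrt n) * (sqrt n * p n) = n * (D * p n)" by simp
      ultimately have m: "(\<Sum>a\<in>?K. \<Sum>b\<in>?K. ?W a b * (incr_cov_deriv \<rho> a b - E n h a b)) \<le> n * (2 * \<kappa> + \<bar>C\<bar> / n + D * p n)"
        "- (n * (2 * \<kappa> + \<bar>C\<bar> / n + D * p n)) \<le> (\<Sum>a\<in>?K. \<Sum>b\<in>?K. ?W a b * (incr_cov_deriv \<rho> a b - E n h a b))"
      proof -
        have 1: "n * (2 * \<kappa> + \<bar>C\<bar> / n + D * p n) = 2 * \<kappa> * n + \<bar>C\<bar> + n * (D * p n)"
          using n by (simp add: field_simps)
        assume *: "(\<Sum>a\<in>?K. \<Sum>b\<in>?K. ?W a b * (incr_cov_deriv \<rho> a b - E n h a b)) =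
          (\<Sum>a\<in>?K. \<Sum>b\<in>?K. ?W a b * incr_cov_deriv \<rho> a b) - (\<Sum>a\<in>?K. \<Sum>b\<in>?K. ?W a b * E n h a b)"
          "\<bar>\<Sum>a\<in>?K. \<Sum>b\<in>?K. ?W a b * E n h a b\<bar> \<le> frobenius ?K ?W * frobenius ?K (E n h)"
          "frobenius ?K ?W * frobenius ?K (E n h) \<le> (D * sqrt n) * (sqrt n * p n)" "(D * sqrt n) * (sqrt n * p n) = n * (D * p n)"
        have k: "0 \<le> 2 * \<kappa> * n" using \<kappa>0 by simp
        show "(\<Sum>a\<in>?K. \<Sum>b\<in>?K. ?W a b * (incr_cov_deriv \<rho> a b - E n h a b)) \<le> n * (2 * \<kappa> + \<bar>C\<bar> / n + D * p n)"
          unfolding 1 using C[OF n(1)] * by linarith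
        show "- (n * (2 * \<kappa> + \<bar>C\<bar> / n + D * p n)) \<le> (\<Sum>a\<in>?K. \<Sum>b\<in>?K. ?W a b * (incr_cov_deriv \<rho> a b - E n h a b))"
          unfolding 1 using C[OF n(1)] * k by linarith
      qed
      \<comment> \<open>The sign of the trace is left open, and \<open>sqrt\<close> of a negative
        number is the negative of the root of its absolute value. Squaring therefore needs a lower
        bound as well.\<close>
      have r1: "sqrt (\<Sum>a\<in>?K. \<Sum>b\<in>?K. ?W a b * (incr_cov_deriv \<rho> a b - E n h a b)) \<le> sqrt n * sqrt (2 * \<kappa> + \<bar>C\<bar> / n + D * p n)"
        "- (sqrt n * sqrt (2 * \<kappa> + \<bar>C\<bar> / n + D * p n)) \<le> sqrt (\<Sum>a\<in>?K. \<Sum>b\<in>?K. ?W a b * (incr_cov_deriv \<rho> a b - E n h a b))"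
        using real_sqrt_le_mono[OF m(1)] real_sqrt_le_mono[OF m(2)] unfolding real_sqrt_minus real_sqrt_mult by simp_all
      have r2: "sqrt (\<Sum>a\<in>?K. \<Sum>b\<in>?K. (E n h a b)\<^sup>2) / lam \<le> sqrt n * (p n / lam)"
        using divide_right_mono[OF f, of lam] lam by (simp add: frobenius_def)
      have Enn: "0 \<le> sqrt (\<Sum>a\<in>?K. \<Sum>b\<in>?K. (E n h a b)\<^sup>2) / lam"
        using lam by (intro divide_nonneg_pos real_sqrt_ge_zero sum_nonneg) auto
      have mono: "(x + y)\<^sup>2 \<le> (X + Y)\<^sup>2" if "x \<le> X" "- X \<le> x" "0 \<le> y" "y \<le> Y" for x y X Y :: real
        using power_mono[of "\<bar>x + y\<bar>" "X + Y" 2] that by simp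
      have "(sqrt (\<Sum>a\<in>?K. \<Sum>b\<in>?K. ?W a b * (incr_cov_deriv \<rho> a b - E n h a b)) + sqrt (\<Sum>a\<in>?K. \<Sum>b\<in>?K. (E n h a b)\<^sup>2) / lam)\<^sup>2
          \<le> (sqrt n * sqrt (2 * \<kappa> + \<bar>C\<bar> / n + D * p n) + sqrt n * (p n / lam))\<^sup>2"
        by (rule mono[OF r1 Enn r2])
      also have "\<dots> = n * (2 * G n)"
        unfolding distrib_left[symmetric] power_mult_distrib by (simp add: G_def)
      also have "\<dots> \<le> n * (2 * (\<kappa> + \<epsilon>))"
        using elim n by (intro mult_left_mono) auto
      finally show "(sqrt (\<Sum>a\<in>?K. \<Sum>b\<in>?K. ?W a b * (incr_cov_deriv \<rho> a b - E n h a b)) + sqrt (\<Sum>a\<in>?K. \<Sum>b\<in>?K. (E n h a b)\<^sup>2) / lam)\<^sup>2 / 2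
          \<le> real n * (info_I \<rho> \<gamma> + info_J \<rho> \<gamma> + \<epsilon>)"
        by (simp add: \<kappa>_def algebra_simps)
    qed
  qed
qed

section \<open>The law of the observed increments\<close>

lemma char_centred_normal:
  assumes M: "prob_space M" and X: "centred_normal M X s"
  shows "char (distr M borel X) t = of_real (exp (- s * t\<^sup>2 / 2))"
proof -
  interpret prob_space M by fact
  have [measurable]: "X \<in> borel_measurable M" using X by (simp add: centred_normal_def)
  show ?thesis
  proof (cases "s = 0")
    case True
    then have "AE \<omega> in M. X \<omega> = 0" using X by (auto simp: centred_normal_def)
    then have "(CLINT \<omega>|M. iexp (t * X \<omega>)) = (CLINT \<omega>|M. 1)"
      by (intro integral_cong_AE) (auto elim: eventually_mono)
    then show ?thesis using True by (simp add: char_def integral_distr prob_space)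
  next
    case False
    then have s: "s > 0" and d: "distributed M lborel X (\<lambda>x. ennreal (normal_density 0 (sqrt s) x))"
      using X by (auto simp: centred_normal_def)
    have "distributed M lborel (\<lambda>\<omega>. (X \<omega> - 0) / sqrt s) (\<lambda>x. ennreal (std_normal_density x))"
      using d s normal_standard_normal_convert[of "sqrt s" X 0] by simp
    then have D: "distr M borel (\<lambda>\<omega>. X \<omega> / sqrt s) = std_normal_distribution"
      using distributed_distr_eq_density by (fastforce cong: distr_cong)
    have "char (distr M borel X) t = char (distr M borel (\<lambda>\<omega>. X \<omega> / sqrt s)) (t * sqrt s)"
      using s by (simp add: char_def integral_distr)
    also have "\<dots> = of_real (exp (- (t * sqrt s)\<^sup>2 / 2))"
      unfolding D char_std_normal_distribution ..
    finally show ?thesis using s by (simp add: power_mult_distrib mult.commute)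
  qed
qed

text \<open>Brownian increments over consecutive intervals and the noise vectors are independent, so
  the characteristic function of any linear combination is a product of normal ones. The times form
  an infinite increasing sequence because independence of increments is stated in that form.\<close>

lemma char_increments_noise:
  assumes M: "prob_space M" and B: "two_sided_brownian_motion M 1 \<rho> 1 B"
    and eps: "iid_standard_normal2 M eps" and ind: "independent_of_noise M B eps" and \<tau>: "strict_mono \<tau>"
  shows "(CLINT \<omega>|M. iexp ((\<Sum>j<k. p j * (fst (B (\<tau> (Suc j)) \<omega>) - fst (B (\<tau> j) \<omega>)) + q j * (snd (B (\<tau> (Suc j)) \<omega>) - snd (B (\<tau> j) \<omega>))) +
        (\<Sum>i=1..n. c i * fst (eps i \<omega>) + d i * snd (eps i \<omega>)))) =
     of_real (exp (- ((\<Sum>j<k. (\<tau> (Suc j) - \<tau> j) * ((p j)\<^sup>2 + 2 * \<rho> * p j * q j + (q j)\<^sup>2)) + (\<Sum>i=1..n. (c i)\<^sup>2 + (d i)\<^sup>2)) / 2))"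
proof -
  interpret prob_space M by fact
  have [measurable]: "B t \<in> borel_measurable M" for t
    using B by (simp add: two_sided_brownian_motion_def)
  have indeps: "indep_vars (\<lambda>_. borel) eps {1..}"
    using eps by (simp add: iid_standard_normal2_def)
  then have em: "eps i \<in> borel_measurable M" if "i \<ge> 1" for i
    using that by (auto simp: indep_vars_def)
  have [measurable]: "fst \<in> borel_measurable (borel :: (real \<times> real) measure)" "snd \<in> borel_measurable (borel :: (real \<times> real) measure)"
    by (intro borel_measurable_continuous_onI continuous_intros)+
  define I where "I j \<omega> = B (\<tau> (Suc j)) \<omega> - B (\<tau> j) \<omega>" for j \<omega>
  define u where "u j \<omega> = p j * fst (I j \<omega>) + q j * snd (I j \<omega>)" for j \<omega>
  define w where "w i \<omega> = c i * fst (eps i \<omega>) + d i * snd (eps i \<omega>)" for i \<omega>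
  have Iu: "indep_vars (\<lambda>_. borel) u {..<k}"
  proof -
    have "indep_vars (\<lambda>_. borel) I {..<k}"
      using B \<tau> by (simp add: two_sided_brownian_motion_def I_def[abs_def])
    from indep_vars_compose2[OF this, of "\<lambda>j x. p j * fst x + q j * snd x" "\<lambda>_. borel"]
    show ?thesis by (simp add: u_def[abs_def])
  qed
  have Iw: "indep_vars (\<lambda>_. borel) w {1..n}"
  proof -
    have "indep_vars (\<lambda>_. borel) eps {1..n}"
      by (rule indep_vars_subset[OF indeps]) auto
    from indep_vars_compose2[OF this, of "\<lambda>i x. c i * fst x + d i * snd x" "\<lambda>_. borel"]
    show ?thesis by (simp add: w_def[abs_def])
  qed
  have Nu: "centred_normal M (u j) ((\<tau> (Suc j) - \<tau> j) * ((p j)\<^sup>2 + 2 * \<rho> * p j * q j + (q j)\<^sup>2))" for j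
  proof -
    have "\<tau> j < \<tau> (Suc j)" using \<tau> by (simp add: strict_mono_Suc_iff)
    then have "centred_bivariate_normal M (I j) ((\<tau> (Suc j) - \<tau> j) * 1) ((\<tau> (Suc j) - \<tau> j) * \<rho>) ((\<tau> (Suc j) - \<tau> j) * 1)"
      using B unfolding two_sided_brownian_motion_def I_def[abs_def] by blast
    then have "centred_normal M (u j) ((p j)\<^sup>2 * ((\<tau> (Suc j) - \<tau> j) * 1) + 2 * p j * q j * ((\<tau> (Suc j) - \<tau> j) * \<rho>) + (q j)\<^sup>2 * ((\<tau> (Suc j) - \<tau> j) * 1))"
      unfolding centred_bivariate_normal_def u_def[abs_def] by blast
    moreover have "(p j)\<^sup>2 * ((\<tau> (Suc j) - \<tau> j) * 1) + 2 * p j * q j * ((\<tau> (Suc j) - \<tau> j) * \<rho>) + (q j)\<^sup>2 * ((\<tau> (Suc j) - \<tau> j) * 1) =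
        (\<tau> (Suc j) - \<tau> j) * ((p j)\<^sup>2 + 2 * \<rho> * p j * q j + (q j)\<^sup>2)"
      by (simp add: algebra_simps)
    ultimately show ?thesis by simp
  qed
  have Nw: "centred_normal M (w i) ((c i)\<^sup>2 + (d i)\<^sup>2)" if "i \<in> {1..n}" for i
  proof -
    have "centred_bivariate_normal M (eps i) 1 0 1"
      using eps that by (simp add: iid_standard_normal2_def)
    then have "centred_normal M (w i) ((c i)\<^sup>2 * 1 + 2 * c i * d i * 0 + (d i)\<^sup>2 * 1)"
      unfolding centred_bivariate_normal_def w_def[abs_def] by blast
    then show ?thesis by simp
  qed
  have cu: "char (distr M borel (\<lambda>\<omega>. \<Sum>j<k. u j \<omega>)) 1 = of_real (exp (- (\<Sum>j<k. (\<tau> (Suc j) - \<tau> j) * ((p j)\<^sup>2 + 2 * \<rho> * p j * q j + (q j)\<^sup>2)) / 2))"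
    unfolding char_distr_sum[OF Iu] char_centred_normal[OF M Nu]
    by (simp add: exp_sum sum_negf[symmetric] sum_divide_distrib flip: of_real_prod)
  have cw: "char (distr M borel (\<lambda>\<omega>. \<Sum>i=1..n. w i \<omega>)) 1 = of_real (exp (- (\<Sum>i=1..n. (c i)\<^sup>2 + (d i)\<^sup>2) / 2))"
  proof -
    have "(\<Prod>i=1..n. char (distr M borel (w i)) 1) = (\<Prod>i=1..n. of_real (exp (- ((c i)\<^sup>2 + (d i)\<^sup>2) * 1\<^sup>2 / 2)))"
      by (intro prod.cong refl char_centred_normal[OF M Nw])
    then show ?thesis
      unfolding char_distr_sum[OF Iw]
      by (simp add: exp_sum sum_negf[symmetric] sum_divide_distrib flip: of_real_prod)
  qed
  \<comment> \<open>Independence is given for the generated sigma-algebras of the two processes;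
    both linear combinations are shown to be measurable with respect to these.\<close>
  define VB where "VB = vimage_algebra (space M) (\<lambda>\<omega> t. B t \<omega>) (\<Pi>\<^sub>M t\<in>(UNIV::real set). (borel :: (real \<times> real) measure))"
  define VE where "VE = vimage_algebra (space M) (\<lambda>\<omega>. \<lambda>i\<in>{1..}. eps i \<omega>) (\<Pi>\<^sub>M i\<in>{1..}. (borel :: (real \<times> real) measure))"
  have mB: "(\<lambda>\<omega>. B t \<omega>) \<in> borel_measurable VB" for t
  proof -
    have "(\<lambda>\<omega> t. B t \<omega>) \<in> measurable VB (\<Pi>\<^sub>M t\<in>UNIV. borel)"
      unfolding VB_def by (rule measurable_vimage_algebra1) (simp add: space_PiM)
    from measurable_compose[OF this measurable_component_singleton[of t UNIV "\<lambda>_. borel"]] show ?thesis by simp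
  qed
  have mE: "(\<lambda>\<omega>. eps i \<omega>) \<in> borel_measurable VE" if "i \<ge> 1" for i
  proof -
    have "(\<lambda>\<omega>. \<lambda>i\<in>{1..}. eps i \<omega>) \<in> measurable VE (\<Pi>\<^sub>M i\<in>{1..}. borel)"
      unfolding VE_def by (rule measurable_vimage_algebra1) (simp add: space_PiM)
    from measurable_compose[OF this measurable_component_singleton[of i "{1..}" "\<lambda>_. borel"]] show ?thesis using that by simp
  qed
  have mU: "(\<lambda>\<omega>. \<Sum>j<k. u j \<omega>) \<in> borel_measurable VB"
    unfolding u_def I_def using mB by measurable
  have mW: "(\<lambda>\<omega>. \<Sum>i=1..n. w i \<omega>) \<in> borel_measurable VE"
    unfolding w_def using mE by (intro borel_measurable_sum borel_measurable_add borel_measurable_times borel_measurable_const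
      measurable_compose[OF _ \<open>fst \<in> _\<close>] measurable_compose[OF _ \<open>snd \<in> _\<close>]) auto
  have spV: "space VB = space M" "space VE = space M" by (simp_all add: VB_def VE_def)
  have "indep_set (sets VB) (sets VE)"
    using ind by (simp add: independent_of_noise_def VB_def VE_def)
  then have "indep_var borel (\<lambda>\<omega>. \<Sum>j<k. u j \<omega>) borel (\<lambda>\<omega>. \<Sum>i=1..n. w i \<omega>)"
    unfolding indep_var_eq
  proof (intro conjI)
    assume ind: "indep_set (sets VB) (sets VE)"
    show "random_variable borel (\<lambda>\<omega>. \<Sum>j<k. u j \<omega>)"
      unfolding u_def I_def by measurable
    show "random_variable borel (\<lambda>\<omega>. \<Sum>i=1..n. w i \<omega>)"
      unfolding w_def using em by (intro borel_measurable_sum borel_measurable_add borel_measurable_times borel_measurable_const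
        measurable_compose[OF _ \<open>fst \<in> _\<close>] measurable_compose[OF _ \<open>snd \<in> _\<close>]) auto
    have sub: "sigma_sets (space M) {f -` A \<inter> space M |A. A \<in> sets borel} \<subseteq> sets V"
      if "f \<in> borel_measurable V" "space V = space M" for f :: "'a \<Rightarrow> real" and V
      using that by (intro sets.sigma_sets_subset[of _ V, simplified that(2)]) (auto intro: measurable_sets simp flip: that(2))
    show "indep_set (sigma_sets (space M) {(\<lambda>\<omega>. \<Sum>j<k. u j \<omega>) -` A \<inter> space M |A. A \<in> sets borel})
        (sigma_sets (space M) {(\<lambda>\<omega>. \<Sum>i=1..n. w i \<omega>) -` A \<inter> space M |A. A \<in> sets borel})"
      using ind sub[OF mU spV(1)] sub[OF mW spV(2)] unfolding indep_set_def
      by (elim indep_sets_mono_sets) (auto split: bool.split)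
  qed
  from char_distr_add[OF this, of 1]
  have "char (distr M borel (\<lambda>\<omega>. (\<Sum>j<k. u j \<omega>) + (\<Sum>i=1..n. w i \<omega>))) 1 =
     of_real (exp (- ((\<Sum>j<k. (\<tau> (Suc j) - \<tau> j) * ((p j)\<^sup>2 + 2 * \<rho> * p j * q j + (q j)\<^sup>2)) + (\<Sum>i=1..n. (c i)\<^sup>2 + (d i)\<^sup>2)) / 2))"
    unfolding cu cw by (simp add: exp_add[symmetric] add_divide_distrib diff_divide_distrib flip: of_real_mult)
  moreover have "(\<lambda>\<omega>. (\<Sum>j<k. u j \<omega>) + (\<Sum>i=1..n. w i \<omega>)) \<in> borel_measurable M"
    unfolding u_def I_def w_def using em by (intro borel_measurable_sum borel_measurable_add borel_measurable_times borel_measurable_const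
        measurable_compose[OF _ \<open>fst \<in> _\<close>] measurable_compose[OF _ \<open>snd \<in> _\<close>]) auto
  ultimately have "(CLINT \<omega>|M. iexp ((\<Sum>j<k. u j \<omega>) + (\<Sum>i=1..n. w i \<omega>))) =
     of_real (exp (- ((\<Sum>j<k. (\<tau> (Suc j) - \<tau> j) * ((p j)\<^sup>2 + 2 * \<rho> * p j * q j + (q j)\<^sup>2)) + (\<Sum>i=1..n. (c i)\<^sup>2 + (d i)\<^sup>2)) / 2))"
    by (simp add: char_def integral_distr)
  then show ?thesis
    unfolding u_def I_def w_def by simp
qed

section \<open>Quadratic forms of the covariance and of its derivative\<close>

lemma sum_shift:
  fixes f :: "nat \<Rightarrow> real"
  shows "(\<Sum>i=1..n. f (Suc i)) = (\<Sum>i=1..n. f i) - f 1 + f (Suc n)"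
  by (induction n) auto

text \<open>Abel summation, where the indicator replaces \<open>e 0\<close> by 0. It moves the
  differencing from the noise to the weights.\<close>

lemma sum_by_parts:
  fixes \<alpha> e :: "nat \<Rightarrow> real"
  assumes "\<alpha> (Suc n) = 0"
  shows "(\<Sum>i=1..n. \<alpha> i * (e i - of_bool (i \<noteq> 1) * e (i - 1))) = (\<Sum>i=1..n. (\<alpha> i - \<alpha> (Suc i)) * e i)"
proof -
  have "(\<Sum>i=1..n. \<alpha> (Suc i) * (of_bool (Suc i \<noteq> 1) * e (Suc i - 1))) = (\<Sum>i=1..n. \<alpha> i * (of_bool (i \<noteq> 1) * e (i - 1)))"
    unfolding sum_shift[of "\<lambda>i. \<alpha> i * (of_bool (i \<noteq> 1) * e (i - 1))"] using assms by simp
  moreover have "(\<Sum>i=1..n. \<alpha> (Suc i) * (of_bool (Suc i \<noteq> 1) * e (Suc i - 1))) = (\<Sum>i=1..n. \<alpha> (Suc i) * e i)"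
    by (intro sum.cong) auto
  ultimately show ?thesis
    by (simp add: right_diff_distrib left_diff_distrib sum_subtractf)
qed

text \<open>The noise part becomes a sum of squared differences of the weights, extended by 0 beyond
  \<open>n\<close>. There is no difference at the left end, in accordance with the entry 1 of
  \<open>diff_cov\<close>.\<close>

lemma quadratic_form_incr_cov:
  fixes t :: "real \<times> nat \<Rightarrow> real" and n :: nat
  defines "u \<equiv> \<lambda>s i. of_bool (1 \<le> i \<and> i \<le> n) * t (s, i)"
  assumes n: "n \<ge> 1"
  shows "(\<Sum>a\<in>obs_index n. \<Sum>b\<in>obs_index n. incr_cov \<rho> g a b * (t a * t b)) =
    (\<Sum>s\<in>{1,-1}. \<Sum>i=1..n. (1 + s * \<rho>) * (u s i)\<^sup>2 + g * (u s i - u s (Suc i))\<^sup>2)"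
proof -
  have u0: "u s 0 = 0" "u s (Suc n) = 0" for s by (simp_all add: u_def)
  have ut: "t (s, i) = u s i" if "i \<in> {1..n}" for s i using that by (simp add: u_def)
  have row: "(\<Sum>s'\<in>{1,-1}. \<Sum>l=1..n. incr_cov \<rho> g (s, i) (s', l) * (t (s, i) * t (s', l))) =
      u s i * ((1 + s * \<rho> + 2 * g) * u s i - g * (u s (i - 1) + u s (Suc i)) - of_bool (i = 1) * (g * u s 1))"
    if s: "s \<in> {1, -1}" and i: "i \<in> {1..n}" for s i
  proof -
    have "(\<Sum>s'\<in>{1,-1}. \<Sum>l=1..n. incr_cov \<rho> g (s, i) (s', l) * (t (s, i) * t (s', l))) =
        (\<Sum>s'\<in>{1,-1}. of_bool (s = s') * (\<Sum>l=1..n. ((1 + s * \<rho>) * of_bool (i = l) + g * diff_cov i l) * (u s i * u s' (nat (int l - 0)))))"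
      unfolding sum_distrib_left using ut i by (intro sum.cong refl) (simp add: incr_cov_def)
    also have "\<dots> = (\<Sum>l=1..n. ((1 + s * \<rho>) * of_bool (i = l) + g * diff_cov i l) * (u s i * u s (nat (int l - 0))))"
      by (rule sum_sign_of_bool[OF s])
    also have "\<dots> = u s i * (\<Sum>l=1..n. ((1 + s * \<rho>) * of_bool (i = l) + g * diff_cov i l) * u s (nat (int l - 0)))"
      unfolding sum_distrib_left by (intro sum.cong refl) (simp only: ac_simps)
    also have "(\<Sum>l=1..n. ((1 + s * \<rho>) * of_bool (i = l) + g * diff_cov i l) * u s (nat (int l - 0))) =
        (1 + s * \<rho> + 2 * g) * u s i - g * (u s (i - 1) + u s (Suc i)) - of_bool (i = 1) * (g * u s 1)"
    proof -
      have "nat (int i - 1) = i - 1" "nat (int i + 1) = Suc i" "nat (int n + 1) = Suc n" using i by auto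
      then show ?thesis
        unfolding sum_tridiag_section[OF i, where x = "\<lambda>k. u s (nat k)"] by (simp add: tridiag_def u0)
    qed
    finally show ?thesis .
  qed
  have "(\<Sum>i=1..n. u s i * ((1 + s * \<rho> + 2 * g) * u s i - g * (u s (i - 1) + u s (Suc i)) - of_bool (i = 1) * (g * u s 1))) =
      (\<Sum>i=1..n. (1 + s * \<rho>) * (u s i)\<^sup>2 + g * (u s i - u s (Suc i))\<^sup>2)" for s
  proof -
    have a: "(\<Sum>i=1..n. u s i * u s (i - 1)) = (\<Sum>i=1..n. u s (Suc i) * u s i)"
      using sum_shift[of "\<lambda>i. u s i * u s (i - 1)" n] by (simp add: u0)
    have b: "(\<Sum>i=1..n. (u s (Suc i))\<^sup>2) = (\<Sum>i=1..n. (u s i)\<^sup>2) - (u s 1)\<^sup>2"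
      using sum_shift[of "\<lambda>i. (u s i)\<^sup>2" n] by (simp add: u0)
    have c: "(\<Sum>i=1..n. of_bool (i = 1) * (u s i * u s 1)) = (u s 1)\<^sup>2"
      unfolding sum_of_bool_mult[OF finite_atLeastAtMost] using n by (simp add: power2_eq_square)
    have "(\<Sum>i=1..n. u s i * ((1 + s * \<rho> + 2 * g) * u s i - g * (u s (i - 1) + u s (Suc i)) - of_bool (i = 1) * (g * u s 1))) =
        (\<Sum>i=1..n. (1 + s * \<rho> + 2 * g) * (u s i)\<^sup>2 - g * (u s i * u s (i - 1)) - g * (u s (Suc i) * u s i) - g * (of_bool (i = 1) * (u s i * u s 1)))"
      by (intro sum.cong refl) (simp add: algebra_simps power2_eq_square)
    also have "\<dots> = (1 + s * \<rho> + 2 * g) * (\<Sum>i=1..n. (u s i)\<^sup>2) - g * (\<Sum>i=1..n. u s (Suc i) * u s i) - g * (\<Sum>i=1..n. u s (Suc i) * u s i) - g * (u s 1)\<^sup>2"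
      by (simp only: sum_subtractf sum_distrib_left[symmetric] a c)
    also have "\<dots> = (1 + s * \<rho> + g) * (\<Sum>i=1..n. (u s i)\<^sup>2) + g * (\<Sum>i=1..n. (u s (Suc i))\<^sup>2) - 2 * g * (\<Sum>i=1..n. u s (Suc i) * u s i)"
      unfolding b by (simp add: algebra_simps)
    also have "\<dots> = (\<Sum>i=1..n. (1 + s * \<rho> + g) * (u s i)\<^sup>2 + g * (u s (Suc i))\<^sup>2 - 2 * g * (u s (Suc i) * u s i))"
      by (simp only: sum_subtractf sum.distrib sum_distrib_left[symmetric])
    also have "\<dots> = (\<Sum>i=1..n. (1 + s * \<rho>) * (u s i)\<^sup>2 + g * (u s i - u s (Suc i))\<^sup>2)"
      by (intro sum.cong refl) (simp add: algebra_simps power2_eq_square)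
    finally show ?thesis .
  qed
  moreover have "(\<Sum>a\<in>obs_index n. \<Sum>b\<in>obs_index n. incr_cov \<rho> g a b * (t a * t b)) = (\<Sum>s\<in>{1,-1}. \<Sum>i=1..n.
      u s i * ((1 + s * \<rho> + 2 * g) * u s i - g * (u s (i - 1) + u s (Suc i)) - of_bool (i = 1) * (g * u s 1)))"
    unfolding sum_obs_index by (intro sum.cong refl row)
  ultimately show ?thesis by (simp only:)
qed

text \<open>Up to normalisation, \<open>u 1 + u (-1)\<close> and \<open>u 1 - u (-1)\<close> are the
  weights of the leading and of the lagged component. A lag pairs a leading weight with the next
  lagged weight instead of the current one, which is the difference in the formula.\<close>

lemma quadratic_form_incr_cov_deriv:
  fixes t :: "real \<times> nat \<Rightarrow> real" and n :: nat
  defines "u \<equiv> \<lambda>s i. of_bool (1 \<le> i \<and> i \<le> n) * t (s, i)"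
  assumes n: "n \<ge> 1"
  shows "(\<Sum>a\<in>obs_index n. \<Sum>b\<in>obs_index n. incr_cov_deriv \<rho> a b * (t a * t b)) =
    (\<Sum>i=1..n. \<rho> * (u 1 i + u (-1) i) * ((u 1 (Suc i) - u (-1) (Suc i)) - (u 1 i - u (-1) i))) - (u 1 1 - u (-1) 1)\<^sup>2 / 2"
proof -
  have u0: "u s 0 = 0" "u s (Suc n) = 0" for s by (simp_all add: u_def)
  have ut: "t (s, i) = u s i" if "i \<in> {1..n}" for s i using that by (simp add: u_def)
  have row: "(\<Sum>l=1..n. incr_cov_deriv \<rho> (s, i) (s', l) * (t (s, i) * t (s', l))) =
      \<rho> / 2 * (s' * (u s i * u s' (Suc i)) + s * (u s i * u s' (i - 1)) - (s + s') * (u s i * u s' i)) - of_bool (i = 1) * (s * s' / 2 * (u s 1 * u s' 1))"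
    if i: "i \<in> {1..n}" for s s' i
  proof -
    have "(\<Sum>l=1..n. incr_cov_deriv \<rho> (s, i) (s', l) * (t (s, i) * t (s', l))) =
        (\<Sum>l=1..n. of_bool (l = Suc i) * (\<rho> / 2 * s' * (u s i * u s' l)) + of_bool (l = i - 1) * (\<rho> / 2 * s * (u s i * u s' l))
          - of_bool (l = i) * (\<rho> / 2 * (s + s') * (u s i * u s' l)) - of_bool (l = 1) * (of_bool (i = 1) * (s * s' / 2 * (u s 1 * u s' 1))))"
    proof (intro sum.cong refl)
      fix l assume l: "l \<in> {1..n}"
      have e: "int i - int l = 0 \<longleftrightarrow> l = i" "int i - int l = -1 \<longleftrightarrow> l = Suc i" "int i - int l = 1 \<longleftrightarrow> l = i - 1"
        using i l by auto
      have "incr_cov_deriv \<rho> (s, i) (s', l) = \<rho> / 2 * (- (s + s') * of_bool (l = i) + s' * of_bool (l = Suc i) + s * of_bool (l = i - 1))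
          - s * s' / 2 * of_bool (l = 1 \<and> i = 1)"
        unfolding incr_cov_deriv_def drift_symbol_def fst_conv snd_conv e by auto
      moreover have "of_bool (l = 1 \<and> i = 1) * (u s i * u s' l) = of_bool (l = 1) * (of_bool (i = 1) * (u s 1 * u s' 1))"
        by auto
      moreover have "(\<rho> / 2 * (- (s + s') * oa + s' * ob + s * oc) - s * s' / 2 * od) * x =
          ob * (\<rho> / 2 * s' * x) + oc * (\<rho> / 2 * s * x) - oa * (\<rho> / 2 * (s + s') * x) - s * s' / 2 * (od * x)" for oa ob oc od x :: real
        by (simp add: field_simps)
      moreover have "s * s' / 2 * (x * (y * z)) = x * (y * (s * s' / 2 * z))" for x y z
        by simp
      ultimately show "incr_cov_deriv \<rho> (s, i) (s', l) * (t (s, i) * t (s', l)) =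
          of_bool (l = Suc i) * (\<rho> / 2 * s' * (u s i * u s' l)) + of_bool (l = i - 1) * (\<rho> / 2 * s * (u s i * u s' l))
          - of_bool (l = i) * (\<rho> / 2 * (s + s') * (u s i * u s' l)) - of_bool (l = 1) * (of_bool (i = 1) * (s * s' / 2 * (u s 1 * u s' 1)))"
        unfolding ut[OF i] ut[OF l] by (simp only:)
    qed
    also have "\<dots> = of_bool (Suc i \<in> {1..n}) * (\<rho> / 2 * s' * (u s i * u s' (Suc i))) + of_bool (i - 1 \<in> {1..n}) * (\<rho> / 2 * s * (u s i * u s' (i - 1)))
          - of_bool (i \<in> {1..n}) * (\<rho> / 2 * (s + s') * (u s i * u s' i)) - of_bool (1 \<in> {1..n}) * (of_bool (i = 1) * (s * s' / 2 * (u s 1 * u s' 1)))"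
      unfolding sum_subtractf sum.distrib sum_of_bool_mult[OF finite_atLeastAtMost] ..
    also have "of_bool (Suc i \<in> {1..n}) * (\<rho> / 2 * s' * (u s i * u s' (Suc i))) = \<rho> / 2 * s' * (u s i * u s' (Suc i))"
      by (cases "Suc i \<in> {1..n}") (auto simp: u_def)
    also have "of_bool (i - 1 \<in> {1..n}) * (\<rho> / 2 * s * (u s i * u s' (i - 1))) = \<rho> / 2 * s * (u s i * u s' (i - 1))"
      using i by (cases "i - 1 \<in> {1..n}") (auto simp: u_def)
    also have "of_bool (i \<in> {1..n}) = (1 :: real)" using i by simp
    also have "of_bool (1 \<in> {1..n}) = (1 :: real)" using n by simp
    also have "\<rho> / 2 * s' * (u s i * u s' (Suc i)) + \<rho> / 2 * s * (u s i * u s' (i - 1)) - 1 * (\<rho> / 2 * (s + s') * (u s i * u s' i))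
          - 1 * (of_bool (i = 1) * (s * s' / 2 * (u s 1 * u s' 1))) =
        \<rho> / 2 * (s' * (u s i * u s' (Suc i)) + s * (u s i * u s' (i - 1)) - (s + s') * (u s i * u s' i)) - of_bool (i = 1) * (s * s' / 2 * (u s 1 * u s' 1))"
      by (simp add: algebra_simps)
    finally show ?thesis .
  qed
  have col: "(\<Sum>i=1..n. \<Sum>l=1..n. incr_cov_deriv \<rho> (s, i) (s', l) * (t (s, i) * t (s', l))) =
      (\<Sum>i=1..n. \<rho> / 2 * (s' * (u s i * u s' (Suc i)) + s * (u s (Suc i) * u s' i) - (s + s') * (u s i * u s' i))) - s * s' / 2 * (u s 1 * u s' 1)" for s s'
  proof -
    have a: "(\<Sum>i=1..n. u s i * u s' (i - 1)) = (\<Sum>i=1..n. u s (Suc i) * u s' i)"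
      using sum_shift[of "\<lambda>i. u s i * u s' (i - 1)" n] by (simp add: u0)
    have "(\<Sum>i=1..n. \<Sum>l=1..n. incr_cov_deriv \<rho> (s, i) (s', l) * (t (s, i) * t (s', l))) =
        (\<Sum>i=1..n. \<rho> / 2 * (s' * (u s i * u s' (Suc i)) + s * (u s i * u s' (i - 1)) - (s + s') * (u s i * u s' i)) - of_bool (i = 1) * (s * s' / 2 * (u s 1 * u s' 1)))"
      by (intro sum.cong refl row)
    also have "\<dots> = \<rho> / 2 * (s' * (\<Sum>i=1..n. u s i * u s' (Suc i)) + s * (\<Sum>i=1..n. u s i * u s' (i - 1)) - (s + s') * (\<Sum>i=1..n. u s i * u s' i)) - s * s' / 2 * (u s 1 * u s' 1)"
      unfolding sum_subtractf sum_of_bool_mult[OF finite_atLeastAtMost] sum_distrib_left[symmetric] sum.distrib using n by simp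
    also have "\<dots> = (\<Sum>i=1..n. \<rho> / 2 * (s' * (u s i * u s' (Suc i)) + s * (u s (Suc i) * u s' i) - (s + s') * (u s i * u s' i))) - s * s' / 2 * (u s 1 * u s' 1)"
      unfolding a by (simp only: sum_subtractf sum_distrib_left[symmetric] sum.distrib)
    finally show ?thesis .
  qed
  have "(\<Sum>a\<in>obs_index n. \<Sum>b\<in>obs_index n. incr_cov_deriv \<rho> a b * (t a * t b)) =
      (\<Sum>s\<in>{1,-1}. \<Sum>s'\<in>{1,-1}. \<Sum>i=1..n. \<Sum>l=1..n. incr_cov_deriv \<rho> (s, i) (s', l) * (t (s, i) * t (s', l)))"
    unfolding sum_obs_index by (intro sum.cong refl) (rule sum.swap)
  also have "\<dots> = (\<Sum>i=1..n. (\<Sum>s\<in>{1,-1}. \<Sum>s'\<in>{1,-1}. \<rho> / 2 * (s' * (u s i * u s' (Suc i)) + s * (u s (Suc i) * u s' i) - (s + s') * (u s i * u s' i))))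
      - (\<Sum>s\<in>{1,-1}. \<Sum>s'\<in>{1,-1}. s * s' / 2 * (u s 1 * u s' 1))"
    unfolding col sum_subtractf by (simp add: sum.distrib)
  also have "\<dots> = (\<Sum>i=1..n. \<rho> * (u 1 i + u (-1) i) * ((u 1 (Suc i) - u (-1) (Suc i)) - (u 1 i - u (-1) i))) - (u 1 1 - u (-1) 1)\<^sup>2 / 2"
    by (intro arg_cong2[where f = "(-)"] sum.cong refl) (simp_all add: field_simps power2_eq_square)
  finally show ?thesis .
qed

section \<open>The merged observation times of the two components\<close>

text \<open>Even indices carry the times of the leading component, odd indices those of the lagged
  one. The two kinds alternate precisely because the lag lies between 0 and the mesh.\<close>

definition grid :: "nat \<Rightarrow> real \<Rightarrow> nat \<Rightarrow> real" where
  "grid n \<theta> j = (if even j then real (j div 2) / n else real (Suc (j div 2)) / n - \<theta>)"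

lemma grid_simps: "grid n \<theta> (2 * m) = real m / n" "grid n \<theta> (Suc (2 * m)) = real (Suc m) / n - \<theta>"
  by (simp_all add: grid_def)

lemma strict_mono_grid:
  assumes "0 < \<theta>" "\<theta> < 1 / n"
  shows "strict_mono (grid n \<theta>)"
  unfolding strict_mono_Suc_iff
proof
  fix j
  show "grid n \<theta> j < grid n \<theta> (Suc j)"
  proof (cases "even j")
    case True
    then obtain m where "j = 2 * m" by (rule evenE)
    then show ?thesis using assms(2) by (simp add: grid_simps add_divide_distrib)
  next
    case False
    then obtain m where "j = 2 * m + 1" by (rule oddE)
    then have "j = Suc (2 * m)" "Suc j = 2 * Suc m" by auto
    then show ?thesis using assms(1) by (simp only: grid_simps)
  qed
qed

lemma sum_double:
  fixes G :: "nat \<Rightarrow> real"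
  shows "(\<Sum>j<2 * n. G j) = (\<Sum>i=1..n. G (2 * i - 2) + G (2 * i - 1))"
  by (induction n) auto

text \<open>The leading component is observed at the even grid points, so each of its increments
  consists of two consecutive grid increments with the same weight.\<close>

lemma sum_grid_coarse:
  fixes F :: "nat \<Rightarrow> real"
  shows "(\<Sum>j<2 * n. \<alpha> (Suc (j div 2)) * (F (Suc j) - F j)) = (\<Sum>i=1..n. \<alpha> i * (F (2 * i) - F (2 * i - 2)))"
  by (induction n) (auto simp: algebra_simps)

text \<open>The lagged component is observed at the odd grid points. Its first increment covers one
  grid interval only, and after its last observation one interval is left, with the weight
  \<open>\<beta> (Suc n)\<close>, which is 0 in the application.\<close>

lemma sum_grid_lagged:
  fixes F :: "nat \<Rightarrow> real"
  shows "(\<Sum>j<2 * n. \<beta> (Suc (Suc j div 2)) * (F (Suc j) - F j)) =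
    (\<Sum>i=1..n. \<beta> i * (F (2 * i - 1) - F (if i = 1 then 0 else 2 * i - 3))) + \<beta> (Suc n) * (F (2 * n) - F (if n = 0 then 0 else 2 * n - 1))"
proof (induction n)
  case (Suc n)
  show ?case
    by (cases n) (use Suc in \<open>simp_all add: algebra_simps numeral_3_eq_3\<close>)
qed simp

text \<open>The grid intervals have alternating lengths \<open>1 / n - \<theta>\<close> and
  \<open>\<theta>\<close>. On the former the weights \<open>\<alpha> i\<close> and
  \<open>\<beta> i\<close> meet, on the latter \<open>\<alpha> i\<close> and
  \<open>\<beta> (Suc i)\<close>. This is why the variance is affine in the lag.\<close>

lemma grid_quadratic_form:
  fixes t :: "real \<times> nat \<Rightarrow> real" and n :: nat and \<theta> v :: real
  assumes n: "n \<ge> 1" and v: "v \<ge> 0"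
  defines "\<alpha> \<equiv> \<lambda>i. sqrt (n / 2) * of_bool (1 \<le> i \<and> i \<le> n) * (t (1, i) + t (-1, i))"
    and "\<beta> \<equiv> \<lambda>i. sqrt (n / 2) * of_bool (1 \<le> i \<and> i \<le> n) * (t (1, i) - t (-1, i))"
  shows "(\<Sum>j<2 * n. (grid n \<theta> (Suc j) - grid n \<theta> j) * ((\<alpha> (Suc (j div 2)))\<^sup>2 + 2 * \<rho> * \<alpha> (Suc (j div 2)) * \<beta> (Suc (Suc j div 2)) + (\<beta> (Suc (Suc j div 2)))\<^sup>2))
      + (\<Sum>i=1..n. (sqrt v * (\<alpha> i - \<alpha> (Suc i)))\<^sup>2 + (sqrt v * (\<beta> i - \<beta> (Suc i)))\<^sup>2) =
    (\<Sum>a\<in>obs_index n. \<Sum>b\<in>obs_index n. (incr_cov \<rho> (n * v) a b + (n * \<theta>) * incr_cov_deriv \<rho> a b) * (t a * t b))"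
proof -
  define u where "u s i = of_bool (1 \<le> i \<and> i \<le> n) * t (s, i)" for s i
  have c2: "(sqrt (real n / 2))\<^sup>2 = real n / 2" by simp
  have ab: "\<alpha> i = sqrt (n / 2) * (u 1 i + u (-1) i)" "\<beta> i = sqrt (n / 2) * (u 1 i - u (-1) i)" for i
    by (simp_all add: \<alpha>_def \<beta>_def u_def algebra_simps)
  define q where "q i = n / 2 * ((u 1 i - u (-1) i)\<^sup>2)" for i
  have "(\<Sum>j<2 * n. (grid n \<theta> (Suc j) - grid n \<theta> j) * ((\<alpha> (Suc (j div 2)))\<^sup>2 + 2 * \<rho> * \<alpha> (Suc (j div 2)) * \<beta> (Suc (Suc j div 2)) + (\<beta> (Suc (Suc j div 2)))\<^sup>2)) =
      (\<Sum>i=1..n. (1 / n - \<theta>) * ((\<alpha> i)\<^sup>2 + 2 * \<rho> * \<alpha> i * \<beta> i + (\<beta> i)\<^sup>2) + \<theta> * ((\<alpha> i)\<^sup>2 + 2 * \<rho> * \<alpha> i * \<beta> (Suc i) + (\<beta> (Suc i))\<^sup>2))"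
    unfolding sum_double
  proof (intro sum.cong refl arg_cong2[where f = "(+)"])
    fix i assume "i \<in> {1..n}"
    then obtain m where m: "i = Suc m" by (cases i) auto
    have e: "2 * i - 2 = 2 * m" "2 * i - 1 = Suc (2 * m)" "Suc (Suc (2 * m)) = 2 * Suc m" using m by auto
    have d: "2 * m div 2 = m" "Suc (2 * m) div 2 = m" "2 * Suc m div 2 = Suc m" by auto
    have dg: "grid n \<theta> (Suc (2 * m)) - grid n \<theta> (2 * m) = 1 / n - \<theta>" "grid n \<theta> (2 * Suc m) - grid n \<theta> (Suc (2 * m)) = \<theta>"
      unfolding grid_simps by (simp_all add: add_divide_distrib)
    show "(grid n \<theta> (Suc (2 * i - 2)) - grid n \<theta> (2 * i - 2)) * ((\<alpha> (Suc ((2 * i - 2) div 2)))\<^sup>2 +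
          2 * \<rho> * \<alpha> (Suc ((2 * i - 2) div 2)) * \<beta> (Suc (Suc (2 * i - 2) div 2)) + (\<beta> (Suc (Suc (2 * i - 2) div 2)))\<^sup>2) =
        (1 / n - \<theta>) * ((\<alpha> i)\<^sup>2 + 2 * \<rho> * \<alpha> i * \<beta> i + (\<beta> i)\<^sup>2)"
      unfolding e unfolding d dg unfolding m ..
    show "(grid n \<theta> (Suc (2 * i - 1)) - grid n \<theta> (2 * i - 1)) * ((\<alpha> (Suc ((2 * i - 1) div 2)))\<^sup>2 +
          2 * \<rho> * \<alpha> (Suc ((2 * i - 1) div 2)) * \<beta> (Suc (Suc (2 * i - 1) div 2)) + (\<beta> (Suc (Suc (2 * i - 1) div 2)))\<^sup>2) =
        \<theta> * ((\<alpha> i)\<^sup>2 + 2 * \<rho> * \<alpha> i * \<beta> (Suc i) + (\<beta> (Suc i))\<^sup>2)"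
      unfolding e unfolding d dg unfolding m ..
  qed
  also have "\<dots> = (\<Sum>i=1..n. (1 / n - \<theta>) * ((\<alpha> i)\<^sup>2 + 2 * \<rho> * \<alpha> i * \<beta> i + (\<beta> i)\<^sup>2) + \<theta> * ((\<alpha> i)\<^sup>2 + 2 * \<rho> * \<alpha> i * \<beta> (Suc i)) + \<theta> * q (Suc i))"
  proof -
    have "q i = (\<beta> i)\<^sup>2" for i by (simp add: q_def ab power_mult_distrib)
    then show ?thesis by (simp add: algebra_simps)
  qed
  \<comment> \<open>Shifting \<open>q (Suc i)\<close> back to \<open>q i\<close> loses
    \<open>q 1\<close>, since \<open>q (Suc n) = 0\<close>. This term is the corner entry of
    \<open>incr_cov_deriv\<close>.\<close>
  also have "\<dots> = (\<Sum>i=1..n. (1 / n - \<theta>) * ((\<alpha> i)\<^sup>2 + 2 * \<rho> * \<alpha> i * \<beta> i + (\<beta> i)\<^sup>2) + \<theta> * ((\<alpha> i)\<^sup>2 + 2 * \<rho> * \<alpha> i * \<beta> (Suc i)) + \<theta> * q i) - \<theta> * q 1"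
  proof -
    have "(\<Sum>i=1..n. q (Suc i)) = (\<Sum>i=1..n. q i) - q 1"
      unfolding sum_shift by (simp add: q_def u_def)
    then show ?thesis
      unfolding sum.distrib sum_distrib_left[symmetric] by (simp only: right_diff_distrib add_diff_eq)
  qed
  also have "\<dots> = (\<Sum>i=1..n. ((1 + \<rho>) * (u 1 i)\<^sup>2 + (1 - \<rho>) * (u (-1) i)\<^sup>2)
      + n * \<theta> * (\<rho> * (u 1 i + u (-1) i) * ((u 1 (Suc i) - u (-1) (Suc i)) - (u 1 i - u (-1) i)))) - n * \<theta> * ((u 1 1 - u (-1) 1)\<^sup>2 / 2)"
  proof (intro arg_cong2[where f = "(-)"] sum.cong refl)
    fix i
    define c where "c = sqrt (n / 2)"
    have cc: "c * c = n / 2" by (simp add: c_def)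
    have A: "(\<alpha> i)\<^sup>2 = n / 2 * (u 1 i + u (-1) i)\<^sup>2" "(\<beta> i)\<^sup>2 = q i"
      by (simp_all add: ab power_mult_distrib q_def)
    have B: "\<alpha> i * \<beta> k = n / 2 * ((u 1 i + u (-1) i) * (u 1 k - u (-1) k))" for k
    proof -
      have "\<alpha> i * \<beta> k = c * c * ((u 1 i + u (-1) i) * (u 1 k - u (-1) k))"
        unfolding ab c_def[symmetric] by (simp only: ac_simps)
      then show ?thesis unfolding cc .
    qed
    have "(1 / n - \<theta>) * ((\<alpha> i)\<^sup>2 + 2 * \<rho> * \<alpha> i * \<beta> i + (\<beta> i)\<^sup>2) + \<theta> * ((\<alpha> i)\<^sup>2 + 2 * \<rho> * \<alpha> i * \<beta> (Suc i)) + \<theta> * q i =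
        1 / n * ((\<alpha> i)\<^sup>2 + 2 * \<rho> * (\<alpha> i * \<beta> i) + q i) + \<theta> * (2 * \<rho> * (\<alpha> i * \<beta> (Suc i) - \<alpha> i * \<beta> i))"
      unfolding A(2) by (simp add: algebra_simps)
    also have "\<dots> = ((1 + \<rho>) * (u 1 i)\<^sup>2 + (1 - \<rho>) * (u (-1) i)\<^sup>2)
        + n * \<theta> * (\<rho> * (u 1 i + u (-1) i) * ((u 1 (Suc i) - u (-1) (Suc i)) - (u 1 i - u (-1) i)))"
    proof -
      have "1 / n * ((\<alpha> i)\<^sup>2 + 2 * \<rho> * (\<alpha> i * \<beta> i) + q i) = (1 + \<rho>) * (u 1 i)\<^sup>2 + (1 - \<rho>) * (u (-1) i)\<^sup>2"
        unfolding A B q_def using n by (simp add: field_simps power2_eq_square)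
      moreover have "\<theta> * (2 * \<rho> * (\<alpha> i * \<beta> (Suc i) - \<alpha> i * \<beta> i)) = n * \<theta> * (\<rho> * (u 1 i + u (-1) i) * ((u 1 (Suc i) - u (-1) (Suc i)) - (u 1 i - u (-1) i)))"
        unfolding B by (simp add: algebra_simps)
      ultimately show ?thesis by simp
    qed
    finally show "(1 / n - \<theta>) * ((\<alpha> i)\<^sup>2 + 2 * \<rho> * \<alpha> i * \<beta> i + (\<beta> i)\<^sup>2) + \<theta> * ((\<alpha> i)\<^sup>2 + 2 * \<rho> * \<alpha> i * \<beta> (Suc i)) + \<theta> * q i =
        ((1 + \<rho>) * (u 1 i)\<^sup>2 + (1 - \<rho>) * (u (-1) i)\<^sup>2)
        + n * \<theta> * (\<rho> * (u 1 i + u (-1) i) * ((u 1 (Suc i) - u (-1) (Suc i)) - (u 1 i - u (-1) i)))" .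
  qed (simp add: q_def)
  finally have Q: "(\<Sum>j<2 * n. (grid n \<theta> (Suc j) - grid n \<theta> j) * ((\<alpha> (Suc (j div 2)))\<^sup>2 + 2 * \<rho> * \<alpha> (Suc (j div 2)) * \<beta> (Suc (Suc j div 2)) + (\<beta> (Suc (Suc j div 2)))\<^sup>2)) =
      (\<Sum>i=1..n. ((1 + \<rho>) * (u 1 i)\<^sup>2 + (1 - \<rho>) * (u (-1) i)\<^sup>2)
      + n * \<theta> * (\<rho> * (u 1 i + u (-1) i) * ((u 1 (Suc i) - u (-1) (Suc i)) - (u 1 i - u (-1) i)))) - n * \<theta> * ((u 1 1 - u (-1) 1)\<^sup>2 / 2)" .
  have V: "(\<Sum>i=1..n. (sqrt v * (\<alpha> i - \<alpha> (Suc i)))\<^sup>2 + (sqrt v * (\<beta> i - \<beta> (Suc i)))\<^sup>2) =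
      (\<Sum>i=1..n. n * v * ((u 1 i - u 1 (Suc i))\<^sup>2 + (u (-1) i - u (-1) (Suc i))\<^sup>2))"
  proof (intro sum.cong refl)
    fix i
    show "(sqrt v * (\<alpha> i - \<alpha> (Suc i)))\<^sup>2 + (sqrt v * (\<beta> i - \<beta> (Suc i)))\<^sup>2 = n * v * ((u 1 i - u 1 (Suc i))\<^sup>2 + (u (-1) i - u (-1) (Suc i))\<^sup>2)"
      unfolding ab right_diff_distrib[symmetric] power_mult_distrib c2 using v by (simp add: power2_eq_square algebra_simps)
  qed
  have "(\<Sum>a\<in>obs_index n. \<Sum>b\<in>obs_index n. (incr_cov \<rho> (n * v) a b + (n * \<theta>) * incr_cov_deriv \<rho> a b) * (t a * t b)) =
      (\<Sum>a\<in>obs_index n. \<Sum>b\<in>obs_index n. incr_cov \<rho> (n * v) a b * (t a * t b)) +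
      n * \<theta> * (\<Sum>a\<in>obs_index n. \<Sum>b\<in>obs_index n. incr_cov_deriv \<rho> a b * (t a * t b))"
    by (simp only: distrib_right sum.distrib sum_distrib_left mult.assoc)
  also have "\<dots> = (\<Sum>s\<in>{1,-1}. \<Sum>i=1..n. (1 + s * \<rho>) * (u s i)\<^sup>2 + (n * v) * (u s i - u s (Suc i))\<^sup>2) +
      n * \<theta> * ((\<Sum>i=1..n. \<rho> * (u 1 i + u (-1) i) * ((u 1 (Suc i) - u (-1) (Suc i)) - (u 1 i - u (-1) i))) - (u 1 1 - u (-1) 1)\<^sup>2 / 2)"
    unfolding quadratic_form_incr_cov[OF n] quadratic_form_incr_cov_deriv[OF n] u_def[symmetric] ..
  also have "\<dots> = (\<Sum>i=1..n. ((1 + \<rho>) * (u 1 i)\<^sup>2 + (1 - \<rho>) * (u (-1) i)\<^sup>2)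
      + n * \<theta> * (\<rho> * (u 1 i + u (-1) i) * ((u 1 (Suc i) - u (-1) (Suc i)) - (u 1 i - u (-1) i)))) - n * \<theta> * ((u 1 1 - u (-1) 1)\<^sup>2 / 2)
      + (\<Sum>i=1..n. n * v * ((u 1 i - u 1 (Suc i))\<^sup>2 + (u (-1) i - u (-1) (Suc i))\<^sup>2))"
  proof -
    define R where "R i = \<rho> * (u 1 i + u (-1) i) * ((u 1 (Suc i) - u (-1) (Suc i)) - (u 1 i - u (-1) i))" for i
    show ?thesis
      unfolding R_def[symmetric] by (simp add: sum.distrib sum_distrib_left[symmetric] right_diff_distrib)
  qed
  finally show ?thesis unfolding Q V by simp
qed

text \<open>The normalised increments of the observations, with the sums and the differences of the two
  components as coordinates. The flag says which of the two components comes first.\<close>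

definition obs_block :: "nat \<Rightarrow> bool \<Rightarrow> (nat \<Rightarrow> real) \<Rightarrow> nat \<Rightarrow> real" where
  "obs_block n f x i = x (if f then i else n + i)"

definition obs_incr :: "nat \<Rightarrow> bool \<Rightarrow> (nat \<Rightarrow> real) \<Rightarrow> real \<times> nat \<Rightarrow> real" where
  "obs_incr n f x = (\<lambda>a\<in>obs_index n. sqrt (n / 2) *
     ((obs_block n f x (snd a) - of_bool (snd a \<noteq> 1) * obs_block n f x (snd a - 1))
      + fst a * (obs_block n (\<not> f) x (snd a) - of_bool (snd a \<noteq> 1) * obs_block n (\<not> f) x (snd a - 1))))"

text \<open>The inverse of \<open>obs_incr\<close>: a half-sum or half-difference recovers the
  increments of one component, partial sums recover its values. The factor
  \<open>sqrt (2 * n)\<close> is twice \<open>sqrt (n / 2)\<close>.\<close>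

definition obs_of_incr :: "nat \<Rightarrow> bool \<Rightarrow> (real \<times> nat \<Rightarrow> real) \<Rightarrow> nat \<Rightarrow> real" where
  "obs_of_incr n f z = (\<lambda>j\<in>{1..2 * n}. \<Sum>k=1..(if j \<le> n then j else j - n).
     (z (1, k) + (if (j \<le> n) = f then 1 else -1) * z (-1, k)) / sqrt (2 * n))"

lemma sum_increments:
  fixes x :: "nat \<Rightarrow> real"
  shows "(\<Sum>k=1..i. (x k - of_bool (k \<noteq> 1) * x (k - 1))) = of_bool (i \<noteq> 0) * x i"
  by (induction i) auto

text \<open>No information is lost by passing to increments, so an estimator may be regarded as a
  function of them with the same risk.\<close>

lemma obs_of_incr_obs_incr:
  assumes x: "x \<in> space (euclid (2 * n))"
  shows "obs_of_incr n f (obs_incr n f x) = x"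
proof (rule ext)
  fix j
  show "obs_of_incr n f (obs_incr n f x) j = x j"
  proof (cases "j \<in> {1..2 * n}")
    case False
    then show ?thesis using x by (auto simp: obs_of_incr_def euclid_def space_PiM PiE_def extensional_def)
  next
    case j: True
    then have n: "n > 0" by auto
    define i where "i = (if j \<le> n then j else j - n)"
    define b where "b = ((j \<le> n) = f)"
    define y where "y = obs_block n (j \<le> n) x"
    have i: "i \<in> {1..n}" using j by (auto simp: i_def)
    have s: "sqrt (real n / 2) * 2 / sqrt (2 * real n) = 1"
      using n by (simp add: real_sqrt_divide real_sqrt_mult)
    have e: "(obs_incr n f x (1, k) + (if b then 1 else -1) * obs_incr n f x (-1, k)) / sqrt (2 * n) = y k - of_bool (k \<noteq> 1) * y (k - 1)"
      if k: "k \<in> {1..n}" for k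
    proof -
      have "obs_incr n f x (1, k) + (if b then 1 else -1) * obs_incr n f x (-1, k) = sqrt (n / 2) * (2 * (y k - of_bool (k \<noteq> 1) * y (k - 1)))"
        using k by (cases "j \<le> n"; cases f) (auto simp: obs_incr_def obs_index_def b_def y_def algebra_simps)
      then have "(obs_incr n f x (1, k) + (if b then 1 else -1) * obs_incr n f x (-1, k)) / sqrt (2 * n) =
          (sqrt (real n / 2) * 2 / sqrt (2 * real n)) * (y k - of_bool (k \<noteq> 1) * y (k - 1))" by simp
      then show ?thesis unfolding s by simp
    qed
    have "obs_of_incr n f (obs_incr n f x) j = (\<Sum>k=1..i. (obs_incr n f x (1, k) + (if b then 1 else -1) * obs_incr n f x (-1, k)) / sqrt (2 * n))"
      using j by (simp add: obs_of_incr_def i_def b_def)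
    also have "\<dots> = (\<Sum>k=1..i. y k - of_bool (k \<noteq> 1) * y (k - 1))"
      using i by (intro sum.cong refl e) auto
    also have "\<dots> = y i" unfolding sum_increments using i by auto
    also have "y i = x j" using j by (auto simp: y_def i_def obs_block_def)
    finally show ?thesis .
  qed
qed

lemma measurable_obs_incr: "obs_incr n f \<in> measurable (euclid (2 * n)) (\<Pi>\<^sub>M a\<in>obs_index n. borel)"
  unfolding obs_incr_def
proof (rule measurable_restrict)
  fix a assume a: "a \<in> obs_index n"
  have c: "(\<lambda>x. x j) \<in> borel_measurable (euclid (2 * n))" if "j \<in> {1..2 * n}" for j
    unfolding euclid_def using that by (rule measurable_component_singleton)
  have b: "(\<lambda>x. obs_block n f x i) \<in> borel_measurable (euclid (2 * n))" if "i \<in> {1..n}" for f i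
    unfolding obs_block_def using that by (intro c) auto
  have b': "(\<lambda>x. of_bool (i \<noteq> 1) * obs_block n f x (i - 1)) \<in> borel_measurable (euclid (2 * n))" if "i \<in> {1..n}" for f i
  proof (cases "i = 1")
    case False
    then show ?thesis using that by (auto intro!: b)
  qed simp
  show "(\<lambda>x. sqrt (n / 2) * ((obs_block n f x (snd a) - of_bool (snd a \<noteq> 1) * obs_block n f x (snd a - 1))
      + fst a * (obs_block n (\<not> f) x (snd a) - of_bool (snd a \<noteq> 1) * obs_block n (\<not> f) x (snd a - 1)))) \<in> borel_measurable (euclid (2 * n))"
    using a by (intro borel_measurable_add borel_measurable_diff borel_measurable_times borel_measurable_const b b') (auto simp: obs_index_def)
qed

lemma measurable_obs_of_incr: "obs_of_incr n f \<in> measurable (\<Pi>\<^sub>M a\<in>obs_index n. borel) (euclid (2 * n))"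
  unfolding obs_of_incr_def euclid_def
proof (rule measurable_restrict)
  fix j assume j: "j \<in> {1..2 * n}"
  have c: "(\<lambda>z. z a) \<in> borel_measurable (\<Pi>\<^sub>M a\<in>obs_index n. borel)" if "a \<in> obs_index n" for a
    using that by (rule measurable_component_singleton)
  show "(\<lambda>z. \<Sum>k=1..(if j \<le> n then j else j - n). (z (1, k) + (if (j \<le> n) = f then 1 else -1) * z (-1, k)) / sqrt (2 * n))
      \<in> borel_measurable (\<Pi>\<^sub>M a\<in>obs_index n. borel)"
    using j by (intro borel_measurable_sum borel_measurable_add borel_measurable_divide borel_measurable_times borel_measurable_const c)
      (auto simp: obs_index_def split: if_splits)
qed

text \<open>\<open>F\<close> and \<open>G\<close> are the leading and the lagged component along the
  merged grid, read at even and at odd points. Their increments are split into grid increments, and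
  the noise is summed by parts; the result is a combination of independent variables.\<close>

lemma linear_functional_obs_incr:
  fixes t :: "real \<times> nat \<Rightarrow> real" and n :: nat and F G e1 e2 :: "nat \<Rightarrow> real"
  assumes n: "n \<ge> 1" and F0: "F 0 = 0" "G 0 = 0"
    and x: "\<And>i. i \<in> {1..n} \<Longrightarrow> obs_block n f x i = F (2 * i) + s * e1 i"
       "\<And>i. i \<in> {1..n} \<Longrightarrow> obs_block n (\<not> f) x i = G (2 * i - 1) + s * e2 i"
  defines "\<alpha> \<equiv> \<lambda>i. sqrt (n / 2) * of_bool (1 \<le> i \<and> i \<le> n) * (t (1, i) + t (-1, i))"
    and "\<beta> \<equiv> \<lambda>i. sqrt (n / 2) * of_bool (1 \<le> i \<and> i \<le> n) * (t (1, i) - t (-1, i))"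
  shows "(\<Sum>a\<in>obs_index n. t a * obs_incr n f x a) =
    (\<Sum>j<2 * n. \<alpha> (Suc (j div 2)) * (F (Suc j) - F j) + \<beta> (Suc (Suc j div 2)) * (G (Suc j) - G j)) +
    (\<Sum>i=1..n. s * (\<alpha> i - \<alpha> (Suc i)) * e1 i + s * (\<beta> i - \<beta> (Suc i)) * e2 i)"
proof -
  have an: "\<alpha> (Suc n) = 0" "\<beta> (Suc n) = 0" by (simp_all add: \<alpha>_def \<beta>_def)
  have "(\<Sum>a\<in>obs_index n. t a * obs_incr n f x a) =
      (\<Sum>i=1..n. \<alpha> i * (obs_block n f x i - of_bool (i \<noteq> 1) * obs_block n f x (i - 1))
        + \<beta> i * (obs_block n (\<not> f) x i - of_bool (i \<noteq> 1) * obs_block n (\<not> f) x (i - 1)))"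
  proof -
    have "(\<Sum>a\<in>obs_index n. t a * obs_incr n f x a) = (\<Sum>i=1..n. t (1, i) * obs_incr n f x (1, i) + t (-1, i) * obs_incr n f x (-1, i))"
      unfolding sum_obs_index by (simp add: sum.distrib)
    also have "\<dots> = (\<Sum>i=1..n. \<alpha> i * (obs_block n f x i - of_bool (i \<noteq> 1) * obs_block n f x (i - 1))
        + \<beta> i * (obs_block n (\<not> f) x i - of_bool (i \<noteq> 1) * obs_block n (\<not> f) x (i - 1)))"
    proof (rule sum.cong[OF refl])
      fix i assume i: "i \<in> {1..n}"
      define P where "P = obs_block n f x i - of_bool (i \<noteq> 1) * obs_block n f x (i - 1)"
      define Q where "Q = obs_block n (\<not> f) x i - of_bool (i \<noteq> 1) * obs_block n (\<not> f) x (i - 1)"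
      have "obs_incr n f x (1, i) = sqrt (n / 2) * (P + 1 * Q)" "obs_incr n f x (-1, i) = sqrt (n / 2) * (P + (-1) * Q)"
        using i by (simp_all only: obs_incr_def P_def Q_def fst_conv snd_conv) (simp_all add: obs_index_def)
      moreover have "\<alpha> i = sqrt (n / 2) * (t (1, i) + t (-1, i))" "\<beta> i = sqrt (n / 2) * (t (1, i) - t (-1, i))"
        using i by (simp_all add: \<alpha>_def \<beta>_def)
      ultimately show "t (1, i) * obs_incr n f x (1, i) + t (-1, i) * obs_incr n f x (-1, i) = \<alpha> i * (obs_block n f x i - of_bool (i \<noteq> 1) * obs_block n f x (i - 1))
          + \<beta> i * (obs_block n (\<not> f) x i - of_bool (i \<noteq> 1) * obs_block n (\<not> f) x (i - 1))"
        unfolding P_def[symmetric] Q_def[symmetric] by (simp only:) (simp add: algebra_simps)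
    qed
    finally show ?thesis .
  qed
  also have "\<dots> = (\<Sum>i=1..n. \<alpha> i * (F (2 * i) - F (2 * i - 2)) + s * (\<alpha> i * (e1 i - of_bool (i \<noteq> 1) * e1 (i - 1)))
      + \<beta> i * (G (2 * i - 1) - G (if i = 1 then 0 else 2 * i - 3)) + s * (\<beta> i * (e2 i - of_bool (i \<noteq> 1) * e2 (i - 1))))"
  proof (rule sum.cong[OF refl])
    fix i assume i: "i \<in> {1..n}"
    show "\<alpha> i * (obs_block n f x i - of_bool (i \<noteq> 1) * obs_block n f x (i - 1))
        + \<beta> i * (obs_block n (\<not> f) x i - of_bool (i \<noteq> 1) * obs_block n (\<not> f) x (i - 1)) =
        \<alpha> i * (F (2 * i) - F (2 * i - 2)) + s * (\<alpha> i * (e1 i - of_bool (i \<noteq> 1) * e1 (i - 1)))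
      + \<beta> i * (G (2 * i - 1) - G (if i = 1 then 0 else 2 * i - 3)) + s * (\<beta> i * (e2 i - of_bool (i \<noteq> 1) * e2 (i - 1)))"
    proof (cases "i = 1")
      case True
      then show ?thesis using i F0 by (simp add: x algebra_simps)
    next
      case False
      then have "i - 1 \<in> {1..n}" using i by auto
      moreover have "2 * (i - 1) = 2 * i - 2" "2 * i - 2 - 1 = 2 * i - 3" by auto
      ultimately show ?thesis using i False by (simp add: x algebra_simps)
    qed
  qed
  also have "\<dots> = (\<Sum>i=1..n. \<alpha> i * (F (2 * i) - F (2 * i - 2))) + s * (\<Sum>i=1..n. \<alpha> i * (e1 i - of_bool (i \<noteq> 1) * e1 (i - 1)))
      + (\<Sum>i=1..n. \<beta> i * (G (2 * i - 1) - G (if i = 1 then 0 else 2 * i - 3))) + s * (\<Sum>i=1..n. \<beta> i * (e2 i - of_bool (i \<noteq> 1) * e2 (i - 1)))"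
    by (simp only: sum.distrib sum_distrib_left)
  also have "\<dots> = (\<Sum>j<2 * n. \<alpha> (Suc (j div 2)) * (F (Suc j) - F j)) + s * (\<Sum>i=1..n. (\<alpha> i - \<alpha> (Suc i)) * e1 i)
      + (\<Sum>j<2 * n. \<beta> (Suc (Suc j div 2)) * (G (Suc j) - G j)) + s * (\<Sum>i=1..n. (\<beta> i - \<beta> (Suc i)) * e2 i)"
    unfolding sum_by_parts[where \<alpha> = \<alpha>, OF an(1)] sum_by_parts[where \<alpha> = \<beta>, OF an(2)] sum_grid_coarse sum_grid_lagged an by simp
  also have "\<dots> = (\<Sum>j<2 * n. \<alpha> (Suc (j div 2)) * (F (Suc j) - F j) + \<beta> (Suc (Suc j div 2)) * (G (Suc j) - G j)) +
    (\<Sum>i=1..n. s * (\<alpha> i - \<alpha> (Suc i)) * e1 i + s * (\<beta> i - \<beta> (Suc i)) * e2 i)"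
    by (simp add: sum.distrib sum_distrib_left mult.assoc)
  finally show ?thesis .
qed

text \<open>For a lag smaller than the mesh, the covariance of the normalised increments is affine in the lag.\<close>

lemma char_obs_incr:
  assumes M: "prob_space M" and B: "two_sided_brownian_motion M 1 \<rho> 1 B"
    and eps: "iid_standard_normal2 M eps" and ind: "independent_of_noise M B eps"
    and n: "n \<ge> 1" and v: "v n \<ge> 0" and \<theta>: "\<theta> \<noteq> 0" "\<bar>\<theta>\<bar> < 1 / n"
  defines "\<mu> \<equiv> distr (obs_law M B eps v n \<theta>) (\<Pi>\<^sub>M a\<in>obs_index n. borel) (obs_incr n (\<theta> > 0))"
  shows "finite_measure \<mu>" and "sets \<mu> = sets (\<Pi>\<^sub>M a\<in>obs_index n. borel)"
    and "(CLINT z|\<mu>. iexp (\<Sum>a\<in>obs_index n. t a * z a)) =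
      of_real (exp (- (\<Sum>a\<in>obs_index n. \<Sum>b\<in>obs_index n. (incr_cov \<rho> (n * v n) a b + (n * \<bar>\<theta>\<bar>) * incr_cov_deriv \<rho> a b) * (t a * t b)) / 2))"
    and "T \<in> borel_measurable (euclid (2 * n)) \<Longrightarrow>
      mse (obs_law M B eps v n \<theta>) T c = (\<integral>\<^sup>+ z. ennreal ((T (obs_of_incr n (\<theta> > 0) z) - c)\<^sup>2) \<partial>\<mu>)"
proof -
  interpret prob_space M by fact
  define x where "x \<omega> = (\<lambda>i\<in>{1..2 * n}. if i \<le> n then obs_X B eps v n \<theta> i \<omega> else obs_Y B eps v n \<theta> (i - n) \<omega>)" for \<omega>
  have [measurable]: "B t \<in> borel_measurable M" for t
    using B by (simp add: two_sided_brownian_motion_def)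
  have "indep_vars (\<lambda>_. borel) eps {1..}"
    using eps by (simp add: iid_standard_normal2_def)
  then have em: "eps i \<in> borel_measurable M" if "i \<ge> 1" for i
    using that by (auto simp: indep_vars_def)
  have fs: "fst \<in> borel_measurable (borel :: (real \<times> real) measure)" "snd \<in> borel_measurable (borel :: (real \<times> real) measure)"
    by (intro borel_measurable_continuous_onI continuous_intros)+
  have mx: "x \<in> measurable M (euclid (2 * n))"
    unfolding x_def[abs_def] euclid_def
  proof (rule measurable_restrict)
    fix i assume i: "i \<in> {1..2 * n}"
    show "(\<lambda>\<omega>. if i \<le> n then obs_X B eps v n \<theta> i \<omega> else obs_Y B eps v n \<theta> (i - n) \<omega>) \<in> borel_measurable M"
    proof (cases "i \<le> n")
      case True
      have "(\<lambda>\<omega>. obs_X B eps v n \<theta> i \<omega>) \<in> borel_measurable M"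
        unfolding obs_X_def using i
        by (intro borel_measurable_add borel_measurable_times borel_measurable_const measurable_compose[OF _ fs(1)] em) (auto simp: eta_contract_eq)
      then show ?thesis using True by simp
    next
      case False
      have "(\<lambda>\<omega>. obs_Y B eps v n \<theta> (i - n) \<omega>) \<in> borel_measurable M"
        unfolding obs_Y_def using i False
        by (intro borel_measurable_add borel_measurable_times borel_measurable_const measurable_compose[OF _ fs(2)] em) (auto simp: eta_contract_eq)
      then show ?thesis using False by simp
    qed
  qed
  have law: "obs_law M B eps v n \<theta> = distr M (euclid (2 * n)) x"
    unfolding obs_law_def x_def ..
  note mi = measurable_obs_incr[of n "\<theta> > 0"]
  have mu: "\<mu> = distr M (\<Pi>\<^sub>M a\<in>obs_index n. borel) (\<lambda>\<omega>. obs_incr n (\<theta> > 0) (x \<omega>))"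
    unfolding \<mu>_def law by (subst distr_distr[OF mi mx]) (simp add: o_def)
  have mix: "(\<lambda>\<omega>. obs_incr n (\<theta> > 0) (x \<omega>)) \<in> measurable M (\<Pi>\<^sub>M a\<in>obs_index n. borel)"
    by (rule measurable_compose[OF mx mi])
  show "finite_measure \<mu>"
    unfolding mu using prob_space_distr[OF mix] by (simp add: prob_space_def)
  show "sets \<mu> = sets (\<Pi>\<^sub>M a\<in>obs_index n. borel)"
    unfolding \<mu>_def by simp
  define \<tau> where "\<tau> = grid n \<bar>\<theta>\<bar>"
  have \<tau>: "strict_mono \<tau>" unfolding \<tau>_def by (rule strict_mono_grid) (use \<theta> in auto)
  have \<tau>e: "\<tau> (2 * i) = real i / n" "i \<ge> 1 \<Longrightarrow> \<tau> (2 * i - 1) = real i / n - \<bar>\<theta>\<bar>" for i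
  proof -
    show "\<tau> (2 * i) = real i / n" by (simp add: \<tau>_def grid_simps)
    assume "i \<ge> 1"
    then obtain m where "i = Suc m" by (cases i) auto
    then have "2 * i - 1 = Suc (2 * m)" "i = Suc m" by auto
    then show "\<tau> (2 * i - 1) = real i / n - \<bar>\<theta>\<bar>" by (simp only: \<tau>_def grid_simps)
  qed
  have \<tau>0: "\<tau> 0 = 0" by (simp add: \<tau>_def grid_def)
  define \<alpha> where "\<alpha> i = sqrt (n / 2) * of_bool (1 \<le> i \<and> i \<le> n) * (t (1, i) + t (-1, i))" for i
  define \<beta> where "\<beta> i = sqrt (n / 2) * of_bool (1 \<le> i \<and> i \<le> n) * (t (1, i) - t (-1, i))" for i
  have Q: "(\<Sum>j<2 * n. (\<tau> (Suc j) - \<tau> j) * ((\<alpha> (Suc (j div 2)))\<^sup>2 + 2 * \<rho> * \<alpha> (Suc (j div 2)) * \<beta> (Suc (Suc j div 2)) + (\<beta> (Suc (Suc j div 2)))\<^sup>2))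
      + (\<Sum>i=1..n. (sqrt (v n) * (\<alpha> i - \<alpha> (Suc i)))\<^sup>2 + (sqrt (v n) * (\<beta> i - \<beta> (Suc i)))\<^sup>2) =
    (\<Sum>a\<in>obs_index n. \<Sum>b\<in>obs_index n. (incr_cov \<rho> (n * v n) a b + (n * \<bar>\<theta>\<bar>) * incr_cov_deriv \<rho> a b) * (t a * t b))"
    unfolding \<tau>_def \<alpha>_def \<beta>_def by (rule grid_quadratic_form[OF n v])
  have mt: "(\<lambda>z. iexp (\<Sum>a\<in>obs_index n. t a * z a)) \<in> borel_measurable (\<Pi>\<^sub>M a\<in>obs_index n. borel)"
    by measurable
  have "(CLINT z|\<mu>. iexp (\<Sum>a\<in>obs_index n. t a * z a)) = (CLINT \<omega>|M. iexp (\<Sum>a\<in>obs_index n. t a * obs_incr n (\<theta> > 0) (x \<omega>) a))"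
    unfolding mu by (rule integral_distr[OF mix mt])
  also have "\<dots> = of_real (exp (- ((\<Sum>j<2 * n. (\<tau> (Suc j) - \<tau> j) * ((\<alpha> (Suc (j div 2)))\<^sup>2 + 2 * \<rho> * \<alpha> (Suc (j div 2)) * \<beta> (Suc (Suc j div 2)) + (\<beta> (Suc (Suc j div 2)))\<^sup>2))
      + (\<Sum>i=1..n. (sqrt (v n) * (\<alpha> i - \<alpha> (Suc i)))\<^sup>2 + (sqrt (v n) * (\<beta> i - \<beta> (Suc i)))\<^sup>2)) / 2))"
  proof -
    \<comment> \<open>The first increment starts at time 0, where the process vanishes only almost
      surely.\<close>
    have AE0: "AE \<omega> in M. B 0 \<omega> = 0" using B by (simp add: two_sided_brownian_motion_def)
    have m1: "(\<lambda>\<omega>. iexp (\<Sum>a\<in>obs_index n. t a * obs_incr n (\<theta> > 0) (x \<omega>) a)) \<in> borel_measurable M"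
      by (rule measurable_compose[OF mix mt])
    have m2: "(\<lambda>\<omega>. iexp ((\<Sum>j<2 * n. p j * (fst (B (\<tau> (Suc j)) \<omega>) - fst (B (\<tau> j) \<omega>)) + q j * (snd (B (\<tau> (Suc j)) \<omega>) - snd (B (\<tau> j) \<omega>))) +
        (\<Sum>i=1..n. c i * fst (eps i \<omega>) + d i * snd (eps i \<omega>)))) \<in> borel_measurable M" for p q c d
    proof -
      have f: "(\<lambda>\<omega>. fst (B s \<omega>)) \<in> borel_measurable M" "(\<lambda>\<omega>. snd (B s \<omega>)) \<in> borel_measurable M" for s
        by (intro measurable_compose[OF _ fs(1)] measurable_compose[OF _ fs(2)]; simp)+
      have g: "(\<lambda>\<omega>. fst (eps i \<omega>)) \<in> borel_measurable M" "(\<lambda>\<omega>. snd (eps i \<omega>)) \<in> borel_measurable M" if "i \<in> {1..n}" for i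
        using that by (intro measurable_compose[OF _ fs(1)] measurable_compose[OF _ fs(2)] em; simp)+
      have "(\<lambda>\<omega>. (\<Sum>j<2 * n. p j * (fst (B (\<tau> (Suc j)) \<omega>) - fst (B (\<tau> j) \<omega>)) + q j * (snd (B (\<tau> (Suc j)) \<omega>) - snd (B (\<tau> j) \<omega>))) +
        (\<Sum>i=1..n. c i * fst (eps i \<omega>) + d i * snd (eps i \<omega>))) \<in> borel_measurable M"
        by (intro borel_measurable_add borel_measurable_sum borel_measurable_times borel_measurable_diff borel_measurable_const f g)
      then show ?thesis by measurable
    qed
    note ch = char_increments_noise[OF M B eps ind \<tau>]
    show ?thesis
    proof (cases "\<theta> > 0")
      case True
      have "AE \<omega> in M. (\<Sum>a\<in>obs_index n. t a * obs_incr n (\<theta> > 0) (x \<omega>) a) =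
          (\<Sum>j<2 * n. \<alpha> (Suc (j div 2)) * (fst (B (\<tau> (Suc j)) \<omega>) - fst (B (\<tau> j) \<omega>)) + \<beta> (Suc (Suc j div 2)) * (snd (B (\<tau> (Suc j)) \<omega>) - snd (B (\<tau> j) \<omega>))) +
          (\<Sum>i=1..n. sqrt (v n) * (\<alpha> i - \<alpha> (Suc i)) * fst (eps i \<omega>) + sqrt (v n) * (\<beta> i - \<beta> (Suc i)) * snd (eps i \<omega>))"
        using AE0
      proof eventually_elim
        case (elim \<omega>)
        show ?case
          unfolding \<alpha>_def \<beta>_def
          by (rule linear_functional_obs_incr[OF n]) (use elim \<tau>0 \<tau>e True in \<open>auto simp: obs_block_def x_def obs_X_def obs_Y_def\<close>)
      qed
      then have "(CLINT \<omega>|M. iexp (\<Sum>a\<in>obs_index n. t a * obs_incr n (\<theta> > 0) (x \<omega>) a)) =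
          (CLINT \<omega>|M. iexp ((\<Sum>j<2 * n. \<alpha> (Suc (j div 2)) * (fst (B (\<tau> (Suc j)) \<omega>) - fst (B (\<tau> j) \<omega>)) + \<beta> (Suc (Suc j div 2)) * (snd (B (\<tau> (Suc j)) \<omega>) - snd (B (\<tau> j) \<omega>))) +
          (\<Sum>i=1..n. sqrt (v n) * (\<alpha> i - \<alpha> (Suc i)) * fst (eps i \<omega>) + sqrt (v n) * (\<beta> i - \<beta> (Suc i)) * snd (eps i \<omega>))))"
        by (intro integral_cong_AE m1 m2) (erule eventually_mono, simp only:)
      then show ?thesis unfolding ch .
    next
      case False
      then have neg: "\<theta> < 0" using \<theta> by simp
      \<comment> \<open>For a negative lag the first component is the lagged one. The flag then
        exchanges the two blocks, and the covariance is symmetric in the two components.\<close>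
      have "AE \<omega> in M. (\<Sum>a\<in>obs_index n. t a * obs_incr n (\<theta> > 0) (x \<omega>) a) =
          (\<Sum>j<2 * n. \<alpha> (Suc (j div 2)) * (snd (B (\<tau> (Suc j)) \<omega>) - snd (B (\<tau> j) \<omega>)) + \<beta> (Suc (Suc j div 2)) * (fst (B (\<tau> (Suc j)) \<omega>) - fst (B (\<tau> j) \<omega>))) +
          (\<Sum>i=1..n. sqrt (v n) * (\<alpha> i - \<alpha> (Suc i)) * snd (eps i \<omega>) + sqrt (v n) * (\<beta> i - \<beta> (Suc i)) * fst (eps i \<omega>))"
        using AE0
      proof eventually_elim
        case (elim \<omega>)
        show ?case
          unfolding \<alpha>_def \<beta>_def
          by (rule linear_functional_obs_incr[OF n]) (use elim \<tau>0 \<tau>e neg in \<open>auto simp: obs_block_def x_def obs_X_def obs_Y_def\<close>)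
      qed
      then have "AE \<omega> in M. (\<Sum>a\<in>obs_index n. t a * obs_incr n (\<theta> > 0) (x \<omega>) a) =
          (\<Sum>j<2 * n. \<beta> (Suc (Suc j div 2)) * (fst (B (\<tau> (Suc j)) \<omega>) - fst (B (\<tau> j) \<omega>)) + \<alpha> (Suc (j div 2)) * (snd (B (\<tau> (Suc j)) \<omega>) - snd (B (\<tau> j) \<omega>))) +
          (\<Sum>i=1..n. sqrt (v n) * (\<beta> i - \<beta> (Suc i)) * fst (eps i \<omega>) + sqrt (v n) * (\<alpha> i - \<alpha> (Suc i)) * snd (eps i \<omega>))"
        by eventually_elim (simp only: add.commute)
      then have "(CLINT \<omega>|M. iexp (\<Sum>a\<in>obs_index n. t a * obs_incr n (\<theta> > 0) (x \<omega>) a)) =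
          (CLINT \<omega>|M. iexp ((\<Sum>j<2 * n. \<beta> (Suc (Suc j div 2)) * (fst (B (\<tau> (Suc j)) \<omega>) - fst (B (\<tau> j) \<omega>)) + \<alpha> (Suc (j div 2)) * (snd (B (\<tau> (Suc j)) \<omega>) - snd (B (\<tau> j) \<omega>))) +
          (\<Sum>i=1..n. sqrt (v n) * (\<beta> i - \<beta> (Suc i)) * fst (eps i \<omega>) + sqrt (v n) * (\<alpha> i - \<alpha> (Suc i)) * snd (eps i \<omega>))))"
        by (intro integral_cong_AE m1 m2) (erule eventually_mono, simp only:)
      moreover have "a\<^sup>2 + 2 * \<rho> * a * b + b\<^sup>2 = b\<^sup>2 + 2 * \<rho> * b * a + a\<^sup>2" "(c * a)\<^sup>2 + (c * b)\<^sup>2 = (c * b)\<^sup>2 + (c * a)\<^sup>2" for a b c :: real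
        by (simp_all add: algebra_simps)
      ultimately show ?thesis unfolding ch by (simp add: algebra_simps)
    qed
  qed
  finally show "(CLINT z|\<mu>. iexp (\<Sum>a\<in>obs_index n. t a * z a)) =
      of_real (exp (- (\<Sum>a\<in>obs_index n. \<Sum>b\<in>obs_index n. (incr_cov \<rho> (n * v n) a b + (n * \<bar>\<theta>\<bar>) * incr_cov_deriv \<rho> a b) * (t a * t b)) / 2))"
    unfolding Q .
  assume T: "T \<in> borel_measurable (euclid (2 * n))"
  have sp: "space (obs_law M B eps v n \<theta>) = space (euclid (2 * n))" "sets (obs_law M B eps v n \<theta>) = sets (euclid (2 * n))"
    by (simp_all add: obs_law_def)
  have mi': "obs_incr n (\<theta> > 0) \<in> measurable (obs_law M B eps v n \<theta>) (\<Pi>\<^sub>M a\<in>obs_index n. borel)"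
    using mi by (simp add: measurable_cong_sets[OF sp(2) refl])
  have mT: "(\<lambda>z. ennreal ((T (obs_of_incr n (\<theta> > 0) z) - c)\<^sup>2)) \<in> borel_measurable (\<Pi>\<^sub>M a\<in>obs_index n. borel)"
    using measurable_compose[OF measurable_obs_of_incr T, of "\<theta> > 0"] by measurable
  have "(\<integral>\<^sup>+ z. ennreal ((T (obs_of_incr n (\<theta> > 0) z) - c)\<^sup>2) \<partial>\<mu>) =
      (\<integral>\<^sup>+ x. ennreal ((T (obs_of_incr n (\<theta> > 0) (obs_incr n (\<theta> > 0) x)) - c)\<^sup>2) \<partial>obs_law M B eps v n \<theta>)"
    unfolding \<mu>_def by (subst nn_integral_distr[OF mi']) (use mT in simp_all)
  also have "\<dots> = mse (obs_law M B eps v n \<theta>) T c"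
    unfolding mse_def by (intro nn_integral_cong) (simp only: sp obs_of_incr_obs_incr)
  finally show "mse (obs_law M B eps v n \<theta>) T c = (\<integral>\<^sup>+ z. ennreal ((T (obs_of_incr n (\<theta> > 0) z) - c)\<^sup>2) \<partial>\<mu>)" ..
qed

section \<open>The limit experiment\<close>

text \<open>On each half line the exponent of \<open>Z_limit\<close> is a quadratic polynomial in
  \<open>u\<close>, with slope \<open>z1 + z2\<close> on the right and, after reflection,
  \<open>z2 - z1\<close> on the left. All integrals over \<open>Z_limit\<close> reduce to these
  one-sided moments.\<close>

definition half_moment :: "real \<Rightarrow> nat \<Rightarrow> real \<Rightarrow> real" where
  "half_moment K j a = (\<integral>u. indicator {0..} u * (u ^ j * exp (u * a - u\<^sup>2 * K / 2)) \<partial>lborel)"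

text \<open>Completing the square turns the exponential into a multiple of the normal density with
  mean \<open>a / K\<close> and variance \<open>1 / K\<close>.\<close>

lemma integrable_power_exp_quadratic:
  fixes K a :: real
  assumes K: "K > 0"
  shows "integrable lborel (\<lambda>u. u ^ j * exp (u * a - u\<^sup>2 * K / 2))"
proof -
  define \<mu> \<sigma> where "\<mu> = a / K" and "\<sigma> = 1 / sqrt K"
  have \<sigma>: "\<sigma> > 0" using K by (simp add: \<sigma>_def)
  define c where "c = exp (a\<^sup>2 / (2 * K)) * sqrt (2 * pi * \<sigma>\<^sup>2)"
  have e: "exp (u * a - u\<^sup>2 * K / 2) = c * normal_density \<mu> \<sigma> u" for u
  proof -
    have "u * a - u\<^sup>2 * K / 2 = a\<^sup>2 / (2 * K) + - (u - \<mu>)\<^sup>2 / (2 * \<sigma>\<^sup>2)"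
      using K by (simp add: \<mu>_def \<sigma>_def power_divide power2_eq_square field_simps)
    note * = this
    show ?thesis
      unfolding * exp_add c_def normal_density_def using \<sigma> by simp
  qed
  have "u ^ j * exp (u * a - u\<^sup>2 * K / 2) =
      (\<Sum>i\<le>j. (c * of_nat (j choose i) * \<mu> ^ (j - i)) * (normal_density \<mu> \<sigma> u * (u - \<mu>) ^ i))" for u
  proof -
    have "u ^ j = (\<Sum>i\<le>j. of_nat (j choose i) * (u - \<mu>) ^ i * \<mu> ^ (j - i))"
      using binomial_ring[of "u - \<mu>" \<mu> j] by simp
    then show ?thesis
      unfolding e by (simp add: sum_distrib_left sum_distrib_right ac_simps)
  qed
  then show ?thesis
    using integrable_normal_moment[OF \<sigma>, of \<mu>]
    by (auto intro!: Bochner_Integration.integrable_sum integrable_mult_right)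
qed

lemma integrable_half_moment:
  fixes K a :: real
  assumes K: "K > 0"
  shows "integrable lborel (\<lambda>u. indicator {0..} u * (u ^ j * exp (u * a - u\<^sup>2 * K / 2)))"
  using integrable_mult_indicator[OF _ integrable_power_exp_quadratic[OF K, of j a], of "{0..}"]
  by simp

lemma half_moment_pos:
  assumes K: "K > 0"
  shows "0 < half_moment K j a"
proof -
  have "half_moment K j a \<noteq> 0"
  proof
    assume "half_moment K j a = 0"
    then have "AE u in lborel. indicator {0..} u * (u ^ j * exp (u * a - u\<^sup>2 * K / 2)) = 0"
      using integral_nonneg_eq_0_iff_AE[OF integrable_half_moment[OF K, of j a]]
      by (auto simp: half_moment_def indicator_def)
    then have "AE u in lborel. u \<notin> {0<..<1::real}"
      by eventually_elim auto
    then have "emeasure lborel {0<..<1::real} = 0"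
      by (subst (asm) AE_iff_measurable[OF _ refl]) (auto simp: greaterThanLessThan_def greaterThan_def lessThan_def Collect_conj_eq)
    then show False by simp
  qed
  moreover have "0 \<le> half_moment K j a"
    unfolding half_moment_def by (intro integral_nonneg_AE) (auto simp: indicator_def)
  ultimately show ?thesis by simp
qed

lemma half_moment_mono:
  assumes K: "K > 0" and "a \<le> b"
  shows "half_moment K j a \<le> half_moment K j b"
  unfolding half_moment_def
  using assms by (intro integral_mono integrable_half_moment) (auto simp: indicator_def intro!: mult_left_mono)

lemma abs_exp_minus_Taylor2_le: "\<bar>exp x - 1 - x\<bar> \<le> x\<^sup>2 * exp \<bar>x\<bar>" for x :: real
proof -
  obtain t where t: "\<bar>t\<bar> \<le> \<bar>x\<bar>" "exp x = (\<Sum>m<2. x ^ m / fact m) + exp t / fact 2 * x ^ 2"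
    using Maclaurin_exp_le[of x 2] by auto
  then have "exp x - 1 - x = exp t / 2 * x\<^sup>2"
    by (simp add: eval_nat_numeral)
  moreover have "exp t \<le> exp \<bar>x\<bar>" "exp t > 0"
    using t by auto
  moreover have "exp t / 2 * x\<^sup>2 \<le> exp \<bar>x\<bar> * x\<^sup>2"
  proof (intro mult_right_mono)
    show "exp t / 2 \<le> exp \<bar>x\<bar>"
      using \<open>exp t \<le> exp \<bar>x\<bar>\<close> \<open>exp t > 0\<close> by linarith
  qed simp
  moreover have "0 \<le> exp t / 2 * x\<^sup>2" by simp
  ultimately show ?thesis
    by (simp only: abs_of_nonneg mult.commute)
qed

text \<open>Differentiation under the integral by a second-order remainder: for
  \<open>\<bar>h\<bar> \<le> 1\<close> the remainder is at most \<open>h\<^sup>2\<close> times a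
  half moment of order \<open>j + 2\<close> at \<open>a + 1\<close>, where the shift by 1 absorbs
  the exponential of \<open>\<bar>u * h\<bar>\<close>.\<close>

lemma DERIV_half_moment:
  assumes K: "K > 0"
  shows "(half_moment K j has_real_derivative half_moment K (Suc j) a) (at a)"
proof -
  define C where "C = half_moment K (j + 2) (a + 1)"
  let ?f = "\<lambda>j a u. indicator {0..} u * (u ^ j * exp (u * a - u\<^sup>2 * K / 2)) :: real"
  have bound: "\<bar>half_moment K j (a + h) - half_moment K j a - h * half_moment K (Suc j) a\<bar> \<le> h\<^sup>2 * C" if h: "\<bar>h\<bar> \<le> 1" for h
  proof -
    have i: "integrable lborel (?f k b)" for k b
      by (rule integrable_half_moment[OF K])
    have 1: "half_moment K j (a + h) - half_moment K j a - h * half_moment K (Suc j) a =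
        (\<integral>u. ?f j (a + h) u - ?f j a u - h * ?f (Suc j) a u \<partial>lborel)"
      unfolding half_moment_def
      by (simp only: Bochner_Integration.integral_diff[OF Bochner_Integration.integrable_diff[OF i i] integrable_mult_right[OF i]]
         Bochner_Integration.integral_diff[OF i i] integral_mult_right_zero)
    have 2: "\<bar>\<integral>u. ?f j (a + h) u - ?f j a u - h * ?f (Suc j) a u \<partial>lborel\<bar> \<le> (\<integral>u. h\<^sup>2 * ?f (j + 2) (a + 1) u \<partial>lborel)"
    proof (rule integral_abs_bound[THEN order_trans], rule integral_mono)
      fix u :: real
      show "\<bar>?f j (a + h) u - ?f j a u - h * ?f (Suc j) a u\<bar> \<le> h\<^sup>2 * ?f (j + 2) (a + 1) u"
      proof (cases "0 \<le> u")
        case True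
        have 3: "?f j (a + h) u - ?f j a u - h * ?f (Suc j) a u = u ^ j * exp (u * a - u\<^sup>2 * K / 2) * (exp (u * h) - 1 - u * h)"
        proof -
          have "exp (u * (a + h) - u\<^sup>2 * K / 2) = exp (u * a - u\<^sup>2 * K / 2) * exp (u * h)"
            by (simp flip: exp_add add: algebra_simps)
          then show ?thesis
            using True by (simp add: algebra_simps)
        qed
        have "\<bar>u ^ j * exp (u * a - u\<^sup>2 * K / 2) * (exp (u * h) - 1 - u * h)\<bar> \<le> u ^ j * exp (u * a - u\<^sup>2 * K / 2) * ((u * h)\<^sup>2 * exp u)"
          unfolding abs_mult
        proof (intro mult_mono)
          have "\<bar>u * h\<bar> \<le> u"
            using True h by (simp add: abs_mult mult_left_le)
          then have "(u * h)\<^sup>2 * exp \<bar>u * h\<bar> \<le> (u * h)\<^sup>2 * exp u"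
            by (intro mult_left_mono) auto
          then show "\<bar>exp (u * h) - 1 - u * h\<bar> \<le> (u * h)\<^sup>2 * exp u"
            using abs_exp_minus_Taylor2_le[of "u * h"] by linarith
        qed (use True in auto)
        also have "\<dots> = h\<^sup>2 * ?f (j + 2) (a + 1) u"
        proof -
          have "exp (u * (a + 1) - u\<^sup>2 * K / 2) = exp (u * a - u\<^sup>2 * K / 2) * exp u"
            by (simp flip: exp_add add: algebra_simps)
          then show ?thesis
            using True by (simp add: power2_eq_square)
        qed
        finally show ?thesis by (simp only: 3)
      qed simp
      have "integrable lborel (\<lambda>u. ?f j (a + h) u - ?f j a u - h * ?f (Suc j) a u)"
        by (rule Bochner_Integration.integrable_diff[OF Bochner_Integration.integrable_diff[OF i i] integrable_mult_right[OF i]])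
      then show "integrable lborel (\<lambda>u. \<bar>?f j (a + h) u - ?f j a u - h * ?f (Suc j) a u\<bar>)"
        by (rule integrable_abs)
      show "integrable lborel (\<lambda>u. h\<^sup>2 * ?f (j + 2) (a + 1) u)"
        by (rule integrable_mult_right[OF i])
    qed
    have 4: "(\<integral>u. h\<^sup>2 * ?f (j + 2) (a + 1) u \<partial>lborel) = h\<^sup>2 * C"
      unfolding C_def half_moment_def by (simp only: integral_mult_right_zero)
    show ?thesis
      using 2 unfolding 1 4 .
  qed
  show ?thesis
    unfolding DERIV_def
  proof (rule LIM_zero_cancel, rule Lim_null_comparison)
    have "norm ((half_moment K j (a + h) - half_moment K j a) / h - half_moment K (Suc j) a) \<le> \<bar>h\<bar> * C"
      if "h \<noteq> 0" "\<bar>h\<bar> < 1" for h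
    proof -
      note h = that
      have "\<bar>(half_moment K j (a + h) - half_moment K j a) / h - half_moment K (Suc j) a\<bar> =
          \<bar>half_moment K j (a + h) - half_moment K j a - h * half_moment K (Suc j) a\<bar> / \<bar>h\<bar>"
        unfolding abs_divide[symmetric] using h by (simp add: diff_divide_distrib)
      also have "\<dots> \<le> h\<^sup>2 * C / \<bar>h\<bar>"
        using bound[of h] h by (intro divide_right_mono) auto
      also have "\<dots> = \<bar>h\<bar> * C"
        using h by (simp add: power2_eq_square abs_if)
      finally show ?thesis by simp
    qed
    then show "\<forall>\<^sub>F h in at 0. norm ((half_moment K j (a + h) - half_moment K j a) / h - half_moment K (Suc j) a) \<le> \<bar>h\<bar> * C"
      unfolding eventually_at by (intro exI[of _ 1]) (simp add: dist_real_def)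
    show "((\<lambda>h. \<bar>h\<bar> * C) \<longlongrightarrow> 0) (at 0)"
      by (rule tendsto_eq_intros | simp)+
  qed
qed

text \<open>The derivatives of the exponential and of \<open>u\<close> times the exponential are
  integrated over the half line. Only the first of the two functions has a nonzero value at 0, which
  is the 1 in the first identity.\<close>

lemma half_moment_recursion:
  assumes K: "K > 0"
  shows "K * half_moment K 1 a = 1 + a * half_moment K 0 a"
    and "K * half_moment K 2 a = half_moment K 0 a + a * half_moment K 1 a"
proof -
  have *: "(\<integral>u. indicator {0..} u * f u \<partial>lborel) = 0 - F 0"
    if F: "\<And>u. (F has_real_derivative f u) (at u)" and f: "continuous_on UNIV f" and l: "(F \<longlongrightarrow> 0) at_top"
      and i: "integrable lborel (\<lambda>u. indicator {0..} u * f u)" for F f :: "real \<Rightarrow> real"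
  proof -
    have AE: "AE u in lborel. indicator {0..} u * f u = indicator {0<..} u * f u"
      using AE_lborel_singleton[of "0::real"] by eventually_elim (auto simp: indicator_def)
    have e: "einterval (ereal 0) \<infinity> = {0<..}"
      by (auto simp: einterval_def)
    have [measurable]: "f \<in> borel_measurable borel"
      using f by (rule borel_measurable_continuous_onI)
    have "integrable lborel (\<lambda>u. indicator {0<..} u * f u)"
      using i by (subst integrable_cong_AE[symmetric, OF _ _ AE]) auto
    then have si: "set_integrable lborel {0<..} f"
      by (simp add: set_integrable_def)
    have "(LBINT u=ereal 0..\<infinity>. f u) = 0 - F 0"
    proof (rule interval_integral_FTC_integrable)
      show "(F has_vector_derivative f x) (at x)" for x
        using F by (simp add: has_real_derivative_iff_has_vector_derivative)
      show "isCont f x" for x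
        using f by (simp add: continuous_on_eq_continuous_at)
      show "set_integrable lborel (einterval (ereal 0) \<infinity>) f"
        using si by (simp only: e)
      show "((F \<circ> real_of_ereal) \<longlongrightarrow> F 0) (at_right (ereal 0))"
        using DERIV_isCont[OF F, of 0] by (simp only: ereal_tendsto_simps isCont_def filterlim_at_split)
      show "((F \<circ> real_of_ereal) \<longlongrightarrow> 0) (at_left \<infinity>)"
        using l by (simp only: ereal_tendsto_simps)
    qed simp
    then have "(\<integral>u. indicator {0<..} u * f u \<partial>lborel) = 0 - F 0"
      by (simp add: interval_lebesgue_integral_def set_lebesgue_integral_def e)
    then show ?thesis
      by (subst integral_cong_AE[OF _ _ AE]) auto
  qed
  have i: "integrable lborel (\<lambda>u. indicator {0..} u * (u ^ k * exp (u * a - u\<^sup>2 * K / 2)))" for k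
    by (rule integrable_half_moment[OF K])
  \<comment> \<open>Completing the square in \<open>u * (a + 1) - u\<^sup>2 * K / 2\<close> gives
    the constant \<open>exp ((a + 1)\<^sup>2 / (2 * K))\<close>.\<close>
  have ek: "\<exists>c\<ge>0. \<forall>u\<ge>0. exp (u * a - u\<^sup>2 * K / 2) \<le> c * exp (- u)"
  proof (intro exI conjI allI impI)
    fix u :: real assume "u \<ge> 0"
    have "(a + 1)\<^sup>2 / (2 * K) - (u * (a + 1) - u\<^sup>2 * K / 2) = (a + 1 - K * u)\<^sup>2 / (2 * K)"
      using K by (simp add: power2_eq_square field_simps)
    also have "\<dots> \<ge> 0" using K by simp
    finally have "u * a - u\<^sup>2 * K / 2 \<le> (a + 1)\<^sup>2 / (2 * K) - u"
      by (simp add: ring_distribs)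
    then show "exp (u * a - u\<^sup>2 * K / 2) \<le> exp ((a + 1)\<^sup>2 / (2 * K)) * exp (- u)"
      by (simp flip: exp_add)
  qed simp
  then obtain c where c: "c \<ge> 0" "\<And>u. u \<ge> 0 \<Longrightarrow> exp (u * a - u\<^sup>2 * K / 2) \<le> c * exp (- u)" by blast
  have lim: "((\<lambda>u. u ^ k * exp (u * a - u\<^sup>2 * K / 2)) \<longlongrightarrow> 0) at_top" if "k \<le> 1" for k
  proof (rule Lim_null_comparison)
    show "\<forall>\<^sub>F u in at_top. norm (u ^ k * exp (u * a - u\<^sup>2 * K / 2)) \<le> c * (u ^ k * exp (- u))"
      using eventually_ge_at_top[of 0]
    proof eventually_elim
      case (elim u)
      then show ?case using mult_left_mono[OF c(2)[of u], of "u ^ k"] by (simp add: abs_mult ac_simps)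
    qed
    have "((\<lambda>u::real. u ^ k * exp (- u)) \<longlongrightarrow> 0) at_top"
    proof (cases "k = 0")
      case True then show ?thesis by simp real_asymp
    next
      case False
      then have "k = 1" using that by simp
      then show ?thesis by simp real_asymp
    qed
    then show "((\<lambda>u. c * (u ^ k * exp (- u))) \<longlongrightarrow> 0) at_top"
      using tendsto_mult[OF tendsto_const[of c]] by fastforce
  qed
  have "(\<integral>u. indicator {0..} u * ((a - u * K) * exp (u * a - u\<^sup>2 * K / 2)) \<partial>lborel) = 0 - exp (0 * a - 0\<^sup>2 * K / 2)"
  proof (rule *[where F="\<lambda>u. exp (u * a - u\<^sup>2 * K / 2)"])
    show "integrable lborel (\<lambda>u. indicator {0..} u * ((a - u * K) * exp (u * a - u\<^sup>2 * K / 2)))"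
      using Bochner_Integration.integrable_diff[OF integrable_mult_right[OF i[of 0], of a] integrable_mult_right[OF i[of 1], of K]]
      by (simp add: algebra_simps)
  qed (use lim[of 0] in \<open>auto intro!: derivative_eq_intros continuous_intros simp: power2_eq_square\<close>)
  moreover have "(\<integral>u. indicator {0..} u * ((a - u * K) * exp (u * a - u\<^sup>2 * K / 2)) \<partial>lborel) =
      a * half_moment K 0 a - K * half_moment K 1 a"
    unfolding half_moment_def integral_mult_right_zero[symmetric]
    by (subst Bochner_Integration.integral_diff[symmetric]) (intro integrable_mult_right i, intro integrable_mult_right i, simp add: algebra_simps)
  ultimately show "K * half_moment K 1 a = 1 + a * half_moment K 0 a" by simp
  have "(\<integral>u. indicator {0..} u * ((1 + u * a - u\<^sup>2 * K) * exp (u * a - u\<^sup>2 * K / 2)) \<partial>lborel) = 0 - 0 * exp (0 * a - 0\<^sup>2 * K / 2)"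
  proof (rule *[where F="\<lambda>u. u * exp (u * a - u\<^sup>2 * K / 2)"])
    show "integrable lborel (\<lambda>u. indicator {0..} u * ((1 + u * a - u\<^sup>2 * K) * exp (u * a - u\<^sup>2 * K / 2)))"
      using Bochner_Integration.integrable_diff[OF Bochner_Integration.integrable_add[OF i[of 0] integrable_mult_right[OF i[of 1], of a]] integrable_mult_right[OF i[of 2], of K]]
      by (simp add: algebra_simps)
  qed (use lim[of 1] in \<open>auto intro!: derivative_eq_intros continuous_intros simp: power2_eq_square algebra_simps\<close>)
  moreover have "(\<integral>u. indicator {0..} u * ((1 + u * a - u\<^sup>2 * K) * exp (u * a - u\<^sup>2 * K / 2)) \<partial>lborel) =
      half_moment K 0 a + a * half_moment K 1 a - K * half_moment K 2 a"
    unfolding half_moment_def integral_mult_right_zero[symmetric]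
    by (subst Bochner_Integration.integral_add[symmetric], rule i, intro integrable_mult_right i,
        subst Bochner_Integration.integral_diff[symmetric],
        intro Bochner_Integration.integrable_add i integrable_mult_right, intro integrable_mult_right i, simp add: algebra_simps)
  ultimately show "K * half_moment K 2 a = half_moment K 0 a + a * half_moment K 1 a" by simp
qed

lemma integral_Z_limit:
  assumes K: "I + J > 0"
  shows "(\<integral>u. u ^ j * Z_limit I J z1 z2 u \<partial>lborel) =
      half_moment (I + J) j (z1 + z2) + (-1) ^ j * half_moment (I + J) j (z2 - z1)"
proof -
  let ?K = "I + J"
  let ?g = "\<lambda>u. u ^ j * Z_limit I J z1 z2 u"
  have 1: "indicator {0..} u * ?g u = indicator {0..} u * (u ^ j * exp (u * (z1 + z2) - u\<^sup>2 * ?K / 2))" for u :: real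
    by (auto simp: indicator_def Z_limit_def algebra_simps)
  have 2: "indicator {0..} u * ?g (- u) = (-1) ^ j * (indicator {0..} u * (u ^ j * exp (u * (z2 - z1) - u\<^sup>2 * ?K / 2)))" for u :: real
    by (auto simp: indicator_def Z_limit_def algebra_simps power_minus[of u])
  have i1: "integrable lborel (\<lambda>u. indicator {0..} u * ?g u)"
    unfolding 1 by (rule integrable_half_moment[OF K])
  have i2: "integrable lborel (\<lambda>u. indicator {0..} u * ?g (- u))"
    unfolding 2 by (intro integrable_mult_right integrable_half_moment[OF K])
  have i3: "integrable lborel (\<lambda>u. indicator {0..} (- u) * ?g u)"
    using lborel_integrable_real_affine[OF i2, of "-1" 0] by simp
  have "AE u in lborel. ?g u = indicator {0..} u * ?g u + indicator {0..} (- u) * ?g u"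
    using AE_lborel_singleton[of "0::real"] by eventually_elim (auto simp: indicator_def)
  then have "(\<integral>u. ?g u \<partial>lborel) = (\<integral>u. indicator {0..} u * ?g u + indicator {0..} (- u) * ?g u \<partial>lborel)"
    by (intro integral_cong_AE) (auto simp: Z_limit_def)
  also have "\<dots> = (\<integral>u. indicator {0..} u * ?g u \<partial>lborel) + (\<integral>u. indicator {0..} (- u) * ?g u \<partial>lborel)"
    using i1 i3 by simp
  also have "(\<integral>u. indicator {0..} (- u) * ?g u \<partial>lborel) = (\<integral>u. indicator {0..} u * ?g (- u) \<partial>lborel)"
    using lborel_integral_real_affine[of "-1" "\<lambda>u. indicator {0..} u * ?g (- u)" 0] by simp
  finally show ?thesis
    unfolding 1 2 by (simp add: half_moment_def)
qed

lemma u_tilde_eq: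
  assumes K: "I + J > 0"
  shows "u_tilde I J x y = (half_moment (I + J) 1 (x + y) - half_moment (I + J) 1 (y - x)) /
      (half_moment (I + J) 0 (x + y) + half_moment (I + J) 0 (y - x))"
  using integral_Z_limit[OF K, of 1 x y] integral_Z_limit[OF K, of 0 x y] by (simp add: u_tilde_def)

text \<open>The ratio is the mean of a normal variable conditioned to be nonnegative. For
  \<open>a < -1\<close>, positivity of the second half moment in the second recursion makes it at
  most 1; otherwise the first recursion gives linear growth, because \<open>half_moment K 0\<close>
  is increasing in \<open>a\<close>.\<close>

lemma half_moment_ratio_le:
  assumes K: "K > 0"
  shows "\<exists>C\<ge>0. \<forall>a. half_moment K 1 a / half_moment K 0 a \<le> C * (1 + \<bar>a\<bar>)"
proof (intro exI conjI allI)
  let ?C = "1 + 1 / K + 1 / (K * half_moment K 0 (-1))"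
  note pos = half_moment_pos[OF K]
  show "0 \<le> ?C" using K pos[of 0 "-1"] by simp
  fix a :: real
  show "half_moment K 1 a / half_moment K 0 a \<le> ?C * (1 + \<bar>a\<bar>)"
  proof (cases "a < -1")
    case True
    have "0 < half_moment K 0 a + a * half_moment K 1 a"
      using half_moment_recursion(2)[OF K, of a] pos[of 2 a] K by (metis mult_pos_pos)
    moreover have "a * half_moment K 1 a \<le> - 1 * half_moment K 1 a"
      using True pos[of 1 a] by (intro mult_right_mono) auto
    ultimately have "half_moment K 1 a \<le> half_moment K 0 a" by simp
    then have "half_moment K 1 a / half_moment K 0 a \<le> 1" using pos[of 0 a] by simp
    also have "1 \<le> ?C * (1 + \<bar>a\<bar>)"
      using K pos[of 0 "-1"] mult_mono[of 1 ?C 1 "1 + \<bar>a\<bar>"] by simp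
    finally show ?thesis .
  next
    case False
    have "half_moment K 1 a / half_moment K 0 a = (1 / half_moment K 0 a + a) / K"
      using half_moment_recursion(1)[OF K, of a] pos[of 0 a] K by (simp add: field_simps)
    also have "\<dots> \<le> (1 / half_moment K 0 (-1) + \<bar>a\<bar>) / K"
      using False half_moment_mono[OF K, of "-1" a 0] pos[of 0 "-1"] pos[of 0 a] K
      by (intro divide_right_mono add_mono divide_left_mono) auto
    also have "\<dots> = 1 / (K * half_moment K 0 (-1)) * 1 + 1 / K * \<bar>a\<bar>"
      using K pos[of 0 "-1"] by (simp add: field_simps)
    also have "\<dots> \<le> 1 / (K * half_moment K 0 (-1)) * (1 + \<bar>a\<bar>) + (1 + 1 / K) * (1 + \<bar>a\<bar>)"
      using K pos[of 0 "-1"] by (intro add_mono mult_mono) auto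
    also have "\<dots> = ?C * (1 + \<bar>a\<bar>)" by (simp add: algebra_simps)
    finally show ?thesis .
  qed
qed

text \<open>For variance 0 the law is the Dirac mass at 0 and both sides vanish, so the degenerate
  case needs no separate treatment later.\<close>

lemma centred_normal_Stein:
  assumes N: "prob_space N" and X: "centred_normal N X s"
    and f: "\<And>x. (f has_real_derivative f' x) (at x)" and f': "continuous_on UNIV f'"
    and le: "\<And>x. \<bar>f x\<bar> \<le> C * (1 + x\<^sup>2)" "\<And>x. \<bar>f' x\<bar> \<le> C * (1 + x\<^sup>2)"
  shows "(LINT x|distr N borel X. x * f x) = s * (LINT x|distr N borel X. f' x)"
    and "integrable (distr N borel X) (\<lambda>x. x\<^sup>2)"
proof -
  interpret N: prob_space N by fact
  have [measurable]: "X \<in> borel_measurable N" using X by (simp add: centred_normal_def)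
  interpret D: prob_space "distr N borel X" by (rule N.prob_space_distr) simp
  have cf: "continuous_on UNIV f"
    using f by (meson DERIV_isCont continuous_at_imp_continuous_on)
  have [measurable]: "f \<in> borel_measurable borel" "f' \<in> borel_measurable borel"
    using cf f' by (auto intro: borel_measurable_continuous_onI)
  have "(LINT x|distr N borel X. x * f x) = s * (LINT x|distr N borel X. f' x) \<and>
      integrable (distr N borel X) (\<lambda>x. x\<^sup>2)"
  proof (cases "s = 0")
    case True
    then have AE: "AE x in distr N borel X. x = 0"
      using X by (auto simp: centred_normal_def AE_distr_iff)
    have "(LINT x|distr N borel X. x * f x) = (LINT x|distr N borel X. 0)"
      using AE by (intro integral_cong_AE) (auto elim: eventually_mono)
    moreover have "integrable (distr N borel X) (\<lambda>x. x\<^sup>2)"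
      using AE by (subst integrable_cong_AE[where g="\<lambda>_. 0"]) (auto elim: eventually_mono)
    ultimately show ?thesis using True by simp
  next
    case False
    then have s: "s > 0" and d: "distributed N lborel X (\<lambda>x. ennreal (normal_density 0 (sqrt s) x))"
      using X by (auto simp: centred_normal_def)
    have D: "distr N borel X = density lborel (\<lambda>x. ennreal (normal_density 0 (sqrt s) x))"
      using distributed_distr_eq_density[OF d] by (simp cong: distr_cong)
    have nn: "AE x in lborel. 0 \<le> normal_density 0 (sqrt s) x" by simp
    have "integrable lborel (\<lambda>x. normal_density 0 (sqrt s) x *\<^sub>R x\<^sup>2)"
      using integrable_normal_moment[of "sqrt s" 0 2] s by simp
    then have "integrable (distr N borel X) (\<lambda>x. x\<^sup>2)"
      unfolding D by (subst integrable_density) auto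
    moreover have "(\<integral>x. normal_density 0 (sqrt s) x *\<^sub>R (x *\<^sub>R f x) \<partial>lborel) =
        (sqrt s)\<^sup>2 *\<^sub>R (\<integral>x. normal_density 0 (sqrt s) x *\<^sub>R f' x \<partial>lborel)"
      using f f' le s
      by (intro stein_normal_density) (auto simp: has_real_derivative_iff_has_vector_derivative)
    ultimately show ?thesis
      using s unfolding D by (simp add: integral_density)
  qed
  then show "(LINT x|distr N borel X. x * f x) = s * (LINT x|distr N borel X. f' x)"
    "integrable (distr N borel X) (\<lambda>x. x\<^sup>2)" by auto
qed

text \<open>The estimate rests on the exact identity \<open>I E[U\<^sup>2] + J E[V\<^sup>2] = 1\<close>, where \<open>U\<close> and \<open>V\<close> are the means of
  \<open>u\<close> and \<open>\<bar>u\<bar>\<close> under the density proportional to \<open>Z\<close>, so that \<open>\<bar>U\<bar> \<le> V\<close>. It follows from Stein's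
  identity in both coordinates, since the derivatives of \<open>U\<close> and \<open>V\<close> are the variances of \<open>u\<close> and \<open>\<bar>u\<bar>\<close>.\<close>

proposition nn_integral_u_tilde_le:
  assumes N: "prob_space N" and X: "centred_normal N X I" and Y: "centred_normal N Y J"
    and indep: "prob_space.indep_var N borel X borel Y" and K: "I + J > 0"
  shows "(\<integral>\<^sup>+ \<omega>. ennreal ((u_tilde I J (X \<omega>) (Y \<omega>))\<^sup>2) \<partial>N) \<le> ennreal (1 / (I + J))"
proof -
  interpret N: prob_space N by fact
  have IJ: "I \<ge> 0" "J \<ge> 0" using X Y by (auto simp: centred_normal_def)
  have [measurable]: "X \<in> borel_measurable N" "Y \<in> borel_measurable N"
    using X Y by (auto simp: centred_normal_def)
  define A where "A = distr N borel X"
  define B where "B = distr N borel Y"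
  interpret A: prob_space A unfolding A_def by (rule N.prob_space_distr) simp
  interpret B: prob_space B unfolding B_def by (rule N.prob_space_distr) simp
  interpret AB: pair_prob_space A B ..
  have [measurable_cong]: "sets A = sets borel" "sets B = sets borel" by (simp_all add: A_def B_def)
  have AB: "distr N (borel \<Otimes>\<^sub>M borel) (\<lambda>\<omega>. (X \<omega>, Y \<omega>)) = A \<Otimes>\<^sub>M B"
    using indep unfolding N.indep_var_distribution_eq by (simp add: A_def B_def)
  let ?K = "I + J"
  let ?m = "half_moment ?K"
  note pos = half_moment_pos[OF K]
  note D[derivative_intros] = DERIV_chain2[OF DERIV_half_moment[OF K]]
  have cm: "continuous_on UNIV (?m j)" for j
    using DERIV_half_moment[OF K] by (meson DERIV_isCont continuous_at_imp_continuous_on)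
  have cm': "continuous_on S (\<lambda>x. ?m j (g x))" if "continuous_on S g" for S g j
    by (rule continuous_on_compose2[OF cm that]) auto
  have [measurable]: "?m j \<in> borel_measurable borel" for j
    using cm by (rule borel_measurable_continuous_onI)
  \<comment> \<open>\<open>Q\<close> is the total mass of \<open>Z_limit\<close>; \<open>U\<close>,
    \<open>V\<close> and \<open>W\<close> are the means of \<open>u\<close>,
    \<open>\<bar>u\<bar>\<close> and \<open>u\<^sup>2\<close> under the normalised density.\<close>
  define Q where "Q x y = ?m 0 (x + y) + ?m 0 (y - x)" for x y
  define U where "U x y = (?m 1 (x + y) - ?m 1 (y - x)) / Q x y" for x y
  define V where "V x y = (?m 1 (x + y) + ?m 1 (y - x)) / Q x y" for x y
  define W where "W x y = (?m 2 (x + y) + ?m 2 (y - x)) / Q x y" for x y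
  have Q: "Q x y > 0" for x y using pos by (simp add: Q_def add_pos_pos)
  have V0: "V x y \<ge> 0" and W0: "W x y \<ge> 0" for x y
    using pos[THEN less_imp_le] Q[THEN less_imp_le] by (auto simp: V_def W_def intro!: divide_nonneg_nonneg add_nonneg_nonneg)
  have UV: "\<bar>U x y\<bar> \<le> V x y" for x y
  proof -
    have "\<bar>?m 1 (x + y) - ?m 1 (y - x)\<bar> \<le> ?m 1 (x + y) + ?m 1 (y - x)"
      using pos[of 1 "x + y"] pos[of 1 "y - x"] by linarith
    then show ?thesis
      using Q[of x y] by (simp add: U_def V_def divide_right_mono)
  qed
  \<comment> \<open>The second recursion, added over the two half lines with slopes
    \<open>x + y\<close> and \<open>y - x\<close>.\<close>
  have W: "?K * W x y = 1 + x * U x y + y * V x y" for x y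
  proof -
    have "?K * W x y = (?K * ?m 2 (x + y) + ?K * ?m 2 (y - x)) / Q x y"
      by (simp add: W_def ring_distribs add_divide_distrib)
    also have "\<dots> = (Q x y + x * (?m 1 (x + y) - ?m 1 (y - x)) + y * (?m 1 (x + y) + ?m 1 (y - x))) / Q x y"
      unfolding half_moment_recursion(2)[OF K] by (simp add: Q_def algebra_simps)
    also have "\<dots> = 1 + x * U x y + y * V x y"
      using Q[of x y] by (simp add: U_def V_def field_simps)
    finally show ?thesis .
  qed
  obtain C where C: "C \<ge> 0" "\<And>a. ?m 1 a / ?m 0 a \<le> C * (1 + \<bar>a\<bar>)"
    using half_moment_ratio_le[OF K] by blast
  have V1: "V x y \<le> 2 * C * (1 + \<bar>x\<bar> + \<bar>y\<bar>)" for x y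
  proof -
    have "V x y \<le> ?m 1 (x + y) / ?m 0 (x + y) + ?m 1 (y - x) / ?m 0 (y - x)"
      unfolding V_def Q_def add_divide_distrib
      using pos[of 0] pos[of 1] by (intro add_mono divide_left_mono mult_pos_pos add_pos_pos) (auto intro: less_imp_le)
    also have "\<dots> \<le> C * (1 + (\<bar>x\<bar> + \<bar>y\<bar>)) + C * (1 + (\<bar>x\<bar> + \<bar>y\<bar>))"
      using C by (intro add_mono order_trans[OF C(2)] mult_left_mono) auto
    finally show ?thesis by (simp add: algebra_simps)
  qed
  \<comment> \<open>One constant that dominates all functions below: the sum of the bounds for
    \<open>V\<close>, including its multiples by \<open>x\<close> and \<open>y\<close>, for the
    square of \<open>V\<close>, and for \<open>W\<close>.\<close>
  define E where "E = 1 + 3 * (2 * C) + 3 * (2 * C)\<^sup>2 + (1 + 3 * (2 * C)) / ?K"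
  have sq: "(1 + \<bar>x\<bar> + \<bar>y\<bar>)\<^sup>2 \<le> 3 * (1 + x\<^sup>2 + y\<^sup>2)" for x y :: real
    using zero_le_power2[of "1 - \<bar>x\<bar>"] zero_le_power2[of "1 - \<bar>y\<bar>"] zero_le_power2[of "\<bar>x\<bar> - \<bar>y\<bar>"]
    by (simp add: power2_eq_square algebra_simps abs_mult_self_eq)
  have le: "\<bar>U x y\<bar> \<le> E * (1 + x\<^sup>2 + y\<^sup>2)" "\<bar>V x y\<bar> \<le> E * (1 + x\<^sup>2 + y\<^sup>2)"
      "\<bar>W x y\<bar> \<le> E * (1 + x\<^sup>2 + y\<^sup>2)" "\<bar>x * U x y\<bar> \<le> E * (1 + x\<^sup>2 + y\<^sup>2)" "\<bar>y * V x y\<bar> \<le> E * (1 + x\<^sup>2 + y\<^sup>2)"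
      "\<bar>(U x y)\<^sup>2\<bar> \<le> E * (1 + x\<^sup>2 + y\<^sup>2)" "\<bar>(V x y)\<^sup>2\<bar> \<le> E * (1 + x\<^sup>2 + y\<^sup>2)"
      "\<bar>W x y - (U x y)\<^sup>2\<bar> \<le> E * (1 + x\<^sup>2 + y\<^sup>2)" "\<bar>W x y - (V x y)\<^sup>2\<bar> \<le> E * (1 + x\<^sup>2 + y\<^sup>2)" for x y
  proof -
    define r where "r = 1 + \<bar>x\<bar> + \<bar>y\<bar>"
    define q where "q = 1 + x\<^sup>2 + y\<^sup>2"
    have r: "1 \<le> r" "\<bar>x\<bar> \<le> r" "\<bar>y\<bar> \<le> r" "r\<^sup>2 \<le> 3 * q" "1 \<le> q" "\<bar>x\<bar> + \<bar>y\<bar> \<le> r" using sq[of x y] by (auto simp: r_def q_def)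
    have rr: "r \<le> r\<^sup>2" using r by (simp add: power2_eq_square)
    have v: "V x y \<le> 2 * C * r" using V1[of x y] by (simp add: r_def)
    have vr: "\<bar>z\<bar> * V x y \<le> 3 * (2 * C) * q" if "\<bar>z\<bar> \<le> r" for z
    proof -
      have "\<bar>z\<bar> * V x y \<le> r * (2 * C * r)"
        using that v V0 r C by (intro mult_mono) auto
      also have "\<dots> = 2 * C * r\<^sup>2" by (simp add: power2_eq_square)
      also have "\<dots> \<le> 2 * C * (3 * q)" using r C by (intro mult_left_mono) auto
      finally show ?thesis by simp
    qed
    have V2: "(V x y)\<^sup>2 \<le> 3 * (2 * C)\<^sup>2 * q"
    proof -
      have "(V x y)\<^sup>2 \<le> (2 * C * r)\<^sup>2" using v V0 by (intro power_mono) auto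
      also have "\<dots> = (2 * C)\<^sup>2 * r\<^sup>2" by (simp add: power_mult_distrib)
      also have "\<dots> \<le> (2 * C)\<^sup>2 * (3 * q)" using r by (intro mult_left_mono) auto
      finally show ?thesis by simp
    qed
    have U2: "(U x y)\<^sup>2 \<le> (V x y)\<^sup>2"
      using UV[of x y] by (simp add: abs_le_square_iff[symmetric])
    have "x * U x y + y * V x y \<le> \<bar>x\<bar> * V x y + \<bar>y\<bar> * V x y"
    proof (rule add_mono)
      have "x * U x y \<le> \<bar>x\<bar> * \<bar>U x y\<bar>" by (simp flip: abs_mult)
      also have "\<dots> \<le> \<bar>x\<bar> * V x y" using UV[of x y] by (intro mult_left_mono) auto
      finally show "x * U x y \<le> \<bar>x\<bar> * V x y" .
      show "y * V x y \<le> \<bar>y\<bar> * V x y" using V0[of x y] by (intro mult_right_mono) auto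
    qed
    also have "\<dots> \<le> 3 * (2 * C) * q"
      using vr[of "\<bar>x\<bar> + \<bar>y\<bar>"] r by (simp add: ring_distribs)
    finally have "?K * W x y \<le> (1 + 3 * (2 * C)) * q"
      unfolding W using r by (simp add: ring_distribs)
    then have W2: "W x y \<le> (1 + 3 * (2 * C)) / ?K * q"
      using K by (simp add: field_simps)
    have e: "0 \<le> 3 * (2 * C) * q" "0 \<le> 3 * (2 * C)\<^sup>2 * q" "0 \<le> (1 + 3 * (2 * C)) / ?K * q" "0 \<le> q"
      using r C K by auto
    have Eq: "E * q = q + 3 * (2 * C) * q + 3 * (2 * C)\<^sup>2 * q + (1 + 3 * (2 * C)) / ?K * q"
      by (simp only: E_def ring_distribs mult_1)
    have "V x y \<le> 3 * (2 * C) * q" using vr[of 1] r by simp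
    then have V1': "V x y \<le> E * q" unfolding Eq using e by linarith
    show "\<bar>U x y\<bar> \<le> E * (1 + x\<^sup>2 + y\<^sup>2)" "\<bar>V x y\<bar> \<le> E * (1 + x\<^sup>2 + y\<^sup>2)"
      using V1' UV[of x y] V0[of x y] unfolding q_def[symmetric] by auto
    show "\<bar>W x y\<bar> \<le> E * (1 + x\<^sup>2 + y\<^sup>2)"
      unfolding q_def[symmetric] Eq using W2 W0[of x y] e by linarith
    have "\<bar>x * U x y\<bar> \<le> \<bar>x\<bar> * V x y"
      using UV[of x y] by (simp add: abs_mult mult_left_mono)
    then show "\<bar>x * U x y\<bar> \<le> E * (1 + x\<^sup>2 + y\<^sup>2)"
      unfolding q_def[symmetric] Eq using vr[of x] r e by linarith
    have "\<bar>y * V x y\<bar> = \<bar>y\<bar> * V x y" using V0[of x y] by (simp add: abs_mult)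
    then show "\<bar>y * V x y\<bar> \<le> E * (1 + x\<^sup>2 + y\<^sup>2)"
      unfolding q_def[symmetric] Eq using vr[of y] r(3) e by linarith
    show "\<bar>(U x y)\<^sup>2\<bar> \<le> E * (1 + x\<^sup>2 + y\<^sup>2)" "\<bar>(V x y)\<^sup>2\<bar> \<le> E * (1 + x\<^sup>2 + y\<^sup>2)"
      unfolding q_def[symmetric] Eq using U2 V2 e zero_le_power2[of "U x y"] zero_le_power2[of "V x y"] by linarith+
    show "\<bar>W x y - (U x y)\<^sup>2\<bar> \<le> E * (1 + x\<^sup>2 + y\<^sup>2)" "\<bar>W x y - (V x y)\<^sup>2\<bar> \<le> E * (1 + x\<^sup>2 + y\<^sup>2)"
      unfolding q_def[symmetric] Eq using U2 V2 W2 W0[of x y] e zero_le_power2[of "U x y"] zero_le_power2[of "V x y"] by linarith+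
  qed
  have E0: "E \<ge> 0" using C K by (auto simp: E_def)
  \<comment> \<open>Stein's identity is used in one coordinate with the other one fixed, so the
    joint quadratic bound is turned into a product.\<close>
  have sep: "z \<le> E * (1 + y\<^sup>2) * (1 + x\<^sup>2)" "z \<le> E * (1 + x\<^sup>2) * (1 + y\<^sup>2)" if "z \<le> E * (1 + x\<^sup>2 + y\<^sup>2)" for z x y
  proof -
    have "E * (1 + x\<^sup>2 + y\<^sup>2) \<le> E * ((1 + y\<^sup>2) * (1 + x\<^sup>2))"
      using E0 by (intro mult_left_mono) (auto simp: algebra_simps)
    then show "z \<le> E * (1 + y\<^sup>2) * (1 + x\<^sup>2)" "z \<le> E * (1 + x\<^sup>2) * (1 + y\<^sup>2)"
      using that by (simp_all add: ac_simps)
  qed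
  have DU: "((\<lambda>x. U x y) has_real_derivative W x y - (U x y)\<^sup>2) (at x)" for x y
    unfolding U_def W_def Q_def using Q[of x y, unfolded Q_def]
    by (auto intro!: derivative_eq_intros simp: power2_eq_square divide_simps numeral_2_eq_2) (auto simp: algebra_simps)?
  have DV: "((\<lambda>y. V x y) has_real_derivative W x y - (V x y)\<^sup>2) (at y)" for x y
    unfolding V_def W_def Q_def using Q[of x y, unfolded Q_def]
    by (auto intro!: derivative_eq_intros simp: power2_eq_square divide_simps numeral_2_eq_2) (auto simp: algebra_simps)?
  have cD: "continuous_on UNIV (\<lambda>x. W x y - (U x y)\<^sup>2)" "continuous_on UNIV (\<lambda>y. W x y - (V x y)\<^sup>2)" for x y
    using Q unfolding U_def V_def W_def Q_def
    by (auto intro!: continuous_intros cm' simp: less_imp_neq[symmetric])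
  have [measurable]: "(\<lambda>p. U (fst p) (snd p)) \<in> borel_measurable (borel \<Otimes>\<^sub>M borel)"
      "(\<lambda>p. V (fst p) (snd p)) \<in> borel_measurable (borel \<Otimes>\<^sub>M borel)"
      "(\<lambda>p. W (fst p) (snd p)) \<in> borel_measurable (borel \<Otimes>\<^sub>M borel)"
    unfolding U_def V_def W_def Q_def by measurable
  have StA: "(LINT x|A. x * U x y) = I * (LINT x|A. W x y - (U x y)\<^sup>2)" for y
    unfolding A_def by (rule centred_normal_Stein(1)[OF N X DU cD(1)]) (rule sep(1), rule le)+
  have StB: "(LINT y|B. y * V x y) = J * (LINT y|B. W x y - (V x y)\<^sup>2)" for x
    unfolding B_def by (rule centred_normal_Stein(1)[OF N Y DV cD(2)]) (rule sep(2), rule le)+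
  have i2: "integrable A (\<lambda>x. x\<^sup>2)" "integrable B (\<lambda>x. x\<^sup>2)"
    unfolding A_def B_def
    using centred_normal_Stein(2)[OF N X, of "\<lambda>_. 0" "\<lambda>_. 0" 0] centred_normal_Stein(2)[OF N Y, of "\<lambda>_. 0" "\<lambda>_. 0" 0]
    by auto
  have "integrable (A \<Otimes>\<^sub>M B) (\<lambda>p. (fst p)\<^sup>2)" "integrable (A \<Otimes>\<^sub>M B) (\<lambda>p. (snd p)\<^sup>2)"
    using i2 by (auto intro!: AB.Fubini_integrable simp: B.prob_space)
  then have iq: "integrable (A \<Otimes>\<^sub>M B) (\<lambda>p. E * (1 + (fst p)\<^sup>2 + (snd p)\<^sup>2))"
    by auto
  have int: "integrable (A \<Otimes>\<^sub>M B) (\<lambda>p. f (fst p) (snd p))"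
    if "(\<lambda>p. f (fst p) (snd p)) \<in> borel_measurable (borel \<Otimes>\<^sub>M borel)" "\<And>x y. \<bar>f x y\<bar> \<le> E * (1 + x\<^sup>2 + y\<^sup>2)" for f
  proof (rule Bochner_Integration.integrable_bound[OF iq])
    show "(\<lambda>p. f (fst p) (snd p)) \<in> borel_measurable (A \<Otimes>\<^sub>M B)"
      using that(1) by simp
    show "AE p in A \<Otimes>\<^sub>M B. norm (f (fst p) (snd p)) \<le> norm (E * (1 + (fst p)\<^sup>2 + (snd p)\<^sup>2))"
      using that(2) by (auto intro!: AE_I2 order_trans[OF that(2)])
  qed
  have mes: "(\<lambda>p. fst p * U (fst p) (snd p)) \<in> borel_measurable (borel \<Otimes>\<^sub>M borel)"
      "(\<lambda>p. snd p * V (fst p) (snd p)) \<in> borel_measurable (borel \<Otimes>\<^sub>M borel)"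
      "(\<lambda>p. (U (fst p) (snd p))\<^sup>2) \<in> borel_measurable (borel \<Otimes>\<^sub>M borel)"
      "(\<lambda>p. (V (fst p) (snd p))\<^sup>2) \<in> borel_measurable (borel \<Otimes>\<^sub>M borel)"
      "(\<lambda>p. W (fst p) (snd p) - (U (fst p) (snd p))\<^sup>2) \<in> borel_measurable (borel \<Otimes>\<^sub>M borel)"
      "(\<lambda>p. W (fst p) (snd p) - (V (fst p) (snd p))\<^sup>2) \<in> borel_measurable (borel \<Otimes>\<^sub>M borel)"
    by measurable
  have iW: "integrable (A \<Otimes>\<^sub>M B) (\<lambda>p. W (fst p) (snd p))"
    by (rule int[OF _ le(3)]) measurable
  note ints = iW int[OF mes(1) le(4)] int[OF mes(2) le(5)] int[OF mes(3) le(6)] int[OF mes(4) le(7)]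
    int[OF mes(5) le(8)] int[OF mes(6) le(9)]
  let ?E = "\<lambda>f. LINT p|(A \<Otimes>\<^sub>M B). f (fst p) (snd p)"
  have fub: "?E f = (LINT y|B. LINT x|A. f x y)" "?E f = (LINT x|A. LINT y|B. f x y)"
    if "integrable (A \<Otimes>\<^sub>M B) (\<lambda>p. f (fst p) (snd p))" for f :: "real \<Rightarrow> real \<Rightarrow> real"
    using AB.integral_snd[of f] AB.integral_fst[of f] that by (auto simp: case_prod_beta')
  have EA: "?E (\<lambda>x y. x * U x y) = I * (?E W - ?E (\<lambda>x y. (U x y)\<^sup>2))"
  proof -
    have "?E (\<lambda>x y. x * U x y) = I * ?E (\<lambda>x y. W x y - (U x y)\<^sup>2)"
      unfolding fub(1)[OF ints(2)] fub(1)[OF ints(6)] StA by (rule integral_mult_right_zero)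
    then show ?thesis unfolding Bochner_Integration.integral_diff[OF ints(1) ints(4)] .
  qed
  have EB: "?E (\<lambda>x y. y * V x y) = J * (?E W - ?E (\<lambda>x y. (V x y)\<^sup>2))"
  proof -
    have "?E (\<lambda>x y. y * V x y) = J * ?E (\<lambda>x y. W x y - (V x y)\<^sup>2)"
      unfolding fub(2)[OF ints(3)] fub(2)[OF ints(7)] StB by (rule integral_mult_right_zero)
    then show ?thesis unfolding Bochner_Integration.integral_diff[OF ints(1) ints(5)] .
  qed
  have "?K * ?E W = ?E (\<lambda>x y. 1 + x * U x y + y * V x y)"
    unfolding W[symmetric] by simp
  also have "\<dots> = 1 + ?E (\<lambda>x y. x * U x y) + ?E (\<lambda>x y. y * V x y)"
    using ints by (simp add: AB.P.prob_space)
  \<comment> \<open>The expectation of \<open>W\<close> cancels because its coefficients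
    \<open>I\<close> and \<open>J\<close> on the right add up to \<open>?K\<close> on the
    left.\<close>
  finally have id: "I * ?E (\<lambda>x y. (U x y)\<^sup>2) + J * ?E (\<lambda>x y. (V x y)\<^sup>2) = 1"
    unfolding EA EB by (simp add: algebra_simps)
  have "?E (\<lambda>x y. (U x y)\<^sup>2) \<le> ?E (\<lambda>x y. (V x y)\<^sup>2)"
    using ints UV V0 by (intro integral_mono) (auto simp: abs_le_square_iff[symmetric])
  then have "J * ?E (\<lambda>x y. (U x y)\<^sup>2) \<le> J * ?E (\<lambda>x y. (V x y)\<^sup>2)"
    using IJ by (intro mult_left_mono)
  then have fin: "?E (\<lambda>x y. (U x y)\<^sup>2) \<le> 1 / ?K"
    using id K by (simp add: field_simps)
  have "(\<integral>\<^sup>+ \<omega>. ennreal ((u_tilde I J (X \<omega>) (Y \<omega>))\<^sup>2) \<partial>N) = (\<integral>\<^sup>+ \<omega>. ennreal ((U (X \<omega>) (Y \<omega>))\<^sup>2) \<partial>N)"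
    unfolding u_tilde_eq[OF K] U_def Q_def ..
  also have "\<dots> = (\<integral>\<^sup>+ p. ennreal ((U (fst p) (snd p))\<^sup>2) \<partial>(A \<Otimes>\<^sub>M B))"
    unfolding AB[symmetric] by (subst nn_integral_distr) auto
  also have "\<dots> = ennreal (?E (\<lambda>x y. (U x y)\<^sup>2))"
    using ints by (intro nn_integral_eq_integral) auto
  also have "\<dots> \<le> ennreal (1 / ?K)"
    using fin by (rule ennreal_leI)
  finally show ?thesis .
qed

section \<open>The minimax bound\<close>

lemma inverse_rate_sq:
  assumes "n \<ge> 1"
  shows "inverse (rate n) > 0" "(inverse (rate n))\<^sup>2 = real n ^ 3"
proof -
  have r: "inverse (rate n) = real n powr (3 / 2)"
    by (simp add: rate_def powr_minus)
  show "inverse (rate n) > 0" using assms by (simp add: r)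
  have "(inverse (rate n))\<^sup>2 = real n powr (3 / 2 + 3 / 2)"
    unfolding r powr_add by (simp add: power2_eq_square)
  also have "\<dots> = real n ^ 3" using assms powr_realpow[of "real n" 3] by simp
  finally show "(inverse (rate n))\<^sup>2 = real n ^ 3" .
qed

text \<open>On an interval without 0 all lags have the same sign, so one map to increments serves
  the whole interval and the covariance is affine in
  \<open>h = n * \<bar>c\<bar> * \<eta> n\<close>. In this parameter the prior interval has length
  proportional to \<open>n * \<eta> n\<close>, and the squared scaling factor of the risk is
  \<open>n * (n * \<eta> n)\<^sup>2\<close>.\<close>

proposition minimax_risk_ge:
  fixes M :: "'a measure" and B :: "real \<Rightarrow> 'a \<Rightarrow> real \<times> real" and eps :: "nat \<Rightarrow> 'a \<Rightarrow> real \<times> real"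
  assumes \<rho>: "\<bar>\<rho>\<bar> < 1" and M: "prob_space M" and B: "two_sided_brownian_motion M 1 \<rho> 1 B"
    and eps: "iid_standard_normal2 M eps" and ind: "independent_of_noise M B eps"
    and v: "\<And>n. v n \<ge> 0" and \<gamma>: "(\<lambda>n. real n * v n) \<longlonglongrightarrow> \<gamma>"
    and \<eta>: "\<And>n. \<eta> n > 0" "(\<lambda>n. real n * \<eta> n) \<longlonglongrightarrow> 0" "filterlim (\<lambda>n. inverse (rate n) * \<eta> n) at_top sequentially"
    and \<kappa>: "info_I \<rho> \<gamma> + info_J \<rho> \<gamma> > 0" and lu: "l < u" "0 \<notin> {l..u}" and T: "estimator_sequence T"
  shows "ennreal (1 / (info_I \<rho> \<gamma> + info_J \<rho> \<gamma>)) \<le>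
    liminf (\<lambda>n. SUP c\<in>{l..u}. ennreal ((inverse (rate n) * \<eta> n)\<^sup>2) * mse (obs_law M B eps v n (c * \<eta> n)) (T n) c)"
    (is "_ \<le> ?L")
proof -
  define \<kappa> where "\<kappa> = info_I \<rho> \<gamma> + info_J \<rho> \<gamma>"
  have \<kappa>0: "\<kappa> > 0" using \<kappa> by (simp add: \<kappa>_def)
  define w where "w n = inverse (rate n) * \<eta> n" for n
  \<comment> \<open>An interval on the negative side is reflected to the positive interval
    \<open>{a..b}\<close>; \<open>\<sigma>\<close> restores the sign.\<close>
  define \<sigma> :: real where "\<sigma> = (if l > 0 then 1 else -1)"
  define a where "a = (if l > 0 then l else - u)"
  define b where "b = (if l > 0 then u else - l)"
  have ab: "0 < a" "a < b" using lu by (auto simp: a_def b_def)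
  have \<sigma>2: "\<sigma> * \<sigma> = 1" and \<sigma>l: "(\<sigma> * x > 0) = (l > 0)" if "x > 0" for x
    using that by (auto simp: \<sigma>_def)
  have \<sigma>x: "\<sigma> * x \<in> {l..u}" if "x \<in> {a..b}" for x
    using that by (auto simp: \<sigma>_def a_def b_def split: if_splits)
  define lam where "lam = (1 - \<bar>\<rho>\<bar>) / 2"
  have lam: "lam > 0" using \<rho> by (simp add: lam_def)
  have \<gamma>0: "\<gamma> \<ge> 0" using v by (intro LIMSEQ_le_const[OF \<gamma>]) auto
  have main: "\<forall>\<^sub>F n in sequentially. ennreal (1 / (\<kappa> + \<epsilon>)) \<le> (SUP c\<in>{l..u}. ennreal ((w n)\<^sup>2) * mse (obs_law M B eps v n (c * \<eta> n)) (T n) c)"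
    if \<epsilon>: "\<epsilon> > 0" for \<epsilon>
  proof -
    have "(\<lambda>n. real n * \<eta> n * b) \<longlonglongrightarrow> 0 * b" by (intro tendsto_intros \<eta>)
    then have d0: "(\<lambda>n. real n * \<eta> n * b) \<longlonglongrightarrow> 0" by simp
    \<comment> \<open>The bound 1 keeps the lag below the mesh. The bound \<open>lam / 4\<close>
      keeps the excess above \<open>lam\<close>, because the lag costs four times \<open>h\<close>
      and \<open>1 - \<bar>\<rho>\<bar> = 2 * lam\<close>.\<close>
    have ev1: "\<forall>\<^sub>F n in sequentially. real n * \<eta> n * b < min 1 (lam / 4)"
      using lam by (intro order_tendstoD(2)[OF d0]) auto
    \<comment> \<open>This makes the information of the prior,
      \<open>40 / ((w n)\<^sup>2 * (b - a)\<^sup>2)\<close> in units of the scaled risk, at most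
      \<epsilon> / 2. The other half of \<epsilon> goes to the approximation of the Fisher
      information.\<close>
    have ev2: "\<forall>\<^sub>F n in sequentially. sqrt (80 / (\<epsilon> * (b - a)\<^sup>2)) \<le> w n"
      using \<eta>(3) unfolding w_def filterlim_at_top by blast
    have ev3: "\<forall>\<^sub>F n in sequentially. n \<ge> (1::nat)" by (rule eventually_ge_at_top)
    have "info_I \<rho> \<gamma> + info_J \<rho> \<gamma> \<ge> 0" "\<epsilon> / 2 > 0" using \<kappa> \<epsilon> by auto
    note ev4 = eventually_information_le[OF \<rho> \<gamma>0 \<gamma> d0 this lam, folded \<kappa>_def]
    show ?thesis
      using ev1 ev2 ev3 ev4
    proof eventually_elim
      case (elim n)
      note inf = elim(4)
      have n: "n \<ge> 1" "real n > 0" using elim(3) by auto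
      have w: "w n > 0" using inverse_rate_sq(1)[OF n(1)] \<eta>(1)[of n] by (simp add: w_def)
      have w2: "(w n)\<^sup>2 = real n * (real n * \<eta> n)\<^sup>2"
        unfolding w_def power_mult_distrib inverse_rate_sq(2)[OF n(1)] by (simp add: power2_eq_square power3_eq_cube)
      define S where "S = (SUP c\<in>{l..u}. ennreal ((w n)\<^sup>2) * mse (obs_law M B eps v n (c * \<eta> n)) (T n) c)"
      show "ennreal (1 / (\<kappa> + \<epsilon>)) \<le> (SUP c\<in>{l..u}. ennreal ((w n)\<^sup>2) * mse (obs_law M B eps v n (c * \<eta> n)) (T n) c)"
      proof (cases S)
        case top
        then show ?thesis unfolding S_def[symmetric] by simp
      next
        case (real R0)
        define q where "q = real n * \<eta> n"
        have q: "q > 0" using n \<eta>(1)[of n] by (simp add: q_def)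
        let ?K = "obs_index n"
        define \<mu> where "\<mu> h = distr (obs_law M B eps v n (\<sigma> * (h / n))) (\<Pi>\<^sub>M a\<in>?K. borel) (obs_incr n (l > 0))" for h
        \<comment> \<open>Projecting the estimator onto the parameter interval does not increase its
          error and makes it bounded, as the van Trees inequality requires.\<close>
        define U where "U z = q * max a (min b (\<sigma> * T n (obs_of_incr n (l > 0) z)))" for z
        have h: "0 < h" "h < 1" "h < lam / 4" "\<bar>h\<bar> \<le> real n * \<eta> n * b" if "h \<in> {q * a..q * b}" for h
        proof -
          have "0 < q * a" using q ab by simp
          then show "0 < h" using that by auto
          show "h < 1" "h < lam / 4" "\<bar>h\<bar> \<le> real n * \<eta> n * b" using that elim(1) \<open>0 < h\<close> by (auto simp: q_def)
        qed
        have \<theta>: "\<sigma> * (h / n) \<noteq> 0" "\<bar>\<sigma> * (h / n)\<bar> < 1 / n" "n * \<bar>\<sigma> * (h / n)\<bar> = h" "(\<sigma> * (h / n) > 0) = (l > 0)"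
          if "h \<in> {q * a..q * b}" for h
          using h[OF that] n \<sigma>l[of "h / n"] by (auto simp: \<sigma>_def abs_mult divide_strict_right_mono)
        have law: "finite_measure (\<mu> h)" "sets (\<mu> h) = sets (\<Pi>\<^sub>M a\<in>?K. borel)"
          "(CLINT z|\<mu> h. iexp (\<Sum>a\<in>?K. t a * z a)) =
            of_real (exp (- (\<Sum>a\<in>?K. \<Sum>b\<in>?K. (incr_cov \<rho> (n * v n) a b + h * incr_cov_deriv \<rho> a b) * (t a * t b)) / 2))"
          "T' \<in> borel_measurable (euclid (2 * n)) \<Longrightarrow>
            mse (obs_law M B eps v n (\<sigma> * (h / n))) T' c = (\<integral>\<^sup>+ z. ennreal ((T' (obs_of_incr n (l > 0) z) - c)\<^sup>2) \<partial>\<mu> h)"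
          if hh: "h \<in> {q * a..q * b}" for h t T' c
          unfolding \<mu>_def
          using char_obs_incr[where v = v and n = n, OF M B eps ind n(1) v \<theta>(1,2)[OF hh]] unfolding \<theta>(3,4)[OF hh] .
        have Tm: "T n \<in> borel_measurable (euclid (2 * n))" using T by (simp add: estimator_sequence_def)
        have Um: "U \<in> borel_measurable (\<Pi>\<^sub>M k\<in>?K. borel)"
          unfolding U_def[abs_def] using measurable_compose[OF measurable_obs_of_incr Tm, of "l > 0"] by measurable
        have Ub: "\<bar>U z\<bar> \<le> q * b" for z
        proof -
          have "\<bar>max a (min b (\<sigma> * T n (obs_of_incr n (l > 0) z)))\<bar> \<le> b" using ab by auto
          then show ?thesis using q by (simp add: U_def abs_mult)
        qed
        have risk: "(LINT z|\<mu> h. (U z - h)\<^sup>2) \<le> R0 / n" if hh: "h \<in> {q * a..q * b}" for h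
        proof (rule integral_real_bounded)
          show "0 \<le> R0 / n" using real n by simp
          define x where "x = h / q"
          have x: "x \<in> {a..b}" using hh q by (simp add: x_def field_simps)
          have hx: "h = q * x" using q by (simp add: x_def)
          have "(U z - h)\<^sup>2 \<le> q\<^sup>2 * (T n (obs_of_incr n (l > 0) z) - \<sigma> * x)\<^sup>2" for z
          proof -
            define y where "y = T n (obs_of_incr n (l > 0) z)"
            have "\<bar>max a (min b (\<sigma> * y)) - x\<bar> \<le> \<bar>\<sigma> * y - x\<bar>" using x ab by auto
            then have "(max a (min b (\<sigma> * y)) - x)\<^sup>2 \<le> (\<sigma> * y - x)\<^sup>2"
              by (simp add: abs_le_square_iff)
            also have "(\<sigma> * y - x)\<^sup>2 = (y - \<sigma> * x)\<^sup>2"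
              by (auto simp: \<sigma>_def power2_eq_square algebra_simps)
            finally have "q\<^sup>2 * (max a (min b (\<sigma> * y)) - x)\<^sup>2 \<le> q\<^sup>2 * (y - \<sigma> * x)\<^sup>2"
              by (rule mult_left_mono) simp
            then show ?thesis
              unfolding U_def y_def[symmetric] hx by (simp add: power_mult_distrib flip: right_diff_distrib)
          qed
          then have "(\<integral>\<^sup>+ z. ennreal ((U z - h)\<^sup>2) \<partial>\<mu> h) \<le> (\<integral>\<^sup>+ z. ennreal (q\<^sup>2) * ennreal ((T n (obs_of_incr n (l > 0) z) - \<sigma> * x)\<^sup>2) \<partial>\<mu> h)"
            by (intro nn_integral_mono) (simp add: ennreal_mult[symmetric] ennreal_leI)
          also have "\<dots> = ennreal (q\<^sup>2) * (\<integral>\<^sup>+ z. ennreal ((T n (obs_of_incr n (l > 0) z) - \<sigma> * x)\<^sup>2) \<partial>\<mu> h)"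
          proof (rule nn_integral_cmult)
            have "(\<lambda>z. ennreal ((T n (obs_of_incr n (l > 0) z) - \<sigma> * x)\<^sup>2)) \<in> borel_measurable (\<Pi>\<^sub>M a\<in>?K. borel)"
              using measurable_compose[OF measurable_obs_of_incr Tm, of "l > 0"] by measurable
            then show "(\<lambda>z. ennreal ((T n (obs_of_incr n (l > 0) z) - \<sigma> * x)\<^sup>2)) \<in> borel_measurable (\<mu> h)"
              by (simp add: \<mu>_def)
          qed
          also have "(\<integral>\<^sup>+ z. ennreal ((T n (obs_of_incr n (l > 0) z) - \<sigma> * x)\<^sup>2) \<partial>\<mu> h) = mse (obs_law M B eps v n (\<sigma> * (h / n))) (T n) (\<sigma> * x)"
            by (rule law(4)[OF hh Tm, symmetric])
          also have "\<sigma> * (h / n) = \<sigma> * x * \<eta> n"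
            using n by (simp add: hx q_def)
          also have "ennreal (q\<^sup>2) * mse (obs_law M B eps v n (\<sigma> * x * \<eta> n)) (T n) (\<sigma> * x) =
              ennreal (1 / n) * (ennreal ((w n)\<^sup>2) * mse (obs_law M B eps v n (\<sigma> * x * \<eta> n)) (T n) (\<sigma> * x))"
          proof -
            have "q\<^sup>2 = 1 / n * (w n)\<^sup>2" using n by (simp add: w2 q_def)
            then have "ennreal (q\<^sup>2) = ennreal (1 / n) * ennreal ((w n)\<^sup>2)"
              by (simp only:) (rule ennreal_mult; simp)
            then show ?thesis by (simp only: mult.assoc)
          qed
          also have "\<dots> \<le> ennreal (1 / n) * S"
            unfolding S_def using \<sigma>x[OF x] by (intro mult_left_mono SUP_upper) auto
          also have "\<dots> = ennreal (R0 / n)"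
            using real n by (simp add: ennreal_mult[symmetric])
          finally show "(\<integral>\<^sup>+ z. ennreal ((U z - h)\<^sup>2) \<partial>\<mu> h) \<le> ennreal (R0 / n)" .
        qed
        have qq: "q * a < q * b" using q ab by simp
        have ex: "lam \<le> excess ?K (\<lambda>a b. incr_cov \<rho> (n * v n) a b + h * incr_cov_deriv \<rho> a b) k" if "h \<in> {q * a..q * b}" "k \<in> ?K" for h k
          using excess_incr_cov[OF \<rho> _ that(2), of "n * v n" h] h[OF that(1)] v[of n] by (simp add: lam_def)
        have "1 \<le> R0 / n * (real n * (\<kappa> + \<epsilon> / 2) + 40 / (q * b - q * a)\<^sup>2)"
        proof (rule Gaussian_van_Trees[where K = ?K and ?\<Sigma>0.0 = "incr_cov \<rho> (n * v n)" and A = "incr_cov_deriv \<rho>" and W = "score_toeplitz \<rho> \<gamma>"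
                and \<mu> = \<mu> and T = U and lam = lam and l = "q * a" and u = "q * b" and C = "q * b"], goal_cases)
          case (3 a b) show ?case by (rule incr_cov_sym)
        next
          case (4 a b) show ?case by (rule incr_cov_deriv_sym)
        next
          case (5 a b) show ?case by (rule score_toeplitz_sym)
        next
          case (7 h k) then show ?case by (rule ex)
        next
          case (8 h) show ?case by (rule inf[rule_format, OF h(4)[OF 8]])
        next
          case (13 h t) show ?case by (rule law(3)[OF 13])
        qed (rule finite_obs_index qq lam Um Ub law(1) law(2) risk, assumption?)+
        also have "R0 / n * (real n * (\<kappa> + \<epsilon> / 2) + 40 / (q * b - q * a)\<^sup>2) = R0 * (\<kappa> + \<epsilon> / 2 + 40 / ((w n)\<^sup>2 * (b - a)\<^sup>2))"
        proof -
          have "(q * b - q * a)\<^sup>2 = q\<^sup>2 * (b - a)\<^sup>2" by (simp add: power_mult_distrib flip: right_diff_distrib)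
          then show ?thesis using n q ab by (simp add: w2 flip: q_def) (simp add: field_simps)
        qed
        finally have 1: "1 \<le> R0 * (\<kappa> + \<epsilon> / 2 + 40 / ((w n)\<^sup>2 * (b - a)\<^sup>2))" .
        have "80 / (\<epsilon> * (b - a)\<^sup>2) \<le> (w n)\<^sup>2"
          using power_mono[OF elim(2), of 2] \<epsilon> by simp
        then have "40 / ((w n)\<^sup>2 * (b - a)\<^sup>2) \<le> \<epsilon> / 2"
          using \<epsilon> w ab by (simp add: field_simps)
        then have "R0 * (\<kappa> + \<epsilon> / 2 + 40 / ((w n)\<^sup>2 * (b - a)\<^sup>2)) \<le> R0 * (\<kappa> + \<epsilon>)"
          using real by (intro mult_left_mono) auto
        then have "1 \<le> R0 * (\<kappa> + \<epsilon>)" using 1 by linarith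
        then have "1 / (\<kappa> + \<epsilon>) \<le> R0" using \<kappa>0 \<epsilon> by (simp add: divide_le_eq)
        then have "ennreal (1 / (\<kappa> + \<epsilon>)) \<le> S" using real by (simp add: ennreal_leI)
        then show ?thesis by (simp only: S_def)
      qed
    qed
  qed
  have "ennreal (1 / (\<kappa> + \<epsilon>)) \<le> ?L" if "\<epsilon> > 0" for \<epsilon>
    using main[OF that] unfolding w_def by (rule Liminf_bounded)
  then have "\<forall>\<^sub>F \<epsilon> in at_right (0::real). ennreal (1 / (\<kappa> + \<epsilon>)) \<le> ?L"
    by (intro eventually_at_right_less[THEN eventually_mono]) auto
  moreover have "((\<lambda>\<epsilon>. ennreal (1 / (\<kappa> + \<epsilon>))) \<longlongrightarrow> ennreal (1 / (\<kappa> + 0))) (at_right 0)"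
    using \<kappa>0 by (intro tendsto_ennrealI tendsto_intros) auto
  ultimately have "ennreal (1 / (\<kappa> + 0)) \<le> ?L"
    by (intro tendsto_upperbound[where F = "at_right (0::real)"]) auto
  then show ?thesis by (simp add: \<kappa>_def)
qed

text \<open>The suprema decrease as the neighbourhood shrinks, so the limit exists and is an
  infimum; a lower bound for every radius is then enough.\<close>

lemma mono_tendsto_at_right_INF:
  fixes f :: "real \<Rightarrow> ennreal"
  assumes "\<And>x y. a < x \<Longrightarrow> x \<le> y \<Longrightarrow> f x \<le> f y"
  shows "(f \<longlongrightarrow> (INF x\<in>{a<..}. f x)) (at_right a)"
proof (rule order_tendstoI)
  fix y assume y: "y < (INF x\<in>{a<..}. f x)"
  show "\<forall>\<^sub>F x in at_right a. y < f x"
    using eventually_at_right_less[of a]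
  proof eventually_elim
    case (elim x)
    then have "(INF x\<in>{a<..}. f x) \<le> f x" by (intro INF_lower) simp
    then show "y < f x" using y by (rule order.strict_trans2[rotated])
  qed
next
  fix y assume "(INF x\<in>{a<..}. f x) < y"
  then obtain x0 where x0: "x0 > a" "f x0 < y" by (auto simp: INF_less_iff)
  show "\<forall>\<^sub>F x in at_right a. f x < y"
    using eventually_at_right_real[OF x0(1)]
  proof eventually_elim
    case (elim x)
    then have "f x \<le> f x0" by (intro assms) auto
    then show "f x < y" using x0(2) by (rule le_less_trans)
  qed
qed

lemma u_tilde_0: "u_tilde 0 0 0 0 = 0"
  by (simp add: u_tilde_def Z_limit_def measure_def)

theorem theorem3p2:
  fixes M :: "'a measure" and B :: "real \<Rightarrow> 'a \<Rightarrow> real \<times> real"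
    and eps :: "nat \<Rightarrow> 'a \<Rightarrow> real \<times> real"
    and N :: "'b measure" and \<zeta>1 \<zeta>2 :: "'b \<Rightarrow> real"
    and \<rho> \<gamma> a b :: real and v \<eta> :: "nat \<Rightarrow> real" and C :: "real set"
  assumes "\<rho> \<in> {-1<..<0} \<union> {0<..<1}"
    and "prob_space M"
    and "two_sided_brownian_motion M 1 \<rho> 1 B"
    and "iid_standard_normal2 M eps"
    and "independent_of_noise M B eps"
    and "\<And>n. v n \<ge> 0"
    and "limsup (\<lambda>n. ereal (v n)) < \<infinity>"
    and "(\<lambda>n. real n * v n) \<longlonglongrightarrow> \<gamma>"
    and "a < b" and "C = {a<..<b}"
    and "\<And>n. \<eta> n > 0"
    and "\<eta> \<longlonglongrightarrow> 0"
    and "\<eta> \<in> o(\<lambda>n. max (1 / real n) (real n powr (- 4 / 3)))"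
    and "filterlim (\<lambda>n. inverse (rate n) * \<eta> n) at_top sequentially"
    and "prob_space N"
    and "centred_normal N \<zeta>1 (info_I \<rho> \<gamma>)"
    and "centred_normal N \<zeta>2 (info_J \<rho> \<gamma>)"
    and "prob_space.indep_var N borel \<zeta>1 borel \<zeta>2"
  defines "risk_bound \<equiv>
      \<integral>\<^sup>+ \<omega>. ennreal ((u_tilde (info_I \<rho> \<gamma>) (info_J \<rho> \<gamma>) (\<zeta>1 \<omega>) (\<zeta>2 \<omega>))\<^sup>2) \<partial>N"
  shows "(\<forall>c0\<in>C. \<forall>cs. estimator_sequence cs \<longrightarrow>
            (\<exists>L. ((\<lambda>\<delta>. liminf (\<lambda>n. SUP c\<in>{c\<in>C. \<bar>c - c0\<bar> < \<delta>}.
                      ennreal ((inverse (rate n) * \<eta> n)\<^sup>2) *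
                        mse (obs_law M B eps v n (c * \<eta> n)) (cs n) c)) \<longlongrightarrow> L) (at_right 0)
                 \<and> L \<ge> risk_bound))
       \<and> (\<forall>ts. estimator_sequence ts \<longrightarrow>
            (\<exists>L. ((\<lambda>\<delta>. liminf (\<lambda>n. SUP \<theta>\<in>{\<theta>. \<bar>\<theta>\<bar> < \<delta> * \<eta> n}.
                      ennreal ((inverse (rate n))\<^sup>2) *
                        mse (obs_law M B eps v n \<theta>) (ts n) \<theta>)) \<longlongrightarrow> L) (at_right 0)
                 \<and> L \<ge> risk_bound))"
proof -
  note M = assms(2) and B = assms(3) and eps = assms(4) and ind = assms(5) and v = assms(6) and \<gamma> = assms(8)
    and ab = assms(9) and C = assms(10) and \<eta> = assms(11) and big = assms(14) and N = assms(15) and \<zeta> = assms(16,17,18)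
  have \<rho>: "\<bar>\<rho>\<bar> < 1" using assms(1) by auto
  \<comment> \<open>For \<open>n \<ge> 1\<close> the maximum in the assumption is
    \<open>1 / n\<close>.\<close>
  have \<eta>0: "(\<lambda>n. real n * \<eta> n) \<longlonglongrightarrow> 0"
  proof -
    have "(\<lambda>n. \<eta> n / max (1 / real n) (real n powr (- 4 / 3))) \<longlonglongrightarrow> 0"
      using assms(13) by (rule smalloD_tendsto)
    moreover have "\<forall>\<^sub>F n in sequentially. \<eta> n / max (1 / real n) (real n powr (- 4 / 3)) = real n * \<eta> n"
      using eventually_ge_at_top[of "1::nat"]
    proof eventually_elim
      case (elim n)
      have "real n powr (- 4 / 3) \<le> real n powr (- 1)" using elim by (intro powr_mono) auto
      also have "\<dots> = 1 / real n" using elim by (simp add: powr_minus divide_inverse)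
      finally have "max (1 / real n) (real n powr (- 4 / 3)) = 1 / real n" by (rule max_absorb1)
      then show ?case by simp
    qed
    ultimately show ?thesis by (rule Lim_transform_eventually)
  qed
  have nonneg: "info_I \<rho> \<gamma> \<ge> 0" "info_J \<rho> \<gamma> \<ge> 0"
    using \<zeta>(1,2) by (auto simp: centred_normal_def)
  have core: "risk_bound \<le> liminf (\<lambda>n. SUP c\<in>{l..u}. ennreal ((inverse (rate n) * \<eta> n)\<^sup>2) * mse (obs_law M B eps v n (c * \<eta> n)) (T n) c)"
    if "l < u" "0 \<notin> {l..u}" "estimator_sequence T" for l u T
  proof (cases "info_I \<rho> \<gamma> + info_J \<rho> \<gamma> = 0")
    case True
    then have z: "info_I \<rho> \<gamma> = 0" "info_J \<rho> \<gamma> = 0" using nonneg by auto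
    then have "AE \<omega> in N. \<zeta>1 \<omega> = 0" "AE \<omega> in N. \<zeta>2 \<omega> = 0"
      using \<zeta>(1,2) by (auto simp: centred_normal_def)
    then have "AE \<omega> in N. ennreal ((u_tilde (info_I \<rho> \<gamma>) (info_J \<rho> \<gamma>) (\<zeta>1 \<omega>) (\<zeta>2 \<omega>))\<^sup>2) = 0"
      by eventually_elim (simp add: z u_tilde_0)
    then have "risk_bound = (\<integral>\<^sup>+ \<omega>. 0 \<partial>N)"
      unfolding risk_bound_def by (rule nn_integral_cong_AE)
    then show ?thesis by simp
  next
    case False
    then have pos: "info_I \<rho> \<gamma> + info_J \<rho> \<gamma> > 0" using nonneg by auto
    have "risk_bound \<le> ennreal (1 / (info_I \<rho> \<gamma> + info_J \<rho> \<gamma>))"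
      unfolding risk_bound_def by (rule nn_integral_u_tilde_le[OF N \<zeta> pos])
    also have "\<dots> \<le> liminf (\<lambda>n. SUP c\<in>{l..u}. ennreal ((inverse (rate n) * \<eta> n)\<^sup>2) * mse (obs_law M B eps v n (c * \<eta> n)) (T n) c)"
      by (rule minimax_risk_ge[OF \<rho> M B eps ind v \<gamma> \<eta> \<eta>0 big pos that])
    finally show ?thesis .
  qed
  show ?thesis
  proof (intro conjI ballI allI impI)
    fix c0 cs assume c0: "c0 \<in> C" and cs: "estimator_sequence cs"
    let ?f = "\<lambda>\<delta>. liminf (\<lambda>n. SUP c\<in>{c\<in>C. \<bar>c - c0\<bar> < \<delta>}. ennreal ((inverse (rate n) * \<eta> n)\<^sup>2) * mse (obs_law M B eps v n (c * \<eta> n)) (cs n) c)"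
    have "(?f \<longlongrightarrow> (INF \<delta>\<in>{0<..}. ?f \<delta>)) (at_right 0)"
      by (intro mono_tendsto_at_right_INF Liminf_mono always_eventually allI SUP_subset_mono) auto
    moreover have "risk_bound \<le> (INF \<delta>\<in>{0<..}. ?f \<delta>)"
    proof (rule INF_greatest)
      fix \<delta> :: real assume \<delta>: "\<delta> \<in> {0<..}"
      define p where "p = max a (c0 - \<delta>)"
      define q where "q = min b (c0 + \<delta>)"
      \<comment> \<open>The part \<open>(m, q)\<close> of the interval lies on one side of 0: right
        of 0 if \<open>q > 0\<close>, and otherwise it is the whole of \<open>(p, q)\<close>, left
        of 0. Its middle third is a compact interval that avoids 0.\<close>
      define m where "m = (if q > 0 then max p 0 else p)"
      have mq: "m < q" "p \<le> m" using c0 C \<delta> by (auto simp: p_def q_def m_def)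
      define l where "l = m + (q - m) / 3"
      define u where "u = m + 2 * (q - m) / 3"
      have lu: "m < l" "l < u" "u < q" using mq by (auto simp: l_def u_def field_simps)
      have "0 \<notin> {l..u}" using lu by (auto simp: m_def split: if_splits)
      then have "risk_bound \<le> liminf (\<lambda>n. SUP c\<in>{l..u}. ennreal ((inverse (rate n) * \<eta> n)\<^sup>2) * mse (obs_law M B eps v n (c * \<eta> n)) (cs n) c)"
        by (intro core lu cs)
      also have "\<dots> \<le> ?f \<delta>"
      proof (intro Liminf_mono always_eventually allI SUP_subset_mono order_refl subsetI)
        fix c assume "c \<in> {l..u}"
        then have "p < c" "c < q" using lu mq by auto
        then show "c \<in> {c\<in>C. \<bar>c - c0\<bar> < \<delta>}" using C by (auto simp: p_def q_def)
      qed
      finally show "risk_bound \<le> ?f \<delta>" .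
    qed
    ultimately show "\<exists>L. (?f \<longlongrightarrow> L) (at_right 0) \<and> L \<ge> risk_bound" by blast
  next
    fix ts assume ts: "estimator_sequence ts"
    let ?f = "\<lambda>\<delta>. liminf (\<lambda>n. SUP \<theta>\<in>{\<theta>. \<bar>\<theta>\<bar> < \<delta> * \<eta> n}. ennreal ((inverse (rate n))\<^sup>2) * mse (obs_law M B eps v n \<theta>) (ts n) \<theta>)"
    have "(?f \<longlongrightarrow> (INF \<delta>\<in>{0<..}. ?f \<delta>)) (at_right 0)"
    proof (intro mono_tendsto_at_right_INF Liminf_mono always_eventually allI SUP_subset_mono order_refl subsetI)
      fix x y \<theta> :: real and n assume "x \<le> y" "\<theta> \<in> {\<theta>. \<bar>\<theta>\<bar> < x * \<eta> n}"
      then show "\<theta> \<in> {\<theta>. \<bar>\<theta>\<bar> < y * \<eta> n}"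
        using mult_right_mono[OF \<open>x \<le> y\<close> less_imp_le[OF \<eta>[of n]]] by simp
    qed
    moreover have "risk_bound \<le> (INF \<delta>\<in>{0<..}. ?f \<delta>)"
    proof (rule INF_greatest)
      fix \<delta> :: real assume \<delta>: "\<delta> \<in> {0<..}"
      \<comment> \<open>The lags of the second claim are written as \<open>c * \<eta> n\<close> with
        \<open>c\<close> in a compact subinterval of \<open>(0, \<delta>)\<close>. Dividing the
        estimator by \<open>\<eta> n\<close> makes the two scaled risks equal.\<close>
      define cs where "cs n x = ts n x / \<eta> n" for n x
      have tm: "ts n \<in> borel_measurable (euclid (2 * n))" for n using ts by (simp add: estimator_sequence_def)
      have cs: "estimator_sequence cs"
        unfolding estimator_sequence_def cs_def[abs_def] using tm by (intro allI borel_measurable_divide borel_measurable_const)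
      have scale: "ennreal ((inverse (rate n) * \<eta> n)\<^sup>2) * mse (obs_law M B eps v n (c * \<eta> n)) (cs n) c =
          ennreal ((inverse (rate n))\<^sup>2) * mse (obs_law M B eps v n (c * \<eta> n)) (ts n) (c * \<eta> n)" for n c
      proof -
        have "mse (obs_law M B eps v n (c * \<eta> n)) (ts n) (c * \<eta> n) = (\<integral>\<^sup>+ x. ennreal ((\<eta> n)\<^sup>2) * ennreal ((cs n x - c)\<^sup>2) \<partial>obs_law M B eps v n (c * \<eta> n))"
          unfolding mse_def
        proof (rule nn_integral_cong)
          fix x
          have "ts n x - c * \<eta> n = \<eta> n * (cs n x - c)" using \<eta>[of n] by (simp add: cs_def field_simps)
          then show "ennreal ((ts n x - c * \<eta> n)\<^sup>2) = ennreal ((\<eta> n)\<^sup>2) * ennreal ((cs n x - c)\<^sup>2)"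
            by (simp add: power_mult_distrib ennreal_mult)
        qed
        also have "\<dots> = ennreal ((\<eta> n)\<^sup>2) * mse (obs_law M B eps v n (c * \<eta> n)) (cs n) c"
          unfolding mse_def
        proof (rule nn_integral_cmult)
          have "(\<lambda>x. ennreal ((cs n x - c)\<^sup>2)) \<in> borel_measurable (euclid (2 * n))"
            unfolding cs_def using tm[of n] by measurable
          then show "(\<lambda>x. ennreal ((cs n x - c)\<^sup>2)) \<in> borel_measurable (obs_law M B eps v n (c * \<eta> n))"
            by (simp add: obs_law_def)
        qed
        finally show ?thesis by (simp add: power_mult_distrib ennreal_mult mult.assoc)
      qed
      have "risk_bound \<le> liminf (\<lambda>n. SUP c\<in>{\<delta> / 3..\<delta> / 2}. ennreal ((inverse (rate n) * \<eta> n)\<^sup>2) * mse (obs_law M B eps v n (c * \<eta> n)) (cs n) c)"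
        using \<delta> by (intro core cs) auto
      also have "\<dots> \<le> ?f \<delta>"
      proof (intro Liminf_mono always_eventually allI SUP_least)
        fix n c assume c: "c \<in> {\<delta> / 3..\<delta> / 2}"
        have "\<bar>c * \<eta> n\<bar> < \<delta> * \<eta> n" using c \<delta> \<eta>[of n] by (auto simp: abs_mult)
        then show "ennreal ((inverse (rate n) * \<eta> n)\<^sup>2) * mse (obs_law M B eps v n (c * \<eta> n)) (cs n) c \<le>
            (SUP \<theta>\<in>{\<theta>. \<bar>\<theta>\<bar> < \<delta> * \<eta> n}. ennreal ((inverse (rate n))\<^sup>2) * mse (obs_law M B eps v n \<theta>) (ts n) \<theta>)"
          unfolding scale by (intro SUP_upper) simp
      qed
      finally show "risk_bound \<le> ?f \<delta>" .
    qed
    ultimately show "\<exists>L. (?f \<longlongrightarrow> L) (at_right 0) \<and> L \<ge> risk_bound" by blast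
  qed
qed

end
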